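(* Let $n\ge1$, $\alpha\in(0,1)$ and $p\in\left[1,\frac{n}{1-\alpha}\right)$. The operator $$I_{n-\alpha}:BV^{\alpha,p}_+(\mathbb{R}^n)\to LSC_b(\mathbb{R}^n)$$ is (well defined and) continuous. In addition, if $n\ge2$, then $I_{n-\alpha}:BV^{\alpha,p}(\mathbb{R}^n)\to L^\infty(\mathbb{R}^n)$ is (well defined and) continuous.
   Context: Let $\mu_{n,\alpha}=2^{\alpha}\pi^{-n/2}\,\Gamma\left(\frac{n+\alpha+1}{2}\right)/\Gamma\left(\frac{1-\alpha}{2}\right)$. For $\varphi\in \mathrm{Lip}_c(\mathbb{R}^n;\mathbb{R}^n)$ (compactly supported Lipschitz), the fractional $\alpha$-divergence is $$\mathrm{div}^\alpha\varphi(x)=\mu_{n,\alpha}\int_{\mathbb{R}^n}\frac{(y-x)\cdot(\varphi(y)-\varphi(x))}{|y-x|^{n+\alpha+1}}\,dy,\quad x\in\mathbb{R}^n.$$ For $p\in[1,+\infty]$ and $f\in L^p(\mathbb{R}^n)$ let $$|D^\alpha f|(\mathbb{R}^n)=\sup\left\{\int_{\mathbb{R}^n} f\,\mathrm{div}^\alpha\varphi\,dx:\varphi\in C^\infty_c(\mathbb{R}^n;\mathbb{R}^n),\ \|\varphi\|_{L^\infty(\mathbb{R}^n;\mathbb{R}^n)}\le1\right\},$$ and $BV^{\alpha,p}(\mathbb{R}^n)=\{f\in L^p(\mathbb{R}^n):|D^\alpha f|(\mathbb{R}^n)<+\infty\}$, with norm $\|f\|_{BV^{\alpha,p}(\mathbb{R}^n)}=\|f\|_{L^p(\mathbb{R}^n)}+|D^\alpha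 f|(\mathbb{R}^n)$. The subset $BV^{\alpha,p}_+(\mathbb{R}^n)=\{f\in BV^{\alpha,p}(\mathbb{R}^n):f\ge0\}$ carries the induced topology. $LSC_b(\mathbb{R}^n)$ is the set of functions $\mathbb{R}^n\to\mathbb{R}$ that are lower semicontinuous and bounded, with the distance induced by the supremum norm. For $s\in(0,n)$, the Riesz potential of order $s$ is $$I_sf(x)=2^{-s}\pi^{-n/2}\frac{\Gamma\left(\frac{n-s}{2}\right)}{\Gamma\left(\frac{s}{2}\right)}\int_{\mathbb{R}^n}\frac{f(y)}{|x-y|^{n-s}}\,dy,\quad x\in\mathbb{R}^n.$$ *)

theory Defs
  imports "HOL-Analysis.Analysis" "HOL-Probability.Essential_Supremum"
begin

subsection \<open>Topology of a pseudometric\<close>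

text \<open>
  Elements of \<open>L\<^sup>p\<close>, \<open>BV\<^sup>\<alpha>\<^sup>,\<^sup>p\<close> and \<open>L\<^sup>\<infinity>\<close> are represented by functions, not by classes of
  functions modulo equality almost everywhere, so their norms only induce pseudometrics and the
  locale \<^locale>\<open>Metric_space\<close> does not apply.
\<close>

definition pseudometric_topology :: "'a set \<Rightarrow> ('a \<Rightarrow> 'a \<Rightarrow> real) \<Rightarrow> 'a topology" where
  "pseudometric_topology S d =
     topology (\<lambda>U. U \<subseteq> S \<and> (\<forall>f\<in>U. \<exists>r>0. \<forall>g\<in>S. d f g < r \<longrightarrow> g \<in> U))"

lemma openin_pseudometric_topology:
  "openin (pseudometric_topology S d) U \<longleftrightarrow>
     U \<subseteq> S \<and> (\<forall>f\<in>U. \<exists>r>0. \<forall>g\<in>S. d f g < r \<longrightarrow> g \<in> U)"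
proof -
  let ?P = "\<lambda>U. U \<subseteq> S \<and> (\<forall>f\<in>U. \<exists>r>0. \<forall>g\<in>S. d f g < r \<longrightarrow> g \<in> U)"
  have Int: "?P (U \<inter> V)" if U: "?P U" and V: "?P V" for U V
  proof (intro conjI ballI)
    show "U \<inter> V \<subseteq> S"
      using U by blast
    fix f assume f: "f \<in> U \<inter> V"
    obtain r where r: "r > 0" "\<forall>g\<in>S. d f g < r \<longrightarrow> g \<in> U"
      using U f by blast
    obtain s where s: "s > 0" "\<forall>g\<in>S. d f g < s \<longrightarrow> g \<in> V"
      using V f by blast
    have "min r s > 0" "\<forall>g\<in>S. d f g < min r s \<longrightarrow> g \<in> U \<inter> V"
      using r s by simp_all
    then show "\<exists>t>0. \<forall>g\<in>S. d f g < t \<longrightarrow> g \<in> U \<inter> V"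
      by blast
  qed
  have Un: "?P (\<Union>\<U>)" if \<U>: "\<forall>U\<in>\<U>. ?P U" for \<U>
  proof (intro conjI ballI)
    show "\<Union>\<U> \<subseteq> S"
      using \<U> by blast
    fix f assume "f \<in> \<Union>\<U>"
    then obtain U where U: "U \<in> \<U>" "f \<in> U"
      by blast
    then obtain r where "r > 0" "\<forall>g\<in>S. d f g < r \<longrightarrow> g \<in> U"
      using \<U> by blast
    with U show "\<exists>r>0. \<forall>g\<in>S. d f g < r \<longrightarrow> g \<in> \<Union>\<U>"
      by blast
  qed
  have "istopology ?P"
    unfolding istopology_def using Int Un by blast
  then show ?thesis
    by (simp add: pseudometric_topology_def)
qed

lemma topspace_pseudometric_topology [simp]: "topspace (pseudometric_topology S d) = S"
proof
  show "topspace (pseudometric_topology S d) \<subseteq> S"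
    using openin_topspace[of "pseudometric_topology S d"]
    unfolding openin_pseudometric_topology by blast
  have "openin (pseudometric_topology S d) S"
    unfolding openin_pseudometric_topology using zero_less_one by blast
  then show "S \<subseteq> topspace (pseudometric_topology S d)"
    by (rule openin_subset)
qed


subsection \<open>Lebesgue spaces\<close>

definition Lp :: "real \<Rightarrow> (real ^ 'n \<Rightarrow> real) set" where
  "Lp p = {f \<in> borel_measurable lebesgue. integrable lebesgue (\<lambda>x. \<bar>f x\<bar> powr p)}"

definition Lp_norm :: "real \<Rightarrow> (real ^ 'n \<Rightarrow> real) \<Rightarrow> real" where
  "Lp_norm p f = (LINT x|lebesgue. \<bar>f x\<bar> powr p) powr (1 / p)"

definition Linf_norm :: "(real ^ 'n \<Rightarrow> 'b::real_normed_vector) \<Rightarrow> ereal" where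
  "Linf_norm f = esssup lebesgue (\<lambda>x. ereal (norm (f x)))"

definition Linf :: "(real ^ 'n \<Rightarrow> real) set" where
  "Linf = {f \<in> borel_measurable lebesgue. Linf_norm f < \<infinity>}"

definition Linf_topology :: "(real ^ 'n \<Rightarrow> real) topology" where
  "Linf_topology = pseudometric_topology Linf (\<lambda>f g. real_of_ereal (Linf_norm (\<lambda>x. f x - g x)))"


subsection \<open>Bounded lower semicontinuous functions\<close>

definition lower_semicontinuous :: "('a::topological_space \<Rightarrow> real) \<Rightarrow> bool" where
  "lower_semicontinuous f \<longleftrightarrow> (\<forall>x. \<forall>a < f x. \<forall>\<^sub>F y in nhds x. a < f y)"

definition LSC_b :: "(real ^ 'n \<Rightarrow> real) set" where
  "LSC_b = {f. lower_semicontinuous f \<and> bounded (range f)}"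

text \<open>\<^const>\<open>funspace\<close> is the space of bounded functions with the supremum distance.\<close>

definition LSC_b_topology :: "(real ^ 'n \<Rightarrow> real) topology" where
  "LSC_b_topology = mtopology_of (submetric (funspace UNIV euclidean_metric) LSC_b)"


subsection \<open>Test vector fields\<close>

text \<open>
  Class \<open>C\<^sup>k\<close>, by recursion on the directional derivatives \<open>x \<mapsto> Df(x) v\<close> in a fixed direction \<open>v\<close>;
  in finite dimensions their continuity is that of \<open>Df\<close>.
\<close>

primrec C_k :: "nat \<Rightarrow> ('a::real_normed_vector \<Rightarrow> 'b::real_normed_vector) \<Rightarrow> bool" where
  "C_k 0 f \<longleftrightarrow> continuous_on UNIV f"
| "C_k (Suc k) f \<longleftrightarrow>
     (\<forall>x. f differentiable (at x)) \<and> (\<forall>v. C_k k (\<lambda>x. frechet_derivative f (at x) v))"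

definition Cc_infinity :: "('a::real_normed_vector \<Rightarrow> 'b::real_normed_vector) set" where
  "Cc_infinity = {\<phi>. (\<forall>k. C_k k \<phi>) \<and> compact (closure {x. \<phi> x \<noteq> 0})}"


subsection \<open>Fractional divergence, fractional variation and Riesz potential\<close>

definition frac_const :: "nat \<Rightarrow> real \<Rightarrow> real" where
  "frac_const n \<alpha> =
     2 powr \<alpha> * pi powr (- real n / 2) * Gamma ((real n + \<alpha> + 1) / 2) / Gamma ((1 - \<alpha>) / 2)"

definition frac_div :: "real \<Rightarrow> (real ^ 'n \<Rightarrow> real ^ 'n) \<Rightarrow> real ^ 'n \<Rightarrow> real" where
  "frac_div \<alpha> \<phi> x = frac_const CARD('n) \<alpha> *
     (LINT y|lebesgue. ((y - x) \<bullet> (\<phi> y - \<phi> x)) / norm (y - x) powr (real CARD('n) + \<alpha> + 1))"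

definition frac_variation :: "real \<Rightarrow> (real ^ 'n \<Rightarrow> real) \<Rightarrow> ereal" where
  "frac_variation \<alpha> f =
     (SUP \<phi> \<in> {\<phi> \<in> Cc_infinity. Linf_norm \<phi> \<le> 1}. ereal (LINT x|lebesgue. f x * frac_div \<alpha> \<phi> x))"

definition BV :: "real \<Rightarrow> real \<Rightarrow> (real ^ 'n \<Rightarrow> real) set" where
  "BV \<alpha> p = {f \<in> Lp p. frac_variation \<alpha> f < \<infinity>}"

definition BV_norm :: "real \<Rightarrow> real \<Rightarrow> (real ^ 'n \<Rightarrow> real) \<Rightarrow> real" where
  "BV_norm \<alpha> p f = Lp_norm p f + real_of_ereal (frac_variation \<alpha> f)"

definition BV_topology :: "real \<Rightarrow> real \<Rightarrow> (real ^ 'n \<Rightarrow> real) topology" where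
  "BV_topology \<alpha> p = pseudometric_topology (BV \<alpha> p) (\<lambda>f g. BV_norm \<alpha> p (\<lambda>x. f x - g x))"

definition BV_plus :: "real \<Rightarrow> real \<Rightarrow> (real ^ 'n \<Rightarrow> real) set" where
  "BV_plus \<alpha> p = {f \<in> BV \<alpha> p. AE x in lebesgue. 0 \<le> f x}"

definition riesz_potential :: "real \<Rightarrow> (real ^ 'n \<Rightarrow> real) \<Rightarrow> real ^ 'n \<Rightarrow> real" where
  "riesz_potential s f x =
     2 powr (- s) * pi powr (- real CARD('n) / 2) * Gamma ((real CARD('n) - s) / 2) / Gamma (s / 2) *
     (LINT y|lebesgue. f y / norm (x - y) powr (real CARD('n) - s))"

text \<open>
  The Bochner integral of a non-integrable function is \<open>0\<close> by convention, so that the integral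
  defining the potential makes sense has to be stated separately.
\<close>

definition riesz_potential_defined :: "real \<Rightarrow> (real ^ 'n \<Rightarrow> real) \<Rightarrow> bool" where
  "riesz_potential_defined s f \<longleftrightarrow>
     (\<forall>x. integrable lebesgue (\<lambda>y. f y / norm (x - y) powr (real CARD('n) - s)))"

end

theory Submission
  imports Defs
begin

text \<open>
  For every \<open>\<epsilon> > 0\<close> a mixture of Gaussians gives a field \<open>K\<^sub>\<epsilon>\<close> whose fractional divergence is exactly a
  multiple of the heat kernel at time proportional to \<open>\<epsilon>\<close>, with \<open>\<bar>K\<^sub>\<epsilon>(w)\<bar> \<le> C \<bar>w\<bar>\<^bsup>\<alpha>-n\<^esup>\<close> and
  \<open>\<bar>DK\<^sub>\<epsilon>(w)\<bar> \<le> C \<bar>w\<bar>\<^bsup>\<alpha>-n-1\<^esup>\<close> uniformly in \<open>\<epsilon>\<close>. For a weight \<open>h\<close> with \<open>\<bar>h(y)\<bar> \<le> \<bar>y\<bar>\<^bsup>-\<alpha>\<^esup>\<close> that vanishes near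
  \<open>0\<close> and \<open>\<infinity>\<close>, the field \<open>K\<^sub>\<epsilon> * h\<close> therefore has divergence close to a multiple of \<open>h\<close>, but as \<open>\<epsilon>\<close> and \<open>h\<close>
  vary it is only bounded up to a logarithm, since \<open>\<bar>z - y\<bar>\<^bsup>\<alpha>-n\<^esup> \<bar>y\<bar>\<^bsup>-\<alpha>\<^esup>\<close> decays like \<open>\<bar>y\<bar>\<^bsup>-n\<^esup>\<close>. Cancelling
  \<open>K\<^sub>\<epsilon>(- y)\<close> in the region \<open>\<bar>y\<bar> > 2 \<bar>z\<bar>\<close> makes it uniformly bounded. For even \<open>h\<close> this is automatic, because
  \<open>K\<^sub>\<epsilon>\<close> is odd; for \<open>n \<ge> 2\<close> one adds a sum of rotation fields, which are divergence free for every \<open>\<alpha>\<close> and take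
  the value \<open>K\<^sub>\<epsilon>(y)\<close> at \<open>0\<close>. Testing \<open>|D\<^sup>\<alpha>f|\<close> with these fields and letting \<open>\<epsilon> \<rightarrow> 0\<close> yields
  \<open>\<bar>\<integral> f(x) h(x - x\<^sub>0) dx\<bar> \<le> C |D\<^sup>\<alpha>f|(\<real>\<^sup>n)\<close>. Even \<open>h\<close> increasing to \<open>\<bar>y\<bar>\<^bsup>-\<alpha>\<^esup>\<close> bound the potential, and
  \<open>h = \<sigma> \<bar>y\<bar>\<^bsup>-\<alpha>\<^esup>\<close> with \<open>\<sigma>\<close> close to the sign of \<open>f\<close> give the Hardy inequality that makes it absolutely convergent
  at every point when \<open>n \<ge> 2\<close>.
\<close>

subsection \<open>Integrals of radial powers\<close>

text \<open>Formally the fractional divergence is I_(1-\<alpha>) div, and -\<Delta> I_2 is the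
  identity, so the field -grad I_(1+\<alpha>) g has divergence g. Taking a Gaussian for g and
  writing I_(1+\<alpha>) as an integral over heat kernels gives the mixture behind
  \<open>riesz_kernel\<close>. This operator calculus is only a guide: the divergence is computed
  from explicit Gaussian integrals, whose exponents are tuned so that the last integrand is a
  derivative.

  The resulting fields decay like |z|^(\<alpha>-n) and are not test fields. The predicate
  \<open>decay\<close> with exponent n - \<alpha> admits them: it bounds the divergence by a
  multiple of (1+|x|)^(-n), which is integrable against every L^p function with 1 \<le> p <
  \<infinity>, and it survives cutting off and mollifying with a constant independent of the
  approximation. Dominated convergence then extends the variation inequality to such fields. Their
  sup bounds must be uniform in \<epsilon>; their \<open>decay\<close> constants need not be.

  The final estimates see f only through |D^\<alpha> f|, so both operators are Lipschitz for the
  variation seminorm alone.\<close>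

lemma nn_integral_lborel_affine:
  fixes t :: "'a::euclidean_space"
  assumes [measurable]: "f \<in> borel_measurable borel" and c: "c \<noteq> 0"
  shows "(\<integral>\<^sup>+x. f x \<partial>lborel) = ennreal (\<bar>c\<bar> ^ DIM('a)) * (\<integral>\<^sup>+x. f (t + c *\<^sub>R x) \<partial>lborel)"
  by (subst lborel_affine[OF c, of t])
     (simp add: nn_integral_density nn_integral_distr nn_integral_cmult)

lemma integrable_lborel_affine:
  fixes f :: "'a::euclidean_space \<Rightarrow> 'b::{banach, second_countable_topology}"
  assumes c: "c \<noteq> 0" and f: "integrable lborel f"
  shows "integrable lborel (\<lambda>x. f (t + c *\<^sub>R x))"
proof -
  have [measurable]: "f \<in> borel_measurable borel"
    using borel_measurable_integrable[OF f] by simp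
  have "integrable (density (distr lborel borel (\<lambda>x. t + c *\<^sub>R x)) (\<lambda>_. ennreal (\<bar>c\<bar> ^ DIM('a)))) f"
    using f lborel_affine[OF c, of t] by simp
  then have "integrable (distr lborel borel (\<lambda>x. t + c *\<^sub>R x)) (\<lambda>x. (\<bar>c\<bar> ^ DIM('a)) *\<^sub>R f x)"
    by (subst (asm) integrable_density) auto
  then show ?thesis
    using c integrable_scaleR_right[of "inverse (\<bar>c\<bar> ^ DIM('a))" lborel "\<lambda>x. (\<bar>c\<bar> ^ DIM('a)) *\<^sub>R f (t + c *\<^sub>R x)"]
    by (subst (asm) integrable_distr_eq) auto
qed

lemma integral_lborel_affine:
  fixes f :: "'a::euclidean_space \<Rightarrow> 'b::{banach, second_countable_topology}"
  assumes c: "c \<noteq> 0" and f [measurable]: "f \<in> borel_measurable borel"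
  shows "(\<integral>x. f x \<partial>lborel) = (\<bar>c\<bar> ^ DIM('a)) *\<^sub>R (\<integral>x. f (t + c *\<^sub>R x) \<partial>lborel)"
proof -
  have "(\<integral>x. f x \<partial>lborel) = (\<integral>x. f x \<partial>density (distr lborel borel (\<lambda>x. t + c *\<^sub>R x)) (\<lambda>_. ennreal (\<bar>c\<bar> ^ DIM('a))))"
    using lborel_affine[OF c, of t] by simp
  also have "\<dots> = (\<integral>x. (\<bar>c\<bar> ^ DIM('a)) *\<^sub>R f x \<partial>distr lborel borel (\<lambda>x. t + c *\<^sub>R x))"
    by (rule integral_density) auto
  also have "\<dots> = (\<integral>x. (\<bar>c\<bar> ^ DIM('a)) *\<^sub>R f (t + c *\<^sub>R x) \<partial>lborel)"
    by (rule integral_distr) auto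
  finally show ?thesis
    by simp
qed

lemma integral_lborel_shift:
  fixes f :: "'a::euclidean_space \<Rightarrow> 'b::{banach, second_countable_topology}"
  assumes [measurable]: "f \<in> borel_measurable borel"
  shows "(\<integral>x. f (t + x) \<partial>lborel) = (\<integral>x. f x \<partial>lborel)"
    and "(\<integral>x. f (t - x) \<partial>lborel) = (\<integral>x. f x \<partial>lborel)"
  using integral_lborel_affine[of 1 f t] integral_lborel_affine[of "-1" f t] by simp_all

lemma integrable_lborel_shift:
  fixes f :: "'a::euclidean_space \<Rightarrow> 'b::{banach, second_countable_topology}"
  assumes "integrable lborel f"
  shows "integrable lborel (\<lambda>x. f (t + x))" and "integrable lborel (\<lambda>x. f (t - x))"
  using integrable_lborel_affine[OF _ assms, of 1 t] integrable_lborel_affine[OF _ assms, of "-1" t]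
  by simp_all

text \<open>Reflection gives I = - I. The argument also covers nonintegrable f, whose integral is 0
  by convention, so that no integrability has to be shown at the uses.\<close>

lemma integral_lborel_odd:
  fixes f :: "'a::euclidean_space \<Rightarrow> real"
  assumes [measurable]: "f \<in> borel_measurable borel" and "\<And>x. f (- x) = - f x"
  shows "(\<integral>x. f x \<partial>lborel) = 0"
proof -
  have "(\<integral>x. f x \<partial>lborel) = (\<integral>x. f (0 - x) \<partial>lborel)"
    by (rule integral_lborel_shift(2)[symmetric]) simp
  then show ?thesis
    using assms(2) by simp
qed

text \<open>
  The integral over the dilated shell \<open>\<lambda>S\<close> is \<open>\<theta> < 1\<close> times the one over \<open>S\<close>, so the shells sum up
  like a geometric series.
\<close>

lemma nn_integral_norm_powr_geometric:
  fixes A :: "nat \<Rightarrow> 'a::euclidean_space set" and s :: real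
  assumes [measurable]: "\<And>k. A k \<in> sets borel" and A0: "A 0 = {}"
    and l: "l > 0" and theta: "l powr (real DIM('a) - s) < 1"
    and A: "\<And>k. A (Suc k) \<subseteq> S \<union> {w. (1/l) *\<^sub>R w \<in> A k}" and "incseq A"
    and [measurable]: "S \<in> sets borel" and S: "S \<subseteq> cball 0 R" and bd: "\<And>w. w \<in> S \<Longrightarrow> norm w powr (-s) \<le> B"
  shows "(\<integral>\<^sup>+w. ennreal (norm w powr (-s)) * indicator (\<Union>k. A k) w \<partial>(lborel::'a measure)) < \<infinity>"
proof -
  define th where "th = l powr (real DIM('a) - s)"
  define g where "g w = ennreal (norm w powr (-s))" for w :: 'a
  have [measurable]: "g \<in> borel_measurable borel"
    unfolding g_def by measurable
  define a where "a = (\<integral>\<^sup>+w. g w * indicator S w \<partial>lborel)"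
  have "a \<le> (\<integral>\<^sup>+w. ennreal B * indicator (cball 0 R) w \<partial>(lborel::'a measure))"
    unfolding a_def g_def using S bd
    by (intro nn_integral_mono) (auto simp: indicator_def intro!: ennreal_leI)
  also have "\<dots> < \<infinity>"
    using emeasure_lborel_cball_finite[of "0::'a" R]
    by (subst nn_integral_cmult_indicator, auto simp: ennreal_mult_less_top)
  finally obtain a' where a': "a = ennreal a'" "a' \<ge> 0"
    by (cases a) auto
  \<comment> \<open>The fixed point of t -> a' + th t, that is, the sum of the geometric series;
    this bound reproduces itself in the induction over k.\<close>
  define c where "c = a' / (1 - th)"
  have th: "th \<ge> 0" "th < 1"
    using theta by (auto simp: th_def)
  have c: "c \<ge> 0" "a' + th * c = c"
    using th a' by (auto simp: c_def field_simps)
  have scal: "(\<integral>\<^sup>+w. g w * indicator {w. (1/l) *\<^sub>R w \<in> A k} w \<partial>lborel)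
     = ennreal th * (\<integral>\<^sup>+w. g w * indicator (A k) w \<partial>lborel)" for k
  proof -
    have [measurable]: "(\<lambda>w. indicator {w. (1/l) *\<^sub>R w \<in> A k} w :: ennreal) \<in> borel_measurable borel"
    proof -
      have "(\<lambda>w. indicator {w. (1/l) *\<^sub>R w \<in> A k} w :: ennreal) = (\<lambda>w. indicator (A k) ((1/l) *\<^sub>R w))"
        by (auto simp: indicator_def)
      then show ?thesis
        by simp
    qed
    have "(\<integral>\<^sup>+w. g w * indicator {w. (1/l) *\<^sub>R w \<in> A k} w \<partial>lborel)
      = ennreal (\<bar>l\<bar> ^ DIM('a)) * (\<integral>\<^sup>+w. g (l *\<^sub>R w) * indicator {w. (1/l) *\<^sub>R w \<in> A k} (l *\<^sub>R w) \<partial>lborel)"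
      using l by (subst nn_integral_lborel_affine[where c = l and t = 0]) auto
    also have "(\<integral>\<^sup>+w. g (l *\<^sub>R w) * indicator {w. (1/l) *\<^sub>R w \<in> A k} (l *\<^sub>R w) \<partial>lborel)
       = (\<integral>\<^sup>+w. ennreal (l powr (-s)) * (g w * indicator (A k) w) \<partial>lborel)"
      using l by (intro nn_integral_cong)
        (auto simp: g_def indicator_def powr_mult ennreal_mult mult.assoc)
    also have "\<dots> = ennreal (l powr (-s)) * (\<integral>\<^sup>+w. g w * indicator (A k) w \<partial>lborel)"
      by (subst nn_integral_cmult) auto
    also have "ennreal (\<bar>l\<bar> ^ DIM('a)) * (ennreal (l powr (-s)) * (\<integral>\<^sup>+w. g w * indicator (A k) w \<partial>lborel))
       = ennreal th * (\<integral>\<^sup>+w. g w * indicator (A k) w \<partial>lborel)"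
      using l unfolding th_def
      by (simp add: powr_diff powr_minus powr_realpow divide_inverse ennreal_mult mult.assoc)
    finally show ?thesis .
  qed
  have bound: "(\<integral>\<^sup>+w. g w * indicator (A k) w \<partial>lborel) \<le> ennreal c" for k
  proof (induction k)
    case 0
    then show ?case
      by (simp add: A0)
  next
    case (Suc k)
    have [measurable]: "(\<lambda>w. indicator {w. (1/l) *\<^sub>R w \<in> A k} w :: ennreal) \<in> borel_measurable borel"
    proof -
      have "(\<lambda>w. indicator {w. (1/l) *\<^sub>R w \<in> A k} w :: ennreal) = (\<lambda>w. indicator (A k) ((1/l) *\<^sub>R w))"
        by (auto simp: indicator_def)
      then show ?thesis
        by simp
    qed
    have "(\<integral>\<^sup>+w. g w * indicator (A (Suc k)) w \<partial>lborel)
      \<le> (\<integral>\<^sup>+w. g w * indicator S w + g w * indicator {w. (1/l) *\<^sub>R w \<in> A k} w \<partial>lborel)"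
      using A[of k] by (intro nn_integral_mono) (auto simp: indicator_def)
    also have "\<dots> = a + ennreal th * (\<integral>\<^sup>+w. g w * indicator (A k) w \<partial>lborel)"
      by (subst nn_integral_add) (auto simp: a_def scal)
    also have "\<dots> \<le> ennreal a' + ennreal th * ennreal c"
      using Suc by (auto simp: a' intro!: add_mono mult_left_mono)
    also have "\<dots> = ennreal c"
      using c a' th by (simp flip: ennreal_mult ennreal_plus)
    finally show ?case .
  qed
  have "(\<integral>\<^sup>+w. g w * indicator (\<Union>k. A k) w \<partial>lborel) = (\<integral>\<^sup>+w. (SUP k. g w * indicator (A k) w) \<partial>lborel)"
  proof (intro nn_integral_cong)
    fix w
    show "g w * indicator (\<Union>k. A k) w = (SUP k. g w * indicator (A k) w)"
    proof (cases "w \<in> (\<Union>k. A k)")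
      case True
      then obtain k where "w \<in> A k" by auto
      then have "(SUP k. g w * indicator (A k) w) = g w"
        by (intro antisym SUP_least SUP_upper2[of k]) (auto simp: indicator_def)
      with True show ?thesis by simp
    next
      case False
      then show ?thesis
        by (simp add: indicator_def bot_ennreal)
    qed
  qed
  also have "\<dots> = (SUP k. \<integral>\<^sup>+w. g w * indicator (A k) w \<partial>lborel)"
    using \<open>incseq A\<close>
    by (intro nn_integral_monotone_convergence_SUP)
       (auto simp: incseq_def le_fun_def indicator_def)
  also have "\<dots> \<le> ennreal c"
    using bound by (intro SUP_least) auto
  also have "\<dots> < \<infinity>"
    by simp
  finally show ?thesis
    by (simp add: g_def)
qed

text \<open>Dyadic shells shrinking to the origin: halving w multiplies the integral by 2^(s-n),
  which is below 1 exactly when s < n.\<close>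

lemma nn_integral_norm_powr_ball:
  fixes s :: real
  assumes s: "s < real DIM('a)"
  shows "(\<integral>\<^sup>+w. ennreal (norm w powr (-s)) * indicator (ball 0 1) w \<partial>(lborel::'a::euclidean_space measure)) < \<infinity>"
proof -
  define A where "A k = {w::'a. (1/2) ^ k \<le> norm w \<and> norm w < 1}" for k
  define S where "S = {w::'a. 1/2 \<le> norm w \<and> norm w < 1}"
  have "(\<integral>\<^sup>+w. ennreal (norm w powr (-s)) * indicator (\<Union>k. A k) w \<partial>(lborel::'a measure)) < \<infinity>"
  \<comment> \<open>The bound \<open>B\<close> serves both signs of s: on the shell the power is at
    most 2^s for s \<ge> 0 and at most 1 otherwise.\<close>
  proof (rule nn_integral_norm_powr_geometric[where l = "1/2" and S = S and R = 1 and B = "1 + 2 powr s"])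
    show "A k \<in> sets borel" for k
      unfolding A_def by measurable
    show "S \<in> sets borel"
      unfolding S_def by measurable
    show "incseq A"
    proof (rule incseq_SucI)
      show "A k \<subseteq> A (Suc k)" for k
      proof -
        have "(1/2) ^ Suc k \<le> (1/2::real) ^ k"
          by (intro power_decreasing) auto
        then show ?thesis
          unfolding A_def by (intro Collect_mono) linarith
      qed
    qed
    show "(1/2) powr (real DIM('a) - s) < (1::real)"
      using s powr_less_mono2[of "real DIM('a) - s" "1/2" 1] by simp
    show "norm w powr (-s) \<le> 1 + 2 powr s" if "w \<in> S" for w
    proof (cases "s \<ge> 0")
      case True
      have "norm w powr (-s) \<le> (1/2) powr (-s)"
        using that True by (intro powr_mono2') (auto simp: S_def)
      also have "\<dots> = 2 powr s"
        by (simp add: powr_divide powr_minus)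
      finally show ?thesis by simp
    next
      case False
      have "norm w powr (-s) \<le> 1 powr (-s)"
        using that False by (intro powr_mono2) (auto simp: S_def)
      then show ?thesis
        by (simp add: add_increasing2)
    qed
  qed (auto simp: A_def S_def)
  also have "(\<integral>\<^sup>+w. ennreal (norm w powr (-s)) * indicator (\<Union>k. A k) w \<partial>(lborel::'a measure))
    = (\<integral>\<^sup>+w. ennreal (norm w powr (-s)) * indicator (ball 0 1) w \<partial>(lborel::'a measure))"
  proof (intro nn_integral_cong)
    fix w :: 'a
    show "ennreal (norm w powr (-s)) * indicator (\<Union>k. A k) w = ennreal (norm w powr (-s)) * indicator (ball 0 1) w"
    \<comment> \<open>The shells miss the origin. There \<open>0 powr (-s)\<close> is 0 by
      convention, so the two integrands agree.\<close>
    proof (cases "w = 0")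
      case False
      obtain k where "(1/2) ^ k < norm w"
        using real_arch_pow_inv[of "norm w" "1/2"] False by auto
      then have "w \<in> ball 0 1 \<longleftrightarrow> w \<in> (\<Union>k. A k)"
        by (auto simp: A_def intro!: exI[of _ k])
      then show ?thesis
        by (auto simp: indicator_def)
    qed simp
  qed
  finally show ?thesis .
qed

lemma nn_integral_norm_powr_compl_ball:
  fixes s :: real
  assumes s: "s > real DIM('a)"
  shows "(\<integral>\<^sup>+w. ennreal (norm w powr (-s)) * indicator (- ball 0 1) w \<partial>(lborel::'a::euclidean_space measure)) < \<infinity>"
proof -
  define A where "A k = {w::'a. 1 \<le> norm w \<and> norm w < 2 ^ k}" for k
  define S where "S = {w::'a. 1 \<le> norm w \<and> norm w < 2}"
  have "(\<integral>\<^sup>+w. ennreal (norm w powr (-s)) * indicator (\<Union>k. A k) w \<partial>(lborel::'a measure)) < \<infinity>"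
  proof (rule nn_integral_norm_powr_geometric[where l = "2" and S = S and R = 2 and B = 1])
    show "A k \<in> sets borel" for k
      unfolding A_def by measurable
    show "S \<in> sets borel"
      unfolding S_def by measurable
    show "incseq A"
      by (rule incseq_SucI) (auto simp: A_def)
    show "2 powr (real DIM('a) - s) < (1::real)"
      using s powr_less_mono[of "real DIM('a) - s" 0 2] by simp
    show "norm w powr (-s) \<le> 1" if "w \<in> S" for w
      using that s powr_mono2'[of "-s" 1 "norm w"] by (auto simp: S_def)
  qed (auto simp: A_def S_def)
  also have "(\<Union>k. A k) = - ball 0 1"
    using real_arch_pow[of 2] by (auto simp: A_def)
  finally show ?thesis .
qed

lemma norm_powr_ball_1:
  fixes s :: real
  assumes s: "s < real DIM('a)"
  shows "integrable (lborel::'a::euclidean_space measure) (\<lambda>w. norm w powr (-s) * indicator (ball 0 1) w)"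
proof (intro integrableI_bounded)
  have "(\<integral>\<^sup>+w. ennreal (norm (norm w powr (-s) * indicator (ball 0 1) w)) \<partial>(lborel::'a measure)) =
    (\<integral>\<^sup>+w. ennreal (norm w powr (-s)) * indicator (ball 0 1) w \<partial>(lborel::'a measure))"
    by (intro nn_integral_cong) (simp add: indicator_def)
  then show "(\<integral>\<^sup>+w. ennreal (norm (norm w powr (-s) * indicator (ball 0 1) w)) \<partial>(lborel::'a measure)) < \<infinity>"
    using nn_integral_norm_powr_ball[OF s] by simp
qed (intro borel_measurable_times borel_measurable_indicator, auto)

lemma norm_powr_compl_ball_1:
  fixes s :: real
  assumes s: "s > real DIM('a)"
  shows "integrable (lborel::'a::euclidean_space measure) (\<lambda>w. norm w powr (-s) * indicator (- ball 0 1) w)"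
proof (intro integrableI_bounded)
  have "(\<integral>\<^sup>+w. ennreal (norm (norm w powr (-s) * indicator (- ball 0 1) w)) \<partial>(lborel::'a measure)) =
    (\<integral>\<^sup>+w. ennreal (norm w powr (-s)) * indicator (- ball 0 1) w \<partial>(lborel::'a measure))"
    by (intro nn_integral_cong) (simp add: indicator_def)
  then show "(\<integral>\<^sup>+w. ennreal (norm (norm w powr (-s) * indicator (- ball 0 1) w)) \<partial>(lborel::'a measure)) < \<infinity>"
    using nn_integral_norm_powr_compl_ball[OF s] by simp
qed (intro borel_measurable_times borel_measurable_indicator, auto)

lemma norm_powr_scale:
  fixes s :: real and r :: real
  assumes r: "r > 0" and [measurable]: "U \<in> sets borel" and f: "integrable (lborel::'a::euclidean_space measure) (\<lambda>w. norm w powr (-s) * indicator U w)"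
  shows "integrable (lborel::'a measure) (\<lambda>w. norm w powr (-s) * indicator U ((1/r) *\<^sub>R w))"
    and "(\<integral>w. norm w powr (-s) * indicator U ((1/r) *\<^sub>R w) \<partial>(lborel::'a measure)) =
      r powr (real DIM('a) - s) * (\<integral>w. norm w powr (-s) * indicator U w \<partial>(lborel::'a measure))"
proof -
  have eq: "norm w powr (-s) * indicator U ((1/r) *\<^sub>R w) = 
     r powr (-s) * (norm ((1/r) *\<^sub>R w) powr (-s) * indicator U ((1/r) *\<^sub>R w))" for w :: 'a
    using r by (simp add: powr_divide)
  have "integrable (lborel::'a measure) (\<lambda>w. norm (0 + (1/r) *\<^sub>R w) powr (-s) * indicator U (0 + (1/r) *\<^sub>R w))"
    using r by (intro integrable_lborel_affine[OF _ f]) auto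
  then have "integrable (lborel::'a measure) (\<lambda>w. norm ((1/r) *\<^sub>R w) powr (-s) * indicator U ((1/r) *\<^sub>R w))"
    by (simp only: add_0_left)
  then show "integrable (lborel::'a measure) (\<lambda>w. norm w powr (-s) * indicator U ((1/r) *\<^sub>R w))"
    unfolding eq by (intro integrable_mult_right) auto
  have "(\<integral>w. norm w powr (-s) * indicator U ((1/r) *\<^sub>R w) \<partial>(lborel::'a measure)) = 
     r ^ DIM('a) * (\<integral>w. norm (r *\<^sub>R w) powr (-s) * indicator U ((1/r) *\<^sub>R r *\<^sub>R w) \<partial>(lborel::'a measure))"
    using r by (subst integral_lborel_affine[of r _ 0]) auto
  also have "(\<lambda>w::'a. norm (r *\<^sub>R w) powr (-s) * indicator U ((1/r) *\<^sub>R r *\<^sub>R w)) = 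
       (\<lambda>w. r powr (-s) * (norm w powr (-s) * indicator U w))"
    using r by (auto simp: powr_mult)
  finally show "(\<integral>w. norm w powr (-s) * indicator U ((1/r) *\<^sub>R w) \<partial>(lborel::'a measure)) =
      r powr (real DIM('a) - s) * (\<integral>w. norm w powr (-s) * indicator U w \<partial>(lborel::'a measure))"
    using r by (simp add: powr_diff powr_minus powr_realpow divide_inverse)
qed

text \<open>One constant for all radii: the later uniform estimates reduce to matching powers of
  r.\<close>

lemma norm_powr_ball:
  fixes s :: real
  assumes s: "s < real DIM('a::euclidean_space)"
  obtains C where "C \<ge> 0"
    "\<And>r. r > 0 \<Longrightarrow> integrable (lborel::'a measure) (\<lambda>w. norm w powr (-s) * indicator (ball 0 r) w)"
    "\<And>r. r > 0 \<Longrightarrow> (\<integral>w. norm w powr (-s) * indicator (ball 0 r) w \<partial>(lborel::'a measure)) =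
      C * r powr (real DIM('a) - s)"
proof
  show "(\<integral>w. norm w powr (-s) * indicator (ball 0 1) w \<partial>(lborel::'a measure)) \<ge> 0"
    by simp
  fix r :: real assume r: "r > 0"
  have eq: "(indicator (ball 0 1) ((1/r) *\<^sub>R w) :: real) = indicator (ball 0 r) w" for w :: 'a
    using r by (simp add: indicator_def)
  show "integrable (lborel::'a measure) (\<lambda>w. norm w powr (-s) * indicator (ball 0 r) w)"
    using norm_powr_scale(1)[OF r _ norm_powr_ball_1[OF s]] by (simp add: eq)
  show "(\<integral>w. norm w powr (-s) * indicator (ball 0 r) w \<partial>(lborel::'a measure)) =
      (\<integral>w. norm w powr (-s) * indicator (ball 0 1) w \<partial>(lborel::'a measure)) * r powr (real DIM('a) - s)"
    using norm_powr_scale(2)[OF r _ norm_powr_ball_1[OF s]] by (simp add: eq mult.commute)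
qed

lemma norm_powr_compl_ball:
  fixes s :: real
  assumes s: "s > real DIM('a::euclidean_space)"
  obtains C where "C \<ge> 0"
    "\<And>r. r > 0 \<Longrightarrow> integrable (lborel::'a measure) (\<lambda>w. norm w powr (-s) * indicator (- ball 0 r) w)"
    "\<And>r. r > 0 \<Longrightarrow> (\<integral>w. norm w powr (-s) * indicator (- ball 0 r) w \<partial>(lborel::'a measure)) =
      C * r powr (real DIM('a) - s)"
proof
  show "(\<integral>w. norm w powr (-s) * indicator (- ball 0 1) w \<partial>(lborel::'a measure)) \<ge> 0"
    by simp
  fix r :: real assume r: "r > 0"
  have eq: "(indicator (- ball 0 1) ((1/r) *\<^sub>R w) :: real) = indicator (- ball 0 r) w" for w :: 'a
    using r by (simp add: indicator_def)
  show "integrable (lborel::'a measure) (\<lambda>w. norm w powr (-s) * indicator (- ball 0 r) w)"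
    using norm_powr_scale(1)[OF r _ norm_powr_compl_ball_1[OF s]] by (simp add: eq)
  show "(\<integral>w. norm w powr (-s) * indicator (- ball 0 r) w \<partial>(lborel::'a measure)) =
      (\<integral>w. norm w powr (-s) * indicator (- ball 0 1) w \<partial>(lborel::'a measure)) * r powr (real DIM('a) - s)"
    using norm_powr_scale(2)[OF r _ norm_powr_compl_ball_1[OF s]] by (simp add: eq mult.commute)
qed

lemma integrable_one_plus_norm_powr:
  fixes m :: real
  assumes m: "m > real DIM('a::euclidean_space)"
  shows "integrable (lborel::'a measure) (\<lambda>w. (1 + norm w) powr (-m))"
proof (rule Bochner_Integration.integrable_bound)
  show "integrable (lborel::'a measure) (\<lambda>w. indicator (ball 0 1) w + norm w powr (-m) * indicator (- ball 0 1) w)"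
    using norm_powr_compl_ball_1[OF m] emeasure_lborel_ball_finite[of "0::'a" 1]
    by (intro Bochner_Integration.integrable_add integrable_real_indicator) auto
  show "AE w in (lborel::'a measure). norm ((1 + norm w) powr (-m)) \<le>
      norm (indicator (ball 0 1) w + norm w powr (-m) * indicator (- ball 0 1) w :: real)"
  proof (intro AE_I2)
    fix w :: 'a
    have "(1 + norm w) powr (-m) \<le> norm w powr (-m)" if "norm w \<ge> 1"
      using that m by (intro powr_mono2') auto
    moreover have "(1 + norm w) powr (-m) \<le> 1"
      using m powr_mono2'[of "-m" 1 "1 + norm w"] by simp
    ultimately show "norm ((1 + norm w) powr (-m)) \<le>
      norm (indicator (ball 0 1) w + norm w powr (-m) * indicator (- ball 0 1) w :: real)"
      by (auto simp: indicator_def)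
  qed
qed measurable

subsection \<open>The fractional divergence of decaying fields\<close>

text \<open>Models a field of size (1+|z|)^(-s) with gradient of size (1+|z|)^(-s-1). The second
  condition is put on differences, not on derivatives, so that Lipschitz cutoffs and superpositions
  stay in the class, and the single constant makes it linear in A.\<close>

definition decay :: "real \<Rightarrow> real \<Rightarrow> ('a::real_normed_vector \<Rightarrow> 'b::real_normed_vector) \<Rightarrow> bool" where
  "decay s A \<phi> \<longleftrightarrow> (\<forall>z. norm (\<phi> z) \<le> A * (1 + norm z) powr (-s)) \<and>
     (\<forall>z z'. norm (\<phi> z - \<phi> z') \<le> A * norm (z - z') * (1 + min (norm z) (norm z')) powr (-s-1))"

text \<open>This is \<open>frac_div\<close> without its constant, in the variable w = y - x, with
  respect to \<open>lborel\<close> and on any Euclidean space.\<close>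

definition fdiv :: "real \<Rightarrow> ('a::euclidean_space \<Rightarrow> 'a) \<Rightarrow> 'a \<Rightarrow> real" where
  "fdiv \<alpha> \<phi> x = (\<integral>w. (w \<bullet> (\<phi> (x + w) - \<phi> x)) * norm w powr (-(real DIM('a) + \<alpha> + 1)) \<partial>lborel)"

lemma decayD:
  assumes "decay s A \<phi>"
  shows "norm (\<phi> z) \<le> A * (1 + norm z) powr (-s)"
    and "norm (\<phi> z - \<phi> z') \<le> A * norm (z - z') * (1 + min (norm z) (norm z')) powr (-s-1)"
  using assms by (auto simp: decay_def)

lemma decay_nonneg:
  assumes "decay s A \<phi>" shows "0 \<le> A"
proof -
  have "0 \<le> A * (1 + norm (0::'a)) powr (-s)"
    using decayD(1)[OF assms, of 0] norm_ge_zero order_trans by blast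
  then show ?thesis
    by simp
qed

lemma decay_lipschitz:
  assumes "decay s A \<phi>" "0 \<le> s"
  shows "norm (\<phi> z - \<phi> z') \<le> A * norm (z - z')"
proof -
  have "(1 + min (norm z) (norm z')) powr (-s-1) \<le> 1"
    using assms(2) powr_mono2'[of "-s-1" 1 "1 + min (norm z) (norm z')"] by simp
  then have "A * norm (z - z') * (1 + min (norm z) (norm z')) powr (-s-1) \<le> A * norm (z - z') * 1"
    using decay_nonneg[OF assms(1)] by (intro mult_left_mono) auto
  then show ?thesis
    using decayD(2)[OF assms(1), of z z'] by simp
qed

lemma decay_continuous:
  assumes "decay s A \<phi>" "0 \<le> s"
  shows "continuous_on UNIV \<phi>"
proof -
  have "A-lipschitz_on UNIV \<phi>"
    using decay_lipschitz[OF assms] decay_nonneg[OF assms(1)]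
    by (intro lipschitz_onI) (auto simp: dist_norm)
  then show ?thesis
    by (rule lipschitz_on_continuous_on)
qed

lemma decay_borel:
  assumes "decay s A \<phi>" "0 \<le> s"
  shows "\<phi> \<in> borel_measurable borel"
  using decay_continuous[OF assms] by (rule borel_measurable_continuous_onI)

lemma decay_mono:
  fixes \<phi> :: "'a::real_normed_vector \<Rightarrow> 'b::real_normed_vector"
  assumes "decay s A \<phi>" "A \<le> B"
  shows "decay s B \<phi>"
  unfolding decay_def
proof (intro conjI allI)
  fix z z' :: 'a
  have "A * (1 + norm z) powr (-s) \<le> B * (1 + norm z) powr (-s)"
    using assms by (intro mult_right_mono) auto
  then show "norm (\<phi> z) \<le> B * (1 + norm z) powr (-s)"
    using decayD(1)[OF assms(1), of z] by linarith
  have "A * norm (z - z') * (1 + min (norm z) (norm z')) powr (-s-1) \<le> B * norm (z - z') * (1 + min (norm z) (norm z')) powr (-s-1)"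
    using assms by (intro mult_right_mono) auto
  then show "norm (\<phi> z - \<phi> z') \<le> B * norm (z - z') * (1 + min (norm z) (norm z')) powr (-s-1)"
    using decayD(2)[OF assms(1), of z z'] by linarith
qed

lemma decay_bounded_linear:
  assumes "decay s A \<phi>" "bounded_linear L" "\<And>v. norm (L v) \<le> B * norm v" "0 \<le> B"
  shows "decay s (B * A) (\<lambda>z. L (\<phi> z))"
proof -
  have diff: "L u - L v = L (u - v)" for u v
    using bounded_linear.linear[OF assms(2)] by (simp add: linear_diff)
  have "norm (L (\<phi> z)) \<le> B * A * (1 + norm z) powr (-s)" for z
    using assms(3)[of "\<phi> z"] mult_left_mono[OF decayD(1)[OF assms(1), of z] assms(4)]
    by (simp add: mult.assoc)
  moreover have "norm (L (\<phi> z) - L (\<phi> z')) \<le> B * A * norm (z - z') * (1 + min (norm z) (norm z')) powr (-s-1)" for z z'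
    using assms(3)[of "\<phi> z - \<phi> z'"] mult_left_mono[OF decayD(2)[OF assms(1), of z z'] assms(4)]
    by (simp add: mult.assoc diff)
  ultimately show ?thesis
    by (simp add: decay_def)
qed

lemma decay_scaleR:
  assumes "decay s A \<phi>"
  shows "decay s (\<bar>c\<bar> * A) (\<lambda>z. c *\<^sub>R \<phi> z)"
  using decay_bounded_linear[OF assms bounded_linear_scaleR_right[of c], of "\<bar>c\<bar>"] by simp

lemma decay_add:
  assumes "decay s A \<phi>" "decay s B \<psi>"
  shows "decay s (A + B) (\<lambda>z. \<phi> z + \<psi> z)"
  unfolding decay_def
proof (intro conjI allI)
  fix z z'
  show "norm (\<phi> z + \<psi> z) \<le> (A + B) * (1 + norm z) powr - s"
    using decayD(1)[OF assms(1), of z] decayD(1)[OF assms(2), of z] norm_triangle_ineq[of "\<phi> z" "\<psi> z"]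
    by (simp add: algebra_simps)
  have "norm (\<phi> z + \<psi> z - (\<phi> z' + \<psi> z')) \<le> norm (\<phi> z - \<phi> z') + norm (\<psi> z - \<psi> z')"
    by (rule norm_diff_triangle_ineq)
  then show "norm (\<phi> z + \<psi> z - (\<phi> z' + \<psi> z')) \<le> (A + B) * norm (z - z') * (1 + min (norm z) (norm z')) powr (- s - 1)"
    using decayD(2)[OF assms(1), of z z'] decayD(2)[OF assms(2), of z z']
    by (simp add: algebra_simps)
qed

lemma decay_sum:
  assumes "finite I" "\<And>i. i \<in> I \<Longrightarrow> decay s (A i) (\<phi> i)"
  shows "decay s (\<Sum>i\<in>I. A i) (\<lambda>z. \<Sum>i\<in>I. \<phi> i z)"
  using assms
proof (induction I rule: finite_induct)
  case empty
  then show ?case by (simp add: decay_def)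
next
  case (insert i I)
  then show ?case by (auto intro!: decay_add)
qed

text \<open>Peetre's inequality, from 1 + u \<le> (1 + c)(1 + v): shifting by c costs a factor (1 +
  c)^m in the weight.\<close>

lemma powr_one_plus_shift:
  fixes u v c :: real
  assumes "0 \<le> u" "0 \<le> v" "0 \<le> c" "u \<le> v + c" "0 \<le> m"
  shows "(1 + v) powr (-m) \<le> (1 + c) powr m * (1 + u) powr (-m)"
proof -
  have "1 + u \<le> (1 + c) * (1 + v)"
    using assms mult_nonneg_nonneg[OF assms(3,2)] unfolding distrib_left distrib_right by linarith
  then have "((1 + c) * (1 + v)) powr (-m) \<le> (1 + u) powr (-m)"
    using assms by (intro powr_mono2') auto
  then have "(1 + c) powr (-m) * (1 + v) powr (-m) \<le> (1 + u) powr (-m)"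
    using assms by (simp add: powr_mult)
  then have "(1 + c) powr m * ((1 + c) powr (-m) * (1 + v) powr (-m)) \<le> (1 + c) powr m * (1 + u) powr (-m)"
    by (intro mult_left_mono) auto
  then show ?thesis
    using assms by (simp add: powr_minus field_simps)
qed

lemma decay_shift:
  fixes \<phi> :: "'a::real_normed_vector \<Rightarrow> 'b::real_normed_vector"
  assumes "decay s A \<phi>" "0 \<le> s" "norm y \<le> c"
  shows "decay s ((1 + c) powr (s + 1) * A) (\<lambda>z. \<phi> (z + y))"
  unfolding decay_def
proof (intro conjI allI)
  fix z z' :: 'a
  have A: "0 \<le> A" using decay_nonneg[OF assms(1)] .
  have c: "0 \<le> c" using assms(3) norm_ge_zero order_trans by blast
  have tri: "norm z \<le> norm (z + y) + c" for z
    using norm_triangle_ineq4[of "z + y" y] assms(3) by simp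
  have "(1 + norm (z + y)) powr (-s) \<le> (1 + c) powr s * (1 + norm z) powr (-s)"
    using tri[of z] c assms by (intro powr_one_plus_shift) auto
  also have "\<dots> \<le> (1 + c) powr (s + 1) * (1 + norm z) powr (-s)"
    using c assms(2) by (intro mult_right_mono powr_mono) auto
  finally have "A * (1 + norm (z + y)) powr (-s) \<le> A * ((1 + c) powr (s + 1) * (1 + norm z) powr (-s))"
    using A by (intro mult_left_mono)
  then show "norm (\<phi> (z + y)) \<le> (1 + c) powr (s + 1) * A * (1 + norm z) powr - s"
    using decayD(1)[OF assms(1), of "z + y"] by (simp add: mult_ac)
  have "(1 + min (norm (z + y)) (norm (z' + y))) powr (-(s+1)) \<le> (1 + c) powr (s + 1) * (1 + min (norm z) (norm z')) powr (-(s+1))"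
    using tri[of z] tri[of z'] c assms by (intro powr_one_plus_shift) auto
  then have "A * norm (z - z') * (1 + min (norm (z + y)) (norm (z' + y))) powr (-s-1)
     \<le> A * norm (z - z') * ((1 + c) powr (s + 1) * (1 + min (norm z) (norm z')) powr (-s-1))"
    using A by (intro mult_left_mono) auto
  then show "norm (\<phi> (z + y) - \<phi> (z' + y)) \<le> (1 + c) powr (s + 1) * A * norm (z - z') * (1 + min (norm z) (norm z')) powr (- s - 1)"
    using decayD(2)[OF assms(1), of "z + y" "z' + y"] by (simp add: mult_ac)
qed

text \<open>A majorant for the integrand of \<open>fdiv\<close> in three regions. For |w| < \<rho>
  the Lipschitz estimate at distance about |x| from the origin is used; for |w| \<ge> \<rho> the
  values at x and x + w; and the last term accounts for x + w close to the origin, where the field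
  is not small.\<close>

definition fdiv_dom :: "real \<Rightarrow> 'a::euclidean_space \<Rightarrow> 'a \<Rightarrow> real" where
  "fdiv_dom \<alpha> x w = (let n = real DIM('a); \<rho> = (1 + norm x) / 2 in
      \<rho> powr (-(n-\<alpha>)-1) * (norm w powr (-(n+\<alpha>-1)) * indicator (ball 0 \<rho>) w)
    + 2 * \<rho> powr (-(n-\<alpha>)) * (norm w powr (-(n+\<alpha>)) * indicator (- ball 0 \<rho>) w)
    + \<rho> powr (-(n+\<alpha>)) * (norm (x + w) powr (-(n-\<alpha>)) * indicator (ball 0 \<rho>) (x + w)))"

lemma one_le_DIM: "1 \<le> real DIM('a::euclidean_space)"
  using of_nat_mono[OF Suc_leI[OF DIM_positive[where 'a='a]], where 'a=real] by simp

text \<open>Each term is a power of \<rho> times a homogeneous integral, and the total degree is -n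
  in all three. Convergence at w = 0 needs \<alpha> < 1; convergence at infinity and at x + w = 0
  needs \<alpha> > 0.\<close>

lemma fdiv_dom_integral:
  assumes \<alpha>: "0 < \<alpha>" "\<alpha> < 1"
  obtains C where "C \<ge> 0" "\<And>x::'a::euclidean_space. integrable lborel (fdiv_dom \<alpha> x)"
    "\<And>x::'a. (\<integral>w. fdiv_dom \<alpha> x w \<partial>lborel) = C * (1 + norm x) powr (- real DIM('a))"
proof -
  define n where "n = real DIM('a)"
  have n: "n \<ge> 1"
    using one_le_DIM[where 'a='a] by (simp add: n_def)
  obtain C1 where C1: "C1 \<ge> 0"
    "\<And>r. r > 0 \<Longrightarrow> integrable (lborel::'a measure) (\<lambda>w. norm w powr (-(n+\<alpha>-1)) * indicator (ball 0 r) w)"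
    "\<And>r. r > 0 \<Longrightarrow> (\<integral>w. norm w powr (-(n+\<alpha>-1)) * indicator (ball 0 r) w \<partial>(lborel::'a measure)) = C1 * r powr (n - (n+\<alpha>-1))"
    using norm_powr_ball[where 'a='a, of "n+\<alpha>-1"] \<alpha> unfolding n_def by auto
  obtain C2 where C2: "C2 \<ge> 0"
    "\<And>r. r > 0 \<Longrightarrow> integrable (lborel::'a measure) (\<lambda>w. norm w powr (-(n+\<alpha>)) * indicator (- ball 0 r) w)"
    "\<And>r. r > 0 \<Longrightarrow> (\<integral>w. norm w powr (-(n+\<alpha>)) * indicator (- ball 0 r) w \<partial>(lborel::'a measure)) = C2 * r powr (n - (n+\<alpha>))"
    using norm_powr_compl_ball[where 'a='a, of "n+\<alpha>"] \<alpha> unfolding n_def by auto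
  obtain C3 where C3: "C3 \<ge> 0"
    "\<And>r. r > 0 \<Longrightarrow> integrable (lborel::'a measure) (\<lambda>w. norm w powr (-(n-\<alpha>)) * indicator (ball 0 r) w)"
    "\<And>r. r > 0 \<Longrightarrow> (\<integral>w. norm w powr (-(n-\<alpha>)) * indicator (ball 0 r) w \<partial>(lborel::'a measure)) = C3 * r powr (n - (n-\<alpha>))"
    using norm_powr_ball[where 'a='a, of "n-\<alpha>"] \<alpha> unfolding n_def by auto
  have main: "integrable lborel (fdiv_dom \<alpha> x) \<and>
      (\<integral>w. fdiv_dom \<alpha> x w \<partial>lborel) = ((C1 + 2 * C2 + C3) * 2 powr n) * (1 + norm x) powr (- real DIM('a))" for x :: 'a
  proof -
    define \<rho> where "\<rho> = (1 + norm x) / 2"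
    have \<rho>: "\<rho> > 0"
      by (simp add: \<rho>_def add_pos_nonneg)
    have i3: "integrable lborel (\<lambda>w. norm (x + w) powr (-(n-\<alpha>)) * indicator (ball 0 \<rho>) (x + w))"
      using integrable_lborel_shift(1)[OF C3(2)[OF \<rho>], of x] by simp
    have meas: "(\<lambda>w::'a. norm w powr (-(n-\<alpha>)) * indicator (ball 0 \<rho>) w) \<in> borel_measurable borel"
      using borel_measurable_integrable[OF C3(2)[OF \<rho>]] by simp
    have e3: "(\<integral>w. norm (x + w) powr (-(n-\<alpha>)) * indicator (ball 0 \<rho>) (x + w) \<partial>lborel) = C3 * \<rho> powr (n - (n-\<alpha>))"
      using integral_lborel_shift(1)[OF meas, of x] unfolding C3(3)[OF \<rho>] .
    have dom: "fdiv_dom \<alpha> x = (\<lambda>w. \<rho> powr (-(n-\<alpha>)-1) * (norm w powr (-(n+\<alpha>-1)) * indicator (ball 0 \<rho>) w)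
    + 2 * \<rho> powr (-(n-\<alpha>)) * (norm w powr (-(n+\<alpha>)) * indicator (- ball 0 \<rho>) w)
    + \<rho> powr (-(n+\<alpha>)) * (norm (x + w) powr (-(n-\<alpha>)) * indicator (ball 0 \<rho>) (x + w)))"
      by (simp add: fun_eq_iff fdiv_dom_def Let_def n_def \<rho>_def)
    have int: "integrable lborel (fdiv_dom \<alpha> x)"
      unfolding dom
      by (intro Bochner_Integration.integrable_add integrable_mult_right C1(2) C2(2) i3 \<rho>)
    note hb = has_bochner_integral_integrable
    have "has_bochner_integral lborel (fdiv_dom \<alpha> x) (\<rho> powr (-(n-\<alpha>)-1) * (C1 * \<rho> powr (n - (n+\<alpha>-1)))
      + 2 * \<rho> powr (-(n-\<alpha>)) * (C2 * \<rho> powr (n - (n+\<alpha>))) + \<rho> powr (-(n+\<alpha>)) * (C3 * \<rho> powr (n - (n-\<alpha>))))"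
      unfolding dom
      by (intro has_bochner_integral_add has_bochner_integral_mult_right
        hb[OF C1(2)[OF \<rho>], unfolded C1(3)[OF \<rho>]] hb[OF C2(2)[OF \<rho>], unfolded C2(3)[OF \<rho>]] hb[OF i3, unfolded e3])
    then have "(\<integral>w. fdiv_dom \<alpha> x w \<partial>lborel) = \<rho> powr (-(n-\<alpha>)-1) * (C1 * \<rho> powr (n - (n+\<alpha>-1)))
      + 2 * \<rho> powr (-(n-\<alpha>)) * (C2 * \<rho> powr (n - (n+\<alpha>))) + \<rho> powr (-(n+\<alpha>)) * (C3 * \<rho> powr (n - (n-\<alpha>)))"
      by (rule has_bochner_integral_integral_eq)
    also have "\<dots> = (C1 + 2 * C2 + C3) * \<rho> powr (-n)"
    proof -
      have 1: "\<rho> powr (-(n-\<alpha>)-1) * \<rho> powr (n - (n+\<alpha>-1)) = \<rho> powr (-n)"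
        unfolding powr_add[symmetric] by (rule arg_cong[where f = "\<lambda>t. \<rho> powr t"]) simp
      have 2: "\<rho> powr (-(n-\<alpha>)) * \<rho> powr (n - (n+\<alpha>)) = \<rho> powr (-n)"
        unfolding powr_add[symmetric] by (rule arg_cong[where f = "\<lambda>t. \<rho> powr t"]) simp
      have 3: "\<rho> powr (-(n+\<alpha>)) * \<rho> powr (n - (n-\<alpha>)) = \<rho> powr (-n)"
        unfolding powr_add[symmetric] by (rule arg_cong[where f = "\<lambda>t. \<rho> powr t"]) simp
      have "\<rho> powr (-(n-\<alpha>)-1) * (C1 * \<rho> powr (n - (n+\<alpha>-1)))
      + 2 * \<rho> powr (-(n-\<alpha>)) * (C2 * \<rho> powr (n - (n+\<alpha>))) + \<rho> powr (-(n+\<alpha>)) * (C3 * \<rho> powr (n - (n-\<alpha>)))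
       = C1 * (\<rho> powr (-(n-\<alpha>)-1) * \<rho> powr (n - (n+\<alpha>-1))) + 2 * C2 * (\<rho> powr (-(n-\<alpha>)) * \<rho> powr (n - (n+\<alpha>)))
        + C3 * (\<rho> powr (-(n+\<alpha>)) * \<rho> powr (n - (n-\<alpha>)))"
        by (simp only: mult_ac)
      then show ?thesis
        unfolding 1 2 3 by (simp add: algebra_simps)
    qed
    also have "\<rho> powr (-n) = 2 powr n * (1 + norm x) powr (-n)"
      by (simp add: \<rho>_def powr_divide powr_minus field_simps)
    finally show ?thesis
      using int by (simp add: n_def)
  qed
  show thesis
    by (rule that[of "(C1 + 2 * C2 + C3) * 2 powr n"]) (use main C1 C2 C3 in auto)
qed

lemma fdiv_dom_bound:
  fixes \<phi> :: "'a::euclidean_space \<Rightarrow> 'b::real_normed_vector"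
  assumes \<alpha>: "0 < \<alpha>" "\<alpha> < 1" and d: "decay (real DIM('a) - \<alpha>) A \<phi>" and w: "w \<noteq> - x"
  shows "norm (\<phi> (x + w) - \<phi> x) * norm w powr (-(real DIM('a) + \<alpha>)) \<le> A * fdiv_dom \<alpha> x w"
proof -
  define n where "n = real DIM('a)"
  have n: "n \<ge> 1"
    using one_le_DIM[where 'a='a] by (simp add: n_def)
  define \<rho> where "\<rho> = (1 + norm x) / 2"
  have \<rho>: "\<rho> > 0"
    by (simp add: \<rho>_def add_pos_nonneg)
  have A: "A \<ge> 0"
    using decay_nonneg[OF d] .
  note d' = d[folded n_def]
  have dom: "fdiv_dom \<alpha> x w = \<rho> powr (-(n-\<alpha>)-1) * (norm w powr (-(n+\<alpha>-1)) * indicator (ball 0 \<rho>) w)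
    + 2 * \<rho> powr (-(n-\<alpha>)) * (norm w powr (-(n+\<alpha>)) * indicator (- ball 0 \<rho>) w)
    + \<rho> powr (-(n+\<alpha>)) * (norm (x + w) powr (-(n-\<alpha>)) * indicator (ball 0 \<rho>) (x + w))"
    by (simp add: fdiv_dom_def Let_def n_def \<rho>_def)
  show ?thesis
  proof (cases "norm w < \<rho>")
    case True
    \<comment> \<open>As 1 + |x| = 2 \<rho> and |w| < \<rho>, the point x + w still satisfies 1 + |x
      + w| > \<rho>.\<close>
    have "norm x \<le> norm (x + w) + norm w"
      using norm_triangle_ineq4[of "x + w" w] by simp
    then have "1 + min (norm (x + w)) (norm x) \<ge> \<rho>"
      using True by (simp add: \<rho>_def min_def)
    then have "(1 + min (norm (x + w)) (norm x)) powr (-(n-\<alpha>)-1) \<le> \<rho> powr (-(n-\<alpha>)-1)"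
      using \<rho> n \<alpha> by (intro powr_mono2') auto
    then have "A * norm (x + w - x) * (1 + min (norm (x + w)) (norm x)) powr (-(n-\<alpha>)-1) \<le> A * norm w * \<rho> powr (-(n-\<alpha>)-1)"
      using A by (auto intro!: mult_left_mono)
    then have "norm (\<phi> (x + w) - \<phi> x) \<le> A * norm w * \<rho> powr (-(n-\<alpha>)-1)"
      using decayD(2)[OF d', of "x + w" x] by linarith
    then have "norm (\<phi> (x + w) - \<phi> x) * norm w powr (-(n + \<alpha>)) \<le> A * norm w * \<rho> powr (-(n-\<alpha>)-1) * norm w powr (-(n + \<alpha>))"
      by (intro mult_right_mono) auto
    also have "\<dots> = A * (\<rho> powr (-(n-\<alpha>)-1) * (norm w powr (-(n+\<alpha>-1))))"
    proof -
      have "norm w * norm w powr (-(n + \<alpha>)) = norm w powr (-(n+\<alpha>-1))"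
        by (cases "w = 0") (simp_all add: powr_mult_base algebra_simps)
      then show ?thesis by (simp add: mult_ac)
    qed
    also have "\<dots> \<le> A * fdiv_dom \<alpha> x w"
      unfolding dom using True A by (intro mult_left_mono) auto
    finally show ?thesis
      by (simp add: n_def)
  next
    case False
    have 1: "norm (\<phi> x) \<le> A * \<rho> powr (-(n-\<alpha>))"
    proof -
      have "(1 + norm x) powr (-(n-\<alpha>)) \<le> \<rho> powr (-(n-\<alpha>))"
        using \<rho> n \<alpha> by (intro powr_mono2') (auto simp: \<rho>_def)
      then show ?thesis
        using decayD(1)[OF d', of x] A mult_left_mono order_trans by blast
    qed
    have 2: "norm (\<phi> (x + w)) \<le> A * \<rho> powr (-(n-\<alpha>)) + A * (norm (x + w) powr (-(n-\<alpha>)) * indicator (ball 0 \<rho>) (x + w))"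
    proof (cases "norm (x + w) < \<rho>")
      case True
      \<comment> \<open>At x + w = 0 the right side would be 0 by the convention for
        \<open>powr\<close>; this is why w = - x is excluded.\<close>
      have "(1 + norm (x + w)) powr (-(n-\<alpha>)) \<le> norm (x + w) powr (-(n-\<alpha>))"
        using w n \<alpha> by (intro powr_mono2') (auto simp: add_eq_0_iff)
      then have "norm (\<phi> (x + w)) \<le> A * norm (x + w) powr (-(n-\<alpha>))"
        using decayD(1)[OF d', of "x + w"] A mult_left_mono order_trans by blast
      then show ?thesis
        using True A by (simp add: add_increasing)
    next
      case False
      have "(1 + norm (x + w)) powr (-(n-\<alpha>)) \<le> \<rho> powr (-(n-\<alpha>))"
        using \<rho> n \<alpha> False by (intro powr_mono2') auto
      then have "norm (\<phi> (x + w)) \<le> A * \<rho> powr (-(n-\<alpha>))"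
        using decayD(1)[OF d', of "x + w"] A mult_left_mono order_trans by blast
      then show ?thesis
        using False by simp
    qed
    define Q where "Q = norm (x + w) powr (-(n-\<alpha>)) * indicator (ball 0 \<rho>) (x + w)"
    have Q: "Q \<ge> 0" by (simp add: Q_def)
    have nw: "norm w powr (-(n + \<alpha>)) \<le> \<rho> powr (-(n + \<alpha>))"
      using False \<rho> n \<alpha> by (intro powr_mono2') auto
    have "norm (\<phi> (x + w) - \<phi> x) * norm w powr (-(n + \<alpha>)) \<le> (2 * A * \<rho> powr (-(n-\<alpha>)) + A * Q) * norm w powr (-(n + \<alpha>))"
      using 1 2 norm_triangle_ineq4[of "\<phi> (x + w)" "\<phi> x"]
      by (intro mult_right_mono) (auto simp: Q_def)
    also have "\<dots> \<le> 2 * A * \<rho> powr (-(n-\<alpha>)) * norm w powr (-(n + \<alpha>)) + A * Q * \<rho> powr (-(n + \<alpha>))"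
      unfolding distrib_right using nw A Q by (intro add_mono order_refl mult_left_mono) auto
    also have "\<dots> = A * fdiv_dom \<alpha> x w"
      unfolding dom Q_def[symmetric] using False by (simp add: algebra_simps)
    finally show ?thesis
      by (simp add: n_def)
  qed
qed

lemma inner_powr_bound:
  fixes w v :: "'a::real_inner"
  shows "\<bar>(w \<bullet> v) * norm w powr (-(m + 1))\<bar> \<le> norm v * norm w powr (- m)"
proof (cases "w = 0")
  case False
  have "\<bar>(w \<bullet> v) * norm w powr (-(m + 1))\<bar> = \<bar>w \<bullet> v\<bar> * norm w powr (-(m + 1))"
    by (simp add: abs_mult)
  also have "\<dots> \<le> norm w * norm v * norm w powr (-(m + 1))"
    by (intro mult_right_mono Cauchy_Schwarz_ineq2) auto
  also have "\<dots> = norm v * norm w powr (- m)"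
    using False powr_mult_base[of "norm w" "-(m+1)"] by (simp add: mult_ac)
  finally show ?thesis .
qed simp

lemma AE_lborel_neq: "AE w in (lborel::'a::euclidean_space measure). w \<noteq> c"
  by (rule AE_I[where N = "{c}"]) auto

context
  fixes \<alpha> :: real
  assumes \<alpha>: "0 < \<alpha>" "\<alpha> < 1"
begin

lemma DIM_minus_alpha_pos: "0 < real DIM('a::euclidean_space) - \<alpha>"
  using one_le_DIM[where 'a='a] \<alpha> by linarith

lemma fdiv_dom_AE:
  fixes \<phi> :: "'a::euclidean_space \<Rightarrow> 'a"
  assumes d: "decay (real DIM('a) - \<alpha>) A \<phi>"
  shows "AE w in lborel. norm ((w \<bullet> (\<phi> (x + w) - \<phi> x)) * norm w powr (-(real DIM('a) + \<alpha> + 1))) \<le> A * fdiv_dom \<alpha> x w"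
  using AE_lborel_neq[of "-x"]
proof eventually_elim
  case (elim w)
  then show ?case
    using fdiv_dom_bound[OF \<alpha> d elim] inner_powr_bound[of w "\<phi> (x + w) - \<phi> x" "real DIM('a) + \<alpha>"]
    by simp
qed

lemma fdiv_dom_integrable: "integrable lborel (fdiv_dom \<alpha> (x::'a::euclidean_space))"
  using fdiv_dom_integral[OF \<alpha>, where 'a='a] by metis

lemma fdiv_integrable:
  fixes \<phi> :: "'a::euclidean_space \<Rightarrow> 'a"
  assumes d: "decay (real DIM('a) - \<alpha>) A \<phi>"
  shows "integrable lborel (\<lambda>w. (w \<bullet> (\<phi> (x + w) - \<phi> x)) * norm w powr (-(real DIM('a) + \<alpha> + 1)))"
proof (rule Bochner_Integration.integrable_bound)
  show "integrable lborel (\<lambda>w. A * fdiv_dom \<alpha> x w)"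
    by (intro integrable_mult_right fdiv_dom_integrable)
  have [measurable]: "\<phi> \<in> borel_measurable borel"
    using DIM_minus_alpha_pos[where 'a='a] by (intro decay_borel[OF d]) auto
  show "(\<lambda>w. (w \<bullet> (\<phi> (x + w) - \<phi> x)) * norm w powr (-(real DIM('a) + \<alpha> + 1))) \<in> borel_measurable lborel"
    by measurable
  show "AE w in lborel. norm ((w \<bullet> (\<phi> (x + w) - \<phi> x)) * norm w powr (-(real DIM('a) + \<alpha> + 1))) \<le> norm (A * fdiv_dom \<alpha> x w)"
    using fdiv_dom_AE[OF d, of x] by eventually_elim auto
qed

text \<open>The absolute value stays inside the integral because Fubini in
  \<open>fdiv_superposition\<close> needs this stronger form.\<close>

lemma fdiv_abs_integral_bound:
  "\<exists>C\<ge>0. \<forall>A (\<phi> :: 'a::euclidean_space \<Rightarrow> 'a) x. decay (real DIM('a) - \<alpha>) A \<phi> \<longrightarrow>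
    (\<integral>w. \<bar>(w \<bullet> (\<phi> (x + w) - \<phi> x)) * norm w powr (-(real DIM('a) + \<alpha> + 1))\<bar> \<partial>lborel) \<le> C * A * (1 + norm x) powr (- real DIM('a))"
proof -
  obtain C where C: "C \<ge> 0" "\<And>x::'a::euclidean_space. integrable lborel (fdiv_dom \<alpha> x)"
    "\<And>x::'a. (\<integral>w. fdiv_dom \<alpha> x w \<partial>lborel) = C * (1 + norm x) powr (- real DIM('a))"
    using fdiv_dom_integral[OF \<alpha>] by metis
  show ?thesis
  proof (intro exI[of _ C] conjI C(1) allI impI)
    fix A x and \<phi> :: "'a \<Rightarrow> 'a" assume d: "decay (real DIM('a) - \<alpha>) A \<phi>"
    have "(\<integral>w. \<bar>(w \<bullet> (\<phi> (x + w) - \<phi> x)) * norm w powr (-(real DIM('a) + \<alpha> + 1))\<bar> \<partial>lborel) \<le> (\<integral>w. A * fdiv_dom \<alpha> x w \<partial>lborel)"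
      using fdiv_dom_AE[OF d, of x] fdiv_integrable[OF d, of x]
      by (intro integral_mono_AE integrable_mult_right C(2) integrable_abs) auto
    also have "\<dots> = C * A * (1 + norm x) powr (- real DIM('a))"
      using C(2) by (simp add: C(3))
    finally show "(\<integral>w. \<bar>(w \<bullet> (\<phi> (x + w) - \<phi> x)) * norm w powr (-(real DIM('a) + \<alpha> + 1))\<bar> \<partial>lborel) \<le> C * A * (1 + norm x) powr (- real DIM('a))" .
  qed
qed

lemma fdiv_bound:
  "\<exists>C\<ge>0. \<forall>A (\<phi> :: 'a::euclidean_space \<Rightarrow> 'a) x. decay (real DIM('a) - \<alpha>) A \<phi> \<longrightarrow>
    \<bar>fdiv \<alpha> \<phi> x\<bar> \<le> C * A * (1 + norm x) powr (- real DIM('a))"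
proof -
  obtain C where C: "C \<ge> 0" "\<And>A (\<phi> :: 'a \<Rightarrow> 'a) x. decay (real DIM('a) - \<alpha>) A \<phi> \<Longrightarrow>
    (\<integral>w. \<bar>(w \<bullet> (\<phi> (x + w) - \<phi> x)) * norm w powr (-(real DIM('a) + \<alpha> + 1))\<bar> \<partial>lborel) \<le> C * A * (1 + norm x) powr (- real DIM('a))"
    using fdiv_abs_integral_bound[where 'a='a] by blast
  show ?thesis
  proof (intro exI[of _ C] conjI C(1) allI impI)
    fix A x and \<phi> :: "'a \<Rightarrow> 'a" assume d: "decay (real DIM('a) - \<alpha>) A \<phi>"
    show "\<bar>fdiv \<alpha> \<phi> x\<bar> \<le> C * A * (1 + norm x) powr (- real DIM('a))"
      unfolding fdiv_def by (rule order_trans[OF integral_abs_bound C(2)[OF d, of x]])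
  qed
qed

text \<open>Pointwise convergence is enough: the common constant A turns
  \<open>A * fdiv_dom \<alpha> x w\<close> into one majorant for all k.\<close>

lemma fdiv_tendsto:
  fixes \<phi> :: "nat \<Rightarrow> 'a::euclidean_space \<Rightarrow> 'a"
  assumes d: "\<And>k. decay (real DIM('a) - \<alpha>) A (\<phi> k)" "decay (real DIM('a) - \<alpha>) A \<psi>"
    and lim: "\<And>z. (\<lambda>k. \<phi> k z) \<longlonglongrightarrow> \<psi> z"
  shows "(\<lambda>k. fdiv \<alpha> (\<phi> k) x) \<longlonglongrightarrow> fdiv \<alpha> \<psi> x"
  unfolding fdiv_def
proof (rule integral_dominated_convergence)
  have [measurable]: "\<phi> k \<in> borel_measurable borel" for k
    using DIM_minus_alpha_pos[where 'a='a] by (auto intro: decay_borel[OF d(1)])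
  have [measurable]: "\<psi> \<in> borel_measurable borel"
    using DIM_minus_alpha_pos[where 'a='a] by (auto intro: decay_borel[OF d(2)])
  show "integrable lborel (\<lambda>w. A * fdiv_dom \<alpha> x w)"
    by (intro integrable_mult_right fdiv_dom_integrable)
  show "AE w in lborel. norm ((w \<bullet> (\<phi> k (x + w) - \<phi> k x)) * norm w powr (-(real DIM('a) + \<alpha> + 1))) \<le> A * fdiv_dom \<alpha> x w" for k
    by (rule fdiv_dom_AE[OF d(1)])
  show "AE w in lborel. (\<lambda>k. (w \<bullet> (\<phi> k (x + w) - \<phi> k x)) * norm w powr (-(real DIM('a) + \<alpha> + 1)))
     \<longlonglongrightarrow> (w \<bullet> (\<psi> (x + w) - \<psi> x)) * norm w powr (-(real DIM('a) + \<alpha> + 1))"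
    by (intro AE_I2 tendsto_intros lim)
  show "(\<lambda>w. (w \<bullet> (\<psi> (x + w) - \<psi> x)) * norm w powr (-(real DIM('a) + \<alpha> + 1))) \<in> borel_measurable lborel"
    by measurable
  show "(\<lambda>w. (w \<bullet> (\<phi> k (x + w) - \<phi> k x)) * norm w powr (-(real DIM('a) + \<alpha> + 1))) \<in> borel_measurable lborel" for k
    by measurable
qed

lemma fdiv_borel:
  fixes \<phi> :: "'a::euclidean_space \<Rightarrow> 'a"
  assumes [measurable]: "\<phi> \<in> borel_measurable borel"
  shows "fdiv \<alpha> \<phi> \<in> borel_measurable borel"
  unfolding fdiv_def[abs_def] by measurable

lemma fdiv_add:
  fixes \<phi> :: "'a::euclidean_space \<Rightarrow> 'a"
  assumes d: "decay (real DIM('a) - \<alpha>) A \<phi>" "decay (real DIM('a) - \<alpha>) B \<psi>"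
  shows "fdiv \<alpha> (\<lambda>z. \<phi> z + \<psi> z) x = fdiv \<alpha> \<phi> x + fdiv \<alpha> \<psi> x"
proof -
  have "fdiv \<alpha> (\<lambda>z. \<phi> z + \<psi> z) x = (\<integral>w. (w \<bullet> (\<phi> (x + w) - \<phi> x)) * norm w powr (-(real DIM('a) + \<alpha> + 1))
     + (w \<bullet> (\<psi> (x + w) - \<psi> x)) * norm w powr (-(real DIM('a) + \<alpha> + 1)) \<partial>lborel)"
    unfolding fdiv_def by (intro Bochner_Integration.integral_cong) (auto simp: inner_simps algebra_simps)
  also have "\<dots> = fdiv \<alpha> \<phi> x + fdiv \<alpha> \<psi> x"
    unfolding fdiv_def by (intro Bochner_Integration.integral_add fdiv_integrable[OF d(1)] fdiv_integrable[OF d(2)])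
  finally show ?thesis .
qed

lemma fdiv_scaleR: "fdiv \<alpha> (\<lambda>z. c *\<^sub>R \<phi> z) x = c * fdiv \<alpha> \<phi> x"
  unfolding fdiv_def
  by (simp add: scaleR_diff_right[symmetric] mult.assoc)

lemma fdiv_sum:
  fixes \<phi> :: "'i \<Rightarrow> 'a::euclidean_space \<Rightarrow> 'a"
  assumes "finite I" "\<And>i. i \<in> I \<Longrightarrow> decay (real DIM('a) - \<alpha>) A (\<phi> i)"
  shows "fdiv \<alpha> (\<lambda>z. \<Sum>i\<in>I. \<phi> i z) x = (\<Sum>i\<in>I. fdiv \<alpha> (\<phi> i) x)"
  using assms
proof (induction I rule: finite_induct)
  case empty
  then show ?case by (simp add: fdiv_def)
next
  case (insert i I)
  have "decay (real DIM('a) - \<alpha>) (\<Sum>i\<in>I. A) (\<lambda>z. \<Sum>i\<in>I. \<phi> i z)"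
    using insert by (intro decay_sum) auto
  then show ?case
    using insert by (simp add: fdiv_add[of A])
qed

lemma fdiv_shift: "fdiv \<alpha> (\<lambda>z. \<phi> (z + y)) x = fdiv \<alpha> \<phi> (x + y)"
  unfolding fdiv_def by (simp add: algebra_simps)

text \<open>The constant \<open>m y\<close> enters both \<open>decay\<close> inequalities and the
  bound on the absolute integral linearly. Its integrability therefore gives the decay of the
  superposition and the hypothesis of Fubini's theorem at once.\<close>

lemma fdiv_superposition:
  fixes M :: "'c::euclidean_space \<Rightarrow> 'a::euclidean_space \<Rightarrow> 'a"
  assumes M [measurable]: "case_prod M \<in> borel_measurable (borel \<Otimes>\<^sub>M borel)"
    and d: "\<And>y. decay (real DIM('a) - \<alpha>) (m y) (M y)" and m: "integrable lborel m"
  shows "decay (real DIM('a) - \<alpha>) (\<integral>y. m y \<partial>lborel) (\<lambda>z. \<integral>y. M y z \<partial>lborel)"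
    and "fdiv \<alpha> (\<lambda>z. \<integral>y. M y z \<partial>lborel) x = (\<integral>y. fdiv \<alpha> (M y) x \<partial>lborel)"
proof -
  define s where "s = real DIM('a) - \<alpha>"
  note d' = d[folded s_def]
  have [measurable]: "(\<lambda>y. M y z) \<in> borel_measurable borel" for z
    by measurable
  have M_int: "integrable lborel (\<lambda>y. M y z)" for z
  proof (rule Bochner_Integration.integrable_bound)
    show "integrable lborel (\<lambda>y. m y * (1 + norm z) powr (-s))"
      by (intro integrable_mult_left m)
    show "AE y in lborel. norm (M y z) \<le> norm (m y * (1 + norm z) powr (-s))"
    proof (intro AE_I2)
      show "norm (M y z) \<le> norm (m y * (1 + norm z) powr (-s))" for y
        using order_trans[OF decayD(1)[OF d', of y z] abs_ge_self] by simp
    qed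
  qed measurable
  show dec: "decay (real DIM('a) - \<alpha>) (\<integral>y. m y \<partial>lborel) (\<lambda>z. \<integral>y. M y z \<partial>lborel)"
    unfolding decay_def s_def[symmetric]
  proof (intro conjI allI)
    fix z z'
    have "norm (\<integral>y. M y z \<partial>lborel) \<le> (\<integral>y. norm (M y z) \<partial>lborel)"
      by (rule integral_norm_bound)
    also have "\<dots> \<le> (\<integral>y. m y * (1 + norm z) powr (-s) \<partial>lborel)"
      by (intro integral_mono integrable_norm M_int integrable_mult_left m decayD(1)[OF d'])
    finally show "norm (\<integral>y. M y z \<partial>lborel) \<le> (\<integral>y. m y \<partial>lborel) * (1 + norm z) powr - s"
      by simp
    have "(\<integral>y. M y z \<partial>lborel) - (\<integral>y. M y z' \<partial>lborel) = (\<integral>y. M y z - M y z' \<partial>lborel)"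
      by (simp add: M_int)
    also have "norm \<dots> \<le> (\<integral>y. norm (M y z - M y z') \<partial>lborel)"
      by (rule integral_norm_bound)
    also have "\<dots> \<le> (\<integral>y. m y * (norm (z - z') * (1 + min (norm z) (norm z')) powr (- s - 1)) \<partial>lborel)"
      using decayD(2)[OF d', of _ z z'] unfolding mult.assoc
      by (intro integral_mono integrable_norm Bochner_Integration.integrable_diff M_int integrable_mult_left m)
    finally show "norm ((\<integral>y. M y z \<partial>lborel) - (\<integral>y. M y z' \<partial>lborel))
       \<le> (\<integral>y. m y \<partial>lborel) * norm (z - z') * (1 + min (norm z) (norm z')) powr (- s - 1)"
      by (simp add: mult.assoc)
  qed
  obtain C where C: "C \<ge> 0" "\<And>A (\<phi> :: 'a \<Rightarrow> 'a) x. decay (real DIM('a) - \<alpha>) A \<phi> \<Longrightarrow>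
    (\<integral>w. \<bar>(w \<bullet> (\<phi> (x + w) - \<phi> x)) * norm w powr (-(real DIM('a) + \<alpha> + 1))\<bar> \<partial>lborel) \<le> C * A * (1 + norm x) powr (- real DIM('a))"
    using fdiv_abs_integral_bound[where 'a='a] by blast
  define F where "F y w = (w \<bullet> (M y (x + w) - M y x)) * norm w powr (-(real DIM('a) + \<alpha> + 1))" for y w
  have [measurable]: "case_prod F \<in> borel_measurable (borel \<Otimes>\<^sub>M borel)"
    unfolding F_def by measurable
  have mF: "case_prod F \<in> borel_measurable (lborel \<Otimes>\<^sub>M lborel)"
    by measurable
  have F: "integrable (lborel \<Otimes>\<^sub>M lborel) (case_prod F)"
  proof (rule lborel_pair.Fubini_integrable[OF mF])
    show "AE y in lborel. integrable lborel (\<lambda>w. case_prod F (y, w))"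
      using fdiv_integrable[OF d] by (simp add: F_def)
    show "integrable lborel (\<lambda>y. \<integral>w. norm (case_prod F (y, w)) \<partial>lborel)"
    proof (rule Bochner_Integration.integrable_bound)
      show "integrable lborel (\<lambda>y. C * m y * (1 + norm x) powr (- real DIM('a)))"
        by (intro integrable_mult_left integrable_mult_right m)
      show "AE y in lborel. norm (\<integral>w. norm (case_prod F (y, w)) \<partial>lborel) \<le> norm (C * m y * (1 + norm x) powr (- real DIM('a)))"
      proof (intro AE_I2)
        show "norm (\<integral>w. norm (case_prod F (y, w)) \<partial>lborel) \<le> norm (C * m y * (1 + norm x) powr (- real DIM('a)))" for y
          using C(2)[OF d, of y x] by (simp add: F_def)
      qed
    qed measurable
  qed
  have "fdiv \<alpha> (\<lambda>z. \<integral>y. M y z \<partial>lborel) x = (\<integral>w. (\<integral>y. F y w \<partial>lborel) \<partial>lborel)"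
    unfolding fdiv_def F_def
    by (simp add: M_int flip: Bochner_Integration.integral_diff)
  also have "\<dots> = (\<integral>y. (\<integral>w. F y w \<partial>lborel) \<partial>lborel)"
    using lborel_pair.Fubini_integral[of F] F by simp
  finally show "fdiv \<alpha> (\<lambda>z. \<integral>y. M y z \<partial>lborel) x = (\<integral>y. fdiv \<alpha> (M y) x \<partial>lborel)"
    by (simp add: fdiv_def F_def)
qed

end

subsection \<open>Test fields and their approximation\<close>

text \<open>Any explicit derivative agrees with \<open>frechet_derivative\<close>, so smoothness can
  be proved by induction on formulas for derivatives.\<close>

lemma C_k_SucI:
  assumes "\<And>x. (f has_derivative f' x) (at x)" "\<And>v. C_k k (\<lambda>x. f' x v)"
  shows "C_k (Suc k) f"
proof -
  have "frechet_derivative f (at x) = f' x" for x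
    using frechet_derivative_at[OF assms(1)] by simp
  then show ?thesis
    using assms by (auto simp: differentiable_def)
qed

lemma C_k_SucD:
  assumes "C_k (Suc k) f"
  shows "(f has_derivative frechet_derivative f (at x)) (at x)"
    and "C_k k (\<lambda>x. frechet_derivative f (at x) v)"
  using assms by (auto simp: frechet_derivative_works)

lemma C_k_Suc_imp: "C_k (Suc k) f \<Longrightarrow> C_k k f"
proof (induction k arbitrary: f)
  case 0
  then have "continuous (at x) f" for x
    using C_k_SucD(1)[OF 0] has_derivative_continuous by blast
  then show ?case
    by (simp add: continuous_at_imp_continuous_on)
next
  case (Suc k)
  then show ?case
    using C_k_SucD[OF Suc.prems] by (intro C_k_SucI[where f' = "\<lambda>x. frechet_derivative f (at x)"]) auto
qed

lemma C_k_const: "C_k k (\<lambda>_. c)"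
proof (induction k arbitrary: c)
  case 0
  show ?case by simp
next
  case (Suc k)
  show ?case
    by (rule C_k_SucI[where f' = "\<lambda>_ _. 0"]) (auto intro: Suc)
qed

lemma C_k_linear:
  assumes "bounded_linear f"
  shows "C_k k f"
proof (cases k)
  case 0
  then show ?thesis
    using assms by (simp add: linear_continuous_on)
next
  case (Suc l)
  show ?thesis
    unfolding Suc using bounded_linear_imp_has_derivative[OF assms]
    by (intro C_k_SucI[where f' = "\<lambda>_. f"] C_k_const)
qed

lemma C_k_add: "C_k k f \<Longrightarrow> C_k k g \<Longrightarrow> C_k k (\<lambda>x. f x + g x)"
proof (induction k arbitrary: f g)
  case 0
  then show ?case by (auto intro: continuous_intros)
next
  case (Suc k)
  show ?case
  proof (rule C_k_SucI)
    show "((\<lambda>x. f x + g x) has_derivative (\<lambda>v. frechet_derivative f (at x) v + frechet_derivative g (at x) v)) (at x)" for x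
      using C_k_SucD(1)[OF Suc.prems(1)] C_k_SucD(1)[OF Suc.prems(2)] by (rule has_derivative_add)
    show "C_k k (\<lambda>x. frechet_derivative f (at x) v + frechet_derivative g (at x) v)" for v
      by (intro Suc.IH C_k_SucD(2)[OF Suc.prems(1)] C_k_SucD(2)[OF Suc.prems(2)])
  qed
qed

lemma C_k_scaleR: "C_k k f \<Longrightarrow> C_k k g \<Longrightarrow> C_k k (\<lambda>x. f x *\<^sub>R g x)"
proof (induction k arbitrary: f g)
  case 0
  then show ?case by (auto intro: continuous_intros)
next
  case (Suc k)
  show ?case
  proof (rule C_k_SucI)
    show "((\<lambda>x. f x *\<^sub>R g x) has_derivative (\<lambda>v. f x *\<^sub>R frechet_derivative g (at x) v + frechet_derivative f (at x) v *\<^sub>R g x)) (at x)" for x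
      using C_k_SucD(1)[OF Suc.prems(1)] C_k_SucD(1)[OF Suc.prems(2)] by (rule has_derivative_scaleR)
    show "C_k k (\<lambda>x. f x *\<^sub>R frechet_derivative g (at x) v + frechet_derivative f (at x) v *\<^sub>R g x)" for v
      using C_k_Suc_imp[OF Suc.prems(1)] C_k_Suc_imp[OF Suc.prems(2)]
      by (intro C_k_add Suc.IH C_k_SucD(2)[OF Suc.prems(1)] C_k_SucD(2)[OF Suc.prems(2)])
  qed
qed

lemma C_k_dilate: "C_k k f \<Longrightarrow> C_k k (\<lambda>x. f (c *\<^sub>R x))"
proof (induction k arbitrary: f)
  case 0
  then have "continuous_on UNIV (f \<circ> (\<lambda>x. c *\<^sub>R x))"
    by (intro continuous_on_compose continuous_intros) (auto intro: continuous_on_subset)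
  then show ?case
    by (simp add: o_def)
next
  case (Suc k)
  show ?case
  proof (rule C_k_SucI)
    show "((\<lambda>x. f (c *\<^sub>R x)) has_derivative (\<lambda>v. c *\<^sub>R frechet_derivative f (at (c *\<^sub>R x)) v)) (at x)" for x
    proof -
      have lin: "linear (frechet_derivative f (at (c *\<^sub>R x)))"
        using C_k_SucD(1)[OF Suc.prems] has_derivative_linear by blast
      have "((\<lambda>x. f (c *\<^sub>R x)) has_derivative (\<lambda>v. frechet_derivative f (at (c *\<^sub>R x)) (c *\<^sub>R v))) (at x)"
        by (rule has_derivative_compose[OF _ C_k_SucD(1)[OF Suc.prems]])
           (auto intro!: derivative_eq_intros)
      then show ?thesis
        by (simp add: linear_scale[OF lin])
    qed
    show "C_k k (\<lambda>x. c *\<^sub>R frechet_derivative f (at (c *\<^sub>R x)) v)" for v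
      by (intro C_k_scaleR C_k_const Suc.IH[OF C_k_SucD(2)[OF Suc.prems]])
  qed
qed

section \<open>A smooth bump function and the regularity of test fields\<close>

text \<open>Up to linear combinations this family, extended by 0, is closed under differentiation.
  Smoothness can thus be shown by induction on the order of differentiability, for all m
  simultaneously.\<close>

definition exp_bump :: "nat \<Rightarrow> real \<Rightarrow> real" where
  "exp_bump m s = (if 0 < s then exp (- (1 / s)) / s ^ m else 0)"

lemma exp_bump_nonneg: "0 \<le> exp_bump m s"
  by (simp add: exp_bump_def)

text \<open>A single term of the exponential series at 1/s is kept, the one of index m + 2: besides
  cancelling s^m it leaves s^2, one power more than differentiability at 0 requires.\<close>

lemma exp_bump_le:
  assumes "0 < s" shows "exp_bump m s \<le> fact (m + 2) * s\<^sup>2"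
proof -
  have "(1/s) ^ (m+2) / fact (m+2) \<le> exp (1/s)"
  proof -
    have "(\<lambda>k. (1/s) ^ k / fact k) sums exp (1/s)"
      using exp_converges[of "1/s"] by (simp add: divide_inverse mult.commute)
    then have "(\<Sum>k\<in>{m+2}. (1/s) ^ k / fact k) \<le> exp (1/s)"
      using assms sum_le_suminf[of "\<lambda>k. (1/s) ^ k / fact k" "{m+2}"]
      by (auto simp: sums_iff)
    then show ?thesis by simp
  qed
  moreover define F P where "F = (fact (m+2) :: real)" and "P = s ^ (m+2)"
  moreover have "F > 0" "P > 0"
    using assms by (simp_all add: F_def P_def del: fact_Suc)
  ultimately have "exp (-(1/s)) \<le> F * P"
    by (simp add: exp_minus power_one_over field_simps del: fact_Suc power_Suc power_add add_2_eq_Suc')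
  then have "exp (-(1/s)) \<le> fact (m+2) * s ^ (m+2)"
    by (simp only: F_def P_def)
  then have "exp (-(1/s)) / s ^ m \<le> fact (m+2) * s ^ (m+2) / s ^ m"
    using assms by (intro divide_right_mono) auto
  then show ?thesis
    using assms by (simp add: exp_bump_def power_add power2_eq_square)
qed

lemma exp_bump_DERIV: "(exp_bump m has_real_derivative exp_bump (m+2) s - m * exp_bump (m+1) s) (at s)"
proof -
  consider "s > 0" | "s < 0" | "s = 0" by linarith
  then show ?thesis
  proof cases
    case 1
    have "((\<lambda>s. exp (- (1 / s)) / s ^ m) has_real_derivative exp_bump (m+2) s - m * exp_bump (m+1) s) (at s)"
    proof (cases m)
      case 0
      with 1 show ?thesis
        by (auto intro!: derivative_eq_intros simp: exp_bump_def field_simps power2_eq_square)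
    next
      case (Suc k)
      define q where "q = s ^ k"
      have q: "q > 0" "s ^ m = s * q" "s ^ (m+1) = s * s * q" "s ^ (m+2) = s * s * s * q"
        using 1 by (simp_all add: q_def Suc)
      have "((\<lambda>s. exp (- (1 / s))) has_real_derivative exp (- (1 / s)) / (s * s)) (at s)"
        using 1 by (auto intro!: derivative_eq_intros simp: field_simps power2_eq_square)
      moreover have "((\<lambda>s. s ^ m) has_real_derivative real m * q) (at s)"
        using DERIV_pow[of m s UNIV] by (simp add: Suc q_def)
      ultimately have "((\<lambda>s. exp (- (1 / s)) / s ^ m) has_real_derivative
          (exp (- (1 / s)) / (s * s) * s ^ m - exp (- (1 / s)) * (real m * q)) / (s ^ m * s ^ m)) (at s)"
        using 1 by (intro DERIV_divide) auto
      moreover have "(exp (- (1 / s)) / (s * s) * s ^ m - exp (- (1 / s)) * (real m * q)) / (s ^ m * s ^ m)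
          = exp_bump (m+2) s - m * exp_bump (m+1) s"
        using 1 q(1) unfolding exp_bump_def q(2) q(3) q(4) by (simp add: field_simps)
      ultimately show ?thesis
        by simp
    qed
    then show ?thesis
      by (rule has_field_derivative_transform_within_open[of _ _ _ "{0<..}"])
         (use 1 in \<open>auto simp: exp_bump_def\<close>)
  next
    case 2
    have "((\<lambda>s. 0) has_real_derivative exp_bump (m+2) s - m * exp_bump (m+1) s) (at s)"
      using 2 by (simp add: exp_bump_def)
    then show ?thesis
      by (rule has_field_derivative_transform_within_open[of _ _ _ "{..<0}"])
         (use 2 in \<open>auto simp: exp_bump_def\<close>)
  next
    case 3
    \<comment> \<open>By the quadratic bound the difference quotient is O(|y|). Hence the derivative
      at 0 is 0, which is also the value of the claimed expression there.\<close>
    have "((\<lambda>y. (exp_bump m y - exp_bump m 0) / (y - 0)) \<longlongrightarrow> 0) (at 0)"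
    proof (rule Lim_null_comparison)
      show "\<forall>\<^sub>F y in at 0. norm ((exp_bump m y - exp_bump m 0) / (y - 0)) \<le> fact (m+2) * \<bar>y\<bar>"
      proof (intro always_eventually allI)
        fix y :: real
        show "norm ((exp_bump m y - exp_bump m 0) / (y - 0)) \<le> fact (m+2) * \<bar>y\<bar>"
        proof (cases "y > 0")
          case True
          then show ?thesis
            using exp_bump_le[OF True, of m] exp_bump_nonneg[of m y]
            by (simp add: exp_bump_def[of m 0] field_simps power2_eq_square)
        next
          case False
          then have "norm ((exp_bump m y - exp_bump m 0) / (y - 0)) = 0"
            by (simp add: exp_bump_def)
          also have "\<dots> \<le> fact (m+2) * \<bar>y\<bar>"
            by (intro mult_nonneg_nonneg) auto
          finally show ?thesis .
        qed
      qed
      show "((\<lambda>y. fact (m+2) * \<bar>y\<bar>) \<longlongrightarrow> (0::real)) (at 0)"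
        by (auto intro!: tendsto_eq_intros)
    qed
    then show ?thesis
      using 3 by (simp add: has_field_derivative_iff exp_bump_def[of _ 0])
  qed
qed

text \<open>Composing with 1 - x . x instead of 1 - |x| keeps the inner function smooth at the
  origin. Generalising over m closes the induction.\<close>

lemma C_k_exp_bump:
  "C_k k (\<lambda>x::'a::real_inner. exp_bump m (1 - x \<bullet> x))"
proof (induction k arbitrary: m)
  case 0
  have "continuous_on UNIV (exp_bump m)"
    using exp_bump_DERIV by (auto intro!: continuous_at_imp_continuous_on DERIV_isCont)
  then have "continuous_on UNIV (exp_bump m \<circ> (\<lambda>x::'a. 1 - x \<bullet> x))"
    by (intro continuous_on_compose continuous_intros) (auto intro: continuous_on_subset)
  then show ?case
    by (simp add: o_def)
next
  case (Suc k)
  show ?case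
  proof (rule C_k_SucI)
    show "((\<lambda>x::'a. exp_bump m (1 - x \<bullet> x)) has_derivative
      (\<lambda>v. (exp_bump (m+2) (1 - x \<bullet> x) + (- real m) * exp_bump (m+1) (1 - x \<bullet> x)) * (- 2 * (v \<bullet> x)))) (at x)" for x
    proof -
      have "((\<lambda>x::'a. 1 - x \<bullet> x) has_derivative (\<lambda>v. - 2 * (v \<bullet> x))) (at x)"
        by (auto intro!: derivative_eq_intros simp: inner_commute)
      from has_derivative_compose[OF this, of "exp_bump m", OF exp_bump_DERIV[of m "1 - x \<bullet> x", unfolded has_field_derivative_def]]
      show ?thesis by simp
    qed
    have lin: "C_k k (\<lambda>x::'a. - 2 * (v \<bullet> x))" for v
      by (intro C_k_linear bounded_linear_const_mult bounded_linear_inner_right)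
    have sm: "C_k k (\<lambda>x::'a. f x * g x)" if "C_k k f" "C_k k g" for f g :: "'a \<Rightarrow> real"
      using C_k_scaleR[OF that] by simp
    show "C_k k (\<lambda>x::'a. (exp_bump (m+2) (1 - x \<bullet> x) + (- real m) * exp_bump (m+1) (1 - x \<bullet> x)) * (- 2 * (v \<bullet> x)))" for v
      by (intro sm lin C_k_add Suc.IH C_k_const)
  qed
qed

lemma Cc_infinityD:
  assumes "\<phi> \<in> Cc_infinity"
  shows "C_k k \<phi>" and "compact (closure {x. \<phi> x \<noteq> 0})"
  using assms by (auto simp: Cc_infinity_def)

lemma Cc_infinityI:
  fixes \<phi> :: "'a::euclidean_space \<Rightarrow> 'b::real_normed_vector"
  assumes "\<And>k. C_k k \<phi>" and "\<And>x. \<phi> x \<noteq> 0 \<Longrightarrow> norm x \<le> R"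
  shows "\<phi> \<in> Cc_infinity"
proof -
  have "bounded {x. \<phi> x \<noteq> 0}"
    using assms(2) by (auto intro: boundedI)
  then show ?thesis
    using assms(1) by (simp add: Cc_infinity_def compact_closure)
qed

lemma Cc_infinity_support:
  fixes \<phi> :: "'a::euclidean_space \<Rightarrow> 'b::real_normed_vector"
  assumes "\<phi> \<in> Cc_infinity"
  obtains R where "R > 0" "\<And>x. \<phi> x \<noteq> 0 \<Longrightarrow> norm x \<le> R"
proof -
  have "bounded {x. \<phi> x \<noteq> 0}"
    using Cc_infinityD(2)[OF assms] by (simp add: compact_closure)
  then show ?thesis
    using that unfolding bounded_pos by auto
qed

lemma Cc_infinity_frechet_derivative:
  fixes \<phi> :: "'a::euclidean_space \<Rightarrow> 'b::real_normed_vector"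
  assumes "\<phi> \<in> Cc_infinity"
  shows "(\<lambda>x. frechet_derivative \<phi> (at x) v) \<in> Cc_infinity"
proof -
  obtain R where R: "R > 0" "\<And>x. \<phi> x \<noteq> 0 \<Longrightarrow> norm x \<le> R"
    using Cc_infinity_support[OF assms] by metis
  have "frechet_derivative \<phi> (at x) v = 0" if "norm x > R" for x
  proof -
    have "((\<lambda>_. 0) has_derivative (\<lambda>_. 0)) (at x)"
      by simp
    moreover have "open (- cball (0::'a) R)" "x \<in> - cball 0 R"
      using that by auto
    ultimately have "(\<phi> has_derivative (\<lambda>_. 0)) (at x)"
      by (rule has_derivative_transform_within_open) (use R(2) in fastforce)
    then show ?thesis
      using frechet_derivative_at by metis
  qed
  then have "norm x \<le> R" if "frechet_derivative \<phi> (at x) v \<noteq> 0" for x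
    using that by force
  then show ?thesis
    using C_k_SucD(2)[OF Cc_infinityD(1)[OF assms]] by (intro Cc_infinityI[where R = R]) auto
qed

lemma Cc_infinity_bounded:
  fixes \<phi> :: "'a::euclidean_space \<Rightarrow> 'b::real_normed_vector"
  assumes "\<phi> \<in> Cc_infinity"
  obtains B where "B \<ge> 0" "\<And>x. norm (\<phi> x) \<le> B"
proof -
  let ?K = "closure {x. \<phi> x \<noteq> 0}"
  have "continuous_on ?K \<phi>"
    using Cc_infinityD(1)[OF assms, of 0] by (auto intro: continuous_on_subset)
  then have "bounded (\<phi> ` ?K)"
    using Cc_infinityD(2)[OF assms] compact_continuous_image compact_imp_bounded by blast
  then obtain B where B: "B > 0" "\<And>x. x \<in> ?K \<Longrightarrow> norm (\<phi> x) \<le> B"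
    unfolding bounded_pos by auto
  have "norm (\<phi> x) \<le> B" for x
  proof (cases "\<phi> x = 0")
    case False
    then have "x \<in> ?K"
      using closure_subset[of "{x. \<phi> x \<noteq> 0}"] by auto
    then show ?thesis
      using B(2) by auto
  qed (use B in auto)
  then show thesis
    using that[of B] B(1) by auto
qed

text \<open>Smoothness is encoded by directional derivatives in fixed directions, each of which is
  bounded on its own. The finitely many basis directions yield an operator norm bound, and the mean
  value inequality the Lipschitz bound.\<close>

lemma Cc_infinity_derivative_bound:
  fixes \<phi> :: "'a::euclidean_space \<Rightarrow> 'b::real_normed_vector"
  assumes \<phi>: "\<phi> \<in> Cc_infinity"
  obtains B where "B \<ge> 0" "\<And>x v. norm (frechet_derivative \<phi> (at x) v) \<le> B * norm v"
    "\<And>x y. norm (\<phi> x - \<phi> y) \<le> B * norm (x - y)"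
proof -
  have der: "(\<phi> has_derivative frechet_derivative \<phi> (at x)) (at x)" for x
    using C_k_SucD(1)[OF Cc_infinityD(1)[OF \<phi>]] .
  have "\<exists>B\<ge>0. \<forall>x. norm (frechet_derivative \<phi> (at x) b) \<le> B" for b
    using Cc_infinity_bounded[OF Cc_infinity_frechet_derivative[OF \<phi>, of b]] by metis
  then obtain B where B: "\<And>b. B b \<ge> 0" "\<And>b x. norm (frechet_derivative \<phi> (at x) b) \<le> B b"
    by metis
  define C where "C = (\<Sum>b\<in>Basis. B b)"
  have 1: "norm (frechet_derivative \<phi> (at x) v) \<le> C * norm v" for x v
  proof -
    have lin: "linear (frechet_derivative \<phi> (at x))"
      using der has_derivative_linear by blast
    have "frechet_derivative \<phi> (at x) v = frechet_derivative \<phi> (at x) (\<Sum>b\<in>Basis. (v \<bullet> b) *\<^sub>R b)"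
      by (simp add: euclidean_representation)
    also have "\<dots> = (\<Sum>b\<in>Basis. (v \<bullet> b) *\<^sub>R frechet_derivative \<phi> (at x) b)"
      by (simp add: linear_sum[OF lin] linear_scale[OF lin])
    also have "norm \<dots> \<le> (\<Sum>b\<in>Basis. norm v * B b)"
      using B by (intro sum_norm_le) (auto intro!: mult_mono Basis_le_norm)
    also have "\<dots> = C * norm v"
      by (simp add: C_def sum_distrib_left mult.commute)
    finally show ?thesis .
  qed
  have 2: "norm (\<phi> x - \<phi> y) \<le> C * norm (x - y)" for x y
  proof (rule differentiable_bound[where S = UNIV and f' = "\<lambda>x. frechet_derivative \<phi> (at x)"])
    show "onorm (frechet_derivative \<phi> (at x)) \<le> C" for x
      using 1 by (rule onorm_le)
  qed (use der in \<open>auto intro: has_derivative_at_withinI\<close>)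
  have "C \<ge> 0"
    by (auto simp: C_def intro!: sum_nonneg B)
  then show thesis
    using that 1 2 by blast
qed

text \<open>On the ball of radius R the weights are bounded below, so boundedness and the Lipschitz
  estimate suffice; a difference of values at two points outside the ball vanishes.\<close>

lemma Cc_infinity_decay:
  fixes \<phi> :: "'a::euclidean_space \<Rightarrow> 'b::real_normed_vector"
  assumes \<phi>: "\<phi> \<in> Cc_infinity" and s: "0 \<le> s"
  shows "\<exists>A. decay s A \<phi>"
proof -
  obtain R where R: "R > 0" "\<And>x. \<phi> x \<noteq> 0 \<Longrightarrow> norm x \<le> R"
    using Cc_infinity_support[OF \<phi>] by metis
  obtain B where B: "B \<ge> 0" "\<And>x. norm (\<phi> x) \<le> B"
    using Cc_infinity_bounded[OF \<phi>] by metis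
  obtain L where L: "L \<ge> 0" "\<And>x y. norm (\<phi> x - \<phi> y) \<le> L * norm (x - y)"
    using Cc_infinity_derivative_bound[OF \<phi>] by metis
  define A where "A = max (B * (1 + R) powr s) (L * (1 + R) powr (s + 1))"
  have pw: "1 \<le> (1 + R) powr m * (1 + u) powr (- m)" if "0 \<le> u" "u \<le> R" "0 \<le> m" for u m
    using powr_one_plus_shift[of u 0 R m] that by simp
  have "decay s A \<phi>"
    unfolding decay_def
  proof (intro conjI allI)
    fix z z'
    show "norm (\<phi> z) \<le> A * (1 + norm z) powr - s"
    proof (cases "norm z \<le> R")
      case True
      have "B * 1 \<le> B * ((1 + R) powr s * (1 + norm z) powr - s)"
        using pw[of "norm z" s] True s B(1) by (intro mult_left_mono) auto
      also have "\<dots> \<le> A * (1 + norm z) powr - s"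
        unfolding mult.assoc[symmetric] by (intro mult_right_mono) (auto simp: A_def)
      finally show ?thesis
        using B(2)[of z] by simp
    next
      case False
      then have "\<phi> z = 0"
        using R by force
      then show ?thesis
        using L(1) by (auto simp: A_def le_max_iff_disj intro!: mult_nonneg_nonneg)
    qed
    show "norm (\<phi> z - \<phi> z') \<le> A * norm (z - z') * (1 + min (norm z) (norm z')) powr (- s - 1)"
    proof (cases "min (norm z) (norm z') \<le> R")
      case True
      have "L * norm (z - z') * 1 \<le> L * norm (z - z') * ((1 + R) powr (s + 1) * (1 + min (norm z) (norm z')) powr - (s + 1))"
        using pw[of "min (norm z) (norm z')" "s + 1"] True s L(1) by (intro mult_left_mono) auto
      also have "\<dots> = (L * (1 + R) powr (s + 1)) * (norm (z - z') * (1 + min (norm z) (norm z')) powr (- s - 1))"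
        by (simp add: mult_ac)
      also have "\<dots> \<le> A * (norm (z - z') * (1 + min (norm z) (norm z')) powr (- s - 1))"
        by (intro mult_right_mono) (auto simp: A_def)
      finally show ?thesis
        using L(2)[of z z'] by (simp add: mult.assoc)
    next
      case False
      then have "\<phi> z = 0" "\<phi> z' = 0"
        using R by force+
      then show ?thesis
        using L(1) by (auto simp: A_def le_max_iff_disj intro!: mult_nonneg_nonneg)
    qed
  qed
  then show ?thesis ..
qed

lemma convolution_has_derivative:
  fixes \<eta> :: "'a::euclidean_space \<Rightarrow> real" and \<psi> :: "'a \<Rightarrow> 'b::euclidean_space"
  assumes \<eta>: "\<eta> \<in> Cc_infinity" and \<psi>: "integrable lborel \<psi>"
  shows "((\<lambda>x. \<integral>y. \<eta> (x - y) *\<^sub>R \<psi> y \<partial>lborel) has_derivative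
     (\<lambda>v. \<integral>y. frechet_derivative \<eta> (at (x - y)) v *\<^sub>R \<psi> y \<partial>lborel)) (at x)"
proof -
  let ?D = "\<lambda>z. frechet_derivative \<eta> (at z)"
  obtain B where B: "B \<ge> 0" "\<And>x v. norm (?D x v) \<le> B * norm v" "\<And>x y. norm (\<eta> x - \<eta> y) \<le> B * norm (x - y)"
    using Cc_infinity_derivative_bound[OF \<eta>] by metis
  have der: "(\<eta> has_derivative ?D z) (at z)" for z
    using C_k_SucD(1)[OF Cc_infinityD(1)[OF \<eta>]] .
  have lin: "linear (?D z)" for z
    using der has_derivative_linear by blast
  obtain B0 where B0: "B0 \<ge> 0" "\<And>x. norm (\<eta> x) \<le> B0"
    using Cc_infinity_bounded[OF \<eta>] by metis
  have [measurable]: "\<eta> \<in> borel_measurable borel"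
    using Cc_infinityD(1)[OF \<eta>, of 0] by (simp add: borel_measurable_continuous_onI)
  have [measurable]: "(\<lambda>z. ?D z v) \<in> borel_measurable borel" for v
    using Cc_infinityD(1)[OF Cc_infinity_frechet_derivative[OF \<eta>, of v], of 0]
    by (simp add: borel_measurable_continuous_onI)
  have [measurable]: "\<psi> \<in> borel_measurable borel"
    using \<psi> by (simp add: borel_measurable_integrable[OF \<psi>, simplified])
  have i1: "integrable lborel (\<lambda>y. \<eta> (x - y) *\<^sub>R \<psi> y)" for x
  proof (rule Bochner_Integration.integrable_bound)
    show "integrable lborel (\<lambda>y. B0 *\<^sub>R \<psi> y)"
      using \<psi> by simp
    show "AE y in lborel. norm (\<eta> (x - y) *\<^sub>R \<psi> y) \<le> norm (B0 *\<^sub>R \<psi> y)"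
      using B0 by (intro AE_I2) (auto intro!: mult_right_mono)
  qed measurable
  have i2: "integrable lborel (\<lambda>y. ?D (x - y) v *\<^sub>R \<psi> y)" for v
  proof (rule Bochner_Integration.integrable_bound)
    show "integrable lborel (\<lambda>y. (B * norm v) *\<^sub>R \<psi> y)"
      using \<psi> by simp
    show "AE y in lborel. norm (?D (x - y) v *\<^sub>R \<psi> y) \<le> norm ((B * norm v) *\<^sub>R \<psi> y)"
      using B by (intro AE_I2) (auto intro!: mult_right_mono)
  qed measurable
  show ?thesis
    unfolding has_derivative_at
  proof
    show "bounded_linear (\<lambda>v. \<integral>y. ?D (x - y) v *\<^sub>R \<psi> y \<partial>lborel)"
    proof (rule bounded_linear_intro)
      show "(\<integral>y. ?D (x - y) (u + v) *\<^sub>R \<psi> y \<partial>lborel) = (\<integral>y. ?D (x - y) u *\<^sub>R \<psi> y \<partial>lborel) + (\<integral>y. ?D (x - y) v *\<^sub>R \<psi> y \<partial>lborel)" for u v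
        by (simp add: linear_add[OF lin] scaleR_add_left i2)
      show "(\<integral>y. ?D (x - y) (r *\<^sub>R v) *\<^sub>R \<psi> y \<partial>lborel) = r *\<^sub>R (\<integral>y. ?D (x - y) v *\<^sub>R \<psi> y \<partial>lborel)" for r v
        by (simp add: linear_scale[OF lin] flip: scaleR_scaleR)
      show "norm (\<integral>y. ?D (x - y) v *\<^sub>R \<psi> y \<partial>lborel) \<le> norm v * (\<integral>y. B * norm (\<psi> y) \<partial>lborel)" for v
      proof -
        have "norm (\<integral>y. ?D (x - y) v *\<^sub>R \<psi> y \<partial>lborel) \<le> (\<integral>y. norm v * (B * norm (\<psi> y)) \<partial>lborel)"
          using B(2)[of _ v] \<psi>
          by (intro order_trans[OF integral_norm_bound integral_mono] integrable_norm[OF i2] integrable_mult_right integrable_norm)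
             (auto simp: mult.assoc[symmetric] mult.commute[of "norm v"] intro!: mult_right_mono)
        then show ?thesis by simp
      qed
    qed
    \<comment> \<open>The remainder of the linear approximation divided by |h|. It is dominated by 2
      B |\<psi>(y)|, one B coming from the Lipschitz bound and one from the derivative.\<close>
    define Q where "Q h y = ((\<eta> (x + h - y) - \<eta> (x - y) - ?D (x - y) h) / norm h) *\<^sub>R \<psi> y" for h y
    show "(\<lambda>h. norm ((\<integral>y. \<eta> (x + h - y) *\<^sub>R \<psi> y \<partial>lborel) - (\<integral>y. \<eta> (x - y) *\<^sub>R \<psi> y \<partial>lborel)
       - (\<integral>y. ?D (x - y) h *\<^sub>R \<psi> y \<partial>lborel)) / norm h) \<midarrow>0\<rightarrow> 0"
      unfolding tendsto_at_iff_sequentially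
    proof (intro allI impI)
      fix X :: "nat \<Rightarrow> 'a" assume X: "\<forall>i. X i \<in> UNIV - {0}" and X0: "X \<longlonglongrightarrow> 0"
      have eq: "(\<integral>y. Q h y \<partial>lborel) = inverse (norm h) *\<^sub>R ((\<integral>y. \<eta> (x + h - y) *\<^sub>R \<psi> y \<partial>lborel) - (\<integral>y. \<eta> (x - y) *\<^sub>R \<psi> y \<partial>lborel)
       - (\<integral>y. ?D (x - y) h *\<^sub>R \<psi> y \<partial>lborel))" for h
      proof -
        have "(\<integral>y. Q h y \<partial>lborel) = (\<integral>y. inverse (norm h) *\<^sub>R (\<eta> (x + h - y) *\<^sub>R \<psi> y - \<eta> (x - y) *\<^sub>R \<psi> y - ?D (x - y) h *\<^sub>R \<psi> y) \<partial>lborel)"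
          unfolding Q_def by (intro Bochner_Integration.integral_cong) (auto simp: algebra_simps divide_inverse)
        then show ?thesis
          by (simp add: i1 i2)
      qed
      have "(\<lambda>i. \<integral>y. Q (X i) y \<partial>lborel) \<longlonglongrightarrow> (\<integral>y. 0 \<partial>(lborel::'a measure))"
      proof (rule integral_dominated_convergence)
        show "integrable lborel (\<lambda>y. (2 * B) * norm (\<psi> y))"
          using \<psi> by simp
        show "AE y in lborel. norm (Q (X i) y) \<le> (2 * B) * norm (\<psi> y)" for i
        proof (intro AE_I2)
          fix y
          have "\<bar>\<eta> (x + X i - y) - \<eta> (x - y) - ?D (x - y) (X i)\<bar> \<le> B * norm (X i) + B * norm (X i)"
            using B(2)[of "x - y" "X i"] B(3)[of "x + X i - y" "x - y"] by (simp add: algebra_simps)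
          then have "\<bar>\<eta> (x + X i - y) - \<eta> (x - y) - ?D (x - y) (X i)\<bar> / norm (X i) \<le> 2 * B"
            using X B(1) by (simp add: field_simps)
          then have "\<bar>\<eta> (x + X i - y) - \<eta> (x - y) - ?D (x - y) (X i)\<bar> / norm (X i) * norm (\<psi> y) \<le> 2 * B * norm (\<psi> y)"
            by (intro mult_right_mono) auto
          then show "norm (Q (X i) y) \<le> (2 * B) * norm (\<psi> y)"
            by (simp add: Q_def)
        qed
        show "AE y in lborel. (\<lambda>i. Q (X i) y) \<longlonglongrightarrow> 0"
        proof (intro AE_I2)
          fix y
          have "(\<lambda>h. norm (\<eta> (x - y + h) - \<eta> (x - y) - ?D (x - y) h) / norm h) \<midarrow>0\<rightarrow> 0"
            using der[of "x - y"] unfolding has_derivative_at by simp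
          then have "((\<lambda>h. norm (\<eta> (x - y + h) - \<eta> (x - y) - ?D (x - y) h) / norm h) \<circ> X) \<longlonglongrightarrow> 0"
            using X X0 unfolding tendsto_at_iff_sequentially by blast
          then have "(\<lambda>i. norm ((\<eta> (x + X i - y) - \<eta> (x - y) - ?D (x - y) (X i)) / norm (X i))) \<longlonglongrightarrow> 0"
            by (simp add: o_def algebra_simps)
          then have "(\<lambda>i. (\<eta> (x + X i - y) - \<eta> (x - y) - ?D (x - y) (X i)) / norm (X i)) \<longlonglongrightarrow> 0"
            by (rule tendsto_norm_zero_cancel)
          then have "(\<lambda>i. Q (X i) y) \<longlonglongrightarrow> 0 *\<^sub>R \<psi> y"
            unfolding Q_def by (intro tendsto_scaleR tendsto_const)
          then show "(\<lambda>i. Q (X i) y) \<longlonglongrightarrow> 0" by simp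
        qed
      qed (auto simp: Q_def)
      then have "(\<lambda>i. norm (\<integral>y. Q (X i) y \<partial>lborel)) \<longlonglongrightarrow> 0"
        by (simp add: tendsto_norm_zero)
      then show "((\<lambda>h. norm ((\<integral>y. \<eta> (x + h - y) *\<^sub>R \<psi> y \<partial>lborel) - (\<integral>y. \<eta> (x - y) *\<^sub>R \<psi> y \<partial>lborel)
       - (\<integral>y. ?D (x - y) h *\<^sub>R \<psi> y \<partial>lborel)) / norm h) \<circ> X) \<longlonglongrightarrow> 0"
        by (simp add: eq o_def divide_inverse mult.commute)
    qed
  qed
qed

text \<open>All derivatives fall on \<eta>, which stays a test function; \<psi> only has to be
  integrable.\<close>

lemma C_k_convolution:
  fixes \<eta> :: "'a::euclidean_space \<Rightarrow> real" and \<psi> :: "'a \<Rightarrow> 'b::euclidean_space"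
  assumes "\<eta> \<in> Cc_infinity" and "integrable lborel \<psi>"
  shows "C_k k (\<lambda>x. \<integral>y. \<eta> (x - y) *\<^sub>R \<psi> y \<partial>lborel)"
  using assms(1)
proof (induction k arbitrary: \<eta>)
  case 0
  then show ?case
    using has_derivative_continuous[OF convolution_has_derivative[OF 0 assms(2)]]
    by (simp add: continuous_at_imp_continuous_on)
next
  case (Suc k)
  show ?case
    by (rule C_k_SucI[OF convolution_has_derivative[OF Suc.prems assms(2)]])
       (rule Suc.IH[OF Cc_infinity_frechet_derivative[OF Suc.prems]])
qed

text \<open>The mollifier and the Gaussian, subordination and Beta constants obtain their positivity
  from here, without being evaluated.\<close>

lemma integral_pos_open:
  fixes g :: "'a::euclidean_space \<Rightarrow> real"
  assumes g: "integrable lborel g" "\<And>x. 0 \<le> g x" and U: "open U" "U \<noteq> {}" "\<And>x. x \<in> U \<Longrightarrow> 0 < g x"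
  shows "0 < (\<integral>x. g x \<partial>lborel)"
proof (rule ccontr)
  assume "\<not> ?thesis"
  then have "(\<integral>x. g x \<partial>lborel) = 0"
    using integral_nonneg_AE[of g lborel] g(2) by (simp add: antisym)
  then have "AE x in lborel. g x = 0"
    using integral_nonneg_eq_0_iff_AE[OF g(1)] g(2) by simp
  then have "AE x in lborel. x \<notin> U"
    by eventually_elim (use U(3) in force)
  then have "U \<in> null_sets lborel"
    using U(1) by (subst AE_iff_null_sets) (auto intro: borel_open)
  then have "negligible U"
    by (simp add: negligible_iff_null_sets null_sets_completionI)
  then show False
    using open_not_negligible[OF U(1,2)] by simp
qed

lemma mollifier_exists:
  "\<exists>\<eta> :: 'a::euclidean_space \<Rightarrow> real. \<eta> \<in> Cc_infinity \<and> (\<forall>x. 0 \<le> \<eta> x) \<and> (\<forall>x. \<eta> x \<noteq> 0 \<longrightarrow> norm x \<le> 1) \<and>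
     integrable lborel \<eta> \<and> (\<integral>x. \<eta> x \<partial>lborel) = 1"
proof -
  define b where "b x = exp_bump 0 (1 - x \<bullet> x)" for x :: 'a
  have supp: "norm x \<le> 1" if "b x \<noteq> 0" for x
  proof -
    have "x \<bullet> x < 1"
      using that by (auto simp: b_def exp_bump_def split: if_splits)
    then show ?thesis
      by (simp add: norm_eq_sqrt_inner)
  qed
  have b: "b \<in> Cc_infinity"
    using supp unfolding b_def by (intro Cc_infinityI[where R = 1] C_k_exp_bump)
  have [measurable]: "b \<in> borel_measurable borel"
    using Cc_infinityD(1)[OF b, of 0] by (simp add: borel_measurable_continuous_onI)
  obtain B where B: "B \<ge> 0" "\<And>x. norm (b x) \<le> B"
    using Cc_infinity_bounded[OF b] by metis
  have int: "integrable lborel b"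
  proof (rule Bochner_Integration.integrable_bound)
    show "integrable lborel (\<lambda>x::'a. B * indicator (cball 0 1) x)"
      using emeasure_lborel_cball_finite[of "0::'a" 1] by (intro integrable_mult_right integrable_real_indicator) auto
    show "AE x in lborel. norm (b x) \<le> norm (B * indicator (cball 0 1) x)"
      using B supp by (intro AE_I2) (force simp: indicator_def)
  qed measurable
  define I where "I = (\<integral>x. b x \<partial>lborel)"
  have I: "I > 0"
    unfolding I_def
  proof (rule integral_pos_open[OF int])
    show "0 \<le> b x" for x
      by (simp add: b_def exp_bump_nonneg)
    show "0 < b x" if "x \<in> ball 0 1" for x
    proof -
      have "x \<bullet> x < 1"
        using that by (simp add: dot_square_norm abs_square_less_1)
      then show ?thesis
        by (simp add: b_def exp_bump_def)
    qed
  qed auto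
  have "(\<lambda>x. inverse I *\<^sub>R b x) \<in> Cc_infinity"
    using supp by (intro Cc_infinityI[where R = 1] C_k_scaleR C_k_const Cc_infinityD(1)[OF b]) auto
  moreover have "integrable lborel (\<lambda>x. inverse I *\<^sub>R b x)" "(\<integral>x. inverse I *\<^sub>R b x \<partial>lborel) = 1"
    using int I by (auto simp: I_def)
  ultimately show ?thesis
    using I supp by (intro exI[of _ "\<lambda>x. inverse I *\<^sub>R b x"]) (auto simp: b_def exp_bump_nonneg)
qed

section \<open>Approximating decaying fields by test fields\<close>

text \<open>Equal to 1 for |y| \<le> R and to 0 for |y| \<ge> 2 R when R > 0, and merely Lipschitz:
  smoothness is supplied by the mollification that follows.\<close>

definition cutoff :: "real \<Rightarrow> 'a::real_normed_vector \<Rightarrow> real" where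
  "cutoff R y = max 0 (min 1 (2 - norm y / R))"

lemma cutoff_range: "0 \<le> cutoff R y" "cutoff R y \<le> 1"
  by (auto simp: cutoff_def)

lemma cutoff_eq_0: "0 < R \<Longrightarrow> 2 * R \<le> norm y \<Longrightarrow> cutoff R y = 0"
  by (auto simp: cutoff_def field_simps)

text \<open>The slope 1/R pays for the weight: unless both values vanish, the smaller norm is below
  2 R, and 1 + 2 R \<le> 3 R.\<close>

lemma cutoff_diff:
  assumes "1 \<le> R"
  shows "\<bar>cutoff R z - cutoff R z'\<bar> * (1 + min (norm z) (norm z')) \<le> 3 * norm (z - z')"
proof (cases "2 * R \<le> min (norm z) (norm z')")
  case True
  then show ?thesis
    using cutoff_eq_0[of R z] cutoff_eq_0[of R z'] assms by simp
next
  case False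
  have "\<bar>cutoff R z - cutoff R z'\<bar> \<le> \<bar>norm z / R - norm z' / R\<bar>"
    by (auto simp: cutoff_def)
  also have "\<dots> = \<bar>norm z - norm z'\<bar> / R"
    using assms by (simp add: diff_divide_distrib[symmetric])
  also have "\<dots> \<le> norm (z - z') / R"
    using assms norm_triangle_ineq3[of z z'] by (intro divide_right_mono) auto
  finally have 1: "\<bar>cutoff R z - cutoff R z'\<bar> \<le> norm (z - z') / R" .
  have "\<bar>cutoff R z - cutoff R z'\<bar> * (1 + min (norm z) (norm z')) \<le> norm (z - z') / R * (3 * R)"
    using False assms by (intro mult_mono 1) (auto simp: min_def)
  then show ?thesis
    using assms by simp
qed

lemma decay_cutoff:
  assumes d: "decay s A \<phi>" and s: "0 \<le> s" and R: "1 \<le> R"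
  shows "decay s (4 * A) (\<lambda>z. cutoff R z *\<^sub>R \<phi> z)"
  unfolding decay_def
proof (intro conjI allI)
  have A: "0 \<le> A" using decay_nonneg[OF d] .
  fix z z' :: 'a
  have "norm (cutoff R z *\<^sub>R \<phi> z) \<le> 1 * norm (\<phi> z)"
    using cutoff_range[of R z] by (simp add: mult_left_le_one_le)
  also have "\<dots> \<le> A * (1 + norm z) powr - s"
    using decayD(1)[OF d, of z] by simp
  also have "\<dots> \<le> 4 * A * (1 + norm z) powr - s"
    using A by (intro mult_right_mono) auto
  finally show "norm (cutoff R z *\<^sub>R \<phi> z) \<le> 4 * A * (1 + norm z) powr - s" .
  define M where "M = 1 + min (norm z) (norm z')"
  have M: "M \<ge> 1" by (simp add: M_def)
  \<comment> \<open>The product rule for differences. The variation of the field contributes A and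
    that of the cutoff 3 A, whence the constant 4 A, independent of R.\<close>
  have eq: "cutoff R z *\<^sub>R \<phi> z - cutoff R z' *\<^sub>R \<phi> z' = cutoff R z *\<^sub>R (\<phi> z - \<phi> z') + (cutoff R z - cutoff R z') *\<^sub>R \<phi> z'"
    by (simp add: algebra_simps)
  have 1: "norm (cutoff R z *\<^sub>R (\<phi> z - \<phi> z')) \<le> A * norm (z - z') * M powr (- s - 1)"
    using cutoff_range[of R z] decayD(2)[OF d, of z z'] mult_left_le_one_le[of "norm (\<phi> z - \<phi> z')" "cutoff R z"]
    by (simp add: M_def)
  have "(1 + norm z') powr (-s) \<le> M powr (-s)"
    using s M by (intro powr_mono2') (linarith, linarith, simp add: M_def)
  then have "norm (\<phi> z') \<le> A * M powr (-s)"
    using decayD(1)[OF d, of z'] A mult_left_mono order_trans by blast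
  then have "norm ((cutoff R z - cutoff R z') *\<^sub>R \<phi> z') \<le> \<bar>cutoff R z - cutoff R z'\<bar> * (A * M powr (-s))"
    by (auto intro!: mult_left_mono)
  also have "M powr (-s) = M * M powr (- s - 1)"
    using M by (simp add: powr_mult_base)
  also have "\<bar>cutoff R z - cutoff R z'\<bar> * (A * (M * M powr (- s - 1))) = (\<bar>cutoff R z - cutoff R z'\<bar> * M) * (A * M powr (- s - 1))"
    by simp
  also have "\<dots> \<le> (3 * norm (z - z')) * (A * M powr (- s - 1))"
    using cutoff_diff[OF R, of z z'] A by (intro mult_right_mono) (auto simp: M_def)
  finally have 2: "norm ((cutoff R z - cutoff R z') *\<^sub>R \<phi> z') \<le> 3 * norm (z - z') * (A * M powr (- s - 1))" .
  show "norm (cutoff R z *\<^sub>R \<phi> z - cutoff R z' *\<^sub>R \<phi> z') \<le> 4 * A * norm (z - z') * (1 + min (norm z) (norm z')) powr (- s - 1)"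
    unfolding eq M_def[symmetric]
    using order_trans[OF norm_triangle_ineq add_mono[OF 1 2]] by (simp only: algebra_simps)
qed

lemma cutoff_tendsto: "(\<lambda>k. cutoff (real (Suc k)) z) \<longlonglongrightarrow> 1"
proof -
  obtain N where N: "norm z \<le> real N"
    using real_arch_simple by blast
  have "cutoff (real (Suc k)) z = 1" if "k \<ge> N" for k
    using that N by (auto simp: cutoff_def field_simps)
  then have "\<forall>\<^sub>F k in sequentially. cutoff (real (Suc k)) z = 1"
    by (auto simp: eventually_sequentially)
  then show ?thesis
    by (rule tendsto_eventually)
qed

context
  fixes \<alpha> :: real
  assumes \<alpha>: "0 < \<alpha>" "\<alpha> < 1"
begin

text \<open>Cut off at radius k + 1, then average at scale 1 / (k + 1). Both operations keep the sup
  bound 1 exactly and the decay constant up to a factor independent of k, which is what dominated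
  convergence against the divergence will need.\<close>

lemma Cc_infinity_approximation:
  fixes \<phi> :: "'a::euclidean_space \<Rightarrow> 'a"
  assumes d: "decay (real DIM('a) - \<alpha>) A \<phi>" and bd: "\<And>z. norm (\<phi> z) \<le> 1"
  shows "\<exists>A' \<Phi>. \<forall>k. \<Phi> k \<in> Cc_infinity \<and> (\<forall>z. norm (\<Phi> k z) \<le> 1) \<and> decay (real DIM('a) - \<alpha>) A' (\<Phi> k) \<and>
     (\<forall>z. (\<lambda>k. \<Phi> k z) \<longlonglongrightarrow> \<phi> z)"
proof -
  define s where "s = real DIM('a) - \<alpha>"
  have s: "0 \<le> s"
    using DIM_minus_alpha_pos[OF \<alpha>, where 'a='a] by (simp add: s_def)
  obtain \<eta> :: "'a \<Rightarrow> real" where \<eta>: "\<eta> \<in> Cc_infinity" "\<And>x. 0 \<le> \<eta> x" "\<And>x. \<eta> x \<noteq> 0 \<Longrightarrow> norm x \<le> 1"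
     "integrable lborel \<eta>" "(\<integral>x. \<eta> x \<partial>lborel) = 1"
    using mollifier_exists[where 'a='a] by metis
  have [measurable]: "\<eta> \<in> borel_measurable borel"
    using borel_measurable_integrable[OF \<eta>(4)] by simp
  define \<psi> where "\<psi> k z = cutoff (real (Suc k)) z *\<^sub>R \<phi> z" for k z
  have d\<psi>: "decay s (4 * A) (\<psi> k)" for k
    unfolding \<psi>_def using d s by (intro decay_cutoff) (auto simp: s_def)
  have [measurable]: "\<psi> k \<in> borel_measurable borel" for k
    by (rule decay_borel[OF d\<psi> s])
  have bd\<psi>: "norm (\<psi> k z) \<le> 1" for k z
    using cutoff_range[of "real (Suc k)" z] bd[of z] mult_mono[of "cutoff (real (Suc k)) z" 1 "norm (\<phi> z)" 1]
    by (simp add: \<psi>_def)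
  have supp\<psi>: "\<psi> k z = 0" if "norm z > 2 * real (Suc k)" for k z
    using that cutoff_eq_0[of "real (Suc k)" z] by (simp add: \<psi>_def)
  have int\<psi>: "integrable lborel (\<psi> k)" for k
  proof (rule Bochner_Integration.integrable_bound)
    show "integrable lborel (\<lambda>x::'a. indicator (cball 0 (2 * real (Suc k))) x :: real)"
      using emeasure_lborel_cball_finite[of "0::'a"] by (intro integrable_real_indicator) auto
    show "AE z in lborel. norm (\<psi> k z) \<le> norm (indicator (cball 0 (2 * real (Suc k))) z :: real)"
      using bd\<psi> supp\<psi>[of k] by (intro AE_I2) (force simp: indicator_def not_le)
  qed measurable
  \<comment> \<open>Mollification is written as an average over shifts by -u / (k + 1), with |u|
    \<le> 1. Its decay is then an instance of \<open>fdiv_superposition\<close>; the convolution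
    form, needed for smoothness, is recovered by a change of variables.\<close>
  define M where "M k u z = \<eta> u *\<^sub>R \<psi> k (z + (- (1 / real (Suc k))) *\<^sub>R u)" for k u z
  define \<Phi> where "\<Phi> k z = (\<integral>u. M k u z \<partial>lborel)" for k z
  have dM: "decay (real DIM('a) - \<alpha>) (\<eta> u * (2 powr (s + 1) * (4 * A))) (M k u)" for k u
  proof (cases "\<eta> u = 0")
    case True
    then show ?thesis by (simp add: M_def decay_def)
  next
    case False
    have "norm ((- (1 / real (Suc k))) *\<^sub>R u) \<le> 1"
      using \<eta>(3)[OF False] by (simp add: field_simps)
    from decay_scaleR[OF decay_shift[OF d\<psi> s this], of "\<eta> u"] \<eta>(2)[of u] show ?thesis
      unfolding M_def by (simp add: s_def)
  qed
  have mM: "case_prod (M k) \<in> borel_measurable (borel \<Otimes>\<^sub>M borel)" for k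
    unfolding M_def by measurable
  have d\<Phi>: "decay (real DIM('a) - \<alpha>) (2 powr (s + 1) * (4 * A)) (\<Phi> k)" for k
    using fdiv_superposition(1)[OF \<alpha> mM[of k] dM integrable_mult_left] \<eta>(4,5)
    unfolding \<Phi>_def by simp
  have intM: "integrable lborel (\<lambda>u. M k u z)" for k z
  proof (rule Bochner_Integration.integrable_bound[OF \<eta>(4)])
    show "AE u in lborel. norm (M k u z) \<le> norm (\<eta> u)"
      using \<eta>(2) bd\<psi> by (intro AE_I2) (simp add: M_def mult_left_le)
  qed (simp add: M_def)
  have bd\<Phi>: "norm (\<Phi> k z) \<le> 1" for k z
  proof -
    have "norm (\<Phi> k z) \<le> (\<integral>u. norm (M k u z) \<partial>lborel)"
      unfolding \<Phi>_def by (rule integral_norm_bound)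
    also have "\<dots> \<le> (\<integral>u. \<eta> u \<partial>lborel)"
      using \<eta>(2) bd\<psi> by (intro integral_mono integrable_norm intM \<eta>(4)) (simp add: M_def mult_left_le)
    finally show ?thesis
      by (simp add: \<eta>(5))
  qed
  have lim: "(\<lambda>k. \<Phi> k z) \<longlonglongrightarrow> \<phi> z" for z
  proof -
    have "(\<lambda>k. \<Phi> k z) \<longlonglongrightarrow> (\<integral>u. \<eta> u *\<^sub>R \<phi> z \<partial>lborel)"
      unfolding \<Phi>_def
    proof (rule integral_dominated_convergence)
      show "integrable lborel \<eta>" by (rule \<eta>(4))
      show "AE u in lborel. norm (M k u z) \<le> \<eta> u" for k
        using \<eta>(2) bd\<psi> by (intro AE_I2) (simp add: M_def mult_left_le)
      show "AE u in lborel. (\<lambda>k. M k u z) \<longlonglongrightarrow> \<eta> u *\<^sub>R \<phi> z"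
      proof (intro AE_I2)
        fix u
        have "(\<lambda>k. \<psi> k z) \<longlonglongrightarrow> 1 *\<^sub>R \<phi> z"
          unfolding \<psi>_def by (intro tendsto_scaleR cutoff_tendsto tendsto_const)
        \<comment> \<open>The field \<psi> k changes with k, but its Lipschitz constant 4 A does
          not, so the vanishing shift is harmless.\<close>
        moreover have "(\<lambda>k. \<psi> k (z + (- (1 / real (Suc k))) *\<^sub>R u) - \<psi> k z) \<longlonglongrightarrow> 0"
        proof (rule Lim_null_comparison)
          show "\<forall>\<^sub>F k in sequentially. norm (\<psi> k (z + (- (1 / real (Suc k))) *\<^sub>R u) - \<psi> k z) \<le> 4 * A * norm u * (1 / real (Suc k))"
            using decay_lipschitz[OF d\<psi> s, of _ "z + (- (1 / real (Suc _))) *\<^sub>R u" z]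
            by (intro always_eventually allI) (simp add: mult.assoc)
          show "(\<lambda>k. 4 * A * norm u * (1 / real (Suc k))) \<longlonglongrightarrow> 0"
            using tendsto_mult[OF tendsto_const LIMSEQ_inverse_real_of_nat, of "4 * A * norm u"]
            by (simp add: divide_inverse)
        qed
        ultimately have "(\<lambda>k. \<psi> k (z + (- (1 / real (Suc k))) *\<^sub>R u) - \<psi> k z + \<psi> k z) \<longlonglongrightarrow> 0 + 1 *\<^sub>R \<phi> z"
          by (intro tendsto_add)
        then have "(\<lambda>k. \<psi> k (z + (- (1 / real (Suc k))) *\<^sub>R u)) \<longlonglongrightarrow> \<phi> z"
          by simp
        then show "(\<lambda>k. M k u z) \<longlonglongrightarrow> \<eta> u *\<^sub>R \<phi> z"
          unfolding M_def by (intro tendsto_intros)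
      qed
    qed (auto simp: M_def)
    then show ?thesis
      using \<eta>(4,5) by simp
  qed
  have "\<Phi> k \<in> Cc_infinity" for k
  proof (rule Cc_infinityI)
    define r where "r = real (Suc k)"
    have r: "r > 0" by (simp add: r_def)
    \<comment> \<open>The mollifier rescaled to the ball of radius 1 / r: with it the average over
      shifts becomes the convolution with the integrable field \<psi> k.\<close>
    define \<eta>k where "\<eta>k x = (r ^ DIM('a)) *\<^sub>R \<eta> (r *\<^sub>R x)" for x
    have "norm x \<le> 1 / r" if "\<eta>k x \<noteq> 0" for x
      using \<eta>(3)[of "r *\<^sub>R x"] that r by (auto simp: \<eta>k_def field_simps)
    then have \<eta>k: "\<eta>k \<in> Cc_infinity"
      unfolding \<eta>k_def
      by (intro Cc_infinityI[where R = "1 / r"] C_k_scaleR C_k_const C_k_dilate Cc_infinityD(1)[OF \<eta>(1)]) auto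
    have [measurable]: "\<eta>k \<in> borel_measurable borel"
      unfolding \<eta>k_def by measurable
    have "\<Phi> k = (\<lambda>z. \<integral>y. \<eta>k (z - y) *\<^sub>R \<psi> k y \<partial>lborel)"
    proof
      fix z
      have "(\<integral>y. \<eta>k (z - y) *\<^sub>R \<psi> k y \<partial>lborel) =
         \<bar>- (1 / r)\<bar> ^ DIM('a) *\<^sub>R (\<integral>u. \<eta>k (z - (z + (- (1 / r)) *\<^sub>R u)) *\<^sub>R \<psi> k (z + (- (1 / r)) *\<^sub>R u) \<partial>lborel)"
        using r by (intro integral_lborel_affine) auto
      also have "\<dots> = (\<integral>u. \<bar>- (1 / r)\<bar> ^ DIM('a) *\<^sub>R \<eta>k (z - (z + (- (1 / r)) *\<^sub>R u)) *\<^sub>R \<psi> k (z + (- (1 / r)) *\<^sub>R u) \<partial>lborel)"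
        by (simp only: Bochner_Integration.integral_scaleR_right)
      also have "\<dots> = \<Phi> k z"
        using r unfolding \<Phi>_def M_def r_def[symmetric]
        by (intro Bochner_Integration.integral_cong) (auto simp: \<eta>k_def power_divide)
      finally show "\<Phi> k z = (\<integral>y. \<eta>k (z - y) *\<^sub>R \<psi> k y \<partial>lborel)" ..
    qed
    then show "C_k j (\<Phi> k)" for j
      using C_k_convolution[OF \<eta>k int\<psi>] by simp
    show "norm z \<le> 2 * r + 1" if "\<Phi> k z \<noteq> 0" for z
    proof (rule ccontr)
      assume z: "\<not> ?thesis"
      have "M k u z = 0" for u
      proof (cases "\<eta> u = 0")
        case False
        have 1: "norm ((1 / r) *\<^sub>R u) \<le> 1"
          using \<eta>(3)[OF False] r by (simp add: r_def field_simps)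
        have "norm z - norm ((1 / r) *\<^sub>R u) \<le> norm (z - (1 / r) *\<^sub>R u)"
          by (rule norm_triangle_ineq2)
        then have "norm (z + (- (1 / r)) *\<^sub>R u) > 2 * r"
          using z 1 by simp
        then show ?thesis
          using supp\<psi>[of k] by (simp add: M_def r_def)
      qed (simp add: M_def)
      then show False
        using that by (simp add: \<Phi>_def)
    qed
  qed
  then show ?thesis
    using bd\<Phi> d\<Phi> lim by blast
qed

end

section \<open>Pairing L^p functions with divergences of decaying fields\<close>

lemma frac_div_eq_fdiv:
  fixes \<phi> :: "real ^ 'n \<Rightarrow> real ^ 'n"
  assumes [measurable]: "\<phi> \<in> borel_measurable borel"
  shows "frac_div \<alpha> \<phi> x = frac_const CARD('n) \<alpha> * fdiv \<alpha> \<phi> x"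
proof -
  have "(LINT y|lebesgue. ((y - x) \<bullet> (\<phi> y - \<phi> x)) / norm (y - x) powr (real CARD('n) + \<alpha> + 1)) =
     (LINT y|lborel. ((y - x) \<bullet> (\<phi> y - \<phi> x)) / norm (y - x) powr (real CARD('n) + \<alpha> + 1))"
    by (intro integral_completion) measurable
  also have "\<dots> = (LINT w|lborel. ((x + w - x) \<bullet> (\<phi> (x + w) - \<phi> x)) / norm (x + w - x) powr (real CARD('n) + \<alpha> + 1))"
    by (rule integral_lborel_shift(1)[symmetric]) measurable
  also have "\<dots> = fdiv \<alpha> \<phi> x"
    unfolding fdiv_def powr_minus_divide by simp
  finally show ?thesis
    by (simp add: frac_div_def)
qed

lemma frac_const_pos: "0 < \<alpha> \<Longrightarrow> \<alpha> < 1 \<Longrightarrow> 0 < frac_const n \<alpha>"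
  unfolding frac_const_def by (intro mult_pos_pos divide_pos_pos Gamma_real_pos) auto

text \<open>Young's inequality without constants: with q conjugate to p and D the weight, the
  product |f| D is at most D^q where |f| \<le> D^(q-1), and at most |f|^p elsewhere. The power D^q
  is integrable since n q > n. For p = 1 the bound D \<le> 1 suffices.\<close>

lemma Lp_integrable_weight:
  fixes f :: "real ^ 'n \<Rightarrow> real"
  assumes f: "f \<in> Lp p" and p: "1 \<le> p"
  shows "integrable lebesgue (\<lambda>x. \<bar>f x\<bar> * (1 + norm x) powr (- real CARD('n)))"
proof -
  have [measurable]: "f \<in> borel_measurable lebesgue" and fp: "integrable lebesgue (\<lambda>x. \<bar>f x\<bar> powr p)"
    using f by (auto simp: Lp_def)
  define D where "D x = (1 + norm x) powr (- real CARD('n))" for x :: "real ^ 'n"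
  have [measurable]: "D \<in> borel_measurable lebesgue"
    unfolding D_def by (intro measurable_completion) measurable
  have D: "0 < D x" "D x \<le> 1" for x
  proof -
    have "0 < 1 + norm x"
      by (simp add: add_pos_nonneg)
    then show "0 < D x" "D x \<le> 1"
      using powr_mono2'[of "- real CARD('n)" 1 "1 + norm x"] by (simp_all add: D_def)
  qed
  have "integrable lebesgue (\<lambda>x. \<bar>f x\<bar> * D x)"
  proof (cases "p = 1")
    case True
    then have "integrable lebesgue (\<lambda>x. \<bar>f x\<bar>)"
      using fp by simp
    then show ?thesis
    proof (rule Bochner_Integration.integrable_bound)
      show "AE x in lebesgue. norm (\<bar>f x\<bar> * D x) \<le> norm \<bar>f x\<bar>"
        using D by (intro AE_I2) (simp add: abs_mult mult_left_le less_imp_le)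
    qed measurable
  next
    case False
    then have p1: "p > 1" using p by simp
    define q where "q = p / (p - 1)"
    have q: "q > 1" "q - 1 = 1 / (p - 1)"
      using p1 by (auto simp: q_def field_simps)
    have Dq: "integrable lebesgue (\<lambda>x. D x powr q)"
    proof -
      have "real CARD('n) * q > real DIM(real ^ 'n)"
        using q by simp
      then have "integrable lborel (\<lambda>x::real ^ 'n. (1 + norm x) powr (- (real CARD('n) * q)))"
        by (rule integrable_one_plus_norm_powr)
      then show ?thesis
        unfolding D_def by (subst integrable_completion) (auto simp: powr_powr)
    qed
    show ?thesis
    proof (rule Bochner_Integration.integrable_bound[OF Bochner_Integration.integrable_add[OF fp Dq]])
      show "AE x in lebesgue. norm (\<bar>f x\<bar> * D x) \<le> norm (\<bar>f x\<bar> powr p + D x powr q)"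
      proof (intro AE_I2)
        fix x
        have "\<bar>f x\<bar> * D x \<le> \<bar>f x\<bar> powr p + D x powr q"
        proof (cases "\<bar>f x\<bar> \<le> D x powr (q - 1)")
          case True
          then have "\<bar>f x\<bar> * D x \<le> D x powr (q - 1) * D x"
            using D by (intro mult_right_mono) (auto intro: less_imp_le)
          also have "\<dots> = D x powr q"
            using D[of x] powr_mult_base[of "D x" "q - 1"] by (simp add: mult.commute)
          finally show ?thesis by (simp add: add_increasing)
        next
          case F: False
          then have f0: "\<bar>f x\<bar> > 0"
            using D[of x] by (metis less_le_trans linorder_not_le powr_ge_zero order_less_irrefl abs_ge_zero order_trans le_less)
          have "D x = (D x powr (q - 1)) powr (p - 1)"
            using D[of x] p1 by (simp add: powr_powr q(2))
          also have "\<dots> \<le> \<bar>f x\<bar> powr (p - 1)"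
            using F p1 by (intro powr_mono2) auto
          finally have "\<bar>f x\<bar> * D x \<le> \<bar>f x\<bar> * \<bar>f x\<bar> powr (p - 1)"
            by (intro mult_left_mono) auto
          also have "\<dots> = \<bar>f x\<bar> powr p"
            using f0 powr_mult_base[of "\<bar>f x\<bar>" "p - 1"] by simp
          finally show ?thesis by (simp add: add_increasing2)
        qed
        then show "norm (\<bar>f x\<bar> * D x) \<le> norm (\<bar>f x\<bar> powr p + D x powr q)"
          using D[of x] by (simp add: abs_mult less_imp_le)
      qed
    qed measurable
  qed
  then show ?thesis
    by (simp add: D_def)
qed

context
  fixes \<alpha> p :: real and f :: "real ^ 'n \<Rightarrow> real"
  assumes \<alpha>: "0 < \<alpha>" "\<alpha> < 1" and p: "1 \<le> p" and f: "f \<in> Lp p"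
begin

lemma Lp_borel: "f \<in> borel_measurable lebesgue"
  using f by (simp add: Lp_def)

lemma integrable_times_fdiv:
  assumes d: "decay (real CARD('n) - \<alpha>) A \<phi>"
  shows "integrable lebesgue (\<lambda>x. f x * fdiv \<alpha> \<phi> x)"
proof -
  obtain C where C: "C \<ge> 0" "\<And>A (\<phi> :: real ^ 'n \<Rightarrow> real ^ 'n) x. decay (real CARD('n) - \<alpha>) A \<phi> \<Longrightarrow>
    \<bar>fdiv \<alpha> \<phi> x\<bar> \<le> C * A * (1 + norm x) powr (- real CARD('n))"
    using fdiv_bound[OF \<alpha>, where 'a="real ^ 'n"] by auto
  have "\<phi> \<in> borel_measurable borel"
    using DIM_minus_alpha_pos[OF \<alpha>, where 'a="real ^ 'n"] by (intro decay_borel[OF d]) simp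
  then have [measurable]: "fdiv \<alpha> \<phi> \<in> borel_measurable lebesgue"
    using fdiv_borel[OF \<alpha>, of \<phi>] by (intro measurable_completion) simp
  note [measurable] = Lp_borel
  show ?thesis
  proof (rule Bochner_Integration.integrable_bound)
    show "integrable lebesgue (\<lambda>x. (C * A) * (\<bar>f x\<bar> * (1 + norm x) powr (- real CARD('n))))"
      by (intro integrable_mult_right Lp_integrable_weight[OF f p])
    show "AE x in lebesgue. norm (f x * fdiv \<alpha> \<phi> x) \<le> norm ((C * A) * (\<bar>f x\<bar> * (1 + norm x) powr (- real CARD('n))))"
    proof (intro AE_I2)
      fix x
      have "\<bar>f x\<bar> * \<bar>fdiv \<alpha> \<phi> x\<bar> \<le> \<bar>f x\<bar> * (C * A * (1 + norm x) powr (- real CARD('n)))"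
        by (intro mult_left_mono C(2)[OF d]) auto
      then show "norm (f x * fdiv \<alpha> \<phi> x) \<le> norm ((C * A) * (\<bar>f x\<bar> * (1 + norm x) powr (- real CARD('n))))"
        using C(1) decay_nonneg[OF d] by (simp add: abs_mult mult_ac)
    qed
  qed measurable
qed

lemma integral_times_fdiv_tendsto:
  assumes d: "\<And>k. decay (real CARD('n) - \<alpha>) A (\<phi> k)" "decay (real CARD('n) - \<alpha>) A \<psi>"
    and lim: "\<And>z. (\<lambda>k. \<phi> k z) \<longlonglongrightarrow> \<psi> z"
  shows "(\<lambda>k. LINT x|lebesgue. f x * fdiv \<alpha> (\<phi> k) x) \<longlonglongrightarrow> (LINT x|lebesgue. f x * fdiv \<alpha> \<psi> x)"
proof -
  obtain C where C: "C \<ge> 0" "\<And>A (\<phi> :: real ^ 'n \<Rightarrow> real ^ 'n) x. decay (real CARD('n) - \<alpha>) A \<phi> \<Longrightarrow>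
    \<bar>fdiv \<alpha> \<phi> x\<bar> \<le> C * A * (1 + norm x) powr (- real CARD('n))"
    using fdiv_bound[OF \<alpha>, where 'a="real ^ 'n"] by auto
  show ?thesis
  proof (rule integral_dominated_convergence)
    show "integrable lebesgue (\<lambda>x. (C * A) * (\<bar>f x\<bar> * (1 + norm x) powr (- real CARD('n))))"
      by (intro integrable_mult_right Lp_integrable_weight[OF f p])
    show "AE x in lebesgue. norm (f x * fdiv \<alpha> (\<phi> k) x) \<le> (C * A) * (\<bar>f x\<bar> * (1 + norm x) powr (- real CARD('n)))" for k
    proof (intro AE_I2)
      fix x
      have "\<bar>f x\<bar> * \<bar>fdiv \<alpha> (\<phi> k) x\<bar> \<le> \<bar>f x\<bar> * (C * A * (1 + norm x) powr (- real CARD('n)))"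
        by (intro mult_left_mono C(2)[OF d(1)]) auto
      then show "norm (f x * fdiv \<alpha> (\<phi> k) x) \<le> (C * A) * (\<bar>f x\<bar> * (1 + norm x) powr (- real CARD('n)))"
        by (simp add: abs_mult mult_ac)
    qed
    show "AE x in lebesgue. (\<lambda>k. f x * fdiv \<alpha> (\<phi> k) x) \<longlonglongrightarrow> f x * fdiv \<alpha> \<psi> x"
      using d lim by (intro AE_I2 tendsto_mult tendsto_const fdiv_tendsto[OF \<alpha>, where A = A]) auto
    show "(\<lambda>x. f x * fdiv \<alpha> (\<phi> k) x) \<in> borel_measurable lebesgue" for k
      using integrable_times_fdiv[OF d(1)] by (rule borel_measurable_integrable)
    show "(\<lambda>x. f x * fdiv \<alpha> \<psi> x) \<in> borel_measurable lebesgue"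
      using integrable_times_fdiv[OF d(2)] by (rule borel_measurable_integrable)
  qed
qed

lemma frac_variation_ge:
  assumes \<phi>: "\<phi> \<in> Cc_infinity" "\<And>z. norm (\<phi> z) \<le> 1"
  shows "ereal (frac_const CARD('n) \<alpha> * (LINT x|lebesgue. f x * fdiv \<alpha> \<phi> x)) \<le> frac_variation \<alpha> f"
proof -
  have [measurable]: "\<phi> \<in> borel_measurable borel"
    using Cc_infinityD(1)[OF \<phi>(1), of 0] by (simp add: borel_measurable_continuous_onI)
  have "Linf_norm \<phi> \<le> 1"
    unfolding Linf_norm_def
  proof (rule esssup_I)
    show "(\<lambda>x. ereal (norm (\<phi> x))) \<in> borel_measurable lebesgue"
      by (intro measurable_completion) measurable
  qed (use \<phi>(2) in auto)
  then have "ereal (LINT x|lebesgue. f x * frac_div \<alpha> \<phi> x) \<le> frac_variation \<alpha> f"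
    unfolding frac_variation_def using \<phi>(1) by (intro SUP_upper) auto
  moreover have "(LINT x|lebesgue. f x * frac_div \<alpha> \<phi> x) = (LINT x|lebesgue. frac_const CARD('n) \<alpha> * (f x * fdiv \<alpha> \<phi> x))"
    by (intro Bochner_Integration.integral_cong) (auto simp: frac_div_eq_fdiv)
  ultimately show ?thesis
    by simp
qed

lemma frac_variation_nonneg: "0 \<le> frac_variation \<alpha> f"
proof -
  have "(\<lambda>_. 0) \<in> (Cc_infinity :: (real ^ 'n \<Rightarrow> real ^ 'n) set)"
    by (rule Cc_infinityI[where R = 0]) (auto intro: C_k_const)
  then have "ereal (frac_const CARD('n) \<alpha> * (LINT x|lebesgue. f x * fdiv \<alpha> (\<lambda>_. 0) x)) \<le> frac_variation \<alpha> f"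
    by (rule frac_variation_ge) simp
  then show ?thesis
    by (simp add: fdiv_def zero_ereal_def)
qed

text \<open>Carries the inequality that defines the variation from smooth compactly supported fields
  over to decaying ones, by the approximation with a common decay constant. This is the only form in
  which the variation is tested afterwards.\<close>

lemma integral_times_fdiv_bound:
  assumes V: "frac_variation \<alpha> f < \<infinity>" and d: "decay (real CARD('n) - \<alpha>) A \<phi>"
    and B: "\<And>z. norm (\<phi> z) \<le> B" "B > 0"
  shows "\<bar>LINT x|lebesgue. f x * fdiv \<alpha> \<phi> x\<bar> \<le> B * real_of_ereal (frac_variation \<alpha> f) / frac_const CARD('n) \<alpha>"
proof -
  define V' where "V' = real_of_ereal (frac_variation \<alpha> f)"
  have V': "frac_variation \<alpha> f = ereal V'"
    using V frac_variation_nonneg by (cases "frac_variation \<alpha> f") (auto simp: V'_def)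
  have main: "frac_const CARD('n) \<alpha> * (LINT x|lebesgue. f x * fdiv \<alpha> \<psi> x) \<le> V'"
    if d\<psi>: "decay (real CARD('n) - \<alpha>) A \<psi>" and \<psi>: "\<And>z. norm (\<psi> z) \<le> 1" for A \<psi>
  proof -
    obtain A' \<Phi> where "\<forall>k. \<Phi> k \<in> Cc_infinity \<and> (\<forall>z. norm (\<Phi> k z) \<le> 1) \<and>
      decay (real CARD('n) - \<alpha>) A' (\<Phi> k) \<and> (\<forall>z. (\<lambda>k. \<Phi> k z) \<longlonglongrightarrow> \<psi> z)"
      using Cc_infinity_approximation[OF \<alpha>, of A \<psi>] d\<psi> \<psi> by auto
    then have \<Phi>: "\<And>k. \<Phi> k \<in> Cc_infinity" "\<And>k z. norm (\<Phi> k z) \<le> 1"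
      "\<And>k. decay (real CARD('n) - \<alpha>) A' (\<Phi> k)" "\<And>z. (\<lambda>k. \<Phi> k z) \<longlonglongrightarrow> \<psi> z"
      by auto
    have "(\<lambda>k. LINT x|lebesgue. f x * fdiv \<alpha> (\<Phi> k) x) \<longlonglongrightarrow> (LINT x|lebesgue. f x * fdiv \<alpha> \<psi> x)"
      using decay_mono[OF \<Phi>(3), of "max A A'"] decay_mono[OF d\<psi>, of "max A A'"]
      by (intro integral_times_fdiv_tendsto[where A = "max A A'"] \<Phi>) auto
    then have "(\<lambda>k. frac_const CARD('n) \<alpha> * (LINT x|lebesgue. f x * fdiv \<alpha> (\<Phi> k) x)) \<longlonglongrightarrow>
       frac_const CARD('n) \<alpha> * (LINT x|lebesgue. f x * fdiv \<alpha> \<psi> x)"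
      by (intro tendsto_intros)
    then show ?thesis
      by (rule LIMSEQ_le_const2) (use frac_variation_ge[OF \<Phi>(1,2)] V' in auto)
  qed
  \<comment> \<open>Applied to c = 1 / B and to c = - 1 / B, which gives both signs of the
    pairing.\<close>
  have scaled: "frac_const CARD('n) \<alpha> * (c * (LINT x|lebesgue. f x * fdiv \<alpha> \<phi> x)) \<le> V'" if "\<bar>c\<bar> = 1 / B" for c
  proof -
    have "frac_const CARD('n) \<alpha> * (LINT x|lebesgue. f x * fdiv \<alpha> (\<lambda>z. c *\<^sub>R \<phi> z) x) \<le> V'"
    proof (rule main[OF decay_scaleR[OF d]])
      fix z
      have "\<bar>c\<bar> * norm (\<phi> z) \<le> 1 / B * B"
        unfolding that using B by (intro mult_left_mono) auto
      then show "norm (c *\<^sub>R \<phi> z) \<le> 1"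
        using B by simp
    qed
    moreover have "(LINT x|lebesgue. f x * fdiv \<alpha> (\<lambda>z. c *\<^sub>R \<phi> z) x) = (LINT x|lebesgue. c * (f x * fdiv \<alpha> \<phi> x))"
      by (intro Bochner_Integration.integral_cong) (auto simp: fdiv_scaleR[OF \<alpha>])
    ultimately show ?thesis
      by simp
  qed
  have pos: "frac_const CARD('n) \<alpha> > 0"
    using \<alpha> by (rule frac_const_pos)
  show ?thesis
    using scaled[of "1 / B"] scaled[of "- (1 / B)"] B(2) pos
    unfolding V'_def[symmetric] by (auto simp: field_simps abs_le_iff)
qed

end

subsection \<open>Gaussian fields\<close>

lemma exp_minus_le_powr:
  fixes m :: real
  obtains C where "C > 0" "\<And>x. 0 \<le> x \<Longrightarrow> exp (-x) \<le> C * (1 + x) powr (-m)"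
proof -
  obtain k :: nat where k: "m \<le> real k"
    using real_arch_simple by blast
  show thesis
  proof (rule that[of "exp 1 * fact k"])
    fix x :: real assume x: "0 \<le> x"
    have "(\<lambda>k. (1+x) ^ k / fact k) sums exp (1+x)"
      using exp_converges[of "1+x"] by (simp add: divide_inverse mult.commute)
    then have "(\<Sum>k\<in>{k}. (1+x) ^ k / fact k) \<le> exp (1+x)"
      using x sum_le_suminf[of "\<lambda>k. (1+x) ^ k / fact k" "{k}"] by (auto simp: sums_iff)
    then have "(1+x) ^ k \<le> fact k * (exp 1 * exp x)"
      by (simp add: field_simps exp_add)
    then have "exp (-x) * (1+x) ^ k \<le> exp 1 * fact k"
      by (simp add: exp_minus field_simps)
    moreover have "(1+x) powr m \<le> (1+x) ^ k"
      using x k powr_mono[OF k, of "1+x"] by (simp add: powr_realpow)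
    then have "exp (-x) * (1+x) powr m \<le> exp (-x) * (1+x) ^ k"
      by (intro mult_left_mono) auto
    ultimately have "exp (-x) * (1+x) powr m \<le> exp 1 * fact k"
      by linarith
    then show "exp (-x) \<le> exp 1 * fact k * (1+x) powr (-m)"
      using x by (simp add: powr_minus field_simps)
  qed simp
qed

text \<open>The constant does not depend on the time T. This scale invariance is the source of all
  bounds that are uniform in \<epsilon>.\<close>

lemma powr_exp_le:
  fixes m :: real
  obtains C where "C > 0" "\<And>T s. 0 < T \<Longrightarrow> 0 \<le> s \<Longrightarrow> T powr (-m) * exp (-(s/T)) \<le> C * (T + s) powr (-m)"
proof -
  obtain C where C: "C > 0" "\<And>x. 0 \<le> x \<Longrightarrow> exp (-x) \<le> C * (1 + x) powr (-m)"
    using exp_minus_le_powr[of m] by metis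
  show thesis
  proof (rule that[OF C(1)])
    fix T s :: real assume T: "0 < T" and s: "0 \<le> s"
    have "T powr (-m) * exp (-(s/T)) \<le> T powr (-m) * (C * (1 + s/T) powr (-m))"
      using C(2)[of "s/T"] T s by (intro mult_left_mono) auto
    also have "\<dots> = C * (T * (1 + s/T)) powr (-m)"
      using T s by (simp add: powr_mult)
    also have "T * (1 + s/T) = T + s"
      using T by (simp add: field_simps)
    finally show "T powr (-m) * exp (-(s/T)) \<le> C * (T + s) powr (-m)" .
  qed
qed

lemma square_powr:
  fixes t m :: real
  assumes "0 < t" shows "(t\<^sup>2) powr m = t powr (2 * m)"
  using assms by (simp add: powr_powr flip: powr_numeral)

lemma one_plus_norm_sq: "(1 + r)\<^sup>2 \<le> 2 * (1 + r\<^sup>2)" for r :: real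
  using zero_le_power2[of "1 - r"] by (simp add: power2_eq_square algebra_simps)

lemma integrable_gauss_weight:
  "integrable (lborel::'a::euclidean_space measure) (\<lambda>u. (1 + norm u) powr k * exp (-((norm u)\<^sup>2)))"
proof -
  define m where "m = (\<bar>k\<bar> + real DIM('a) + 1) / 2"
  have m: "0 \<le> m" and m2: "2 * m = \<bar>k\<bar> + real DIM('a) + 1" by (simp_all add: m_def)
  obtain C where C: "C > 0" "\<And>x. 0 \<le> x \<Longrightarrow> exp (-x) \<le> C * (1 + x) powr (-m)"
    using exp_minus_le_powr[of m] by metis
  show ?thesis
  proof (rule Bochner_Integration.integrable_bound)
    show "integrable lborel (\<lambda>u::'a. C * 2 powr m * (1 + norm u) powr (-(real DIM('a) + 1)))"
      by (intro integrable_mult_right integrable_one_plus_norm_powr) simp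
    show "AE u in (lborel::'a measure). norm ((1 + norm u) powr k * exp (-((norm u)\<^sup>2))) \<le>
        norm (C * 2 powr m * (1 + norm u) powr (-(real DIM('a) + 1)))"
    proof (intro AE_I2)
      fix u :: 'a
      define r where "r = norm u"
      have r: "0 \<le> r" by (simp add: r_def)
      have "exp (-(r\<^sup>2)) \<le> C * (1 + r\<^sup>2) powr (-m)"
        by (rule C(2)) simp
      also have "\<dots> \<le> C * ((1 + r)\<^sup>2 / 2) powr (-m)"
        using one_plus_norm_sq[of r] r m C(1) by (intro mult_left_mono powr_mono2') auto
      also have "((1 + r)\<^sup>2 / 2) powr (-m) = 2 powr m * (1 + r) powr (- 2 * m)"
        using r by (simp add: powr_divide square_powr powr_minus field_simps)
      finally have "(1 + r) powr k * exp (-(r\<^sup>2)) \<le> (1 + r) powr k * (C * (2 powr m * (1 + r) powr (- 2 * m)))"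
        by (intro mult_left_mono) auto
      also have "\<dots> = C * 2 powr m * (1 + r) powr (k - 2 * m)"
        using r by (simp add: powr_add[symmetric] mult_ac)
      also have "\<dots> \<le> C * 2 powr m * (1 + r) powr (-(real DIM('a) + 1))"
        using C(1) r m2 abs_ge_self[of k] by (intro mult_left_mono powr_mono) (linarith | simp)+
      finally show "norm ((1 + norm u) powr k * exp (-((norm u)\<^sup>2))) \<le>
        norm (C * 2 powr m * (1 + norm u) powr (-(real DIM('a) + 1)))"
        using C(1) by (simp add: r_def)
    qed
  qed measurable
qed

lemma integrable_gauss_times:
  fixes g :: "'a::euclidean_space \<Rightarrow> real"
  assumes [measurable]: "g \<in> borel_measurable borel" and g: "\<And>u. \<bar>g u\<bar> \<le> B * (1 + norm u) powr k" and c: "0 < c"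
  shows "integrable lborel (\<lambda>u. g u * exp (-(c * (norm u)\<^sup>2)))"
proof -
  define b where "b = sqrt c"
  have b: "b > 0" "b\<^sup>2 = c"
    using c by (auto simp: b_def)
  have B: "B \<ge> 0"
    using g[of 0] by (simp add: order_trans[OF abs_ge_zero])
  define K where "K = max 1 (1/b)"
  have K: "K \<ge> 1" by (simp add: K_def)
  have "integrable lborel (\<lambda>u::'a. g ((1/b) *\<^sub>R u) * exp (-((norm u)\<^sup>2)))"
  proof (rule Bochner_Integration.integrable_bound[OF integrable_mult_right[OF integrable_gauss_weight[of "\<bar>k\<bar>"], of "B * K powr \<bar>k\<bar>"]])
    show "AE u in (lborel::'a measure). norm (g ((1/b) *\<^sub>R u) * exp (-((norm u)\<^sup>2))) \<le>
       norm (B * K powr \<bar>k\<bar> * ((1 + norm u) powr \<bar>k\<bar> * exp (-((norm u)\<^sup>2))))"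
    proof (intro AE_I2)
      fix u :: 'a
      have "\<bar>g ((1/b) *\<^sub>R u)\<bar> \<le> B * (1 + norm ((1/b) *\<^sub>R u)) powr k"
        by (rule g)
      also have "\<dots> \<le> B * (1 + norm ((1/b) *\<^sub>R u)) powr \<bar>k\<bar>"
        using B by (intro mult_left_mono powr_mono) auto
      also have "\<dots> \<le> B * (K * (1 + norm u)) powr \<bar>k\<bar>"
      proof -
        have "1/b * norm u \<le> K * norm u"
          by (intro mult_right_mono) (auto simp: K_def)
        then have "1 + norm ((1/b) *\<^sub>R u) \<le> K * (1 + norm u)"
          using K b by (simp add: algebra_simps add_mono)
        then show ?thesis
          using B by (intro mult_left_mono powr_mono2) auto
      qed
      also have "\<dots> = B * K powr \<bar>k\<bar> * (1 + norm u) powr \<bar>k\<bar>"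
        using K by (simp add: powr_mult)
      finally show "norm (g ((1/b) *\<^sub>R u) * exp (-((norm u)\<^sup>2))) \<le>
       norm (B * K powr \<bar>k\<bar> * ((1 + norm u) powr \<bar>k\<bar> * exp (-((norm u)\<^sup>2))))"
        using B by (simp add: abs_mult mult_right_mono mult.assoc[symmetric])
    qed
  qed measurable
  from integrable_lborel_affine[of b, OF _ this, of 0] b show ?thesis
    by (simp add: power_mult_distrib)
qed

lemma gauss_scale:
  fixes g :: "'a::euclidean_space \<Rightarrow> real"
  assumes [measurable]: "g \<in> borel_measurable borel" and c: "0 < c" and hom: "\<And>r u. 0 < r \<Longrightarrow> g (r *\<^sub>R u) = r ^ k * g u"
  shows "(\<integral>u. g u * exp (-(c * (norm u)\<^sup>2)) \<partial>lborel) = c powr (-(real DIM('a) + real k) / 2) * (\<integral>u. g u * exp (-((norm u)\<^sup>2)) \<partial>lborel)"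
proof -
  define b where "b = 1 / sqrt c"
  have b: "b > 0" "c * b\<^sup>2 = 1"
    using c by (auto simp: b_def power_divide)
  have bc: "b = c powr (- 1 / 2)"
    using c by (simp add: b_def powr_minus powr_half_sqrt[symmetric] field_simps)
  have "(\<integral>u. g u * exp (-(c * (norm u)\<^sup>2)) \<partial>lborel) =
     \<bar>b\<bar> ^ DIM('a) *\<^sub>R (\<integral>u. g (0 + b *\<^sub>R u) * exp (-(c * (norm (0 + b *\<^sub>R u))\<^sup>2)) \<partial>lborel)"
    using b by (intro integral_lborel_affine) auto
  also have "\<dots> = b ^ DIM('a) * (\<integral>u. b ^ k * (g u * exp (-((norm u)\<^sup>2))) \<partial>lborel)"
    using b hom[OF b(1)] by (simp add: power_mult_distrib mult.assoc[symmetric])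
  also have "\<dots> = b ^ (DIM('a) + k) * (\<integral>u. g u * exp (-((norm u)\<^sup>2)) \<partial>lborel)"
    by (simp add: power_add)
  also have "b ^ (DIM('a) + k) = c powr (-(real DIM('a) + real k) / 2)"
  proof -
    have "b ^ (DIM('a) + k) = c powr (- 1 / 2 * real (DIM('a) + k))"
      using c unfolding bc by (simp add: powr_power del: of_nat_add)
    also have "- 1 / 2 * real (DIM('a) + k) = -(real DIM('a) + real k) / 2"
      unfolding of_nat_add by linarith
    finally show ?thesis .
  qed
  finally show ?thesis .
qed

text \<open>This is pi^(n/2). Only its positivity matters, so it is left unevaluated.\<close>

definition gauss_total :: "'a::euclidean_space itself \<Rightarrow> real" where
  "gauss_total _ = (\<integral>u. exp (-((norm (u::'a))\<^sup>2)) \<partial>lborel)"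

lemma integrable_gauss:
  assumes "0 < c"
  shows "integrable lborel (\<lambda>u::'a::euclidean_space. exp (-(c * (norm u)\<^sup>2)))"
  using integrable_gauss_times[of "\<lambda>_::'a. 1" 1 1, OF _ _ assms] by simp

lemma gauss_total_pos: "0 < gauss_total TYPE('a::euclidean_space)"
  unfolding gauss_total_def
  using integrable_gauss[of 1, where 'a='a] by (intro integral_pos_open[where U = UNIV]) auto

lemma gauss_integral:
  assumes "0 < c"
  shows "(\<integral>u. exp (-(c * (norm (u::'a::euclidean_space))\<^sup>2)) \<partial>lborel) = c powr (- real DIM('a) / 2) * gauss_total TYPE('a)"
  using gauss_scale[of "\<lambda>_::'a. 1" c 0] assms by (simp add: gauss_total_def)

text \<open>For r > 0, exp(-r^2) is the integral of r^2 exp(-c r^2) over c \<ge> 1. Exchanging the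
  integrals turns the total mass into the second moment times the integral of c^(-(n+2)/2), which is
  2/n. The exact factor n/2 is later what makes \<open>gauss_flux\<close> a derivative in
  time.\<close>

lemma gauss_second_moment:
  "(\<integral>u. (norm (u::'a::euclidean_space))\<^sup>2 * exp (-((norm u)\<^sup>2)) \<partial>lborel) = real DIM('a) / 2 * gauss_total TYPE('a)"
proof -
  define n where "n = real DIM('a)"
  have n: "n \<ge> 1"
    using one_le_DIM[where 'a='a] by (simp add: n_def)
  define M2 where "M2 = (\<integral>u. (norm (u::'a))\<^sup>2 * exp (-((norm u)\<^sup>2)) \<partial>lborel)"
  have int: "integrable lborel (\<lambda>u::'a. (norm u)\<^sup>2 * exp (-(c * (norm u)\<^sup>2)))" if "0 < c" for c
  proof (rule integrable_gauss_times[where B = 1 and k = 2])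
    show "\<bar>(norm u)\<^sup>2\<bar> \<le> 1 * (1 + norm u) powr 2" for u :: 'a
      by (simp add: power_mono)
  qed (use that in measurable)
  have M2: "M2 \<ge> 0"
    by (simp add: M2_def)
  have mom: "(\<integral>u. (norm (u::'a))\<^sup>2 * exp (-(c * (norm u)\<^sup>2)) \<partial>lborel) = c powr (-(n + 2) / 2) * M2" if "0 < c" for c
    using gauss_scale[of "\<lambda>u::'a. (norm u)\<^sup>2" c 2] that by (simp add: M2_def n_def power_mult_distrib)
  define F where "F u c = ennreal ((norm u)\<^sup>2 * exp (-(c * (norm u)\<^sup>2))) * indicator {1..} c" for u :: 'a and c :: real
  have [measurable]: "case_prod F \<in> borel_measurable (borel \<Otimes>\<^sub>M borel)"
    unfolding F_def by measurable
  have 1: "(\<integral>\<^sup>+c. F u c \<partial>lborel) = ennreal (exp (-((norm u)\<^sup>2)))" if "u \<noteq> 0" for u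
  proof -
    define k where "k = (norm u)\<^sup>2"
    have k: "k > 0" using that by (simp add: k_def)
    have "(\<integral>\<^sup>+c. ennreal (k * exp (-(c * k))) * indicator {1..} c \<partial>lborel) = ennreal (0 - (- exp (-(1 * k))))"
    proof (rule nn_integral_FTC_atLeast)
      show "((\<lambda>c. - exp (-(c * k))) has_real_derivative k * exp (-(c * k))) (at c)" for c
        by (auto intro!: derivative_eq_intros)
      have "filterlim (\<lambda>c. c * k) at_top at_top"
        using k by (intro filterlim_at_top_mult_tendsto_pos[OF tendsto_const] filterlim_ident)
      then have "filterlim (\<lambda>c. - (c * k)) at_bot at_top"
        by (simp add: filterlim_uminus_at_bot)
      then have "((\<lambda>c. exp (-(c * k))) \<longlongrightarrow> 0) at_top"
        by (rule filterlim_compose[OF exp_at_bot])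
      then show "((\<lambda>c. - exp (-(c * k))) \<longlongrightarrow> 0) at_top"
        using tendsto_minus[of "\<lambda>c. exp (-(c * k))" 0] by simp
    qed (use k in auto)
    then show ?thesis
      by (simp add: F_def k_def)
  qed
  have "(\<integral>\<^sup>+u. (\<integral>\<^sup>+c. F u c \<partial>lborel) \<partial>lborel) = (\<integral>\<^sup>+u. ennreal (exp (-((norm (u::'a))\<^sup>2))) \<partial>lborel)"
    using AE_lborel_neq[of "0::'a"] by (intro nn_integral_cong_AE) (auto simp: 1)
  also have "\<dots> = ennreal (gauss_total TYPE('a))"
    unfolding gauss_total_def using integrable_gauss[of 1, where 'a='a] by (intro nn_integral_eq_integral) auto
  finally have A: "(\<integral>\<^sup>+u. (\<integral>\<^sup>+c. F u c \<partial>lborel) \<partial>lborel) = ennreal (gauss_total TYPE('a))" .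
  have "(\<integral>\<^sup>+u. (\<integral>\<^sup>+c. F u c \<partial>lborel) \<partial>lborel) = (\<integral>\<^sup>+c. (\<integral>\<^sup>+u. F u c \<partial>lborel) \<partial>lborel)"
    by (rule lborel_pair.Fubini'[symmetric]) simp
  also have "\<dots> = (\<integral>\<^sup>+c. ennreal (c powr (-(n + 2) / 2) * M2) * indicator {1..} c \<partial>lborel)"
  proof (intro nn_integral_cong)
    fix c :: real
    show "(\<integral>\<^sup>+u. F u c \<partial>lborel) = ennreal (c powr (-(n + 2) / 2) * M2) * indicator {1..} c"
    proof (cases "1 \<le> c")
      case True
      then have "(\<integral>\<^sup>+u. F u c \<partial>lborel) = ennreal (\<integral>u. (norm (u::'a))\<^sup>2 * exp (-(c * (norm u)\<^sup>2)) \<partial>lborel)"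
        unfolding F_def using int[of c] by (simp add: nn_integral_eq_integral)
      with True show ?thesis
        by (simp add: mom)
    qed (simp add: F_def)
  qed
  also have "\<dots> = ennreal (0 - (- (2 / n * 1 powr (- n / 2)) * M2))"
  proof (rule nn_integral_FTC_atLeast)
    show "((\<lambda>c. - (2 / n * c powr (- n / 2)) * M2) has_real_derivative c powr (-(n + 2) / 2) * M2) (at c)" if "1 \<le> c" for c
      using that n by (auto intro!: derivative_eq_intros simp: field_simps add_divide_distrib)
    have "((\<lambda>c. c powr (- n / 2)) \<longlongrightarrow> 0) at_top"
      using n by (intro tendsto_neg_powr filterlim_ident) auto
    then have "((\<lambda>c. - (2 / n * c powr (- n / 2)) * M2) \<longlongrightarrow> - (2 / n * 0) * M2) at_top"
      by (intro tendsto_intros)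
    then show "((\<lambda>c. - (2 / n * c powr (- n / 2)) * M2) \<longlongrightarrow> 0) at_top"
      by simp
  qed (use M2 in auto)
  finally have "ennreal (gauss_total TYPE('a)) = ennreal (2 / n * M2)"
    unfolding A by simp
  then have "gauss_total TYPE('a) = 2 / n * M2"
    using gauss_total_pos[where 'a='a] M2 n by (subst (asm) ennreal_inj) auto
  then show ?thesis
    using n by (simp add: M2_def n_def field_simps)
qed

lemma complete_square:
  fixes x u :: "'a::real_inner" and T \<rho> :: real
  assumes "0 < T" "0 < \<rho>"
  shows "(norm (u + (T / (T + \<rho>)) *\<^sub>R x))\<^sup>2 / T + (norm (u - (\<rho> / (T + \<rho>)) *\<^sub>R x))\<^sup>2 / \<rho>
    = (T + \<rho>) / (T * \<rho>) * (norm u)\<^sup>2 + (norm x)\<^sup>2 / (T + \<rho>)"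
proof -
  define S where "S = T + \<rho>"
  have S: "S > 0" using assms by (simp add: S_def)
  have 1: "(norm (u + (T / S) *\<^sub>R x))\<^sup>2 = (norm u)\<^sup>2 + 2 * (T / S) * (u \<bullet> x) + (T / S)\<^sup>2 * (norm x)\<^sup>2"
    unfolding power2_norm_eq_inner by (simp add: inner_simps inner_commute power2_eq_square algebra_simps)
  have 2: "(norm (u - (\<rho> / S) *\<^sub>R x))\<^sup>2 = (norm u)\<^sup>2 - 2 * (\<rho> / S) * (u \<bullet> x) + (\<rho> / S)\<^sup>2 * (norm x)\<^sup>2"
    unfolding power2_norm_eq_inner by (simp add: inner_simps inner_commute power2_eq_square algebra_simps)
  have "((norm u)\<^sup>2 + 2 * (T / S) * (u \<bullet> x) + (T / S)\<^sup>2 * (norm x)\<^sup>2) / T + ((norm u)\<^sup>2 - 2 * (\<rho> / S) * (u \<bullet> x) + (\<rho> / S)\<^sup>2 * (norm x)\<^sup>2) / \<rho>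
    = (1 / T + 1 / \<rho>) * (norm u)\<^sup>2 + (T + \<rho>) / S\<^sup>2 * (norm x)\<^sup>2"
    using assms S by (simp add: add_divide_distrib diff_divide_distrib power2_eq_square distrib_right)
  also have "\<dots> = S / (T * \<rho>) * (norm u)\<^sup>2 + (norm x)\<^sup>2 / S"
    using assms S by (simp add: S_def[symmetric] power2_eq_square) (simp add: S_def field_simps)
  finally show ?thesis
    unfolding S_def[symmetric] 1 2 .
qed

text \<open>The product of the two Gaussians is a Gaussian with centre - \<rho> x / (T + \<rho>).
  After recentring, the terms linear in u are odd and vanish, so the pairing sees L only through its
  quadratic form. The identity and skew maps are the two cases used.\<close>

lemma gauss_pairing:
  fixes L :: "'a::euclidean_space \<Rightarrow> 'a"
  assumes L: "bounded_linear L" and T: "0 < T" "0 < \<rho>"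
  shows "(\<integral>w. (w \<bullet> L (x + w)) * exp (-((norm (x + w))\<^sup>2 / T)) * exp (-((norm w)\<^sup>2 / \<rho>)) \<partial>lborel) =
    (T * \<rho> / (T + \<rho>)) powr (real DIM('a) / 2 + 1) * exp (-((norm x)\<^sup>2 / (T + \<rho>))) *
      ((\<integral>u. (u \<bullet> L u) * exp (-((norm u)\<^sup>2)) \<partial>lborel) - (x \<bullet> L x) * gauss_total TYPE('a) / (T + \<rho>))"
proof -
  define S c a b where "S = T + \<rho>" and "c = S / (T * \<rho>)" and "a = T / S" and "b = \<rho> / S"
  have S: "S > 0" and c: "c > 0"
    using T by (auto simp: S_def c_def)
  have ab: "a + b = 1" "a * b = 1 / (c * S)"
    using T S by (auto simp: a_def b_def c_def S_def add_divide_distrib[symmetric])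
  define N where "N = real DIM('a) / 2 + 1"
  interpret L: bounded_linear L by (rule L)
  obtain K where K: "K \<ge> 0" "\<And>u. norm (L u) \<le> norm u * K"
    using L.nonneg_bounded by blast
  have [measurable]: "L \<in> borel_measurable borel"
    using L.continuous_on by (intro borel_measurable_continuous_onI) (auto intro: continuous_intros)
  let ?e = "\<lambda>u::'a. exp (-(c * (norm u)\<^sup>2))"
  define G2 where "G2 = (\<integral>u. (u \<bullet> L u) * exp (-((norm u)\<^sup>2)) \<partial>lborel)"
  have quad: "\<bar>u \<bullet> L u\<bar> \<le> K * (1 + norm u) powr 2" for u
  proof -
    have "\<bar>u \<bullet> L u\<bar> \<le> norm u * (norm u * K)"
      using Cauchy_Schwarz_ineq2[of u "L u"] mult_left_mono[OF K(2)[of u], of "norm u"] by simp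
    also have "\<dots> = K * (norm u)\<^sup>2"
      by (simp add: power2_eq_square)
    also have "\<dots> \<le> K * (1 + norm u) powr 2"
      using K(1) by (intro mult_left_mono) (auto simp: power_mono)
    finally show ?thesis .
  qed
  have i1: "integrable lborel (\<lambda>u. (u \<bullet> L u) * ?e u)"
    by (rule integrable_gauss_times[OF _ quad c]) measurable
  have lin: "\<bar>a * (u \<bullet> L x) - b * (x \<bullet> L u)\<bar> \<le> (\<bar>a\<bar> * norm (L x) + \<bar>b\<bar> * norm x * K) * (1 + norm u) powr 1" for u
  proof -
    have "\<bar>a * (u \<bullet> L x) - b * (x \<bullet> L u)\<bar> \<le> \<bar>a\<bar> * \<bar>u \<bullet> L x\<bar> + \<bar>b\<bar> * \<bar>x \<bullet> L u\<bar>"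
      by (rule order_trans[OF abs_triangle_ineq4]) (simp add: abs_mult)
    also have "\<dots> \<le> \<bar>a\<bar> * (norm u * norm (L x)) + \<bar>b\<bar> * (norm x * (norm u * K))"
      using order_trans[OF Cauchy_Schwarz_ineq2[of x "L u"] mult_left_mono[OF K(2)[of u], of "norm x"]]
      by (intro add_mono mult_left_mono Cauchy_Schwarz_ineq2) auto
    also have "\<dots> = (\<bar>a\<bar> * norm (L x) + \<bar>b\<bar> * norm x * K) * norm u"
      by (simp add: algebra_simps)
    also have "\<dots> \<le> (\<bar>a\<bar> * norm (L x) + \<bar>b\<bar> * norm x * K) * (1 + norm u) powr 1"
      using K(1) by (intro mult_left_mono) auto
    finally show ?thesis .
  qed
  have i2: "integrable lborel (\<lambda>u. (a * (u \<bullet> L x) - b * (x \<bullet> L u)) * ?e u)"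
    by (rule integrable_gauss_times[OF _ lin c]) measurable
  have z2: "(\<integral>u. (a * (u \<bullet> L x) - b * (x \<bullet> L u)) * ?e u \<partial>lborel) = 0"
    by (rule integral_lborel_odd) (auto simp: linear_neg[OF bounded_linear.linear[OF L]] algebra_simps)
  have i3: "integrable lborel (\<lambda>u. (a * b * (x \<bullet> L x)) * ?e u)"
    by (intro integrable_mult_right integrable_gauss c)
  \<comment> \<open>Substitute w = - b x + u, the centre of the product; then x + w = u + a x,
    because a + b = 1.\<close>
  have "(\<integral>w. (w \<bullet> L (x + w)) * exp (-((norm (x + w))\<^sup>2 / T)) * exp (-((norm w)\<^sup>2 / \<rho>)) \<partial>lborel)
    = (\<integral>u. ((- b *\<^sub>R x + u) \<bullet> L (x + (- b *\<^sub>R x + u))) * exp (-((norm (x + (- b *\<^sub>R x + u)))\<^sup>2 / T)) * exp (-((norm (- b *\<^sub>R x + u))\<^sup>2 / \<rho>)) \<partial>lborel)"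
    by (rule integral_lborel_shift(1)[symmetric]) measurable
  also have "\<dots> = (\<integral>u. exp (-((norm x)\<^sup>2 / S)) * ((u \<bullet> L u) * ?e u + (a * (u \<bullet> L x) - b * (x \<bullet> L u)) * ?e u - (a * b * (x \<bullet> L x)) * ?e u) \<partial>lborel)"
  proof (intro Bochner_Integration.integral_cong refl)
    fix u
    have b1: "x + (- b *\<^sub>R x + u) = u + a *\<^sub>R x"
    proof -
      have "x = (a + b) *\<^sub>R x" by (simp add: ab)
      then have "x + (- b *\<^sub>R x + u) = (a + b) *\<^sub>R x + (- b *\<^sub>R x + u)" by simp
      then show ?thesis by (simp add: scaleR_add_left)
    qed
    have b2: "- b *\<^sub>R x + u = u - b *\<^sub>R x"
      by simp
    have e: "exp (-((norm (u + a *\<^sub>R x))\<^sup>2 / T)) * exp (-((norm (u - b *\<^sub>R x))\<^sup>2 / \<rho>)) = exp (-((norm x)\<^sup>2 / S)) * ?e u"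
      using complete_square[OF T, of u x] unfolding exp_add[symmetric] S_def[symmetric] a_def[symmetric] b_def[symmetric] c_def[symmetric]
      by simp
    have i: "(u - b *\<^sub>R x) \<bullet> L (u + a *\<^sub>R x) = (u \<bullet> L u) + (a * (u \<bullet> L x) - b * (x \<bullet> L u)) - a * b * (x \<bullet> L x)"
      by (simp add: L.add L.scale inner_simps algebra_simps)
    show "((- b *\<^sub>R x + u) \<bullet> L (x + (- b *\<^sub>R x + u))) * exp (-((norm (x + (- b *\<^sub>R x + u)))\<^sup>2 / T)) * exp (-((norm (- b *\<^sub>R x + u))\<^sup>2 / \<rho>)) =
       exp (-((norm x)\<^sup>2 / S)) * ((u \<bullet> L u) * ?e u + (a * (u \<bullet> L x) - b * (x \<bullet> L u)) * ?e u - (a * b * (x \<bullet> L x)) * ?e u)"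
      unfolding b1 unfolding b2 mult.assoc e unfolding i by (simp add: algebra_simps)
  qed
  also have "\<dots> = exp (-((norm x)\<^sup>2 / S)) * ((\<integral>u. (u \<bullet> L u) * ?e u \<partial>lborel) - a * b * (x \<bullet> L x) * (\<integral>u. ?e u \<partial>lborel))"
    using i1 i2 i3 z2 by simp
  also have "(\<integral>u. (u \<bullet> L u) * ?e u \<partial>lborel) = c powr (-N) * G2"
  proof -
    have "-(real DIM('a) + real 2) / 2 = -N"
      by (simp add: N_def field_simps)
    then show ?thesis
      using gauss_scale[of "\<lambda>u. u \<bullet> L u" c 2] c
      by (simp add: L.scale G2_def power2_eq_square)
  qed
  also have "(\<integral>u. ?e u \<partial>lborel) = c powr (- real DIM('a) / 2) * gauss_total TYPE('a)"
    by (rule gauss_integral[OF c])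
  also have "c powr (- real DIM('a) / 2) = c * c powr (-N)"
    using c powr_mult_base[of c "-N"] by (simp add: N_def)
  also have "exp (-((norm x)\<^sup>2 / S)) * (c powr (-N) * G2 - a * b * (x \<bullet> L x) * (c * c powr (-N) * gauss_total TYPE('a)))
     = c powr (-N) * exp (-((norm x)\<^sup>2 / S)) * (G2 - (a * b * c) * ((x \<bullet> L x) * gauss_total TYPE('a)))"
    by (simp add: algebra_simps)
  also have "a * b * c = 1 / S"
    using c S by (simp add: ab)
  also have "c powr (-N) = (T * \<rho> / (T + \<rho>)) powr N"
    using T by (simp add: c_def S_def powr_minus powr_divide field_simps)
  finally show ?thesis
    unfolding S_def N_def G2_def by simp
qed

section \<open>Powers of |w| as mixtures of Gaussians\<close>

text \<open>The value Gamma(q), by the substitution \<sigma> -> 1/\<sigma>; again only positivity is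
  used.\<close>

definition subord_const :: "real \<Rightarrow> real" where
  "subord_const q = (\<integral>\<sigma>. indicator {0<..} \<sigma> * (\<sigma> powr (-(q + 1)) * exp (-(1 / \<sigma>))) \<partial>lborel)"

lemma integrable_subord:
  assumes q: "0 < q"
  shows "integrable lborel (\<lambda>\<sigma>::real. indicator {0<..} \<sigma> * (\<sigma> powr (-(q + 1)) * exp (-(1 / \<sigma>))))"
proof -
  obtain C where C: "C > 0" "\<And>T s. 0 < T \<Longrightarrow> 0 \<le> s \<Longrightarrow> T powr (-(q + 1)) * exp (-(s/T)) \<le> C * (T + s) powr (-(q + 1))"
    using powr_exp_le[of "q + 1"] by metis
  show ?thesis
  proof (rule Bochner_Integration.integrable_bound)
    show "integrable lborel (\<lambda>\<sigma>::real. C * (1 + norm \<sigma>) powr (-(q + 1)))"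
      using q by (intro integrable_mult_right integrable_one_plus_norm_powr) simp
    show "AE \<sigma> in lborel. norm (indicator {0<..} \<sigma> * (\<sigma> powr (-(q + 1)) * exp (-(1 / \<sigma>)))) \<le> norm (C * (1 + norm \<sigma>) powr (-(q + 1)))"
    proof (intro AE_I2)
      fix \<sigma> :: real
      show "norm (indicator {0<..} \<sigma> * (\<sigma> powr (-(q + 1)) * exp (-(1 / \<sigma>)))) \<le> norm (C * (1 + norm \<sigma>) powr (-(q + 1)))"
        using C(1) C(2)[of \<sigma> 1] by (auto simp: indicator_def add.commute)
    qed
  qed measurable
qed

lemma subord_const_pos:
  assumes "0 < q" shows "0 < subord_const q"
  unfolding subord_const_def
  by (rule integral_pos_open[OF integrable_subord[OF assms], where U = "{0<..}"]) (auto simp: indicator_def)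

text \<open>The substitution \<rho> = r^2 \<sigma> extracts the power of r. With q = (n + \<alpha> +
  1) / 2 the result is the kernel of the fractional divergence.\<close>

lemma subordination:
  assumes q: "0 < q" and r: "0 < r"
  shows "integrable lborel (\<lambda>\<rho>::real. indicator {0<..} \<rho> * (\<rho> powr (-(q + 1)) * exp (-(r\<^sup>2 / \<rho>))))"
    and "(\<integral>\<rho>. indicator {0<..} \<rho> * (\<rho> powr (-(q + 1)) * exp (-(r\<^sup>2 / \<rho>))) \<partial>lborel) = subord_const q * r powr (- 2 * q)"
proof -
  have r2: "r\<^sup>2 > 0" using r by simp
  have eq: "indicator {0<..} \<rho> * (\<rho> powr (-(q + 1)) * exp (-(r\<^sup>2 / \<rho>))) =
    (r\<^sup>2) powr (-(q + 1)) * (indicator {0<..} (0 + (1/r\<^sup>2) *\<^sub>R \<rho>) * ((0 + (1/r\<^sup>2) *\<^sub>R \<rho>) powr (-(q + 1)) * exp (-(1 / (0 + (1/r\<^sup>2) *\<^sub>R \<rho>)))))" for \<rho> :: real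
  proof (cases "\<rho> > 0")
    case True
    then have "\<rho> powr (-(q + 1)) = (r\<^sup>2 * (\<rho> / r\<^sup>2)) powr (-(q + 1))"
      using r by simp
    also have "\<dots> = (r\<^sup>2) powr (-(q + 1)) * (\<rho> / r\<^sup>2) powr (-(q + 1))"
      by (rule powr_mult)
    finally show ?thesis
      using True r by simp
  next
    case False
    then show ?thesis
      using r by (auto simp: indicator_def zero_less_divide_iff)
  qed
  show "integrable lborel (\<lambda>\<rho>::real. indicator {0<..} \<rho> * (\<rho> powr (-(q + 1)) * exp (-(r\<^sup>2 / \<rho>))))"
    unfolding eq using r2 by (intro integrable_mult_right integrable_lborel_affine[OF _ integrable_subord[OF q]]) auto
  have "subord_const q = \<bar>1/r\<^sup>2\<bar> ^ DIM(real) *\<^sub>R (\<integral>\<rho>. (indicator {0<..} (0 + (1/r\<^sup>2) *\<^sub>R \<rho>) * ((0 + (1/r\<^sup>2) *\<^sub>R \<rho>) powr (-(q + 1)) * exp (-(1 / (0 + (1/r\<^sup>2) *\<^sub>R \<rho>))))) \<partial>lborel)"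
    unfolding subord_const_def using r2 by (intro integral_lborel_affine) auto
  then have "(\<integral>\<rho>. (indicator {0<..} (0 + (1/r\<^sup>2) *\<^sub>R \<rho>) * ((0 + (1/r\<^sup>2) *\<^sub>R \<rho>) powr (-(q + 1)) * exp (-(1 / (0 + (1/r\<^sup>2) *\<^sub>R \<rho>))))) \<partial>lborel) = r\<^sup>2 * subord_const q"
    using r2 by (simp add: field_simps)
  then have "(\<integral>\<rho>. indicator {0<..} \<rho> * (\<rho> powr (-(q + 1)) * exp (-(r\<^sup>2 / \<rho>))) \<partial>lborel) = (r\<^sup>2) powr (-(q + 1)) * (r\<^sup>2 * subord_const q)"
    unfolding eq integral_mult_right_zero by simp
  also have "\<dots> = subord_const q * (r\<^sup>2 * (r\<^sup>2) powr (-(q + 1)))"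
    by (simp only: mult_ac)
  also have "r\<^sup>2 * (r\<^sup>2) powr (-(q + 1)) = r powr (- 2 * q)"
    using r powr_mult_base[of "r\<^sup>2" "-(q+1)"] square_powr[OF r, of "-q"] by simp
  finally show "(\<integral>\<rho>. indicator {0<..} \<rho> * (\<rho> powr (-(q + 1)) * exp (-(r\<^sup>2 / \<rho>))) \<partial>lborel) = subord_const q * r powr (- 2 * q)" .
qed

context
  fixes \<alpha> :: real
  assumes \<alpha>: "0 < \<alpha>" "\<alpha> < 1"
begin

text \<open>Writing \<open>\<bar>w\<bar>\<^bsup>-n-\<alpha>-1\<^esup>\<close> as an integral of Gaussians turns the fractional divergence of a Gaussian field into an
  integral of explicit Gaussian pairings.\<close>

lemma fdiv_subordination:
  fixes \<phi> :: "'a::euclidean_space \<Rightarrow> 'a"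
  assumes d: "decay (real DIM('a) - \<alpha>) A \<phi>"
  shows "subord_const ((real DIM('a) + \<alpha> + 1) / 2) * fdiv \<alpha> \<phi> x =
    (\<integral>\<rho>. indicator {0<..} \<rho> * (\<rho> powr (-((real DIM('a) + \<alpha> + 1) / 2 + 1)) *
       (\<integral>w. (w \<bullet> \<phi> (x + w)) * exp (-((norm w)\<^sup>2 / \<rho>)) \<partial>lborel)) \<partial>lborel)"
proof -
  define q where "q = (real DIM('a) + \<alpha> + 1) / 2"
  have q: "q > 0" using \<alpha> by (simp add: q_def add_nonneg_pos)
  define s where "s = real DIM('a) - \<alpha>"
  have s: "s \<ge> 0"
    using DIM_minus_alpha_pos[OF \<alpha>, where 'a='a] by (simp add: s_def)
  have [measurable]: "\<phi> \<in> borel_measurable borel"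
    using decay_borel[OF d] s by (simp add: s_def)
  define W where "W w = w \<bullet> (\<phi> (x + w) - \<phi> x)" for w
  have [measurable]: "W \<in> borel_measurable borel"
    unfolding W_def by measurable
  define k where "k w \<rho> = indicator {0<..} \<rho> * (\<rho> powr (-(q + 1)) * exp (-((norm (w::'a))\<^sup>2 / \<rho>)))" for w and \<rho> :: real
  have [measurable]: "case_prod k \<in> borel_measurable (borel \<Otimes>\<^sub>M borel)"
    unfolding k_def by measurable
  have k0: "k w \<rho> \<ge> 0" for w \<rho>
    by (simp add: k_def)
  define H where "H w \<rho> = W w * k w \<rho>" for w and \<rho> :: real
  have [measurable]: "case_prod H \<in> borel_measurable (borel \<Otimes>\<^sub>M borel)"
    unfolding H_def by measurable
  have F: "integrable lborel (\<lambda>w. W w * norm w powr (- 2 * q))"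
  proof -
    have "- 2 * q = -(real DIM('a) + \<alpha> + 1)"
      by (simp add: q_def)
    then show ?thesis
      using fdiv_integrable[OF \<alpha> d, of x] by (simp only: W_def)
  qed
  have fd: "fdiv \<alpha> \<phi> x = (\<integral>w. W w * norm w powr (- 2 * q) \<partial>lborel)"
  proof -
    have "- 2 * q = -(real DIM('a) + \<alpha> + 1)"
      by (simp add: q_def)
    then show ?thesis
      by (simp only: W_def fdiv_def)
  qed
  \<comment> \<open>For w = 0 the mixing density is not integrable near \<rho> = 0, but then the
    factor \<open>W w\<close> is 0.\<close>
  have Hi: "integrable lborel (H w)" for w
  proof (cases "w = 0")
    case False
    then show ?thesis
      unfolding H_def k_def by (intro integrable_mult_right subordination(1) q) auto
  next
    case True
    then have "H w = (\<lambda>_. 0)"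
      by (auto simp: H_def W_def)
    then show ?thesis by simp
  qed
  have HI: "(\<integral>\<rho>. H w \<rho> \<partial>lborel) = subord_const q * (W w * norm w powr (- 2 * q))" for w
  proof (cases "w = 0")
    case False
    then show ?thesis
      unfolding H_def k_def integral_mult_right_zero by (subst subordination(2)[OF q]) auto
  qed (simp add: H_def W_def)
  have HA: "(\<integral>\<rho>. \<bar>H w \<rho>\<bar> \<partial>lborel) = subord_const q * \<bar>W w * norm w powr (- 2 * q)\<bar>" for w
  proof (cases "w = 0")
    case False
    have "(\<integral>\<rho>. \<bar>H w \<rho>\<bar> \<partial>lborel) = \<bar>W w\<bar> * (\<integral>\<rho>. k w \<rho> \<partial>lborel)"
      using k0 by (simp add: H_def abs_mult)
    also have "(\<integral>\<rho>. k w \<rho> \<partial>lborel) = subord_const q * norm w powr (- 2 * q)"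
      unfolding k_def using False by (subst subordination(2)[OF q]) auto
    finally show ?thesis
      by (simp add: abs_mult)
  qed (simp add: H_def W_def)
  have int: "integrable (lborel \<Otimes>\<^sub>M lborel) (case_prod H)"
  proof (rule lborel_pair.Fubini_integrable)
    show "integrable lborel (\<lambda>w. \<integral>\<rho>. norm (case_prod H (w, \<rho>)) \<partial>lborel)"
      using HA F by (simp del: abs_mult)
  qed (use Hi in auto)
  have "subord_const q * fdiv \<alpha> \<phi> x = (\<integral>w. (\<integral>\<rho>. H w \<rho> \<partial>lborel) \<partial>lborel)"
    unfolding HI fd by simp
  also have "\<dots> = (\<integral>\<rho>. (\<integral>w. H w \<rho> \<partial>lborel) \<partial>lborel)"
    using lborel_pair.Fubini_integral[of H] int by simp
  also have "\<dots> = (\<integral>\<rho>. indicator {0<..} \<rho> * (\<rho> powr (-(q + 1)) * (\<integral>w. (w \<bullet> \<phi> (x + w)) * exp (-((norm w)\<^sup>2 / \<rho>)) \<partial>lborel)) \<partial>lborel)"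
  proof (intro Bochner_Integration.integral_cong refl)
    fix \<rho> :: real
    show "(\<integral>w. H w \<rho> \<partial>lborel) = indicator {0<..} \<rho> * (\<rho> powr (-(q + 1)) * (\<integral>w. (w \<bullet> \<phi> (x + w)) * exp (-((norm w)\<^sup>2 / \<rho>)) \<partial>lborel))"
    proof (cases "\<rho> > 0")
      case True
      let ?e = "\<lambda>w::'a. exp (-((norm w)\<^sup>2 / \<rho>))"
      have bd: "norm (\<phi> z) \<le> A" for z
      proof -
        have "(1 + norm z) powr (-s) \<le> 1"
          using s powr_mono2'[of "-s" 1 "1 + norm z"] by simp
        then have "A * (1 + norm z) powr (-s) \<le> A"
          using decay_nonneg[OF d] by (simp add: mult_left_le)
        then show ?thesis
          using decayD(1)[OF d, of z] by (simp add: s_def)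
      qed
      have gi: "integrable lborel (\<lambda>w. (w \<bullet> g w) * ?e w)" if [measurable]: "g \<in> borel_measurable borel" and "\<And>w. norm (g w) \<le> A" for g :: "'a \<Rightarrow> 'a"
      proof -
        have "\<bar>w \<bullet> g w\<bar> \<le> A * (1 + norm w) powr 1" for w
        proof -
          have "\<bar>w \<bullet> g w\<bar> \<le> norm w * norm (g w)"
            by (rule Cauchy_Schwarz_ineq2)
          also have "\<dots> \<le> (1 + norm w) * A"
            using that by (intro mult_mono) auto
          finally show ?thesis by (simp add: mult.commute)
        qed
        then show ?thesis
          using integrable_gauss_times[of "\<lambda>w. w \<bullet> g w" A 1 "1 / \<rho>"] True by simp
      qed
      have "(\<integral>w. H w \<rho> \<partial>lborel) = (\<integral>w. \<rho> powr (-(q + 1)) * ((w \<bullet> \<phi> (x + w)) * ?e w - (w \<bullet> \<phi> x) * ?e w) \<partial>lborel)"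
        using True by (intro Bochner_Integration.integral_cong) (auto simp: H_def k_def W_def inner_simps algebra_simps)
      also have "\<dots> = \<rho> powr (-(q + 1)) * ((\<integral>w. (w \<bullet> \<phi> (x + w)) * ?e w \<partial>lborel) - (\<integral>w. (w \<bullet> \<phi> x) * ?e w \<partial>lborel))"
        using gi[of "\<lambda>w. \<phi> (x + w)"] gi[of "\<lambda>w. \<phi> x"] bd by simp
      \<comment> \<open>Subtracting \<phi> x is what makes the double integral converge. Once \<rho>
        is fixed and positive, the subtracted term is odd in w and contributes nothing.\<close>
      also have "(\<integral>w. (w \<bullet> \<phi> x) * ?e w \<partial>lborel) = 0"
        by (rule integral_lborel_odd) auto
      finally show ?thesis
        using True by simp
    qed (simp add: H_def k_def)
  qed
  finally show ?thesis
    by (simp only: q_def)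
qed

text \<open>Both terms of \<open>gauss_pairing\<close> contain the quadratic form z . L z, which
  vanishes for a rotation field; so every Gaussian pairing in the subordination formula is 0,
  whatever \<alpha> is.\<close>

lemma fdiv_gauss_rotation:
  fixes L :: "'a::euclidean_space \<Rightarrow> 'a"
  assumes L: "bounded_linear L" "\<And>z. z \<bullet> L z = 0" and T: "0 < T"
    and d: "decay (real DIM('a) - \<alpha>) A (\<lambda>z. exp (-((norm z)\<^sup>2 / T)) *\<^sub>R L z)"
  shows "fdiv \<alpha> (\<lambda>z. exp (-((norm z)\<^sup>2 / T)) *\<^sub>R L z) x = 0"
proof -
  have "(\<integral>w. (w \<bullet> (exp (-((norm (x + w))\<^sup>2 / T)) *\<^sub>R L (x + w))) * exp (-((norm w)\<^sup>2 / \<rho>)) \<partial>lborel) = 0" if "0 < \<rho>" for \<rho>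
    using gauss_pairing[OF L(1) T that, of x] by (simp add: L(2) mult.commute)
  then have "subord_const ((real DIM('a) + \<alpha> + 1) / 2) * fdiv \<alpha> (\<lambda>z. exp (-((norm z)\<^sup>2 / T)) *\<^sub>R L z) x = (\<integral>\<rho>. 0 \<partial>(lborel::real measure))"
    unfolding fdiv_subordination[OF d]
    by (intro Bochner_Integration.integral_cong) (auto simp: indicator_def)
  then show ?thesis
    using subord_const_pos[of "(real DIM('a) + \<alpha> + 1) / 2"] \<alpha> by (simp add: add_nonneg_pos)
qed

end

subsection \<open>A kernel whose divergence is Gaussian\<close>

text \<open>Euler's Beta function at (b, N - b) for 0 < b < N; only its positivity and its scaling
  behaviour are used.\<close>

definition beta_const :: "real \<Rightarrow> real \<Rightarrow> real" where
  "beta_const b N = (\<integral>t. indicator {0<..} t * (t powr (b - 1) * (1 + t) powr (-N)) \<partial>lborel)"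

lemma beta_integrable:
  fixes b N :: real
  assumes b: "0 < b" "b < N"
  shows "integrable lborel (\<lambda>t::real. indicator {0<..} t * (t powr (b - 1) * (1 + t) powr (-N)))"
proof (rule Bochner_Integration.integrable_bound)
  show "integrable lborel (\<lambda>t::real. norm t powr (-(1-b)) * indicator (ball 0 1) t + norm t powr (-(N+1-b)) * indicator (- ball 0 1) t)"
    using b by (intro Bochner_Integration.integrable_add norm_powr_ball_1 norm_powr_compl_ball_1) auto
  show "AE t in lborel. norm (indicator {0<..} t * (t powr (b - 1) * (1 + t) powr (-N))) \<le>
    norm (norm t powr (-(1-b)) * indicator (ball 0 1) t + norm t powr (-(N+1-b)) * indicator (- ball 0 1) t)"
  proof (intro AE_I2)
    fix t :: real
    consider "t \<le> 0" | "0 < t" "t < 1" | "1 \<le> t" by linarith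
    then show "norm (indicator {0<..} t * (t powr (b - 1) * (1 + t) powr (-N))) \<le>
      norm (norm t powr (-(1-b)) * indicator (ball 0 1) t + norm t powr (-(N+1-b)) * indicator (- ball 0 1) t)"
    proof cases
      case 2
      then have "(1 + t) powr (-N) \<le> 1"
        using b powr_mono2'[of "-N" 1 "1 + t"] by simp
      then have "t powr (b - 1) * (1 + t) powr (-N) \<le> t powr (b - 1) * 1"
        by (intro mult_left_mono) auto
      with 2 show ?thesis by simp
    next
      case 3
      then have "(1 + t) powr (-N) \<le> t powr (-N)"
        using b by (intro powr_mono2') auto
      then have "t powr (b - 1) * (1 + t) powr (-N) \<le> t powr (b - 1) * t powr (-N)"
        by (intro mult_left_mono) auto
      also have "\<dots> = t powr (-(N+1-b))"
        unfolding powr_add[symmetric] by (rule arg_cong[where f = "\<lambda>e. t powr e"]) simp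
      finally show ?thesis using 3 by simp
    qed auto
  qed
qed measurable

lemma beta_const_pos:
  assumes "0 < b" "b < N" shows "0 < beta_const b N"
  unfolding beta_const_def
  by (rule integral_pos_open[OF beta_integrable[OF assms], where U = "{0<..}"])
     (auto simp: indicator_def intro!: mult_pos_pos)

lemma beta_scale:
  fixes b N c :: real
  assumes b: "0 < b" "b < N" and c: "0 < c"
  shows "integrable lborel (\<lambda>t::real. indicator {0<..} t * (t powr (b - 1) * (c + t) powr (-N)))"
    and "(\<integral>t. indicator {0<..} t * (t powr (b - 1) * (c + t) powr (-N)) \<partial>lborel) = beta_const b N * c powr (-(N - b))"
proof -
  let ?g = "\<lambda>t::real. indicator {0<..} t * (t powr (b - 1) * (1 + t) powr (-N))"
  have eq: "indicator {0<..} t * (t powr (b - 1) * (c + t) powr (-N)) = c powr (b - 1 - N) * ?g (0 + (1/c) *\<^sub>R t)" for t :: real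
  proof (cases "t > 0")
    case True
    have "t = c * (t / c)" "c + t = c * (1 + t / c)"
      using c by (simp_all add: distrib_left)
    then have "t powr (b - 1) = (c * (t / c)) powr (b - 1)" "(c + t) powr (-N) = (c * (1 + t / c)) powr (-N)"
      by simp_all
    then have "t powr (b - 1) * (c + t) powr (-N) = (c powr (b - 1) * c powr (-N)) * ((t / c) powr (b - 1) * (1 + t / c) powr (-N))"
      by (simp only: powr_mult mult_ac)
    moreover have "c powr (b - 1) * c powr (-N) = c powr (b - 1 - N)"
      unfolding powr_add[symmetric] by simp
    ultimately show ?thesis
      using True c by simp
  next
    case False
    then show ?thesis using c by (auto simp: indicator_def zero_less_divide_iff)
  qed
  show "integrable lborel (\<lambda>t::real. indicator {0<..} t * (t powr (b - 1) * (c + t) powr (-N)))"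
    unfolding eq using c by (intro integrable_mult_right integrable_lborel_affine[OF _ beta_integrable[OF b]]) auto
  have "beta_const b N = \<bar>1/c\<bar> ^ DIM(real) *\<^sub>R (\<integral>t. ?g (0 + (1/c) *\<^sub>R t) \<partial>lborel)"
    unfolding beta_const_def using c by (intro integral_lborel_affine) auto
  then have *: "(\<integral>t. ?g (0 + (1/c) *\<^sub>R t) \<partial>lborel) = c * beta_const b N"
    using c by (simp add: field_simps)
  have "(\<integral>t. indicator {0<..} t * (t powr (b - 1) * (c + t) powr (-N)) \<partial>lborel) = c powr (b - 1 - N) * (c * beta_const b N)"
    unfolding eq integral_mult_right_zero * ..
  also have "\<dots> = beta_const b N * (c * c powr (b - 1 - N))"
    by (simp only: mult_ac)
  also have "c * c powr (b - 1 - N) = c powr (-(N - b))"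
    using c by (simp add: powr_mult_base)
  finally show "(\<integral>t. indicator {0<..} t * (t powr (b - 1) * (c + t) powr (-N)) \<partial>lborel) = beta_const b N * c powr (-(N - b))" .
qed

section \<open>Radial fields and their size and Lipschitz bounds\<close>

text \<open>The argument s stands for |z|^2, so m counts powers of |z|^2: the field k(|z|^2) z
  decays like |z|^(1-2m). The scale c is separated from A in order that one A can serve all scales,
  and monotonicity lets the value at the farther point be discarded.\<close>

definition radial_profile :: "real \<Rightarrow> real \<Rightarrow> real \<Rightarrow> (real \<Rightarrow> real) \<Rightarrow> bool" where
  "radial_profile A c m k \<longleftrightarrow> (\<forall>s\<ge>0. 0 \<le> k s \<and> k s \<le> A * (c + s) powr (-m)) \<and>
     (\<forall>s\<ge>0. \<forall>s'\<ge>s. k s' \<le> k s \<and> k s - k s' \<le> A * (s' - s) * (c + s) powr (-m-1))"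

lemma exp_minus_diff_le:
  fixes u v :: real
  assumes "u \<le> v"
  shows "exp (-u) - exp (-v) \<le> (v - u) * exp (-u)"
proof -
  have "1 + (u - v) \<le> exp (u - v)"
    by (rule exp_ge_add_one_self)
  then have "exp (-u) * (1 + (u - v)) \<le> exp (-u) * exp (u - v)"
    by (intro mult_left_mono) auto
  then show ?thesis
    by (simp add: algebra_simps exp_add[symmetric])
qed

lemma radial_profile_gauss:
  fixes m :: real
  obtains C where "C > 0" "\<And>T. 0 < T \<Longrightarrow> radial_profile (C * T powr m) T m (\<lambda>s. exp (-(s/T)))"
proof -
  obtain C1 where C1: "C1 > 0" "\<And>T s. 0 < T \<Longrightarrow> 0 \<le> s \<Longrightarrow> T powr (-m) * exp (-(s/T)) \<le> C1 * (T + s) powr (-m)"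
    using powr_exp_le[of m] by metis
  obtain C2 where C2: "C2 > 0" "\<And>T s. 0 < T \<Longrightarrow> 0 \<le> s \<Longrightarrow> T powr (-(m+1)) * exp (-(s/T)) \<le> C2 * (T + s) powr (-(m+1))"
    using powr_exp_le[of "m+1"] by metis
  show thesis
  proof (rule that[of "max C1 C2"])
    fix T :: real assume T: "0 < T"
    have 1: "exp (-(s/T)) \<le> max C1 C2 * T powr m * (T + s) powr (-m)" if "0 \<le> s" for s
    proof -
      have "T powr m * (T powr (-m) * exp (-(s/T))) \<le> T powr m * (C1 * (T + s) powr (-m))"
        using C1(2)[OF T that] by (intro mult_left_mono) auto
      then have "exp (-(s/T)) \<le> C1 * (T powr m * (T + s) powr (-m))"
        using T by (simp add: powr_minus field_simps)
      also have "\<dots> \<le> max C1 C2 * (T powr m * (T + s) powr (-m))"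
        by (intro mult_right_mono) auto
      finally show ?thesis by (simp add: mult.assoc)
    qed
    have 2: "exp (-(s/T)) - exp (-(s'/T)) \<le> max C1 C2 * T powr m * (s' - s) * (T + s) powr (-m-1)" if s: "0 \<le> s" "s \<le> s'" for s s'
    proof -
      have "exp (-(s/T)) - exp (-(s'/T)) \<le> (s'/T - s/T) * exp (-(s/T))"
        using s T by (intro exp_minus_diff_le divide_right_mono) auto
      also have "\<dots> = (s' - s) * T powr m * (T powr (-(m+1)) * exp (-(s/T)))"
      proof -
        have "T powr m * T powr (-(m+1)) = 1 / T"
          using T unfolding powr_add[symmetric] by (simp add: powr_minus divide_inverse)
        then show ?thesis
          by (simp add: diff_divide_distrib[symmetric] mult.assoc[symmetric]) (simp add: mult.assoc)
      qed
      also have "\<dots> \<le> (s' - s) * T powr m * (max C1 C2 * (T + s) powr (-(m+1)))"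
      proof (intro mult_left_mono)
        have "C2 * (T + s) powr (-(m+1)) \<le> max C1 C2 * (T + s) powr (-(m+1))"
          by (intro mult_right_mono) auto
        then show "T powr (-(m+1)) * exp (-(s/T)) \<le> max C1 C2 * (T + s) powr (-(m+1))"
          using C2(2)[OF T s(1)] by linarith
      qed (use s in auto)
      finally show ?thesis by (simp add: mult_ac)
    qed
    show "radial_profile (max C1 C2 * T powr m) T m (\<lambda>s. exp (-(s/T)))"
      unfolding radial_profile_def using 1 2 T by (auto intro: divide_right_mono)
  qed (use C1 in auto)
qed

lemma radial_field_norm:
  assumes "radial_profile A c m k"
  shows "norm (k ((norm z)\<^sup>2) *\<^sub>R z) \<le> A * norm z * (c + (norm z)\<^sup>2) powr (-m)"
proof -
  have k: "0 \<le> k ((norm z)\<^sup>2)" "k ((norm z)\<^sup>2) \<le> A * (c + (norm z)\<^sup>2) powr (-m)"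
    using assms by (auto simp: radial_profile_def)
  have "k ((norm z)\<^sup>2) * norm z \<le> A * (c + (norm z)\<^sup>2) powr (-m) * norm z"
    by (intro mult_right_mono k) auto
  then show ?thesis
    using k by (simp add: mult_ac)
qed

text \<open>Let z be the point of smaller norm. If |z'| \<le> 2 |z|, the slope of the profile is
  used; otherwise |z - z'| is comparable with |z| + |z'|, and the triangle inequality is
  enough.\<close>

lemma radial_field_diff:
  assumes P: "radial_profile A c m k" and c: "0 < c" and m: "0 \<le> m"
  shows "norm (k ((norm z)\<^sup>2) *\<^sub>R z - k ((norm z')\<^sup>2) *\<^sub>R z') \<le> 4 * A * norm (z - z') * (c + (min (norm z) (norm z'))\<^sup>2) powr (-m)"
proof -
  have A: "0 \<le> A"
  proof -
    have "0 \<le> A * (c + 0) powr (-m)"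
      using P by (force simp: radial_profile_def)
    then show ?thesis
      using c by (simp add: zero_le_mult_iff)
  qed
  have main: "norm (k ((norm z)\<^sup>2) *\<^sub>R z - k ((norm z')\<^sup>2) *\<^sub>R z') \<le> 4 * A * norm (z - z') * (c + (norm z)\<^sup>2) powr (-m)"
    if le: "norm z \<le> norm z'" for z z' :: 'a
  proof -
    define r r' where "r = norm z" and "r' = norm z'"
    have r: "0 \<le> r" "r \<le> r'" using le by (auto simp: r_def r'_def)
    have sq: "r\<^sup>2 \<le> r'\<^sup>2" using r by (intro power_mono) auto
    have k: "0 \<le> k (r\<^sup>2)" "k (r\<^sup>2) \<le> A * (c + r\<^sup>2) powr (-m)" "0 \<le> k (r'\<^sup>2)" "k (r'\<^sup>2) \<le> k (r\<^sup>2)"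
      "k (r\<^sup>2) - k (r'\<^sup>2) \<le> A * (r'\<^sup>2 - r\<^sup>2) * (c + r\<^sup>2) powr (-m-1)"
      using P sq by (auto simp: radial_profile_def)
    define D where "D = norm (z - z')"
    have D: "r' - r \<le> D" "0 \<le> D"
      using norm_triangle_ineq3[of z z'] by (auto simp: D_def r_def r'_def)
    define p where "p = (c + r\<^sup>2) powr (-m)"
    have p: "0 \<le> p" by (simp add: p_def)
    show ?thesis
    proof (cases "r' \<le> 2 * r")
      case True
      \<comment> \<open>Splitting off z - z' costs A and the variation of k costs 3 A, since r'^2 -
        r^2 \<le> 3 r D here; hence the factor 4.\<close>
      have "norm (k (r\<^sup>2) *\<^sub>R z - k (r'\<^sup>2) *\<^sub>R z') = norm (k (r'\<^sup>2) *\<^sub>R (z - z') + (k (r\<^sup>2) - k (r'\<^sup>2)) *\<^sub>R z)"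
        by (simp add: algebra_simps)
      also have "\<dots> \<le> k (r'\<^sup>2) * D + (k (r\<^sup>2) - k (r'\<^sup>2)) * r"
        using k by (intro order_trans[OF norm_triangle_ineq]) (simp add: D_def r_def)
      also have "\<dots> \<le> A * p * D + (A * (r'\<^sup>2 - r\<^sup>2) * (c + r\<^sup>2) powr (-m-1)) * r"
        using k r D by (intro add_mono mult_right_mono) (auto simp: p_def)
      also have "(A * (r'\<^sup>2 - r\<^sup>2) * (c + r\<^sup>2) powr (-m-1)) * r \<le> 3 * (A * p * D)"
      proof -
        have "r'\<^sup>2 - r\<^sup>2 = (r' - r) * (r' + r)"
          by (simp add: power2_eq_square algebra_simps)
        also have "\<dots> \<le> D * (3 * r)"
          using D r True by (intro mult_mono) auto
        finally have "(r'\<^sup>2 - r\<^sup>2) * r \<le> D * (3 * r) * r"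
          using r by (intro mult_right_mono)
        also have "\<dots> \<le> 3 * D * (c + r\<^sup>2)"
          using D c by (simp add: power2_eq_square algebra_simps)
        finally have "A * (c + r\<^sup>2) powr (-m-1) * ((r'\<^sup>2 - r\<^sup>2) * r) \<le> A * (c + r\<^sup>2) powr (-m-1) * (3 * D * (c + r\<^sup>2))"
          using A by (intro mult_left_mono) auto
        also have "\<dots> = 3 * (A * ((c + r\<^sup>2) * (c + r\<^sup>2) powr (-m-1)) * D)"
          by (simp only: mult_ac)
        also have "(c + r\<^sup>2) * (c + r\<^sup>2) powr (-m-1) = p"
          using c by (simp add: powr_mult_base p_def add_pos_nonneg)
        finally show ?thesis
          by (simp add: mult_ac)
      qed
      finally show ?thesis
        by (simp add: r_def r'_def D_def p_def mult_ac)
    next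
      case False
      have "norm (k (r\<^sup>2) *\<^sub>R z - k (r'\<^sup>2) *\<^sub>R z') \<le> k (r\<^sup>2) * r + k (r'\<^sup>2) * r'"
        using k by (intro order_trans[OF norm_triangle_ineq4]) (simp add: r_def r'_def)
      also have "\<dots> \<le> k (r\<^sup>2) * r + k (r\<^sup>2) * r'"
        using k r by (intro add_mono mult_right_mono) auto
      also have "\<dots> = k (r\<^sup>2) * (r + r')"
        by (simp add: algebra_simps)
      also have "\<dots> \<le> A * p * (4 * D)"
        using k r D False A p by (intro mult_mono) (auto simp: p_def)
      finally show ?thesis
        by (simp add: r_def r'_def D_def p_def mult_ac)
    qed
  qed
  show ?thesis
  proof (cases "norm z \<le> norm z'")
    case True
    then show ?thesis using main[of z z'] by (simp add: min_def)
  next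
    case False
    then show ?thesis using main[of z' z] by (simp add: min_def norm_minus_commute)
  qed
qed

text \<open>The constant may blow up as c -> 0. Decay is needed only for each fixed scale, to make
  the field admissible; the estimates that are uniform in the scale are
  \<open>radial_field_norm\<close> and \<open>radial_field_diff\<close>.\<close>

lemma radial_field_decay:
  fixes k :: "real \<Rightarrow> real"
  assumes P: "radial_profile A c m k" and c: "0 < c" and m: "0 \<le> m"
  shows "decay (2 * m - 1) (4 * A * (2 / min c 1) powr m) (\<lambda>z::'a::real_normed_vector. k ((norm z)\<^sup>2) *\<^sub>R z)"
proof -
  have A: "0 \<le> A"
  proof -
    have "0 \<le> A * (c + 0) powr (-m)"
      using P by (force simp: radial_profile_def)
    then show ?thesis
      using c by (simp add: zero_le_mult_iff)
  qed
  have w: "(c + r\<^sup>2) powr (-m) \<le> (2 / min c 1) powr m * (1 + r) powr (- 2 * m)" if r: "0 \<le> r" for r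
  proof -
    have "min c 1 / 2 * (1 + r)\<^sup>2 \<le> min c 1 / 2 * (2 * (1 + r\<^sup>2))"
      using c by (intro mult_left_mono one_plus_norm_sq) auto
    also have "\<dots> = min c 1 + min c 1 * r\<^sup>2"
      by (simp add: algebra_simps)
    also have "\<dots> \<le> c + 1 * r\<^sup>2"
      by (intro add_mono mult_right_mono) auto
    finally have "(c + r\<^sup>2) powr (-m) \<le> (min c 1 / 2 * (1 + r)\<^sup>2) powr (-m)"
      using c r m by (intro powr_mono2') (auto intro!: mult_pos_pos)
    also have "\<dots> = (2 / min c 1) powr m * ((1 + r)\<^sup>2) powr (-m)"
      using c by (simp add: powr_mult powr_divide powr_minus field_simps)
    also have "((1 + r)\<^sup>2) powr (-m) = (1 + r) powr (- 2 * m)"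
      using r square_powr[of "1 + r" "-m"] by simp
    finally show ?thesis .
  qed
  define K where "K = A * (2 / min c 1) powr m"
  have K: "0 \<le> K" using A by (simp add: K_def)
  show ?thesis
    unfolding decay_def
  proof (intro conjI allI)
    fix z z' :: 'a
    have "norm (k ((norm z)\<^sup>2) *\<^sub>R z) \<le> A * norm z * (c + (norm z)\<^sup>2) powr (-m)"
      by (rule radial_field_norm[OF P])
    also have "\<dots> \<le> A * norm z * ((2 / min c 1) powr m * (1 + norm z) powr (- 2 * m))"
      using A by (intro mult_left_mono w) auto
    also have "\<dots> \<le> A * (1 + norm z) * ((2 / min c 1) powr m * (1 + norm z) powr (- 2 * m))"
      using A by (intro mult_right_mono mult_left_mono) auto
    also have "\<dots> = K * ((1 + norm z) * (1 + norm z) powr (- 2 * m))"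
      by (simp add: K_def mult_ac)
    also have "(1 + norm z) * (1 + norm z) powr (- 2 * m) = (1 + norm z) powr (-(2 * m - 1))"
      by (simp add: powr_mult_base add_nonneg_eq_0_iff)
    also have "K * \<dots> \<le> 4 * K * (1 + norm z) powr (-(2 * m - 1))"
      using K by (intro mult_right_mono) auto
    finally show "norm (k ((norm z)\<^sup>2) *\<^sub>R z) \<le> 4 * A * (2 / min c 1) powr m * (1 + norm z) powr - (2 * m - 1)"
      by (simp add: K_def mult.assoc)
    have "norm (k ((norm z)\<^sup>2) *\<^sub>R z - k ((norm z')\<^sup>2) *\<^sub>R z') \<le> 4 * A * norm (z - z') * (c + (min (norm z) (norm z'))\<^sup>2) powr (-m)"
      by (rule radial_field_diff[OF P c m])
    also have "\<dots> \<le> 4 * A * norm (z - z') * ((2 / min c 1) powr m * (1 + min (norm z) (norm z')) powr (- 2 * m))"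
      using A by (intro mult_left_mono w) auto
    finally show "norm (k ((norm z)\<^sup>2) *\<^sub>R z - k ((norm z')\<^sup>2) *\<^sub>R z') \<le>
       4 * A * (2 / min c 1) powr m * norm (z - z') * (1 + min (norm z) (norm z')) powr (- (2 * m - 1) - 1)"
      by (simp add: mult_ac)
  qed
qed

text \<open>Gaussians of all times t + \<epsilon> with the weight t^(b-1) of a Riesz potential of
  order 2 b. Starting the times at \<epsilon> smooths the homogeneous profile s^(-(N-b)) at the
  scale s = \<epsilon>.\<close>

definition mixed_gauss :: "real \<Rightarrow> real \<Rightarrow> real \<Rightarrow> real \<Rightarrow> real" where
  "mixed_gauss b N \<epsilon> s = (\<integral>t. indicator {0<..} t * (t powr (b - 1) * ((t + \<epsilon>) powr (-N) * exp (-(s / (t + \<epsilon>))))) \<partial>lborel)"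

lemma mixed_gauss_integrable:
  fixes b N :: real
  assumes b: "0 < b" "b < N" and \<epsilon>: "0 < \<epsilon>" and s: "0 \<le> s"
  shows "integrable lborel (\<lambda>t::real. indicator {0<..} t * (t powr (b - 1) * ((t + \<epsilon>) powr (-N) * exp (-(s / (t + \<epsilon>))))))"
proof (rule Bochner_Integration.integrable_bound[OF beta_scale(1)[OF b \<epsilon>]])
  show "AE t in lborel. norm (indicator {0<..} t * (t powr (b - 1) * ((t + \<epsilon>) powr (-N) * exp (-(s / (t + \<epsilon>))))))
     \<le> norm (indicator {0<..} t * (t powr (b - 1) * (\<epsilon> + t) powr (-N)))"
    using \<epsilon> s by (intro AE_I2) (auto simp: indicator_def add.commute mult_left_le intro!: mult_left_mono)
qed measurable

text \<open>Each Gaussian of time T is replaced by its bound (T + s)^(-N), whose constant is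
  independent of T. The remaining integral in t is a Beta integral at the scale \<epsilon> + s, so
  that \<epsilon> does not enter the constant.\<close>

lemma radial_profile_mixed_gauss:
  fixes b N :: real
  assumes b: "0 < b" "b < N"
  obtains C where "C > 0" "\<And>\<epsilon>. 0 < \<epsilon> \<Longrightarrow> radial_profile C \<epsilon> (N - b) (mixed_gauss b N \<epsilon>)"
proof -
  obtain C1 where C1: "C1 > 0" "\<And>T s. 0 < T \<Longrightarrow> 0 \<le> s \<Longrightarrow> T powr (-N) * exp (-(s/T)) \<le> C1 * (T + s) powr (-N)"
    using powr_exp_le[of N] by metis
  obtain C2 where C2: "C2 > 0" "\<And>T s. 0 < T \<Longrightarrow> 0 \<le> s \<Longrightarrow> T powr (-(N+1)) * exp (-(s/T)) \<le> C2 * (T + s) powr (-(N+1))"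
    using powr_exp_le[of "N+1"] by metis
  define C where "C = max (C1 * beta_const b N) (C2 * beta_const b (N+1))"
  have b1: "b < N + 1" using b by simp
  show thesis
  proof (rule that[of C])
    show "C > 0"
      using C1(1) beta_const_pos[OF b] by (simp add: C_def less_max_iff_disj)
    fix \<epsilon> :: real assume \<epsilon>: "0 < \<epsilon>"
    let ?f = "\<lambda>s t. indicator {0<..} t * (t powr (b - 1) * ((t + \<epsilon>) powr (-N) * exp (-(s / (t + \<epsilon>))))) :: real"
    note int = mixed_gauss_integrable[OF b \<epsilon>]
    have 1: "0 \<le> mixed_gauss b N \<epsilon> s" for s
      unfolding mixed_gauss_def using \<epsilon> by (intro integral_nonneg_AE AE_I2) (auto simp: indicator_def)
    have 2: "mixed_gauss b N \<epsilon> s \<le> C * (\<epsilon> + s) powr (-(N - b))" if s: "0 \<le> s" for s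
    proof -
      have e: "0 < \<epsilon> + s" using \<epsilon> s by simp
      have "mixed_gauss b N \<epsilon> s \<le> (\<integral>t. C1 * (indicator {0<..} t * (t powr (b - 1) * ((\<epsilon> + s) + t) powr (-N))) \<partial>lborel)"
        unfolding mixed_gauss_def
      proof (rule integral_mono[OF int[OF s]])
        show "integrable lborel (\<lambda>t::real. C1 * (indicator {0<..} t * (t powr (b - 1) * ((\<epsilon> + s) + t) powr (-N))))"
          by (intro integrable_mult_right beta_scale(1)[OF b e])
        fix t :: real
        show "?f s t \<le> C1 * (indicator {0<..} t * (t powr (b - 1) * ((\<epsilon> + s) + t) powr (-N)))"
        proof (cases "0 < t")
          case True
          then have "t powr (b - 1) * ((t + \<epsilon>) powr (-N) * exp (-(s / (t + \<epsilon>)))) \<le> t powr (b - 1) * (C1 * ((t + \<epsilon>) + s) powr (-N))"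
            using \<epsilon> s by (intro mult_left_mono C1(2)) auto
          with True show ?thesis
            by (simp add: algebra_simps)
        qed simp
      qed
      also have "\<dots> = C1 * beta_const b N * (\<epsilon> + s) powr (-(N - b))"
        using beta_scale(2)[OF b e] by simp
      also have "\<dots> \<le> C * (\<epsilon> + s) powr (-(N - b))"
        by (intro mult_right_mono) (auto simp: C_def)
      finally show ?thesis .
    qed
    have 3: "mixed_gauss b N \<epsilon> s' \<le> mixed_gauss b N \<epsilon> s" if s: "0 \<le> s" "s \<le> s'" for s s'
    proof -
      have s': "0 \<le> s'" using s by simp
      show ?thesis
        unfolding mixed_gauss_def
      proof (rule integral_mono[OF int[OF s'] int[OF s(1)]])
        show "?f s' t \<le> ?f s t" for t
        proof (cases "0 < t")
          case True
          then have "s / (t + \<epsilon>) \<le> s' / (t + \<epsilon>)"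
            using s \<epsilon> by (intro divide_right_mono) auto
          then have "exp (-(s' / (t + \<epsilon>))) \<le> exp (-(s / (t + \<epsilon>)))"
            by simp
          then show ?thesis
            by (intro mult_left_mono) auto
        qed simp
      qed
    qed
    have 4: "mixed_gauss b N \<epsilon> s - mixed_gauss b N \<epsilon> s' \<le> C * (s' - s) * (\<epsilon> + s) powr (-(N - b) - 1)" if s: "0 \<le> s" "s \<le> s'" for s s'
    proof -
      have s': "0 \<le> s'" using s by simp
      have e: "0 < \<epsilon> + s" using \<epsilon> s by simp
      have "mixed_gauss b N \<epsilon> s - mixed_gauss b N \<epsilon> s' = (\<integral>t. ?f s t - ?f s' t \<partial>lborel)"
        unfolding mixed_gauss_def using int[OF s(1)] int[OF s'] by simp
      also have "\<dots> \<le> (\<integral>t. (s' - s) * C2 * (indicator {0<..} t * (t powr (b - 1) * ((\<epsilon> + s) + t) powr (-(N+1)))) \<partial>lborel)"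
      proof (rule integral_mono[OF Bochner_Integration.integrable_diff[OF int[OF s(1)] int[OF s']]])
        show "integrable lborel (\<lambda>t::real. (s' - s) * C2 * (indicator {0<..} t * (t powr (b - 1) * ((\<epsilon> + s) + t) powr (-(N+1)))))"
          by (intro integrable_mult_right beta_scale(1)[OF b(1) b1 e])
        fix t :: real
        show "?f s t - ?f s' t \<le> (s' - s) * C2 * (indicator {0<..} t * (t powr (b - 1) * ((\<epsilon> + s) + t) powr (-(N+1))))"
        proof (cases "0 < t")
          case True
          define T where "T = t + \<epsilon>"
          have T: "T > 0" using True \<epsilon> by (simp add: T_def)
          have "exp (-(s/T)) - exp (-(s'/T)) \<le> (s'/T - s/T) * exp (-(s/T))"
            using s T by (intro exp_minus_diff_le divide_right_mono) auto
          then have "T powr (-N) * (exp (-(s/T)) - exp (-(s'/T))) \<le> T powr (-N) * ((s'/T - s/T) * exp (-(s/T)))"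
            by (intro mult_left_mono) auto
          also have "\<dots> = (s' - s) * (T powr (-(N+1)) * exp (-(s/T)))"
          proof -
            have "T powr (-(N+1)) = T powr (-N) / T"
            proof -
              have "T powr (-(N+1)) * T = T powr (-N)"
                using T powr_mult_base[of T "-(N+1)"] by (simp add: mult.commute)
              then show ?thesis using T by (simp add: field_simps)
            qed
            then show ?thesis
              by (simp add: diff_divide_distrib[symmetric])
          qed
          also have "\<dots> \<le> (s' - s) * (C2 * (T + s) powr (-(N+1)))"
            using s T by (intro mult_left_mono C2(2)) auto
          finally have "t powr (b - 1) * (T powr (-N) * (exp (-(s/T)) - exp (-(s'/T)))) \<le> t powr (b - 1) * ((s' - s) * (C2 * (T + s) powr (-(N+1))))"
            by (intro mult_left_mono) auto
          with True show ?thesis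
            unfolding T_def by (simp add: algebra_simps)
        qed simp
      qed
      also have "\<dots> = (s' - s) * C2 * (beta_const b (N+1) * (\<epsilon> + s) powr (-(N + 1 - b)))"
        using beta_scale(2)[OF b(1) b1 e] by simp
      also have "\<dots> = C2 * beta_const b (N+1) * ((s' - s) * (\<epsilon> + s) powr (-(N + 1 - b)))"
        by (simp only: mult_ac)
      also have "\<dots> \<le> C * ((s' - s) * (\<epsilon> + s) powr (-(N + 1 - b)))"
        using s by (intro mult_right_mono) (auto simp: C_def)
      finally show ?thesis
        by (simp add: algebra_simps)
    qed
    show "radial_profile C \<epsilon> (N - b) (mixed_gauss b N \<epsilon>)"
      unfolding radial_profile_def using 1 2 3 4 by blast
  qed
qed

lemma integral_half_line_FTC:
  fixes f F :: "real \<Rightarrow> real"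
  assumes F: "\<And>t. 0 \<le> t \<Longrightarrow> (F has_real_derivative f t) (at t)" and f: "\<And>t. 0 < t \<Longrightarrow> isCont f t"
    and int: "integrable lborel (\<lambda>t. indicator {0<..} t * f t)" and lim: "(F \<longlongrightarrow> 0) at_top"
  shows "(\<integral>t. indicator {0<..} t * f t \<partial>lborel) = - F 0"
proof -
  have ei: "einterval 0 \<infinity> = {0::real<..}"
    by (auto simp: einterval_def zero_ereal_def)
  have "(LBINT t=0..\<infinity>. f t) = 0 - F 0"
  proof (rule interval_integral_FTC_integrable)
    show "(F has_vector_derivative f t) (at t)" if "0 < ereal t" for t
      using that F[of t] by (simp add: has_real_derivative_iff_has_vector_derivative zero_ereal_def)
    show "isCont f t" if "0 < ereal t" for t
      using that f[of t] by (simp add: zero_ereal_def)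
    show "set_integrable lborel (einterval 0 \<infinity>) f"
      using int by (simp add: ei set_integrable_def)
    show "((F \<circ> real_of_ereal) \<longlongrightarrow> F 0) (at_right 0)"
    proof -
      have "isCont F 0"
        using F[of 0] by (intro DERIV_isCont) auto
      then have "(F \<longlongrightarrow> F 0) (at_right 0)"
        by (simp add: isCont_def filterlim_at_split)
      then show ?thesis
        by (simp add: zero_ereal_def ereal_tendsto_simps)
    qed
    show "((F \<circ> real_of_ereal) \<longlongrightarrow> 0) (at_left \<infinity>)"
      using lim by (simp add: ereal_tendsto_simps)
  qed (auto simp: zero_ereal_def)
  then show ?thesis
    by (simp add: interval_lebesgue_integral_def set_lebesgue_integral_def ei)
qed

section \<open>The regularised Riesz kernel and its divergence\<close>

text \<open>The exponent n/2 + 1 is that of the gradient of a heat kernel, and (1 + \<alpha>)/2 that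
  of a potential of order 1 + \<alpha>. Their difference (n - \<alpha> + 1)/2, together with the
  factor w, yields the size |w|^(\<alpha>-n).\<close>

definition riesz_kernel :: "real \<Rightarrow> real \<Rightarrow> 'a::euclidean_space \<Rightarrow> 'a" where
  "riesz_kernel \<alpha> \<epsilon> w = mixed_gauss ((1 + \<alpha>) / 2) (real DIM('a) / 2 + 1) \<epsilon> ((norm w)\<^sup>2) *\<^sub>R w"

lemma riesz_kernel_minus: "riesz_kernel \<alpha> \<epsilon> (- w) = - riesz_kernel \<alpha> \<epsilon> w"
  by (simp add: riesz_kernel_def)

context
  fixes \<alpha> :: real
  assumes \<alpha>: "0 < \<alpha>" "\<alpha> < 1"
begin

lemma riesz_kernel_profile:
  obtains C where "C > 0" "\<And>\<epsilon>. 0 < \<epsilon> \<Longrightarrow> radial_profile C \<epsilon> ((real DIM('a::euclidean_space) - \<alpha> + 1) / 2)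
     (mixed_gauss ((1 + \<alpha>) / 2) (real DIM('a) / 2 + 1) \<epsilon>)"
proof -
  have "(1 + \<alpha>) / 2 < real DIM('a) / 2 + 1" "0 < (1 + \<alpha>) / 2"
    using \<alpha> one_le_DIM[where 'a='a] by auto
  from radial_profile_mixed_gauss[OF this(2,1)] obtain C where
    "C > 0" "\<And>\<epsilon>. 0 < \<epsilon> \<Longrightarrow> radial_profile C \<epsilon> (real DIM('a) / 2 + 1 - (1 + \<alpha>) / 2)
     (mixed_gauss ((1 + \<alpha>) / 2) (real DIM('a) / 2 + 1) \<epsilon>)"
    by metis
  moreover have "real DIM('a) / 2 + 1 - (1 + \<alpha>) / 2 = (real DIM('a) - \<alpha> + 1) / 2"
    by (simp add: field_simps)
  ultimately show thesis
    using that by simp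
qed

lemma riesz_kernel_decay:
  assumes \<epsilon>: "0 < \<epsilon>"
  shows "\<exists>A. decay (real DIM('a::euclidean_space) - \<alpha>) A (riesz_kernel \<alpha> \<epsilon> :: 'a \<Rightarrow> 'a)"
proof -
  obtain C where C: "C > 0" "\<And>\<epsilon>. 0 < \<epsilon> \<Longrightarrow> radial_profile C \<epsilon> ((real DIM('a) - \<alpha> + 1) / 2)
     (mixed_gauss ((1 + \<alpha>) / 2) (real DIM('a) / 2 + 1) \<epsilon>)"
    using riesz_kernel_profile[where 'a='a] by metis
  have m: "0 \<le> (real DIM('a) - \<alpha> + 1) / 2"
    using \<alpha> one_le_DIM[where 'a='a] by simp
  have "2 * (y / 2) = y" for y :: real
    by simp
  then have "2 * ((real DIM('a) - \<alpha> + 1) / 2) - 1 = real DIM('a) - \<alpha>"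
    by (simp only:)
  with radial_field_decay[OF C(2)[OF \<epsilon>] \<epsilon> m, where 'a='a] show ?thesis
    unfolding riesz_kernel_def[abs_def] by metis
qed

lemma riesz_kernel_borel:
  assumes \<epsilon>: "0 < \<epsilon>"
  shows "(riesz_kernel \<alpha> \<epsilon> :: 'a::euclidean_space \<Rightarrow> 'a) \<in> borel_measurable borel"
proof -
  obtain A where "decay (real DIM('a) - \<alpha>) A (riesz_kernel \<alpha> \<epsilon> :: 'a \<Rightarrow> 'a)"
    using riesz_kernel_decay[OF \<epsilon>] by metis
  then show ?thesis
    using DIM_minus_alpha_pos[OF \<alpha>, where 'a='a] by (intro decay_borel) auto
qed

lemma riesz_kernel_bounds:
  "\<exists>C>0. \<forall>\<epsilon>>0. (\<forall>w::'a::euclidean_space. w \<noteq> 0 \<longrightarrow> norm (riesz_kernel \<alpha> \<epsilon> w) \<le> C * norm w powr (-(real DIM('a) - \<alpha>))) \<and>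
     (\<forall>w w'::'a. w \<noteq> 0 \<longrightarrow> w' \<noteq> 0 \<longrightarrow> norm (riesz_kernel \<alpha> \<epsilon> w - riesz_kernel \<alpha> \<epsilon> w') \<le>
       C * norm (w - w') * min (norm w) (norm w') powr (-(real DIM('a) - \<alpha> + 1)))"
proof -
  define m where "m = (real DIM('a) - \<alpha> + 1) / 2"
  have m: "0 \<le> m"
    using \<alpha> one_le_DIM[where 'a='a] by (simp add: m_def)
  have "2 * (y / 2) = y" for y :: real
    by simp
  then have m2: "2 * m = real DIM('a) - \<alpha> + 1"
    by (simp only: m_def)
  obtain C where C: "C > 0" "\<And>\<epsilon>. 0 < \<epsilon> \<Longrightarrow> radial_profile C \<epsilon> m
     (mixed_gauss ((1 + \<alpha>) / 2) (real DIM('a) / 2 + 1) \<epsilon>)"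
    using riesz_kernel_profile[where 'a='a] unfolding m_def by metis
  \<comment> \<open>Dropping \<epsilon> only enlarges a negative power; this makes the bounds
    uniform in \<epsilon>, at the price of excluding w = 0.\<close>
  have pw: "(\<epsilon> + r\<^sup>2) powr (-m) \<le> r powr (-(2 * m))" if "0 < r" "0 < \<epsilon>" for r \<epsilon> :: real
  proof -
    have "(\<epsilon> + r\<^sup>2) powr (-m) \<le> (r\<^sup>2) powr (-m)"
      using that m by (intro powr_mono2') auto
    then show ?thesis
      using square_powr[OF that(1), of "-m"] by simp
  qed
  show ?thesis
  proof (intro exI[of _ "4 * C"] conjI allI impI)
    fix \<epsilon> :: real assume \<epsilon>: "0 < \<epsilon>"
    fix w :: 'a assume w: "w \<noteq> 0"
    have "norm (riesz_kernel \<alpha> \<epsilon> w) \<le> C * norm w * (\<epsilon> + (norm w)\<^sup>2) powr (-m)"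
      unfolding riesz_kernel_def by (rule radial_field_norm[OF C(2)[OF \<epsilon>]])
    also have "\<dots> \<le> C * norm w * norm w powr (-(2 * m))"
      using C(1) w \<epsilon> by (intro mult_left_mono pw) auto
    also have "\<dots> = C * norm w powr (-(real DIM('a) - \<alpha>))"
    proof -
      have "1 + -(2 * m) = -(real DIM('a) - \<alpha>)"
        unfolding m2 by simp
      then have "norm w * norm w powr (-(2 * m)) = norm w powr (-(real DIM('a) - \<alpha>))"
        using w powr_mult_base[of "norm w" "-(2 * m)"] by simp
      then show ?thesis
        by (simp only: mult.assoc)
    qed
    also have "\<dots> \<le> 4 * C * norm w powr (-(real DIM('a) - \<alpha>))"
      using C(1) by (intro mult_right_mono) auto
    finally show "norm (riesz_kernel \<alpha> \<epsilon> w) \<le> 4 * C * norm w powr (-(real DIM('a) - \<alpha>))" .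
    fix w' :: 'a assume w': "w' \<noteq> 0"
    have "norm (riesz_kernel \<alpha> \<epsilon> w - riesz_kernel \<alpha> \<epsilon> w') \<le> 4 * C * norm (w - w') * (\<epsilon> + (min (norm w) (norm w'))\<^sup>2) powr (-m)"
      unfolding riesz_kernel_def by (rule radial_field_diff[OF C(2)[OF \<epsilon>] \<epsilon> m])
    also have "\<dots> \<le> 4 * C * norm (w - w') * min (norm w) (norm w') powr (-(2 * m))"
      using C(1) w w' \<epsilon> by (intro mult_left_mono pw) auto
    also note m2
    finally show "norm (riesz_kernel \<alpha> \<epsilon> w - riesz_kernel \<alpha> \<epsilon> w') \<le>
       4 * C * norm (w - w') * min (norm w) (norm w') powr (-(real DIM('a) - \<alpha> + 1))" .
  qed (use C in auto)
qed

text \<open>The time derivative of - S^(-n/2) exp(-X/S), in the form in which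
  \<open>gauss_pairing\<close> produces it for the identity map.\<close>

definition gauss_flux :: "real \<Rightarrow> real \<Rightarrow> real \<Rightarrow> real" where
  "gauss_flux n X S = S powr (-(n / 2 + 1)) * exp (-(X / S)) * (n / 2 - X / S)"

lemma gauss_flux_DERIV:
  assumes "0 < S"
  shows "((\<lambda>S. - (S powr (- n / 2) * exp (-(X / S)))) has_real_derivative gauss_flux n X S) (at S)"
proof -
  have "S powr (- n / 2 - 1) = S powr (-(n / 2 + 1))"
    by (rule arg_cong[where f = "\<lambda>e. S powr e"]) simp
  moreover have "S powr (- n / 2) = S * S powr (-(n / 2 + 1))"
    using assms by (simp add: powr_mult_base)
  ultimately show ?thesis
    using assms unfolding gauss_flux_def
    by (auto intro!: derivative_eq_intros simp: field_simps)
qed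

lemma gauss_flux_bound:
  assumes "0 < \<epsilon>" "\<epsilon> \<le> S" "0 \<le> X" "0 \<le> n"
  shows "\<bar>gauss_flux n X S\<bar> \<le> (n / 2 + X / \<epsilon>) * S powr (-(n / 2 + 1))"
proof -
  have "\<bar>n / 2 - X / S\<bar> \<le> n / 2 + X / S"
    using assms by (intro order_trans[OF abs_triangle_ineq4]) auto
  also have "\<dots> \<le> n / 2 + X / \<epsilon>"
    using assms by (intro add_left_mono divide_left_mono) auto
  finally have 1: "\<bar>n / 2 - X / S\<bar> \<le> n / 2 + X / \<epsilon>" .
  have 2: "exp (-(X / S)) \<le> 1"
    using assms by simp
  have "\<bar>gauss_flux n X S\<bar> = S powr (-(n / 2 + 1)) * (exp (-(X / S)) * \<bar>n / 2 - X / S\<bar>)"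
    by (simp add: gauss_flux_def abs_mult mult.assoc)
  also have "\<dots> \<le> S powr (-(n / 2 + 1)) * (1 * (n / 2 + X / \<epsilon>))"
    using 1 2 by (intro mult_left_mono mult_mono) auto
  finally show ?thesis
    by (simp add: mult.commute)
qed

text \<open>The integrand is a derivative in \<rho>, so only the value at \<rho> = 0 survives: the
  Gaussian at time \<epsilon>. The absolute bound keeps the factor 1 / c because c will be 1 + u
  with u ranging over a half line.\<close>

lemma gauss_flux_half_line:
  assumes \<epsilon>: "0 < \<epsilon>" and c: "1 \<le> c" and X: "0 \<le> X" and n: "1 \<le> n"
  shows "integrable lborel (\<lambda>\<rho>. indicator {0<..} \<rho> * gauss_flux n X (\<epsilon> + \<rho> * c))"
    and "(\<integral>\<rho>. indicator {0<..} \<rho> * gauss_flux n X (\<epsilon> + \<rho> * c) \<partial>lborel) = \<epsilon> powr (- n / 2) * exp (-(X / \<epsilon>)) / c"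
    and "(\<integral>\<rho>. \<bar>indicator {0<..} \<rho> * gauss_flux n X (\<epsilon> + \<rho> * c)\<bar> \<partial>lborel) \<le>
      (n / 2 + X / \<epsilon>) * beta_const 1 (n / 2 + 1) * \<epsilon> powr (- n / 2) / c"
proof -
  define N where "N = n / 2 + 1"
  have N: "1 < N" using n by (simp add: N_def)
  define D where "D = n / 2 + X / \<epsilon>"
  have D: "0 \<le> D" using n X \<epsilon> by (simp add: D_def)
  have ec: "0 < \<epsilon> / c" using \<epsilon> c by simp
  let ?g = "\<lambda>\<rho>. D * c powr (-N) * (indicator {0<..} \<rho> * (\<rho> powr (1 - 1) * (\<epsilon> / c + \<rho>) powr (-N)))"
  have g: "integrable lborel ?g"
    using beta_scale(1)[OF zero_less_one N ec] by (intro integrable_mult_right) simp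
  have bd: "\<bar>indicator {0<..} \<rho> * gauss_flux n X (\<epsilon> + \<rho> * c)\<bar> \<le> ?g \<rho>" for \<rho>
  proof (cases "0 < \<rho>")
    case True
    have "\<bar>gauss_flux n X (\<epsilon> + \<rho> * c)\<bar> \<le> D * (\<epsilon> + \<rho> * c) powr (-N)"
      unfolding D_def N_def using True \<epsilon> c X n by (intro gauss_flux_bound) auto
    also have "(\<epsilon> + \<rho> * c) powr (-N) = c powr (-N) * (\<epsilon> / c + \<rho>) powr (-N)"
    proof -
      have "\<epsilon> + \<rho> * c = c * (\<epsilon> / c + \<rho>)"
        using c by (simp add: field_simps)
      then show ?thesis
        by (simp only: powr_mult)
    qed
    finally show ?thesis
      using True by (simp add: mult.assoc)
  qed simp
  have meas: "(\<lambda>\<rho>. indicator {0<..} \<rho> * gauss_flux n X (\<epsilon> + \<rho> * c)) \<in> borel_measurable lborel"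
    unfolding gauss_flux_def by measurable
  show int: "integrable lborel (\<lambda>\<rho>. indicator {0<..} \<rho> * gauss_flux n X (\<epsilon> + \<rho> * c))"
    by (rule Bochner_Integration.integrable_bound[OF g meas])
       (use order_trans[OF bd abs_ge_self] in auto)
  have "(\<integral>\<rho>. \<bar>indicator {0<..} \<rho> * gauss_flux n X (\<epsilon> + \<rho> * c)\<bar> \<partial>lborel) \<le> (\<integral>\<rho>. ?g \<rho> \<partial>lborel)"
    by (intro integral_mono integrable_abs int g bd)
  also have "\<dots> = D * c powr (-N) * (beta_const 1 N * (\<epsilon> / c) powr (-(N - 1)))"
    using beta_scale(2)[OF zero_less_one N ec] unfolding integral_mult_right_zero by simp
  also have "(\<epsilon> / c) powr (-(N - 1)) = \<epsilon> powr (- n / 2) * c powr (N - 1)"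
    using \<epsilon> c by (simp add: N_def powr_divide powr_minus field_simps)
  also have "D * c powr (-N) * (beta_const 1 N * (\<epsilon> powr (- n / 2) * c powr (N - 1))) =
     D * beta_const 1 N * \<epsilon> powr (- n / 2) * (c powr (-N) * c powr (N - 1))"
    by (simp only: mult_ac)
  also have "c powr (-N) * c powr (N - 1) = 1 / c"
    using c unfolding powr_add[symmetric] by (simp add: powr_minus divide_inverse)
  finally show "(\<integral>\<rho>. \<bar>indicator {0<..} \<rho> * gauss_flux n X (\<epsilon> + \<rho> * c)\<bar> \<partial>lborel) \<le>
      (n / 2 + X / \<epsilon>) * beta_const 1 (n / 2 + 1) * \<epsilon> powr (- n / 2) / c"
    by (simp add: D_def N_def)
  define F where "F \<rho> = - ((\<epsilon> + \<rho> * c) powr (- n / 2) * exp (-(X / (\<epsilon> + \<rho> * c)))) / c" for \<rho>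
  have "(\<integral>\<rho>. indicator {0<..} \<rho> * gauss_flux n X (\<epsilon> + \<rho> * c) \<partial>lborel) = - F 0"
  proof (rule integral_half_line_FTC[OF _ _ int])
    show "(F has_real_derivative gauss_flux n X (\<epsilon> + \<rho> * c)) (at \<rho>)" if "0 \<le> \<rho>" for \<rho>
    proof -
      have pos: "0 < \<epsilon> + \<rho> * c" using that \<epsilon> c by (simp add: add_pos_nonneg)
      have "((\<lambda>\<rho>. \<epsilon> + \<rho> * c) has_real_derivative c) (at \<rho>)"
        by (auto intro!: derivative_eq_intros)
      from DERIV_chain2[OF gauss_flux_DERIV[OF pos, of n X] this]
      have "((\<lambda>\<rho>. - ((\<epsilon> + \<rho> * c) powr (- n / 2) * exp (-(X / (\<epsilon> + \<rho> * c)))) / c) has_real_derivative gauss_flux n X (\<epsilon> + \<rho> * c) * c / c) (at \<rho>)"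
        by (rule DERIV_cdivide)
      then show ?thesis
        unfolding F_def using c by simp
    qed
    show "isCont (\<lambda>\<rho>. gauss_flux n X (\<epsilon> + \<rho> * c)) \<rho>" if "0 < \<rho>" for \<rho>
    proof -
      have "0 < \<epsilon> + \<rho> * c" using that \<epsilon> c by (simp add: add_pos_nonneg)
      then show ?thesis
        unfolding gauss_flux_def by (intro continuous_intros) auto
    qed
    show "(F \<longlongrightarrow> 0) at_top"
    proof (rule Lim_null_comparison)
      have "filterlim (\<lambda>\<rho>. \<epsilon> + \<rho> * c) at_top at_top"
        using c by (intro filterlim_tendsto_add_at_top[OF tendsto_const] filterlim_at_top_mult_tendsto_pos[OF tendsto_const] filterlim_ident) auto
      then have "((\<lambda>\<rho>. (\<epsilon> + \<rho> * c) powr (- n / 2)) \<longlongrightarrow> 0) at_top"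
        using n by (intro tendsto_neg_powr) auto
      then show "((\<lambda>\<rho>. (\<epsilon> + \<rho> * c) powr (- n / 2)) \<longlongrightarrow> 0) at_top" .
      show "\<forall>\<^sub>F \<rho> in at_top. norm (F \<rho>) \<le> (\<epsilon> + \<rho> * c) powr (- n / 2)"
        using eventually_gt_at_top[of 0]
      proof eventually_elim
        case (elim \<rho>)
        have pos: "0 < \<epsilon> + \<rho> * c" using elim \<epsilon> c by (simp add: add_pos_nonneg)
        define P E where "P = (\<epsilon> + \<rho> * c) powr (- n / 2)" and "E = exp (-(X / (\<epsilon> + \<rho> * c)))"
        have "0 \<le> P" "0 \<le> E" "E \<le> 1"
          using X pos by (auto simp: P_def E_def)
        then have "P * E \<le> P"
          by (simp add: mult_left_le)
        also have "P \<le> P * c"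
          using c \<open>0 \<le> P\<close> by (simp add: mult_le_cancel_left1)
        finally have "P * E / c \<le> P"
          using c by (simp add: field_simps)
        moreover have "norm (F \<rho>) = P * E / c"
          using c by (simp add: F_def P_def E_def abs_mult)
        ultimately show ?case
          by (simp add: P_def)
      qed
    qed
  qed
  then show "(\<integral>\<rho>. indicator {0<..} \<rho> * gauss_flux n X (\<epsilon> + \<rho> * c) \<partial>lborel) = \<epsilon> powr (- n / 2) * exp (-(X / \<epsilon>)) / c"
    by (simp add: F_def)
qed

text \<open>With T = t + \<epsilon>, the weight T^(-N) of the mixture cancels the factor T^N coming
  from \<open>gauss_pairing\<close>. This is what fixes N = n/2 + 1, and it leaves the flux at time
  \<epsilon> + \<rho> + t.\<close>

lemma riesz_kernel_gauss_pairing: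
  fixes x :: "'a::euclidean_space"
  assumes \<epsilon>: "0 < \<epsilon>" and \<rho>: "0 < \<rho>"
  defines "n \<equiv> real DIM('a)" and "b \<equiv> (1 + \<alpha>) / 2"
  shows "(\<integral>w. (w \<bullet> riesz_kernel \<alpha> \<epsilon> (x + w)) * exp (-((norm w)\<^sup>2 / \<rho>)) \<partial>lborel) =
    gauss_total TYPE('a) * \<rho> powr (n / 2 + 1) *
      (\<integral>t. indicator {0<..} t * (t powr (b - 1) * gauss_flux n ((norm x)\<^sup>2) (\<epsilon> + \<rho> + t)) \<partial>lborel)"
proof -
  define N where "N = n / 2 + 1"
  have n: "1 \<le> n" using one_le_DIM[where 'a='a] by (simp add: n_def)
  have b: "0 < b" "b < N" using \<alpha> n by (auto simp: b_def N_def)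
  define k where "k w t = indicator {0<..} t * (t powr (b - 1) * ((t + \<epsilon>) powr (-N) * exp (-((norm (x + w))\<^sup>2 / (t + \<epsilon>)))))" for w :: 'a and t :: real
  have [measurable]: "case_prod k \<in> borel_measurable (borel \<Otimes>\<^sub>M borel)"
    unfolding k_def by measurable
  have k0: "0 \<le> k w t" for w t
    by (simp add: k_def)
  have ki: "integrable lborel (k w)" for w
    unfolding k_def by (rule mixed_gauss_integrable[OF b \<epsilon>]) simp
  have kI: "(\<integral>t. k w t \<partial>lborel) = mixed_gauss b N \<epsilon> ((norm (x + w))\<^sup>2)" for w
    by (simp add: k_def mixed_gauss_def)
  define Q where "Q w = (w \<bullet> (x + w)) * exp (-((norm w)\<^sup>2 / \<rho>))" for w
  have [measurable]: "Q \<in> borel_measurable borel"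
    unfolding Q_def by measurable
  define H where "H w t = Q w * k w t" for w t
  have [measurable]: "case_prod H \<in> borel_measurable (borel \<Otimes>\<^sub>M borel)"
    unfolding H_def by measurable
  have Qi: "integrable lborel Q"
  proof -
    have "\<bar>w \<bullet> (x + w)\<bar> \<le> (1 + norm x) * (1 + norm w) powr 2" for w
    proof -
      have "\<bar>w \<bullet> (x + w)\<bar> \<le> norm w * norm (x + w)"
        by (rule Cauchy_Schwarz_ineq2)
      also have "\<dots> \<le> (1 + norm w) * ((1 + norm x) * (1 + norm w))"
      proof (intro mult_mono)
        have "norm (x + w) \<le> norm x + norm w"
          by (rule norm_triangle_ineq)
        also have "\<dots> \<le> (1 + norm x) * (1 + norm w)"
          by (simp add: algebra_simps)
        finally show "norm (x + w) \<le> (1 + norm x) * (1 + norm w)" .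
      qed auto
      finally show ?thesis
        by (simp add: power2_eq_square mult_ac)
    qed
    then show ?thesis
      unfolding Q_def using integrable_gauss_times[of "\<lambda>w. w \<bullet> (x + w)" "1 + norm x" 2 "1 / \<rho>"] \<rho> by simp
  qed
  obtain C where C: "C > 0" "\<And>\<epsilon>. 0 < \<epsilon> \<Longrightarrow> radial_profile C \<epsilon> (N - b) (mixed_gauss b N \<epsilon>)"
    using radial_profile_mixed_gauss[OF b] by metis
  define M where "M = mixed_gauss b N \<epsilon> 0"
  have M: "0 \<le> mixed_gauss b N \<epsilon> s \<and> mixed_gauss b N \<epsilon> s \<le> M" if "0 \<le> s" for s
    using C(2)[OF \<epsilon>] that by (auto simp: radial_profile_def M_def)
  have int: "integrable (lborel \<Otimes>\<^sub>M lborel) (case_prod H)"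
  proof (rule lborel_pair.Fubini_integrable)
    have eq: "(\<integral>t. norm (case_prod H (w, t)) \<partial>lborel) = \<bar>Q w\<bar> * mixed_gauss b N \<epsilon> ((norm (x + w))\<^sup>2)" for w
      using k0 by (simp add: H_def abs_mult kI)
    show "integrable lborel (\<lambda>w. \<integral>t. norm (case_prod H (w, t)) \<partial>lborel)"
    proof (rule Bochner_Integration.integrable_bound)
      show "integrable lborel (\<lambda>w. M * Q w)"
        by (intro integrable_mult_right Qi)
      have "norm (\<integral>t. norm (case_prod H (w, t)) \<partial>lborel) \<le> norm (M * Q w)" for w
      proof -
        have "\<bar>Q w\<bar> * mixed_gauss b N \<epsilon> ((norm (x + w))\<^sup>2) \<le> \<bar>Q w\<bar> * M"
          using M[of "(norm (x + w))\<^sup>2"] by (intro mult_left_mono) auto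
        then show ?thesis
          unfolding eq using M[of "(norm (x + w))\<^sup>2"] M[of 0] by (simp add: abs_mult mult.commute)
      qed
      then show "AE w in lborel. norm (\<integral>t. norm (case_prod H (w, t)) \<partial>lborel) \<le> norm (M * Q w)"
        by auto
    qed measurable
    show "AE w in lborel. integrable lborel (\<lambda>t. case_prod H (w, t))"
      by (simp add: H_def ki)
  qed measurable
  have "(\<integral>w. (w \<bullet> riesz_kernel \<alpha> \<epsilon> (x + w)) * exp (-((norm w)\<^sup>2 / \<rho>)) \<partial>lborel) = (\<integral>w. (\<integral>t. H w t \<partial>lborel) \<partial>lborel)"
    unfolding H_def integral_mult_right_zero kI
    by (intro Bochner_Integration.integral_cong) (auto simp: Q_def riesz_kernel_def b_def N_def n_def)
  also have "\<dots> = (\<integral>t. (\<integral>w. H w t \<partial>lborel) \<partial>lborel)"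
    using lborel_pair.Fubini_integral[of H] int by simp
  also have "\<dots> = (\<integral>t. gauss_total TYPE('a) * \<rho> powr N * (indicator {0<..} t * (t powr (b - 1) * gauss_flux n ((norm x)\<^sup>2) (\<epsilon> + \<rho> + t))) \<partial>lborel)"
  proof (intro Bochner_Integration.integral_cong refl)
    fix t :: real
    show "(\<integral>w. H w t \<partial>lborel) = gauss_total TYPE('a) * \<rho> powr N * (indicator {0<..} t * (t powr (b - 1) * gauss_flux n ((norm x)\<^sup>2) (\<epsilon> + \<rho> + t)))"
    proof (cases "0 < t")
      case True
      define T where "T = t + \<epsilon>"
      have T: "0 < T" using True \<epsilon> by (simp add: T_def)
      define S where "S = T + \<rho>"
      have S: "0 < S" using T \<rho> by (simp add: S_def)
      have "(\<integral>w. H w t \<partial>lborel) = (\<integral>w. t powr (b - 1) * T powr (-N) * ((w \<bullet> (x + w)) * exp (-((norm (x + w))\<^sup>2 / T)) * exp (-((norm w)\<^sup>2 / \<rho>))) \<partial>lborel)"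
        using True by (intro Bochner_Integration.integral_cong) (auto simp: H_def Q_def k_def T_def)
      also have "\<dots> = t powr (b - 1) * T powr (-N) * ((T * \<rho> / S) powr N * exp (-((norm x)\<^sup>2 / S)) *
          (n / 2 * gauss_total TYPE('a) - (x \<bullet> x) * gauss_total TYPE('a) / S))"
        unfolding integral_mult_right_zero
        using gauss_pairing[OF bounded_linear_ident T \<rho>, of x] gauss_second_moment[where 'a='a]
        by (simp add: S_def N_def n_def power2_norm_eq_inner)
      also have "(T * \<rho> / S) powr N = T powr N * \<rho> powr N * S powr (-N)"
        using T \<rho> S by (simp add: powr_mult powr_divide powr_minus field_simps)
      also have "t powr (b - 1) * T powr (-N) * (T powr N * \<rho> powr N * S powr (-N) * exp (-((norm x)\<^sup>2 / S)) *
          (n / 2 * gauss_total TYPE('a) - (x \<bullet> x) * gauss_total TYPE('a) / S)) =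
          (T powr (-N) * T powr N) * (gauss_total TYPE('a) * \<rho> powr N * (t powr (b - 1) * (S powr (-N) * exp (-((norm x)\<^sup>2 / S)) * (n / 2 - (norm x)\<^sup>2 / S))))"
        by (simp add: power2_norm_eq_inner algebra_simps)
      also have "T powr (-N) * T powr N = 1"
        using T unfolding powr_add[symmetric] by simp
      finally show ?thesis
        using True by (simp add: gauss_flux_def N_def S_def T_def add_ac)
    qed (simp add: H_def k_def)
  qed
  finally show ?thesis
    by (simp add: N_def)
qed

text \<open>After the substitution t = \<rho> u all powers of \<rho> cancel, so the integral over
  \<rho> is the one of \<open>gauss_flux_half_line\<close> with c = 1 + u. The remaining integral of
  u^(b-1) / (1 + u) is a Beta constant and depends neither on x nor on \<epsilon>.\<close>

lemma fdiv_riesz_kernel: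
  "\<exists>\<kappa>>0. \<forall>\<epsilon>>0. \<forall>x::'a::euclidean_space. fdiv \<alpha> (riesz_kernel \<alpha> \<epsilon>) x = \<kappa> * (\<epsilon> powr (- real DIM('a) / 2) * exp (-((norm x)\<^sup>2 / \<epsilon>)))"
proof -
  define n q b where "n = real DIM('a)" and "q = (real DIM('a) + \<alpha> + 1) / 2" and "b = (1 + \<alpha>) / 2"
  have n: "1 \<le> n" using one_le_DIM[where 'a='a] by (simp add: n_def)
  have b: "0 < b" "b < 1" using \<alpha> by (auto simp: b_def)
  have q: "0 < q" using \<alpha> by (simp add: q_def add_nonneg_pos)
  have cq: "0 < subord_const q" by (rule subord_const_pos[OF q])
  define G where "G = gauss_total TYPE('a)"
  have G: "0 < G" unfolding G_def by (rule gauss_total_pos)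
  show ?thesis
  proof (intro exI[of _ "G * beta_const b 1 / subord_const q"] conjI allI impI)
    show "0 < G * beta_const b 1 / subord_const q"
      using G cq beta_const_pos[OF b] by simp
    fix \<epsilon> :: real and x :: 'a assume \<epsilon>: "0 < \<epsilon>"
    define X where "X = (norm x)\<^sup>2"
    have X: "0 \<le> X" by (simp add: X_def)
    define H where "H u \<rho> = indicator {0<..} u * u powr (b - 1) * (indicator {0<..} \<rho> * gauss_flux n X (\<epsilon> + \<rho> * (1 + u)))" for u \<rho> :: real
    have [measurable]: "case_prod H \<in> borel_measurable (borel \<Otimes>\<^sub>M borel)"
      unfolding H_def gauss_flux_def by measurable
    obtain A where d: "decay (real DIM('a) - \<alpha>) A (riesz_kernel \<alpha> \<epsilon> :: 'a \<Rightarrow> 'a)"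
      using riesz_kernel_decay[OF \<epsilon>] by metis
    have "subord_const q * fdiv \<alpha> (riesz_kernel \<alpha> \<epsilon>) x = (\<integral>\<rho>. indicator {0<..} \<rho> * (\<rho> powr (-(q + 1)) *
       (\<integral>w. (w \<bullet> riesz_kernel \<alpha> \<epsilon> (x + w)) * exp (-((norm w)\<^sup>2 / \<rho>)) \<partial>lborel)) \<partial>lborel)"
      unfolding q_def by (rule fdiv_subordination[OF \<alpha> d])
    also have "\<dots> = (\<integral>\<rho>. G * (\<integral>u. H u \<rho> \<partial>lborel) \<partial>lborel)"
    proof (intro Bochner_Integration.integral_cong refl)
      fix \<rho> :: real
      show "indicator {0<..} \<rho> * (\<rho> powr (-(q + 1)) * (\<integral>w. (w \<bullet> riesz_kernel \<alpha> \<epsilon> (x + w)) * exp (-((norm w)\<^sup>2 / \<rho>)) \<partial>lborel))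
        = G * (\<integral>u. H u \<rho> \<partial>lborel)"
      proof (cases "0 < \<rho>")
        case True
        have "(\<integral>t. indicator {0<..} t * (t powr (b - 1) * gauss_flux n X (\<epsilon> + \<rho> + t)) \<partial>lborel) =
           \<bar>\<rho>\<bar> ^ DIM(real) *\<^sub>R (\<integral>u. indicator {0<..} (0 + \<rho> *\<^sub>R u) * ((0 + \<rho> *\<^sub>R u) powr (b - 1) * gauss_flux n X (\<epsilon> + \<rho> + (0 + \<rho> *\<^sub>R u))) \<partial>lborel)"
          using True unfolding gauss_flux_def by (intro integral_lborel_affine) (auto, measurable)
        also have "\<dots> = \<rho> * (\<integral>u. \<rho> powr (b - 1) * H u \<rho> \<partial>lborel)"
        proof -
          have "indicator {0<..} (0 + \<rho> *\<^sub>R u) * ((0 + \<rho> *\<^sub>R u) powr (b - 1) * gauss_flux n X (\<epsilon> + \<rho> + (0 + \<rho> *\<^sub>R u))) = \<rho> powr (b - 1) * H u \<rho>" for u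
            using True by (auto simp: H_def indicator_def zero_less_mult_iff powr_mult algebra_simps)
          then show ?thesis
            using True by simp
        qed
        also have "\<dots> = \<rho> powr b * (\<integral>u. H u \<rho> \<partial>lborel)"
          using True powr_mult_base[of \<rho> "b - 1"] by (simp add: mult.assoc[symmetric])
        finally have I: "(\<integral>t. indicator {0<..} t * (t powr (b - 1) * gauss_flux n X (\<epsilon> + \<rho> + t)) \<partial>lborel) = \<rho> powr b * (\<integral>u. H u \<rho> \<partial>lborel)" .
        have "\<rho> powr (-(q + 1)) * (\<integral>w. (w \<bullet> riesz_kernel \<alpha> \<epsilon> (x + w)) * exp (-((norm w)\<^sup>2 / \<rho>)) \<partial>lborel) =
          \<rho> powr (-(q + 1)) * (G * \<rho> powr (n / 2 + 1) * (\<rho> powr b * (\<integral>u. H u \<rho> \<partial>lborel)))"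
          using riesz_kernel_gauss_pairing[OF \<epsilon> True, of x] unfolding I[symmetric] by (simp add: G_def n_def b_def X_def)
        also have "\<dots> = (\<rho> powr (-(q + 1)) * \<rho> powr (n / 2 + 1) * \<rho> powr b) * (G * (\<integral>u. H u \<rho> \<partial>lborel))"
          by (simp only: mult_ac)
        also have "\<rho> powr (-(q + 1)) * \<rho> powr (n / 2 + 1) * \<rho> powr b = 1"
        proof -
          \<comment> \<open>This balance determines b = (1 + \<alpha>) / 2.\<close>
          have "-(q + 1) + (n / 2 + 1) + b = 0"
            by (simp add: q_def n_def b_def field_simps)
          then show ?thesis
            using True unfolding powr_add[symmetric] by simp
        qed
        finally show ?thesis
          using True by simp
      qed (simp add: H_def)
    qed
    also have "\<dots> = G * (\<integral>\<rho>. (\<integral>u. H u \<rho> \<partial>lborel) \<partial>lborel)"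
      by simp
    also have "(\<integral>\<rho>. (\<integral>u. H u \<rho> \<partial>lborel) \<partial>lborel) = (\<integral>u. (\<integral>\<rho>. H u \<rho> \<partial>lborel) \<partial>lborel)"
    proof -
      \<comment> \<open>The absolute integral over \<rho> is at most B / (1 + u); the factor u^(b-1)
        / (1 + u) that remains is integrable because 0 < b < 1.\<close>
      define B where "B = (n / 2 + X / \<epsilon>) * beta_const 1 (n / 2 + 1) * \<epsilon> powr (- n / 2)"
      have "integrable (lborel \<Otimes>\<^sub>M lborel) (case_prod H)"
      proof (rule lborel_pair.Fubini_integrable)
        show "integrable lborel (\<lambda>u. \<integral>\<rho>. norm (case_prod H (u, \<rho>)) \<partial>lborel)"
        proof (rule Bochner_Integration.integrable_bound)
          show "integrable lborel (\<lambda>u. B * (indicator {0<..} u * (u powr (b - 1) * (1 + u) powr (-1))))"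
            by (intro integrable_mult_right beta_integrable b)
          have "norm (\<integral>\<rho>. norm (case_prod H (u, \<rho>)) \<partial>lborel) \<le> norm (B * (indicator {0<..} u * (u powr (b - 1) * (1 + u) powr (-1))))" for u
          proof (cases "0 < u")
            case True
            have "(\<integral>\<rho>. norm (case_prod H (u, \<rho>)) \<partial>lborel) = u powr (b - 1) * (\<integral>\<rho>. \<bar>indicator {0<..} \<rho> * gauss_flux n X (\<epsilon> + \<rho> * (1 + u))\<bar> \<partial>lborel)"
              using True by (simp add: H_def abs_mult)
            also have "\<dots> \<le> u powr (b - 1) * (B / (1 + u))"
              unfolding B_def using True by (intro mult_left_mono gauss_flux_half_line(3) \<epsilon> X n) auto
            also have "\<dots> = B * (u powr (b - 1) * (1 + u) powr (-1))"
              using True by (simp add: powr_minus_divide)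
            also have "\<dots> \<le> norm (B * (indicator {0<..} u * (u powr (b - 1) * (1 + u) powr (-1))))"
            proof -
              have "indicator {0<..} u = (1::real)"
                using True by simp
              then show ?thesis
                by (simp only: mult_1 real_norm_def abs_ge_self)
            qed
            finally show ?thesis
              by simp
          qed (simp add: H_def)
          then show "AE u in lborel. norm (\<integral>\<rho>. norm (case_prod H (u, \<rho>)) \<partial>lborel) \<le> norm (B * (indicator {0<..} u * (u powr (b - 1) * (1 + u) powr (-1))))"
            by auto
        qed measurable
        have "integrable lborel (\<lambda>\<rho>. case_prod H (u, \<rho>))" for u
        proof (cases "0 < u")
          case True
          then show ?thesis
            using gauss_flux_half_line(1)[OF \<epsilon> _ X n, of "1 + u"] by (simp add: H_def)
        qed (simp add: H_def)
        then show "AE u in lborel. integrable lborel (\<lambda>\<rho>. case_prod H (u, \<rho>))"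
          by simp
      qed measurable
      then show ?thesis
        using lborel_pair.Fubini_integral[of H] by simp
    qed
    also have "\<dots> = (\<integral>u. \<epsilon> powr (- n / 2) * exp (-(X / \<epsilon>)) * (indicator {0<..} u * (u powr (b - 1) * (1 + u) powr (-1))) \<partial>lborel)"
    proof (intro Bochner_Integration.integral_cong refl)
      fix u :: real
      show "(\<integral>\<rho>. H u \<rho> \<partial>lborel) = \<epsilon> powr (- n / 2) * exp (-(X / \<epsilon>)) * (indicator {0<..} u * (u powr (b - 1) * (1 + u) powr (-1)))"
      proof (cases "0 < u")
        case True
        then show ?thesis
          using gauss_flux_half_line(2)[OF \<epsilon> _ X n, of "1 + u"] by (simp add: H_def powr_minus_divide)
      qed (simp add: H_def)
    qed
    also have "\<dots> = \<epsilon> powr (- n / 2) * exp (-(X / \<epsilon>)) * beta_const b 1"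
      unfolding beta_const_def by (rule integral_mult_right_zero)
    finally show "fdiv \<alpha> (riesz_kernel \<alpha> \<epsilon>) x = G * beta_const b 1 / subord_const q * (\<epsilon> powr (- real DIM('a) / 2) * exp (-((norm x)\<^sup>2 / \<epsilon>)))"
      using cq by (simp add: n_def X_def field_simps)
  qed
qed

end

context
  fixes \<alpha> :: real
  assumes \<alpha>: "0 < \<alpha>" "\<alpha> < 1"
begin

subsection \<open>Bounded fields with prescribed divergence\<close>

text \<open>The product |y|^(-\<alpha>) |y|^(\<alpha>-n) is borderline at 0 and at infinity. A gain
  |z| / |y| for large y and |y| / |z| for small y makes it integrable, and the singularities at z
  and - z are integrable already. Every term is homogeneous of degree -n in (y, z), so its integral
  does not depend on |z|.\<close>

lemma weighted_kernel_bound: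
  "\<exists>B\<ge>0. \<forall>z::'a::euclidean_space. z \<noteq> 0 \<longrightarrow> (\<exists>g. integrable lborel g \<and> (\<integral>y. g y \<partial>lborel) \<le> B \<and> (\<forall>y. 0 \<le> g y) \<and>
     (\<forall>y. y \<noteq> 0 \<longrightarrow> 2 * norm z \<le> norm y \<longrightarrow> norm y powr (-\<alpha>) * (norm z * norm y powr (-(real DIM('a) - \<alpha> + 1))) \<le> g y) \<and>
     (\<forall>y. y \<noteq> 0 \<longrightarrow> y \<noteq> z \<longrightarrow> y \<noteq> - z \<longrightarrow> norm y < 2 * norm z \<longrightarrow>
        norm y powr (-\<alpha>) * (norm y powr (-(real DIM('a) - \<alpha>)) * (norm y / norm z) +
          norm (z - y) powr (-(real DIM('a) - \<alpha>)) + norm (z + y) powr (-(real DIM('a) - \<alpha>))) \<le> g y))"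
proof -
  define n where "n = real DIM('a)"
  define s where "s = n - \<alpha>"
  have n: "1 \<le> n" using one_le_DIM[where 'a='a] by (simp add: n_def)
  have s: "0 < s" "s < n" using n \<alpha> by (auto simp: s_def)
  obtain C1 where C1: "C1 \<ge> 0"
    "\<And>r. r > 0 \<Longrightarrow> integrable (lborel::'a measure) (\<lambda>w. norm w powr (-(n+1)) * indicator (- ball 0 r) w)"
    "\<And>r. r > 0 \<Longrightarrow> (\<integral>w. norm w powr (-(n+1)) * indicator (- ball 0 r) w \<partial>(lborel::'a measure)) = C1 * r powr (n - (n+1))"
    using norm_powr_compl_ball[where 'a='a, of "n+1"] unfolding n_def by auto
  obtain C2 where C2: "C2 \<ge> 0"
    "\<And>r. r > 0 \<Longrightarrow> integrable (lborel::'a measure) (\<lambda>w. norm w powr (-(n-1)) * indicator (ball 0 r) w)"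
    "\<And>r. r > 0 \<Longrightarrow> (\<integral>w. norm w powr (-(n-1)) * indicator (ball 0 r) w \<partial>(lborel::'a measure)) = C2 * r powr (n - (n-1))"
    using norm_powr_ball[where 'a='a, of "n-1"] unfolding n_def by auto
  obtain C3 where C3: "C3 \<ge> 0"
    "\<And>r. r > 0 \<Longrightarrow> integrable (lborel::'a measure) (\<lambda>w. norm w powr (-\<alpha>) * indicator (ball 0 r) w)"
    "\<And>r. r > 0 \<Longrightarrow> (\<integral>w. norm w powr (-\<alpha>) * indicator (ball 0 r) w \<partial>(lborel::'a measure)) = C3 * r powr (n - \<alpha>)"
    using norm_powr_ball[where 'a='a, of "\<alpha>"] \<alpha> n unfolding n_def by auto
  obtain C4 where C4: "C4 \<ge> 0"
    "\<And>r. r > 0 \<Longrightarrow> integrable (lborel::'a measure) (\<lambda>w. norm w powr (-s) * indicator (ball 0 r) w)"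
    "\<And>r. r > 0 \<Longrightarrow> (\<integral>w. norm w powr (-s) * indicator (ball 0 r) w \<partial>(lborel::'a measure)) = C4 * r powr (n - s)"
    using norm_powr_ball[where 'a='a, of s] s unfolding n_def by auto
  define B where "B = C1 / 2 + 2 * C2 + (2 * (2 powr s * (C3 * 2 powr s)) + 2 * (2 powr \<alpha> * (C4 * 3 powr \<alpha>)))"
  show ?thesis
    unfolding n_def[symmetric] s_def[symmetric]
  proof (intro exI[of _ B] conjI allI impI)
    show "B \<ge> 0"
      using C1(1) C2(1) C3(1) C4(1) by (simp add: B_def)
    fix z :: 'a assume z: "z \<noteq> 0"
    define r where "r = norm z"
    have r: "r > 0" using z by (simp add: r_def)
    have r2: "2 * r > 0" "3 * r > 0" using r by auto
    define g1 where "g1 y = r * (norm y powr (-(n+1)) * indicator (- ball 0 (2*r)) y)" for y :: 'a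
    define g2 where "g2 y = (1/r) * (norm y powr (-(n-1)) * indicator (ball 0 (2*r)) y)" for y :: 'a
    define g3 where "g3 y = (r/2) powr (-s) * (norm y powr (-\<alpha>) * indicator (ball 0 (2*r)) y)" for y :: 'a
    define g0 where "g0 w = norm w powr (-s) * indicator (ball 0 (3*r)) w" for w :: 'a
    define g where "g y = g1 y + g2 y + (2 * g3 y + ((r/2) powr (-\<alpha>) * g0 (z - y) + (r/2) powr (-\<alpha>) * g0 (z + y)))" for y
    have hb1: "has_bochner_integral lborel g1 (r * (C1 * (2*r) powr (n - (n+1))))"
      unfolding g1_def using has_bochner_integral_integrable[OF C1(2)[OF r2(1)]] unfolding C1(3)[OF r2(1)]
      by (rule has_bochner_integral_mult_right)
    have hb2: "has_bochner_integral lborel g2 ((1/r) * (C2 * (2*r) powr (n - (n-1))))"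
      unfolding g2_def using has_bochner_integral_integrable[OF C2(2)[OF r2(1)]] unfolding C2(3)[OF r2(1)]
      by (rule has_bochner_integral_mult_right)
    have hb3: "has_bochner_integral lborel g3 ((r/2) powr (-s) * (C3 * (2*r) powr (n - \<alpha>)))"
      unfolding g3_def using has_bochner_integral_integrable[OF C3(2)[OF r2(1)]] unfolding C3(3)[OF r2(1)]
      by (rule has_bochner_integral_mult_right)
    have g0i: "integrable lborel g0" and g0I: "(\<integral>w. g0 w \<partial>lborel) = C4 * (3*r) powr (n - s)"
      unfolding g0_def using C4(2,3)[OF r2(2)] by auto
    have g0m: "g0 \<in> borel_measurable borel"
      using borel_measurable_integrable[OF g0i] by simp
    have hb4: "has_bochner_integral lborel (\<lambda>y. (r/2) powr (-\<alpha>) * g0 (z - y)) ((r/2) powr (-\<alpha>) * (C4 * (3*r) powr (n - s)))"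
      using has_bochner_integral_integrable[OF integrable_lborel_shift(2)[OF g0i, of z]]
      unfolding integral_lborel_shift(2)[OF g0m] g0I by (rule has_bochner_integral_mult_right)
    have hb5: "has_bochner_integral lborel (\<lambda>y. (r/2) powr (-\<alpha>) * g0 (z + y)) ((r/2) powr (-\<alpha>) * (C4 * (3*r) powr (n - s)))"
      using has_bochner_integral_integrable[OF integrable_lborel_shift(1)[OF g0i, of z]]
      unfolding integral_lborel_shift(1)[OF g0m] g0I by (rule has_bochner_integral_mult_right)
    have hb: "has_bochner_integral lborel g (r * (C1 * (2*r) powr (n - (n+1))) + (1/r) * (C2 * (2*r) powr (n - (n-1))) +
       (2 * ((r/2) powr (-s) * (C3 * (2*r) powr (n - \<alpha>))) + ((r/2) powr (-\<alpha>) * (C4 * (3*r) powr (n - s)) + (r/2) powr (-\<alpha>) * (C4 * (3*r) powr (n - s)))))"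
      unfolding g_def by (intro has_bochner_integral_add has_bochner_integral_mult_right hb1 hb2 hb3 hb4 hb5)
    have e1: "r * (C1 * (2*r) powr (n - (n+1))) = C1 / 2"
      using r by (simp add: powr_minus_divide)
    have e2: "(1/r) * (C2 * (2*r) powr (n - (n-1))) = 2 * C2"
      using r by simp
    have e3: "(r/2) powr (-s) * (C3 * (2*r) powr (n - \<alpha>)) = 2 powr s * (C3 * 2 powr s)"
      using r by (simp add: s_def[symmetric] powr_mult powr_divide powr_minus field_simps)
    have e4: "(r/2) powr (-\<alpha>) * (C4 * (3*r) powr (n - s)) = 2 powr \<alpha> * (C4 * 3 powr \<alpha>)"
    proof -
      have "n - s = \<alpha>" by (simp add: s_def)
      then show ?thesis
        using r by (simp add: powr_mult powr_divide powr_minus field_simps)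
    qed
    have g_nonneg: "0 \<le> g1 y" "0 \<le> g2 y" "0 \<le> g3 y" "0 \<le> (r/2) powr (-\<alpha>) * g0 w" for y w
      using r by (auto simp: g1_def g2_def g3_def g0_def)
    have int: "integrable lborel g" "(\<integral>y. g y \<partial>lborel) \<le> B"
      using hb unfolding e1 e2 e3 e4 by (auto simp: has_bochner_integral_iff B_def)
    have far: "norm y powr (-\<alpha>) * (norm z * norm y powr (-(s + 1))) \<le> g y" if y: "y \<noteq> 0" "2 * norm z \<le> norm y" for y
    proof -
      have "norm y powr (-\<alpha>) * norm y powr (-(s + 1)) = norm y powr (-(n+1))"
        unfolding powr_add[symmetric] by (rule arg_cong[where f = "\<lambda>e. norm y powr e"]) (simp add: s_def)
      then have "norm y powr (-\<alpha>) * (norm z * norm y powr (-(s + 1))) = g1 y"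
        using y by (simp add: g1_def r_def mult_ac)
      then show ?thesis
        unfolding g_def using g_nonneg(2,3)[of y] g_nonneg(4)[of "z - y"] g_nonneg(4)[of "z + y"] by linarith
    qed
    \<comment> \<open>For w = z - y or w = z + y: either |y| < |z| / 2, and then |w| is at least |z|
      / 2, or |y| is at least |z| / 2. So at most one of the two factors is singular.\<close>
    have half: "norm y powr (-\<alpha>) * norm w powr (-s) \<le> g3 y + (r/2) powr (-\<alpha>) * g0 w"
      if y: "norm y < 2 * r" and w: "norm w \<le> r + norm y" "r \<le> norm w + norm y" and w0: "w \<noteq> 0" for y w :: 'a
    proof (cases "norm y < r / 2")
      case True
      have "norm w powr (-s) \<le> (r/2) powr (-s)"
        using True w r s by (intro powr_mono2') auto
      then have "norm y powr (-\<alpha>) * norm w powr (-s) \<le> norm y powr (-\<alpha>) * (r/2) powr (-s)"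
        by (intro mult_left_mono) auto
      also have "\<dots> = g3 y"
        using y by (simp add: g3_def)
      finally show ?thesis
        using g_nonneg(4)[of w] by linarith
    next
      case False
      have "norm y powr (-\<alpha>) \<le> (r/2) powr (-\<alpha>)"
        using False r \<alpha> by (intro powr_mono2') auto
      then have "norm y powr (-\<alpha>) * norm w powr (-s) \<le> (r/2) powr (-\<alpha>) * norm w powr (-s)"
        by (intro mult_right_mono) auto
      also have "\<dots> = (r/2) powr (-\<alpha>) * g0 w"
        using w y by (simp add: g0_def)
      finally show ?thesis
        using g_nonneg(3)[of y] by linarith
    qed
    have near: "norm y powr (-\<alpha>) * (norm y powr (-s) * (norm y / norm z) + norm (z - y) powr (-s) + norm (z + y) powr (-s)) \<le> g y"
      if y: "y \<noteq> 0" "y \<noteq> z" "y \<noteq> - z" "norm y < 2 * norm z" for y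
    proof -
      have 1: "norm y powr (-\<alpha>) * norm (z - y) powr (-s) \<le> g3 y + (r/2) powr (-\<alpha>) * g0 (z - y)"
        using y norm_triangle_ineq4[of z y] norm_triangle_ineq[of "z - y" y] by (intro half) (auto simp: r_def)
      have 2: "norm y powr (-\<alpha>) * norm (z + y) powr (-s) \<le> g3 y + (r/2) powr (-\<alpha>) * g0 (z + y)"
        using y norm_triangle_ineq[of z y] norm_triangle_ineq4[of "z + y" y]
        by (intro half) (auto simp: r_def add_eq_0_iff2)
      have 3: "norm y powr (-\<alpha>) * (norm y powr (-s) * (norm y / norm z)) = g2 y"
      proof -
        have "norm y powr (-\<alpha>) * norm y powr (-s) * norm y = norm y powr (-(n-1))"
        proof -
          have "norm y powr (-\<alpha>) * norm y powr (-s) = norm y powr (-n)"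
            unfolding powr_add[symmetric] by (rule arg_cong[where f = "\<lambda>e. norm y powr e"]) (simp add: s_def)
          then show ?thesis
            using y(1) powr_mult_base[of "norm y" "-n"] by (simp add: mult.commute)
        qed
        then show ?thesis
          using y by (simp add: g2_def r_def mult.assoc[symmetric])
      qed
      show ?thesis
        unfolding distrib_left g_def using 1 2 3 g_nonneg(1)[of y] by linarith
    qed
    show "\<exists>g. integrable lborel g \<and> (\<integral>y. g y \<partial>lborel) \<le> B \<and> (\<forall>y. 0 \<le> g y) \<and>
     (\<forall>y. y \<noteq> 0 \<longrightarrow> 2 * norm z \<le> norm y \<longrightarrow> norm y powr (-\<alpha>) * (norm z * norm y powr (-(s + 1))) \<le> g y) \<and>
     (\<forall>y. y \<noteq> 0 \<longrightarrow> y \<noteq> z \<longrightarrow> y \<noteq> - z \<longrightarrow> norm y < 2 * norm z \<longrightarrow>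
        norm y powr (-\<alpha>) * (norm y powr (-s) * (norm y / norm z) + norm (z - y) powr (-s) + norm (z + y) powr (-s)) \<le> g y)"
      using int far near g_nonneg by (intro exI[of _ g]) (auto simp: g_def)
  qed
qed

text \<open>The common interface of the two cancellations; R y is to be added to K(z - y). For large
  y it must imitate K(y) = - K(- y) up to the gain |z| / |y|. For the other y any bound that is
  integrable against |y|^(-\<alpha>) will do: the term with |y| / |z| serves the rotation fields,
  the other two the symmetrisation. The last clause is qualitative, and its constant may depend on
  \<epsilon>, \<delta> and S.\<close>

definition correction :: "real \<Rightarrow> real \<Rightarrow> real \<Rightarrow> real \<Rightarrow> ('a::euclidean_space \<Rightarrow> 'a \<Rightarrow> 'a) \<Rightarrow> bool" where
  "correction \<epsilon> C \<delta> S R \<longleftrightarrow> case_prod R \<in> borel_measurable (borel \<Otimes>\<^sub>M borel) \<and>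
     (\<forall>y z. y \<noteq> 0 \<longrightarrow> 2 * norm z \<le> norm y \<longrightarrow>
        norm (R y z - riesz_kernel \<alpha> \<epsilon> y) \<le> C * (norm z * norm y powr (-(real DIM('a) - \<alpha> + 1)))) \<and>
     (\<forall>y z. y \<noteq> 0 \<longrightarrow> y \<noteq> z \<longrightarrow> y \<noteq> - z \<longrightarrow> norm y < 2 * norm z \<longrightarrow>
        norm (R y z) \<le> C * (norm y powr (-(real DIM('a) - \<alpha>)) * (norm y / norm z) +
          norm (z - y) powr (-(real DIM('a) - \<alpha>)) + norm (z + y) powr (-(real DIM('a) - \<alpha>)))) \<and>
     (\<exists>A. \<forall>y. \<delta> \<le> norm y \<longrightarrow> norm y \<le> S \<longrightarrow> decay (real DIM('a) - \<alpha>) A (R y))"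

lemma correctionD:
  fixes R :: "'a::euclidean_space \<Rightarrow> 'a \<Rightarrow> 'a"
  assumes "correction \<epsilon> C \<delta> S R"
  shows "case_prod R \<in> borel_measurable (borel \<Otimes>\<^sub>M borel)"
    and "y \<noteq> 0 \<Longrightarrow> 2 * norm z \<le> norm y \<Longrightarrow>
        norm (R y z - riesz_kernel \<alpha> \<epsilon> y) \<le> C * (norm z * norm y powr (-(real DIM('a) - \<alpha> + 1)))"
    and "y \<noteq> 0 \<Longrightarrow> y \<noteq> z \<Longrightarrow> y \<noteq> - z \<Longrightarrow> norm y < 2 * norm z \<Longrightarrow>
        norm (R y z) \<le> C * (norm y powr (-(real DIM('a) - \<alpha>)) * (norm y / norm z) +
          norm (z - y) powr (-(real DIM('a) - \<alpha>)) + norm (z + y) powr (-(real DIM('a) - \<alpha>)))"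
    and "\<exists>A. \<forall>y. \<delta> \<le> norm y \<longrightarrow> norm y \<le> S \<longrightarrow> decay (real DIM('a) - \<alpha>) A (R y)"
  using assms unfolding correction_def by simp_all

text \<open>Both points z + y and y have norm at least |y| / 2, which is where the power of 2 comes
  from.\<close>

lemma riesz_kernel_shift_diff:
  fixes y z :: "'a::euclidean_space"
  assumes C: "0 \<le> C" "\<And>w w'::'a. w \<noteq> 0 \<Longrightarrow> w' \<noteq> 0 \<Longrightarrow> norm (riesz_kernel \<alpha> \<epsilon> w - riesz_kernel \<alpha> \<epsilon> w') \<le>
       C * norm (w - w') * min (norm w) (norm w') powr (-(real DIM('a) - \<alpha> + 1))"
    and y: "y \<noteq> 0" "2 * norm z \<le> norm y"
  shows "norm (riesz_kernel \<alpha> \<epsilon> (z + y) - riesz_kernel \<alpha> \<epsilon> y) \<le> C * 2 powr (real DIM('a) - \<alpha> + 1) * (norm z * norm y powr (-(real DIM('a) - \<alpha> + 1)))"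
proof -
  define m where "m = real DIM('a) - \<alpha> + 1"
  have m: "0 \<le> m" using \<alpha> one_le_DIM[where 'a='a] by (simp add: m_def)
  have ny: "norm y > 0" using y by simp
  have "norm y \<le> norm (z + y) + norm z"
    using norm_triangle_ineq4[of "z + y" z] by simp
  then have h: "norm y / 2 \<le> norm (z + y)"
    using y by simp
  then have "z + y \<noteq> 0"
    using ny by auto
  then have "norm (riesz_kernel \<alpha> \<epsilon> (z + y) - riesz_kernel \<alpha> \<epsilon> y) \<le> C * norm (z + y - y) * min (norm (z + y)) (norm y) powr (-m)"
    unfolding m_def using y by (intro C)
  also have "\<dots> \<le> C * norm (z + y - y) * (norm y / 2) powr (-m)"
    using h C ny m by (intro mult_left_mono powr_mono2') auto
  also have "(norm y / 2) powr (-m) = 2 powr m * norm y powr (-m)"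
    by (simp add: powr_divide powr_minus field_simps)
  finally show ?thesis
    by (simp add: m_def mult_ac)
qed

text \<open>The sup bound C0 is chosen before \<epsilon>, \<delta>, S, h and R, and depends on the
  correction only through C1. The decay constant, by contrast, comes from the support of h and
  serves only to move the divergence under the integral.\<close>

lemma corrected_field:
  assumes C1: "0 \<le> C1"
  shows "\<exists>C0>0. \<forall>\<epsilon>>0. \<forall>\<delta>>0. \<forall>S. \<forall>h::'a::euclidean_space \<Rightarrow> real. \<forall>R. correction \<epsilon> C1 \<delta> S R \<longrightarrow> h \<in> borel_measurable borel \<longrightarrow>
     (\<forall>y. \<bar>h y\<bar> \<le> norm y powr (-\<alpha>)) \<longrightarrow> (\<forall>y. h y \<noteq> 0 \<longrightarrow> \<delta> \<le> norm y \<and> norm y \<le> S) \<longrightarrow>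
     (\<exists>A. decay (real DIM('a) - \<alpha>) A (\<lambda>z. \<integral>y. h y *\<^sub>R (riesz_kernel \<alpha> \<epsilon> (z - y) + R y z) \<partial>lborel)) \<and>
     (\<forall>z. norm (\<integral>y. h y *\<^sub>R (riesz_kernel \<alpha> \<epsilon> (z - y) + R y z) \<partial>lborel) \<le> C0) \<and>
     (\<forall>x. fdiv \<alpha> (\<lambda>z. \<integral>y. h y *\<^sub>R (riesz_kernel \<alpha> \<epsilon> (z - y) + R y z) \<partial>lborel) x =
        (\<integral>y. h y * (fdiv \<alpha> (riesz_kernel \<alpha> \<epsilon>) (x - y) + fdiv \<alpha> (R y) x) \<partial>lborel))"
proof -
  define s where "s = real DIM('a) - \<alpha>"
  have s: "0 \<le> s" using DIM_minus_alpha_pos[OF \<alpha>, where 'a='a] by (simp add: s_def)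
  obtain C where C: "C > 0" "\<And>\<epsilon> w. 0 < \<epsilon> \<Longrightarrow> w \<noteq> 0 \<Longrightarrow> norm (riesz_kernel \<alpha> \<epsilon> w) \<le> C * norm (w::'a) powr (-s)"
     "\<And>\<epsilon> w w'::'a. 0 < \<epsilon> \<Longrightarrow> w \<noteq> 0 \<Longrightarrow> w' \<noteq> 0 \<Longrightarrow> norm (riesz_kernel \<alpha> \<epsilon> w - riesz_kernel \<alpha> \<epsilon> w') \<le>
       C * norm (w - w') * min (norm w) (norm w') powr (-(s + 1))"
    using riesz_kernel_bounds[OF \<alpha>, where 'a='a] unfolding s_def by metis
  obtain B where B: "B \<ge> 0" "\<And>z::'a. z \<noteq> 0 \<Longrightarrow> \<exists>g. integrable lborel g \<and> (\<integral>y. g y \<partial>lborel) \<le> B \<and> (\<forall>y. 0 \<le> g y) \<and>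
     (\<forall>y. y \<noteq> 0 \<longrightarrow> 2 * norm z \<le> norm y \<longrightarrow> norm y powr (-\<alpha>) * (norm z * norm y powr (-(s + 1))) \<le> g y) \<and>
     (\<forall>y. y \<noteq> 0 \<longrightarrow> y \<noteq> z \<longrightarrow> y \<noteq> - z \<longrightarrow> norm y < 2 * norm z \<longrightarrow>
        norm y powr (-\<alpha>) * (norm y powr (-s) * (norm y / norm z) +
          norm (z - y) powr (-s) + norm (z + y) powr (-s)) \<le> g y)"
    using weighted_kernel_bound[where 'a='a] unfolding s_def by metis
  define D where "D = C * 2 powr (s + 1) + C1"
  have D: "C \<le> C * 2 powr (s + 1)" "0 \<le> D"
    using C(1) C1 s by (auto simp: D_def ge_one_powr_ge_zero)
  show ?thesis
  \<comment> \<open>The added 1 makes the bound strictly positive, as the normalisation in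
    \<open>integral_times_fdiv_bound\<close> requires.\<close>
  proof (rule exI[of _ "D * B + 1"], intro conjI allI impI)
    show "0 < D * B + 1"
      using D B(1) by (simp add: add_nonneg_pos)
    fix \<epsilon> \<delta> S :: real and h :: "'a \<Rightarrow> real" and R :: "'a \<Rightarrow> 'a \<Rightarrow> 'a"
    assume \<epsilon>: "0 < \<epsilon>" and \<delta>: "0 < \<delta>" and R: "correction \<epsilon> C1 \<delta> S R" and hm [measurable]: "h \<in> borel_measurable borel"
      and hb: "\<forall>y. \<bar>h y\<bar> \<le> norm y powr (-\<alpha>)" and hs: "\<forall>y. h y \<noteq> 0 \<longrightarrow> \<delta> \<le> norm y \<and> norm y \<le> S"
    note [measurable] = riesz_kernel_borel[OF \<alpha> \<epsilon>, where 'a='a]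
    have [measurable]: "case_prod R \<in> borel_measurable (borel \<Otimes>\<^sub>M borel)"
      by (rule correctionD(1)[OF R])
    obtain A1 where "\<forall>y. \<delta> \<le> norm y \<longrightarrow> norm y \<le> S \<longrightarrow> decay s A1 (R y)"
      using correctionD(4)[OF R, folded s_def] by (elim exE)
    then have A1: "decay s A1 (R y)" if "\<delta> \<le> norm y" "norm y \<le> S" for y
      using that by simp
    obtain A2 where A2: "decay s A2 (riesz_kernel \<alpha> \<epsilon> :: 'a \<Rightarrow> 'a)"
      using riesz_kernel_decay[OF \<alpha> \<epsilon>, where 'a='a] unfolding s_def by metis
    define M where "M y z = h y *\<^sub>R (riesz_kernel \<alpha> \<epsilon> (z - y) + R y z)" for y z
    have [measurable]: "case_prod M \<in> borel_measurable (borel \<Otimes>\<^sub>M borel)"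
      unfolding M_def by measurable
    define A where "A = (1 + S) powr (s + 1) * A2 + A1"
    have shift: "decay s ((1 + S) powr (s + 1) * A2) (\<lambda>z. riesz_kernel \<alpha> \<epsilon> (z - y))" if "norm y \<le> S" for y :: 'a
      using decay_shift[OF A2 s, of "- y" S] that by simp
    have dM: "decay (real DIM('a) - \<alpha>) (\<bar>h y\<bar> * A) (M y)" for y
    proof (cases "h y = 0")
      case True
      then show ?thesis by (simp add: M_def decay_def)
    next
      case False
      then have y: "\<delta> \<le> norm y" "norm y \<le> S" using hs by auto
      show ?thesis
        unfolding M_def A_def s_def[symmetric]
        by (intro decay_scaleR decay_add shift A1 y)
    qed
    have hi: "integrable lborel (\<lambda>y. \<bar>h y\<bar>)"
    proof (rule Bochner_Integration.integrable_bound)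
      show "integrable lborel (\<lambda>y::'a. \<delta> powr (-\<alpha>) * indicator (cball 0 S) y)"
        using emeasure_lborel_cball_finite[of "0::'a" S] by (intro integrable_mult_right integrable_real_indicator) auto
      have "\<bar>h y\<bar> \<le> \<delta> powr (-\<alpha>) * indicator (cball 0 S) y" for y
      proof (cases "h y = 0")
        case False
        then have y: "\<delta> \<le> norm y" "norm y \<le> S" using hs by auto
        have "\<bar>h y\<bar> \<le> norm y powr (-\<alpha>)" using hb by auto
        also have "\<dots> \<le> \<delta> powr (-\<alpha>)"
          using y \<delta> \<alpha> by (intro powr_mono2') auto
        finally show ?thesis using y by simp
      qed simp
      then show "AE y in lborel. norm \<bar>h y\<bar> \<le> norm (\<delta> powr (-\<alpha>) * indicator (cball 0 S) y)"
        by simp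
    qed measurable
    have mi: "integrable lborel (\<lambda>y. \<bar>h y\<bar> * A)"
      by (intro integrable_mult_left hi)
    note sup = fdiv_superposition[OF \<alpha> _ dM mi, unfolded M_def[abs_def]]
    show "\<exists>A. decay (real DIM('a) - \<alpha>) A (\<lambda>z. \<integral>y. h y *\<^sub>R (riesz_kernel \<alpha> \<epsilon> (z - y) + R y z) \<partial>lborel)"
      by (rule exI, rule sup(1)) measurable
    fix x
    have "fdiv \<alpha> (\<lambda>z. \<integral>y. M y z \<partial>lborel) x = (\<integral>y. fdiv \<alpha> (M y) x \<partial>lborel)"
      by (rule fdiv_superposition(2)[OF \<alpha> _ dM mi]) measurable
    also have "\<dots> = (\<integral>y. h y * (fdiv \<alpha> (riesz_kernel \<alpha> \<epsilon>) (x - y) + fdiv \<alpha> (R y) x) \<partial>lborel)"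
    proof (intro Bochner_Integration.integral_cong refl)
      fix y
      show "fdiv \<alpha> (M y) x = h y * (fdiv \<alpha> (riesz_kernel \<alpha> \<epsilon>) (x - y) + fdiv \<alpha> (R y) x)"
      proof (cases "h y = 0")
        case True
        then show ?thesis by (simp add: M_def fdiv_def)
      next
        case False
        then have y: "\<delta> \<le> norm y" "norm y \<le> S" using hs by auto
        have "fdiv \<alpha> (M y) x = h y * fdiv \<alpha> (\<lambda>z. riesz_kernel \<alpha> \<epsilon> (z - y) + R y z) x"
          unfolding M_def by (rule fdiv_scaleR[OF \<alpha>])
        also have "fdiv \<alpha> (\<lambda>z. riesz_kernel \<alpha> \<epsilon> (z - y) + R y z) x = fdiv \<alpha> (\<lambda>z. riesz_kernel \<alpha> \<epsilon> (z - y)) x + fdiv \<alpha> (R y) x"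
          using shift[OF y(2)] A1[OF y] unfolding s_def by (rule fdiv_add[OF \<alpha>])
        also have "fdiv \<alpha> (\<lambda>z. riesz_kernel \<alpha> \<epsilon> (z - y)) x = fdiv \<alpha> (riesz_kernel \<alpha> \<epsilon>) (x - y)"
          using fdiv_shift[OF \<alpha>, of "riesz_kernel \<alpha> \<epsilon>" "- y" x] by simp
        finally show ?thesis .
      qed
    qed
    finally show "fdiv \<alpha> (\<lambda>z. \<integral>y. h y *\<^sub>R (riesz_kernel \<alpha> \<epsilon> (z - y) + R y z) \<partial>lborel) x =
        (\<integral>y. h y * (fdiv \<alpha> (riesz_kernel \<alpha> \<epsilon>) (x - y) + fdiv \<alpha> (R y) x) \<partial>lborel)"
      by (simp add: M_def)
  next
    fix \<epsilon> \<delta> S :: real and h :: "'a \<Rightarrow> real" and R :: "'a \<Rightarrow> 'a \<Rightarrow> 'a" and z :: 'a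
    assume \<epsilon>: "0 < \<epsilon>" and \<delta>: "0 < \<delta>" and R: "correction \<epsilon> C1 \<delta> S R" and hm [measurable]: "h \<in> borel_measurable borel"
      and hb: "\<forall>y. \<bar>h y\<bar> \<le> norm y powr (-\<alpha>)" and hs: "\<forall>y. h y \<noteq> 0 \<longrightarrow> \<delta> \<le> norm y \<and> norm y \<le> S"
    note R1 = correctionD(2)[OF R, folded s_def]
    note R2 = correctionD(3)[OF R, folded s_def]
    have far: "norm (riesz_kernel \<alpha> \<epsilon> (z - y) + R y z) \<le> D * (norm z * norm y powr (-(s + 1)))" if y: "y \<noteq> 0" "2 * norm z \<le> norm y" for y
    proof -
      have "norm (riesz_kernel \<alpha> \<epsilon> (z + - y) - riesz_kernel \<alpha> \<epsilon> (- y)) \<le> C * 2 powr (s + 1) * (norm z * norm (- y) powr (-(s + 1)))"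
        using y unfolding s_def by (intro riesz_kernel_shift_diff C(3)[OF \<epsilon>, unfolded s_def] less_imp_le[OF C(1)]) auto
      then have 1: "norm (riesz_kernel \<alpha> \<epsilon> (z - y) + riesz_kernel \<alpha> \<epsilon> y) \<le> C * 2 powr (s + 1) * (norm z * norm y powr (-(s + 1)))"
        by (simp add: riesz_kernel_minus)
      have "riesz_kernel \<alpha> \<epsilon> (z - y) + R y z = (riesz_kernel \<alpha> \<epsilon> (z - y) + riesz_kernel \<alpha> \<epsilon> y) + (R y z - riesz_kernel \<alpha> \<epsilon> y)"
        by simp
      also have "norm \<dots> \<le> C * 2 powr (s + 1) * (norm z * norm y powr (-(s + 1))) + C1 * (norm z * norm y powr (-(s + 1)))"
        by (rule norm_triangle_mono[OF 1 R1[OF y]])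
      finally show ?thesis
        by (simp add: D_def distrib_right)
    qed
    show "norm (\<integral>y. h y *\<^sub>R (riesz_kernel \<alpha> \<epsilon> (z - y) + R y z) \<partial>lborel) \<le> D * B + 1"
    proof (cases "z = 0")
      case True
      \<comment> \<open>At z = 0 the bound \<open>far\<close> is 0: the correction equals K(y), and
        K(- y) cancels it exactly.\<close>
      have "h y *\<^sub>R (riesz_kernel \<alpha> \<epsilon> (z - y) + R y z) = 0" for y
      proof (cases "h y = 0")
        case False
        then have "y \<noteq> 0" using hs \<delta> by auto
        then show ?thesis
          using far[of y] True by simp
      qed simp
      then have "(\<integral>y. h y *\<^sub>R (riesz_kernel \<alpha> \<epsilon> (z - y) + R y z) \<partial>lborel) = (\<integral>y. 0 \<partial>(lborel::'a measure))"
        by (intro Bochner_Integration.integral_cong) auto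
      then show ?thesis
        using D B(1) by simp
    next
      case False
      obtain g where g: "integrable lborel g" "(\<integral>y. g y \<partial>lborel) \<le> B" "\<And>y. 0 \<le> g y"
       "\<And>y. y \<noteq> 0 \<Longrightarrow> 2 * norm z \<le> norm y \<Longrightarrow> norm y powr (-\<alpha>) * (norm z * norm y powr (-(s + 1))) \<le> g y"
       "\<And>y. y \<noteq> 0 \<Longrightarrow> y \<noteq> z \<Longrightarrow> y \<noteq> - z \<Longrightarrow> norm y < 2 * norm z \<Longrightarrow>
        norm y powr (-\<alpha>) * (norm y powr (-s) * (norm y / norm z) +
          norm (z - y) powr (-s) + norm (z + y) powr (-s)) \<le> g y"
        using B(2)[OF False] by metis
      have bd: "norm (h y *\<^sub>R (riesz_kernel \<alpha> \<epsilon> (z - y) + R y z)) \<le> D * g y" if y: "y \<noteq> 0" "y \<noteq> z" "y \<noteq> - z" for y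
      proof -
        have h: "\<bar>h y\<bar> \<le> norm y powr (-\<alpha>)" using hb by auto
        show ?thesis
        proof (cases "2 * norm z \<le> norm y")
          case True
          have "\<bar>h y\<bar> * norm (riesz_kernel \<alpha> \<epsilon> (z - y) + R y z) \<le> norm y powr (-\<alpha>) * (D * (norm z * norm y powr (-(s + 1))))"
            by (intro mult_mono h far y(1) True) auto
          also have "\<dots> \<le> D * g y"
            using mult_left_mono[OF g(4)[OF y(1) True] D(2)] by (simp add: mult_ac)
          finally show ?thesis by simp
        next
          case F: False
          define Q where "Q = norm y powr (-s) * (norm y / norm z) + norm (z - y) powr (-s) + norm (z + y) powr (-s)"
          have Q: "norm (z - y) powr (-s) \<le> Q" "0 \<le> Q"
            by (auto simp: Q_def)
          have "norm (riesz_kernel \<alpha> \<epsilon> (z - y) + R y z) \<le> C * norm (z - y) powr (-s) + C1 * Q"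
            unfolding Q_def using F y by (intro norm_triangle_mono C(2)[OF \<epsilon>] R2) auto
          also have "\<dots> \<le> D * Q"
          proof -
            have "C * norm (z - y) powr (-s) \<le> C * 2 powr (s + 1) * Q"
              using D(1) Q C(1) by (intro mult_mono) auto
            then show ?thesis
              by (simp add: D_def distrib_right)
          qed
          finally have "\<bar>h y\<bar> * norm (riesz_kernel \<alpha> \<epsilon> (z - y) + R y z) \<le> norm y powr (-\<alpha>) * (D * Q)"
            by (intro mult_mono h) auto
          also have "\<dots> \<le> D * g y"
            using mult_left_mono[OF g(5)[OF y] D(2)] F by (simp add: Q_def mult_ac)
          finally show ?thesis by simp
        qed
      qed
      have "norm (\<integral>y. h y *\<^sub>R (riesz_kernel \<alpha> \<epsilon> (z - y) + R y z) \<partial>lborel) \<le> (\<integral>y. norm (h y *\<^sub>R (riesz_kernel \<alpha> \<epsilon> (z - y) + R y z)) \<partial>lborel)"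
        by (rule integral_norm_bound)
      also have "\<dots> \<le> (\<integral>y. D * g y \<partial>lborel)"
      proof (rule integral_mono_AE')
        show "integrable lborel (\<lambda>y. D * g y)"
          using g(1) by (intro integrable_mult_right)
        show "AE y in lborel. norm (h y *\<^sub>R (riesz_kernel \<alpha> \<epsilon> (z - y) + R y z)) \<le> D * g y"
          using AE_lborel_neq[of 0] AE_lborel_neq[of z] AE_lborel_neq[of "- z"]
          by eventually_elim (rule bd)
        show "AE y in lborel. 0 \<le> D * g y"
          using g(3) D(2) by simp
      qed
      also have "\<dots> \<le> D * B"
        using mult_left_mono[OF g(2) D(2)] by simp
      finally show ?thesis
        by simp
    qed
  qed
qed

end

section \<open>The two corrections: symmetrisation and rotations\<close>

text \<open>A skew map in the plane of e and b. For a unit vector b it sends b to the component of e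
  orthogonal to b.\<close>

definition rotation :: "'a::real_inner \<Rightarrow> 'a \<Rightarrow> 'a \<Rightarrow> 'a" where
  "rotation e b v = (b \<bullet> v) *\<^sub>R e - (e \<bullet> v) *\<^sub>R b"

lemma bounded_linear_rotation: "bounded_linear (rotation e b)"
  unfolding rotation_def[abs_def]
  by (intro bounded_linear_sub bounded_linear_scaleR_left[THEN bounded_linear_compose] bounded_linear_inner_right)

lemma rotation_scaleR: "rotation e b (c *\<^sub>R v) = c *\<^sub>R rotation e b v"
  by (simp add: rotation_def scaleR_diff_right)

lemma rotation_diff: "rotation e b v - rotation e b w = rotation e b (v - w)"
  by (simp add: rotation_def inner_diff_right scaleR_diff_left)

lemma inner_rotation: "v \<bullet> rotation e b v = 0"
  by (simp add: rotation_def inner_diff_right inner_commute)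

lemma norm_rotation:
  assumes "norm b = 1"
  shows "norm (rotation e b v) \<le> 2 * norm e * norm v"
proof -
  have "norm (rotation e b v) \<le> \<bar>b \<bullet> v\<bar> * norm e + \<bar>e \<bullet> v\<bar> * norm b"
    unfolding rotation_def by (rule order_trans[OF norm_triangle_ineq4]) simp
  also have "\<dots> \<le> (norm b * norm v) * norm e + (norm e * norm v) * norm b"
    by (intro add_mono mult_right_mono Cauchy_Schwarz_ineq2) auto
  finally show ?thesis
    using assms by simp
qed

lemma sum_rotation_Basis:
  fixes e :: "'a::euclidean_space"
  shows "(\<Sum>b\<in>Basis. rotation e b b) = (real DIM('a) - 1) *\<^sub>R e"
  by (simp add: rotation_def sum_subtractf euclidean_representation sum_constant_scaleR scaleR_diff_left)

context
  fixes \<alpha> :: real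
  assumes \<alpha>: "0 < \<alpha>" "\<alpha> < 1"
begin

text \<open>Added to K(z - y) it gives the mean of K(z + y) and K(z - y). It is odd in y, so it
  drops out against an even weight. For large y both K(z + y) and - K(z - y) are close to
  K(y).\<close>

lemma even_correction:
  "\<exists>C\<ge>0. \<forall>\<epsilon>>0. \<forall>\<delta> S. correction \<alpha> \<epsilon> C \<delta> S
     (\<lambda>y z::'a::euclidean_space. (1/2) *\<^sub>R riesz_kernel \<alpha> \<epsilon> (z + y) + (-(1/2)) *\<^sub>R riesz_kernel \<alpha> \<epsilon> (z + - y))"
proof -
  define s where "s = real DIM('a) - \<alpha>"
  have s: "0 \<le> s" using DIM_minus_alpha_pos[OF \<alpha>, where 'a='a] by (simp add: s_def)
  obtain C where C: "C > 0" "\<And>\<epsilon> w. 0 < \<epsilon> \<Longrightarrow> w \<noteq> 0 \<Longrightarrow> norm (riesz_kernel \<alpha> \<epsilon> w) \<le> C * norm (w::'a) powr (-s)"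
     "\<And>\<epsilon> w w'::'a. 0 < \<epsilon> \<Longrightarrow> w \<noteq> 0 \<Longrightarrow> w' \<noteq> 0 \<Longrightarrow> norm (riesz_kernel \<alpha> \<epsilon> w - riesz_kernel \<alpha> \<epsilon> w') \<le>
       C * norm (w - w') * min (norm w) (norm w') powr (-(s + 1))"
    using riesz_kernel_bounds[OF \<alpha>, where 'a='a] unfolding s_def by metis
  define C1 where "C1 = C * 2 powr (s + 1)"
  have CC1: "C \<le> C1"
    using C(1) s by (simp add: C1_def ge_one_powr_ge_zero)
  show ?thesis
  proof (rule exI[of _ C1], intro conjI allI impI)
    show "0 \<le> C1" using C(1) CC1 by simp
    fix \<epsilon> \<delta> S :: real assume \<epsilon>: "0 < \<epsilon>"
    let ?K = "riesz_kernel \<alpha> \<epsilon> :: 'a \<Rightarrow> 'a"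
    note [measurable] = riesz_kernel_borel[OF \<alpha> \<epsilon>, where 'a='a]
    obtain A where A: "decay s A ?K"
      using riesz_kernel_decay[OF \<alpha> \<epsilon>, where 'a='a] unfolding s_def by metis
    let ?R = "\<lambda>y z. (1/2) *\<^sub>R ?K (z + y) + (-(1/2)) *\<^sub>R ?K (z + - y)"
    show "correction \<alpha> \<epsilon> C1 \<delta> S ?R"
      unfolding correction_def[OF \<alpha>] s_def[symmetric]
    proof (intro conjI allI impI)
      show "case_prod ?R \<in> borel_measurable (borel \<Otimes>\<^sub>M borel)"
        by measurable
    next
      fix y z :: 'a assume y: "y \<noteq> 0" "2 * norm z \<le> norm y"
      define B where "B = C1 * (norm z * norm y powr (-(s + 1)))"
      have 1: "norm (?K (z + y) - ?K y) \<le> B"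
        unfolding B_def C1_def s_def using y
        by (intro riesz_kernel_shift_diff[OF \<alpha>] C(3)[OF \<epsilon>, unfolded s_def] less_imp_le[OF C(1)]) auto
      have 2: "norm (?K (z + - y) - ?K (- y)) \<le> B"
      proof -
        have "norm (?K (z + - y) - ?K (- y)) \<le> C1 * (norm z * norm (- y) powr (-(s + 1)))"
          unfolding C1_def s_def using y
          by (intro riesz_kernel_shift_diff[OF \<alpha>] C(3)[OF \<epsilon>, unfolded s_def] less_imp_le[OF C(1)]) auto
        then show ?thesis by (simp add: B_def)
      qed
      have "?R y z - ?K y = (1/2) *\<^sub>R (?K (z + y) - ?K y) + (-(1/2)) *\<^sub>R (?K (z + - y) - ?K (- y))"
        by (simp add: riesz_kernel_minus algebra_simps flip: scaleR_left.add)
      also have "norm \<dots> \<le> 1/2 * norm (?K (z + y) - ?K y) + 1/2 * norm (?K (z + - y) - ?K (- y))"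
        by (rule order_trans[OF norm_triangle_ineq]) simp
      also have "\<dots> \<le> B"
        using 1 2 by simp
      finally show "norm (?R y z - ?K y) \<le> C1 * (norm z * norm y powr (-(s + 1)))"
        by (simp only: B_def)
    next
      fix y z :: 'a assume y: "y \<noteq> 0" "y \<noteq> z" "y \<noteq> - z" "norm y < 2 * norm z"
      define P where "P = norm (z - y) powr (-s) + norm (z + y) powr (-s)"
      have "z + y \<noteq> 0" "z + - y \<noteq> 0"
        using y by (auto simp: add_eq_0_iff2)
      then have k: "norm (?K (z + y)) \<le> C * norm (z + y) powr (-s)" "norm (?K (z + - y)) \<le> C * norm (z - y) powr (-s)"
        using C(2)[OF \<epsilon>, of "z + y"] C(2)[OF \<epsilon>, of "z + - y"] by auto
      have "norm (?R y z) \<le> 1/2 * norm (?K (z + y)) + 1/2 * norm (?K (z + - y))"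
        by (rule order_trans[OF norm_triangle_ineq]) simp
      also have "\<dots> \<le> norm (?K (z + y)) + norm (?K (z + - y))"
        by (intro add_mono) auto
      also have "\<dots> \<le> C * P"
        using k by (simp add: P_def distrib_left)
      also have "\<dots> \<le> C1 * (norm y powr (-s) * (norm y / norm z) + P)"
        using CC1 C(1) by (intro mult_mono) (auto simp: P_def)
      finally show "norm (?R y z) \<le> C1 * (norm y powr (-s) * (norm y / norm z) + norm (z - y) powr (-s) + norm (z + y) powr (-s))"
        by (simp add: P_def add.assoc)
    next
      define A' where "A' = \<bar>1/2\<bar> * ((1 + S) powr (s + 1) * A) + \<bar>-(1/2)\<bar> * ((1 + S) powr (s + 1) * A)"
      have "decay s A' (?R y)" if "norm y \<le> S" for y
        unfolding A'_def using that by (intro decay_add decay_scaleR decay_shift[OF A s]) auto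
      then show "\<exists>A. \<forall>y. \<delta> \<le> norm y \<longrightarrow> norm y \<le> S \<longrightarrow> decay s A (?R y)"
        by blast
    qed
  qed
qed

text \<open>The Gaussian rotation field in the plane of \<open>e = K\<^sub>\<epsilon>(y)\<close> and \<open>b\<close>, centred at \<open>- \<bar>y\<bar> b\<close>, takes at \<open>0\<close> a fixed multiple
  of the component of \<open>e\<close> orthogonal to \<open>b\<close>, and these components add up to \<open>(n - 1) e\<close>.\<close>

definition rotation_field :: "real \<Rightarrow> 'a::euclidean_space \<Rightarrow> 'a \<Rightarrow> 'a" where
  "rotation_field \<epsilon> y z = (exp 1 / ((real DIM('a) - 1) * norm y)) *\<^sub>R
     (\<Sum>b\<in>Basis. rotation (riesz_kernel \<alpha> \<epsilon> y) b
        (exp (-((norm (z + norm y *\<^sub>R b))\<^sup>2 / (norm y)\<^sup>2)) *\<^sub>R (z + norm y *\<^sub>R b)))"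

text \<open>The constant is left explicit in T because \<open>rotation_correction\<close> needs one
  bound for all T between \<delta>^2 and S^2.\<close>

lemma gauss_field_decay:
  assumes s: "0 \<le> s"
  shows "\<exists>C>0. \<forall>T>0. decay s (4 * (C * T powr ((s + 1) / 2)) * (2 / min T 1) powr ((s + 1) / 2))
    (\<lambda>z::'a::euclidean_space. exp (-((norm z)\<^sup>2 / T)) *\<^sub>R z)"
proof -
  obtain C where C: "C > 0" "\<And>T. 0 < T \<Longrightarrow> radial_profile (C * T powr ((s + 1) / 2)) T ((s + 1) / 2) (\<lambda>s. exp (-(s/T)))"
    using radial_profile_gauss[of "(s + 1) / 2"] by metis
  have "2 * (t / 2) = t" for t :: real by simp
  then have e: "2 * ((s + 1) / 2) = s + 1" .
  have "decay (2 * ((s + 1) / 2) - 1) (4 * (C * T powr ((s + 1) / 2)) * (2 / min T 1) powr ((s + 1) / 2))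
    (\<lambda>z::'a. exp (-((norm z)\<^sup>2 / T)) *\<^sub>R z)" if "0 < T" for T
    using s by (intro radial_field_decay[OF C(2)] that) auto
  then show ?thesis
    using C(1) unfolding e add_diff_cancel_right' by blast
qed

lemma rotation_field_fdiv:
  fixes y :: "'a::euclidean_space"
  assumes "y \<noteq> 0"
  shows "fdiv \<alpha> (rotation_field \<epsilon> y) x = 0"
proof -
  define e where "e = riesz_kernel \<alpha> \<epsilon> y"
  define l where "l = norm y"
  have l: "l > 0" using assms by (simp add: l_def)
  have T: "l\<^sup>2 > 0" using l by simp
  define s where "s = real DIM('a) - \<alpha>"
  have s: "0 \<le> s" using DIM_minus_alpha_pos[OF \<alpha>, where 'a='a] by (simp add: s_def)
  obtain A where A: "decay s A (\<lambda>z::'a. exp (-((norm z)\<^sup>2 / l\<^sup>2)) *\<^sub>R z)"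
    using gauss_field_decay[OF s, where 'a='a] T by blast
  define F where "F b z = rotation e b (exp (-((norm z)\<^sup>2 / l\<^sup>2)) *\<^sub>R z)" for b z
  have dF: "decay s (2 * norm e * A) (F b)" if "b \<in> Basis" for b
    unfolding F_def using that
    by (intro decay_bounded_linear[OF A] bounded_linear_rotation norm_rotation) auto
  have F0: "fdiv \<alpha> (F b) x = 0" if b: "b \<in> Basis" for b x
  proof -
    have eq: "F b = (\<lambda>z. exp (-((norm z)\<^sup>2 / l\<^sup>2)) *\<^sub>R rotation e b z)"
      by (simp add: fun_eq_iff F_def rotation_scaleR)
    show ?thesis
      using dF[OF b] unfolding eq s_def
      by (intro fdiv_gauss_rotation[OF \<alpha> bounded_linear_rotation inner_rotation T])
  qed
  have "fdiv \<alpha> (rotation_field \<epsilon> y) x = fdiv \<alpha> (\<lambda>z. (exp 1 / ((real DIM('a) - 1) * l)) *\<^sub>R (\<Sum>b\<in>Basis. F b (z + l *\<^sub>R b))) x"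
    unfolding rotation_field_def F_def e_def l_def by simp
  also have "\<dots> = (exp 1 / ((real DIM('a) - 1) * l)) * fdiv \<alpha> (\<lambda>z. \<Sum>b\<in>Basis. F b (z + l *\<^sub>R b)) x"
    by (rule fdiv_scaleR[OF \<alpha>])
  also have "fdiv \<alpha> (\<lambda>z. \<Sum>b\<in>Basis. F b (z + l *\<^sub>R b)) x = (\<Sum>b\<in>Basis. fdiv \<alpha> (\<lambda>z. F b (z + l *\<^sub>R b)) x)"
  proof (rule fdiv_sum[OF \<alpha>])
    fix b :: 'a assume b: "b \<in> Basis"
    show "decay (real DIM('a) - \<alpha>) ((1 + l) powr (s + 1) * (2 * norm e * A)) (\<lambda>z. F b (z + l *\<^sub>R b))"
      using decay_shift[OF dF[OF b] s, of "l *\<^sub>R b" l] l b by (simp add: s_def)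
  qed simp
  also have "\<dots> = 0"
    by (simp add: fdiv_shift[OF \<alpha>] F0)
  finally show ?thesis by simp
qed

text \<open>The Gaussians have width |y|. The undirected Gaussian field then has a Lipschitz
  constant independent of |y|, which gives the gain |z| / |y| near the origin, and it is at most a
  multiple of |y|^2 / |z| far away, which gives the gain |y| / |z|.\<close>

lemma rotation_correction:
  assumes n2: "2 \<le> DIM('a::euclidean_space)"
  shows "\<exists>C\<ge>0. \<forall>\<epsilon>>0. \<forall>\<delta>>0. \<forall>S. correction \<alpha> \<epsilon> C \<delta> S (rotation_field \<epsilon> :: 'a \<Rightarrow> 'a \<Rightarrow> 'a)"
proof -
  define n where "n = real DIM('a)"
  have n: "2 \<le> n" using n2 by (simp add: n_def)
  define s where "s = real DIM('a) - \<alpha>"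
  have s: "0 \<le> s" using DIM_minus_alpha_pos[OF \<alpha>, where 'a='a] by (simp add: s_def)
  obtain C where C: "C > 0" "\<And>\<epsilon> w. 0 < \<epsilon> \<Longrightarrow> w \<noteq> 0 \<Longrightarrow> norm (riesz_kernel \<alpha> \<epsilon> w) \<le> C * norm (w::'a) powr (-s)"
    using riesz_kernel_bounds[OF \<alpha>, where 'a='a] unfolding s_def by metis
  \<comment> \<open>The profile exponent 1 provides both facts: a slope bounded independently of T,
    and a size of order T / |z| for large |z|.\<close>
  obtain C2 where C2: "C2 > 0" "\<And>T. 0 < T \<Longrightarrow> radial_profile (C2 * T powr 1) T 1 (\<lambda>s. exp (-(s/T)))"
    using radial_profile_gauss[of 1] by metis
  obtain C3 where C3: "C3 > 0" "\<And>T. 0 < T \<Longrightarrow> decay s (4 * (C3 * T powr ((s + 1) / 2)) * (2 / min T 1) powr ((s + 1) / 2))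
    (\<lambda>z::'a. exp (-((norm z)\<^sup>2 / T)) *\<^sub>R z)"
    using gauss_field_decay[OF s, where 'a='a] by blast
  define X where "X T z = exp (-((norm z)\<^sup>2 / T)) *\<^sub>R z" for T and z :: 'a
  have X_norm: "norm (X T z) \<le> C2 * T * norm z * (T + (norm z)\<^sup>2) powr (-1)" if "0 < T" for T z
    unfolding X_def using radial_field_norm[OF C2(2)[OF that], of z] that by simp
  have X_diff: "norm (X T z - X T z') \<le> 4 * C2 * norm (z - z')" if T: "0 < T" for T z z'
  proof -
    have "norm (X T z - X T z') \<le> 4 * (C2 * T) * norm (z - z') * (T + (min (norm z) (norm z'))\<^sup>2) powr (-1)"
      unfolding X_def using radial_field_diff[OF C2(2)[OF T] T, of z z'] T by simp
    also have "\<dots> \<le> 4 * (C2 * T) * norm (z - z') * T powr (-1)"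
      using T C2(1) by (intro mult_left_mono powr_mono2') auto
    finally show ?thesis
      using T by (simp add: powr_minus_divide)
  qed
  define c where "c y = exp 1 / ((n - 1) * norm y)" for y :: 'a
  define C1 where "C1 = exp 1 * n * 8 * C2 * C"
  have "n / (n - 1) \<le> 2" using n by (simp add: field_simps)
  have rf: "rotation_field \<epsilon> y z = c y *\<^sub>R (\<Sum>b\<in>Basis. rotation (riesz_kernel \<alpha> \<epsilon> y) b (X ((norm y)\<^sup>2) (z + norm y *\<^sub>R b)))" for \<epsilon> y z
    by (simp add: rotation_field_def c_def X_def n_def)
  have c: "0 \<le> c y" "c y \<le> exp 1 / norm y" if "y \<noteq> 0" for y
    using that n unfolding c_def by (auto intro!: divide_left_mono)
  have bound: "norm (c y *\<^sub>R (\<Sum>b\<in>Basis. rotation (riesz_kernel \<alpha> \<epsilon> y) b (v b))) \<le> exp 1 / norm y * (n * (2 * (C * norm y powr (-s)) * w))"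
    if y: "y \<noteq> 0" and \<epsilon>: "0 < \<epsilon>" and v: "\<And>b. b \<in> Basis \<Longrightarrow> norm (v b) \<le> w" for \<epsilon> y v w
  proof -
    have w: "0 \<le> w"
      using order_trans[OF norm_ge_zero v[OF SOME_Basis]] .
    have "norm (\<Sum>b\<in>Basis. rotation (riesz_kernel \<alpha> \<epsilon> y) b (v b)) \<le> (\<Sum>b\<in>(Basis::'a set). 2 * (C * norm y powr (-s)) * w)"
    proof (rule sum_norm_le)
      fix b :: 'a assume b: "b \<in> Basis"
      have "norm (rotation (riesz_kernel \<alpha> \<epsilon> y) b (v b)) \<le> 2 * norm (riesz_kernel \<alpha> \<epsilon> y) * norm (v b)"
        using b by (intro norm_rotation) simp
      also have "\<dots> \<le> 2 * (C * norm y powr (-s)) * w"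
        using C(1) by (intro mult_mono C(2)[OF \<epsilon> y] v b) auto
      finally show "norm (rotation (riesz_kernel \<alpha> \<epsilon> y) b (v b)) \<le> 2 * (C * norm y powr (-s)) * w" .
    qed
    also have "\<dots> = n * (2 * (C * norm y powr (-s)) * w)"
      by (simp add: n_def)
    finally have "c y * norm (\<Sum>b\<in>Basis. rotation (riesz_kernel \<alpha> \<epsilon> y) b (v b)) \<le> exp 1 / norm y * (n * (2 * (C * norm y powr (-s)) * w))"
      using c[OF y] n w C(1) by (intro mult_mono) auto
    then show ?thesis
      using c[OF y] by simp
  qed
  have ny: "norm y powr (-s) / norm y = norm y powr (-(s + 1))" if "y \<noteq> 0" for y :: 'a
  proof -
    have "norm y * norm y powr (-(s + 1)) = norm y powr (-s)"
      using that powr_mult_base[of "norm y" "-(s + 1)"] by simp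
    then show ?thesis using that by (simp add: field_simps)
  qed
  show ?thesis
  proof (rule exI[of _ C1], intro conjI allI impI)
    show "0 \<le> C1" using C(1) C2(1) n by (simp add: C1_def)
    fix \<epsilon> \<delta> S :: real assume \<epsilon>: "0 < \<epsilon>" and \<delta>: "0 < \<delta>"
    note [measurable] = riesz_kernel_borel[OF \<alpha> \<epsilon>, where 'a='a]
    let ?K = "riesz_kernel \<alpha> \<epsilon> :: 'a \<Rightarrow> 'a"
    show "correction \<alpha> \<epsilon> C1 \<delta> S (rotation_field \<epsilon> :: 'a \<Rightarrow> 'a \<Rightarrow> 'a)"
      unfolding correction_def[OF \<alpha>] s_def[symmetric]
    proof (intro conjI allI impI)
      show "case_prod (rotation_field \<epsilon>) \<in> borel_measurable (borel \<Otimes>\<^sub>M (borel :: 'a measure))"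
        unfolding rotation_field_def rotation_def by measurable
    next
      fix y z :: 'a assume y: "y \<noteq> 0" "2 * norm z \<le> norm y"
      have T: "0 < (norm y)\<^sup>2" using y by simp
      \<comment> \<open>The Gaussian centred at - |y| b has the value exp(-1) at 0 and acts on a
        vector of length |y|; summing over the basis gives n - 1. The prefactor inverts these three
        numbers.\<close>
      have at0: "c y *\<^sub>R (\<Sum>b\<in>Basis. rotation (?K y) b (X ((norm y)\<^sup>2) (norm y *\<^sub>R b))) = ?K y"
      proof -
        have "(\<Sum>b\<in>Basis. rotation (?K y) b (X ((norm y)\<^sup>2) (norm y *\<^sub>R b))) = (\<Sum>b\<in>Basis. (exp (-1) * norm y) *\<^sub>R rotation (?K y) b b)"
          using y by (intro sum.cong) (auto simp: X_def rotation_scaleR)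
        also have "\<dots> = (exp (-1) * norm y) *\<^sub>R (n - 1) *\<^sub>R ?K y"
          by (simp only: scaleR_right.sum[symmetric] sum_rotation_Basis n_def)
        finally have "c y *\<^sub>R (\<Sum>b\<in>Basis. rotation (?K y) b (X ((norm y)\<^sup>2) (norm y *\<^sub>R b))) = (c y * (exp (-1) * norm y) * (n - 1)) *\<^sub>R ?K y"
          by simp
        also have "c y * (exp (-1) * norm y) * (n - 1) = 1"
          using y n by (simp add: c_def exp_minus field_simps)
        finally show ?thesis by simp
      qed
      have "rotation_field \<epsilon> y z - ?K y = c y *\<^sub>R (\<Sum>b\<in>Basis. rotation (?K y) b (X ((norm y)\<^sup>2) (z + norm y *\<^sub>R b) - X ((norm y)\<^sup>2) (norm y *\<^sub>R b)))"
        unfolding rf by (subst (2) at0[symmetric]) (simp add: scaleR_diff_right[symmetric] sum_subtractf[symmetric] rotation_diff)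
      also have "norm \<dots> \<le> exp 1 / norm y * (n * (2 * (C * norm y powr (-s)) * (4 * C2 * norm z)))"
        using X_diff[OF T] by (intro bound y \<epsilon>) (metis add_diff_cancel_right')
      also have "\<dots> = C1 * (norm z * (norm y powr (-s) / norm y))"
        by (simp add: C1_def field_simps)
      finally show "norm (rotation_field \<epsilon> y z - ?K y) \<le> C1 * (norm z * norm y powr (-(s + 1)))"
        by (simp only: ny[OF y(1)])
    next
      fix y z :: 'a assume y: "y \<noteq> 0" "y \<noteq> z" "y \<noteq> - z" "norm y < 2 * norm z"
      have T: "0 < (norm y)\<^sup>2" using y by simp
      have z: "0 < norm z" using y norm_ge_zero[of y] by linarith
      have Xb: "norm (X ((norm y)\<^sup>2) (z + norm y *\<^sub>R b)) \<le> 2 * C2 * ((norm y)\<^sup>2 / norm z)" if b: "b \<in> Basis" for b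
      proof -
        define l r where "l = norm y" and "r = norm (z + norm y *\<^sub>R b)"
        have l: "0 < l" "0 \<le> r" using y by (auto simp: l_def r_def)
        have "norm z \<le> r + l"
          using norm_triangle_ineq4[of "z + norm y *\<^sub>R b" "norm y *\<^sub>R b"] b by (simp add: l_def r_def)
        then have "r * norm z \<le> r * (r + l)"
          using l by (intro mult_left_mono) auto
        also have "\<dots> \<le> 2 * (l\<^sup>2 + r\<^sup>2)"
        proof -
          have "2 * (r * l) \<le> r * r + l * l"
            using sum_squares_bound[of r l] by (simp add: power2_eq_square)
          moreover have "0 \<le> r * r" "0 \<le> l * l"
            by simp_all
          ultimately show ?thesis
            unfolding power2_eq_square distrib_left by linarith
        qed
        finally have "r / (l\<^sup>2 + r\<^sup>2) \<le> 2 / norm z"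
          using z l by (simp add: field_simps add_pos_nonneg)
        then have "C2 * l\<^sup>2 * (r / (l\<^sup>2 + r\<^sup>2)) \<le> C2 * l\<^sup>2 * (2 / norm z)"
          using C2(1) by (intro mult_left_mono) auto
        moreover have "norm (X ((norm y)\<^sup>2) (z + norm y *\<^sub>R b)) \<le> C2 * l\<^sup>2 * r * (l\<^sup>2 + r\<^sup>2) powr (-1)"
          using X_norm[OF T, of "z + norm y *\<^sub>R b"] by (simp add: l_def r_def)
        moreover have "(l\<^sup>2 + r\<^sup>2) powr (-1) = 1 / (l\<^sup>2 + r\<^sup>2)"
          using l by (simp add: powr_minus_divide add_pos_nonneg)
        ultimately show ?thesis
          by (simp add: l_def mult_ac)
      qed
      have "norm (rotation_field \<epsilon> y z) \<le> exp 1 / norm y * (n * (2 * (C * norm y powr (-s)) * (2 * C2 * ((norm y)\<^sup>2 / norm z))))"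
        unfolding rf by (intro bound y \<epsilon> Xb)
      also have "\<dots> = (exp 1 * n * 4 * C2 * C) * (norm y powr (-s) * (norm y / norm z))"
        using y by (simp add: power2_eq_square field_simps)
      also have "\<dots> \<le> C1 * (norm y powr (-s) * (norm y / norm z) + norm (z - y) powr (-s) + norm (z + y) powr (-s))"
        using C(1) C2(1) n by (intro mult_mono) (auto simp: C1_def)
      finally show "norm (rotation_field \<epsilon> y z) \<le> C1 * (norm y powr (-s) * (norm y / norm z) + norm (z - y) powr (-s) + norm (z + y) powr (-s))" .
    next
      define m where "m = (s + 1) / 2"
      have m: "0 \<le> m" using s by (simp add: m_def)
      \<comment> \<open>The worst case over T between \<delta>^2 and S^2: the positive power is
        taken at S^2, the inverse one at \<delta>^2.\<close>
      define AX where "AX = 4 * (C3 * (S\<^sup>2) powr m) * (2 / min (\<delta>\<^sup>2) 1) powr m"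
      define A where "A = exp 1 / \<delta> * (\<Sum>b\<in>(Basis::'a set). (1 + S) powr (s + 1) * (2 * (C * \<delta> powr (-s)) * AX))"
      have "decay s A (rotation_field \<epsilon> y)" if y: "\<delta> \<le> norm y" "norm y \<le> S" for y :: 'a
      proof -
        define l where "l = norm y"
        have l: "0 < l" "\<delta> \<le> l" "l \<le> S" using y \<delta> by (auto simp: l_def)
        have y0: "y \<noteq> 0" using y \<delta> by auto
        have sq: "\<delta>\<^sup>2 \<le> l\<^sup>2" "l\<^sup>2 \<le> S\<^sup>2"
          using l \<delta> by (auto intro!: power_mono)
        have dX: "decay s AX (X (l\<^sup>2))"
        proof (rule decay_mono)
          show "decay s (4 * (C3 * (l\<^sup>2) powr m) * (2 / min (l\<^sup>2) 1) powr m) (X (l\<^sup>2))"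
            unfolding X_def m_def using l by (intro C3(2)) simp
          show "4 * (C3 * (l\<^sup>2) powr m) * (2 / min (l\<^sup>2) 1) powr m \<le> AX"
            unfolding AX_def using sq m C3(1) l \<delta>
            by (intro mult_mono mult_left_mono powr_mono2 divide_left_mono min.mono) auto
        qed
        have e: "norm (?K y) \<le> C * \<delta> powr (-s)"
        proof -
          have "norm (?K y) \<le> C * l powr (-s)"
            unfolding l_def by (rule C(2)[OF \<epsilon> y0])
          also have "\<dots> \<le> C * \<delta> powr (-s)"
            using C(1) l \<delta> s by (intro mult_left_mono powr_mono2') auto
          finally show ?thesis .
        qed
        have dF: "decay s ((1 + S) powr (s + 1) * (2 * (C * \<delta> powr (-s)) * AX)) (\<lambda>z. rotation (?K y) b (X (l\<^sup>2) (z + l *\<^sub>R b)))"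
          if b: "b \<in> Basis" for b
        proof (rule decay_shift[OF _ s])
          show "decay s (2 * (C * \<delta> powr (-s)) * AX) (\<lambda>z. rotation (?K y) b (X (l\<^sup>2) z))"
          proof (rule decay_bounded_linear[OF dX bounded_linear_rotation])
            fix v
            have "norm (rotation (?K y) b v) \<le> 2 * norm (?K y) * norm v"
              using b by (intro norm_rotation) simp
            also have "\<dots> \<le> 2 * (C * \<delta> powr (-s)) * norm v"
              using e by (intro mult_right_mono) auto
            finally show "norm (rotation (?K y) b v) \<le> 2 * (C * \<delta> powr (-s)) * norm v" .
          qed (use C(1) in auto)
          show "norm (l *\<^sub>R b) \<le> S" using b l by simp
        qed
        have dS: "decay s (\<Sum>b\<in>(Basis::'a set). (1 + S) powr (s + 1) * (2 * (C * \<delta> powr (-s)) * AX))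
            (\<lambda>z. \<Sum>b\<in>Basis. rotation (?K y) b (X (l\<^sup>2) (z + l *\<^sub>R b)))"
          by (intro decay_sum dF) auto
        have d1: "decay s (\<bar>c y\<bar> * (\<Sum>b\<in>(Basis::'a set). (1 + S) powr (s + 1) * (2 * (C * \<delta> powr (-s)) * AX))) (rotation_field \<epsilon> y)"
          unfolding rf[abs_def] l_def[symmetric] by (rule decay_scaleR[OF dS])
        have d2: "\<bar>c y\<bar> \<le> exp 1 / \<delta>"
        proof -
          have "\<bar>c y\<bar> \<le> exp 1 / l"
            using c[OF y0] by (simp add: l_def)
          also have "\<dots> \<le> exp 1 / \<delta>"
            using l \<delta> by (intro divide_left_mono) auto
          finally show ?thesis .
        qed
        show ?thesis
          unfolding A_def by (rule decay_mono[OF d1 mult_right_mono[OF d2 decay_nonneg[OF dS]]])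
      qed
      then show "\<exists>A. \<forall>y::'a. \<delta> \<le> norm y \<longrightarrow> norm y \<le> S \<longrightarrow> decay s A (rotation_field \<epsilon> y)"
        by (intro exI[of _ A] allI impI)
    qed
  qed
qed

end

subsection \<open>Pairing with a function of finite variation\<close>

lemma integrable_gauss_norm: "integrable lborel (\<lambda>u::'a::euclidean_space. exp (-((norm u)\<^sup>2)))"
  using integrable_gauss[of 1, where 'a='a] by simp

text \<open>For r > 0 the convolution of h with an unnormalised heat kernel of time proportional to
  r^2, rescaled to a fixed Gaussian so that r -> 0 becomes dominated convergence.\<close>

definition gauss_average :: "('a::euclidean_space \<Rightarrow> real) \<Rightarrow> real \<Rightarrow> 'a \<Rightarrow> real" where
  "gauss_average h r x = (\<integral>u. exp (-((norm u)\<^sup>2)) * h (x - r *\<^sub>R u) \<partial>lborel)"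

lemma gauss_average_eq:
  fixes h :: "'a::euclidean_space \<Rightarrow> real"
  assumes [measurable]: "h \<in> borel_measurable borel" and r: "0 < r"
  shows "(\<integral>y. h y * ((r\<^sup>2) powr (- real DIM('a) / 2) * exp (-((norm (x - y))\<^sup>2 / r\<^sup>2))) \<partial>lborel) = gauss_average h r x"
proof -
  have p: "(r\<^sup>2) powr (- real DIM('a) / 2) = 1 / r ^ DIM('a)"
  proof -
    have "2 * (t / 2) = t" for t :: real by simp
    then have e: "2 * (- real DIM('a) / 2) = - real DIM('a)" .
    have "(r\<^sup>2) powr (- real DIM('a) / 2) = r powr (- real DIM('a))"
      unfolding square_powr[OF r] e ..
    also have "\<dots> = 1 / r ^ DIM('a)"
      using r powr_realpow[OF r, of "DIM('a)"] by (simp only: powr_minus_divide)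
    finally show ?thesis .
  qed
  have "(\<integral>y. h y * ((r\<^sup>2) powr (- real DIM('a) / 2) * exp (-((norm (x - y))\<^sup>2 / r\<^sup>2))) \<partial>lborel) =
    \<bar>- r\<bar> ^ DIM('a) *\<^sub>R (\<integral>u. h (x + (- r) *\<^sub>R u) * ((r\<^sup>2) powr (- real DIM('a) / 2) * exp (-((norm (x - (x + (- r) *\<^sub>R u)))\<^sup>2 / r\<^sup>2))) \<partial>lborel)"
    using r by (intro integral_lborel_affine) auto
  also have "\<dots> = (\<integral>u. \<bar>- r\<bar> ^ DIM('a) *\<^sub>R (h (x + (- r) *\<^sub>R u) * ((r\<^sup>2) powr (- real DIM('a) / 2) * exp (-((norm (x - (x + (- r) *\<^sub>R u)))\<^sup>2 / r\<^sup>2)))) \<partial>lborel)"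
    by (simp only: Bochner_Integration.integral_scaleR_right)
  also have "\<dots> = gauss_average h r x"
    unfolding gauss_average_def p using r
    by (intro Bochner_Integration.integral_cong) (auto simp: power_mult_distrib)
  finally show ?thesis .
qed

text \<open>Peetre's inequality, uniform in r \<le> 1. With m = n the averages stay below the weight
  that L^p functions can be integrated against.\<close>

lemma gauss_average_bound:
  fixes h :: "'a::euclidean_space \<Rightarrow> real"
  assumes [measurable]: "h \<in> borel_measurable borel" and r: "0 \<le> r" "r \<le> 1"
    and h: "\<And>y. \<bar>h y\<bar> \<le> M * (1 + norm y) powr (- m)" and m: "0 \<le> m"
  shows "\<bar>gauss_average h r x\<bar> \<le> M * (\<integral>u. (1 + norm (u::'a)) powr m * exp (-((norm u)\<^sup>2)) \<partial>lborel) * (1 + norm x) powr (- m)"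
proof -
  have M: "0 \<le> M"
    using order_trans[OF abs_ge_zero h[of 0]] by simp
  let ?w = "\<lambda>u::'a. (1 + norm u) powr m * exp (-((norm u)\<^sup>2))"
  have bd: "\<bar>exp (-((norm u)\<^sup>2)) * h (x - r *\<^sub>R u)\<bar> \<le> M * (1 + norm x) powr (- m) * ?w u" for u
  proof -
    have "norm x \<le> norm (x - r *\<^sub>R u) + norm (r *\<^sub>R u)"
      using norm_triangle_ineq[of "x - r *\<^sub>R u" "r *\<^sub>R u"] by simp
    also have "norm (r *\<^sub>R u) \<le> norm u"
      using r by (simp add: mult_left_le_one_le)
    finally have "(1 + norm (x - r *\<^sub>R u)) powr (- m) \<le> (1 + norm u) powr m * (1 + norm x) powr (- m)"
      using m by (intro powr_one_plus_shift) auto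
    then have "M * (1 + norm (x - r *\<^sub>R u)) powr (- m) \<le> M * ((1 + norm u) powr m * (1 + norm x) powr (- m))"
      using M by (intro mult_left_mono)
    then have "\<bar>h (x - r *\<^sub>R u)\<bar> \<le> M * ((1 + norm u) powr m * (1 + norm x) powr (- m))"
      using h[of "x - r *\<^sub>R u"] by linarith
    then have "exp (-((norm u)\<^sup>2)) * \<bar>h (x - r *\<^sub>R u)\<bar> \<le> exp (-((norm u)\<^sup>2)) * (M * ((1 + norm u) powr m * (1 + norm x) powr (- m)))"
      by (intro mult_left_mono) auto
    then show ?thesis
      by (simp add: abs_mult mult_ac)
  qed
  have w: "integrable lborel (\<lambda>u. M * (1 + norm x) powr (- m) * ?w u)"
    by (intro integrable_mult_right integrable_gauss_weight)
  have "\<bar>gauss_average h r x\<bar> \<le> (\<integral>u. \<bar>exp (-((norm u)\<^sup>2)) * h (x - r *\<^sub>R u)\<bar> \<partial>lborel)"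
    unfolding gauss_average_def by (rule integral_abs_bound)
  also have "\<dots> \<le> (\<integral>u. M * (1 + norm x) powr (- m) * ?w u \<partial>lborel)"
    using M bd by (intro integral_mono_AE' w AE_I2) auto
  also have "\<dots> = M * (\<integral>u. ?w u \<partial>lborel) * (1 + norm x) powr (- m)"
    unfolding integral_mult_right_zero by (simp only: mult_ac)
  finally show ?thesis .
qed

lemma gauss_average_tendsto:
  fixes h :: "'a::euclidean_space \<Rightarrow> real"
  assumes h: "continuous_on UNIV h" "\<And>y. \<bar>h y\<bar> \<le> M"
  shows "(\<lambda>k. gauss_average h (1 / real (Suc k)) x) \<longlonglongrightarrow> gauss_total TYPE('a) * h x"
proof -
  have [measurable]: "h \<in> borel_measurable borel"
    using h(1) by (rule borel_measurable_continuous_onI)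
  have "(\<lambda>k. gauss_average h (1 / real (Suc k)) x) \<longlonglongrightarrow> (\<integral>u. exp (-((norm (u::'a))\<^sup>2)) * h x \<partial>lborel)"
    unfolding gauss_average_def
  proof (rule integral_dominated_convergence)
    show "integrable lborel (\<lambda>u::'a. exp (-((norm u)\<^sup>2)) * M)"
      by (intro integrable_mult_left integrable_gauss_norm)
    show "AE u in lborel. norm (exp (-((norm u)\<^sup>2)) * h (x - (1 / real (Suc k)) *\<^sub>R u)) \<le> exp (-((norm u)\<^sup>2)) * M" for k
      using h(2) by (intro AE_I2) (simp add: abs_mult mult_left_mono)
    show "AE u in lborel. (\<lambda>k. exp (-((norm u)\<^sup>2)) * h (x - (1 / real (Suc k)) *\<^sub>R u)) \<longlonglongrightarrow> exp (-((norm u)\<^sup>2)) * h x"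
    proof (intro AE_I2 tendsto_mult tendsto_const)
      fix u :: 'a
      have "(\<lambda>k. 1 / real (Suc k)) \<longlonglongrightarrow> 0"
        using LIMSEQ_inverse_real_of_nat by (simp add: divide_inverse)
      then have "(\<lambda>k. x - (1 / real (Suc k)) *\<^sub>R u) \<longlonglongrightarrow> x - 0 *\<^sub>R u"
        by (intro tendsto_intros)
      then have "(\<lambda>k. x - (1 / real (Suc k)) *\<^sub>R u) \<longlonglongrightarrow> x"
        by simp
      moreover have "isCont h x"
        using h(1) by (simp add: continuous_on_eq_continuous_at)
      ultimately show "(\<lambda>k. h (x - (1 / real (Suc k)) *\<^sub>R u)) \<longlonglongrightarrow> h x"
        by (rule isCont_tendsto_compose[rotated])
    qed
  qed auto
  then show ?thesis
    by (simp add: gauss_total_def)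
qed

context
  fixes \<alpha> :: real
  assumes \<alpha>: "0 < \<alpha>" "\<alpha> < 1"
begin

text \<open>The two cancellations enter only through the last hypothesis: a correction must exist
  for every \<epsilon> with the same C1, and its divergence must not be seen by h. The corrected
  field then has the Gaussian average of h as divergence, up to a factor, and \<epsilon> -> 0
  returns h.\<close>

lemma variation_controls_pairing:
  assumes C1: "0 \<le> C1"
  shows "\<exists>C\<ge>0. \<forall>p. \<forall>f::real ^ 'n \<Rightarrow> real. \<forall>x0 h \<delta> S. 1 \<le> p \<longrightarrow> f \<in> Lp p \<longrightarrow> frac_variation \<alpha> f < \<infinity> \<longrightarrow>
    continuous_on UNIV h \<longrightarrow> 0 < \<delta> \<longrightarrow> (\<forall>y. h y \<noteq> 0 \<longrightarrow> \<delta> \<le> norm y \<and> norm y \<le> S) \<longrightarrow> (\<forall>y. \<bar>h y\<bar> \<le> norm y powr (-\<alpha>)) \<longrightarrow>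
    (\<forall>\<epsilon>>0. \<exists>R. correction \<alpha> \<epsilon> C1 \<delta> S R \<and>
       (\<forall>x. (\<integral>y. h y * (fdiv \<alpha> (riesz_kernel \<alpha> \<epsilon>) (x - y) + fdiv \<alpha> (R y) x) \<partial>lborel) =
            (\<integral>y. h y * fdiv \<alpha> (riesz_kernel \<alpha> \<epsilon>) (x - y) \<partial>lborel))) \<longrightarrow>
    \<bar>LINT x|lebesgue. f x * h (x - x0)\<bar> \<le> C * real_of_ereal (frac_variation \<alpha> f)"
proof -
  define n where "n = real CARD('n)"
  obtain C0 where C0: "C0 > 0" "\<And>\<epsilon> \<delta> S h R. 0 < \<epsilon> \<Longrightarrow> 0 < \<delta> \<Longrightarrow> correction \<alpha> \<epsilon> C1 \<delta> S R \<Longrightarrow> h \<in> borel_measurable borel \<Longrightarrow>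
     (\<forall>y::real ^ 'n. \<bar>h y\<bar> \<le> norm y powr (-\<alpha>)) \<Longrightarrow> (\<forall>y. h y \<noteq> 0 \<longrightarrow> \<delta> \<le> norm y \<and> norm y \<le> S) \<Longrightarrow>
     (\<exists>A. decay (n - \<alpha>) A (\<lambda>z. \<integral>y. h y *\<^sub>R (riesz_kernel \<alpha> \<epsilon> (z - y) + R y z) \<partial>lborel)) \<and>
     (\<forall>z. norm (\<integral>y. h y *\<^sub>R (riesz_kernel \<alpha> \<epsilon> (z - y) + R y z) \<partial>lborel) \<le> C0) \<and>
     (\<forall>x. fdiv \<alpha> (\<lambda>z. \<integral>y. h y *\<^sub>R (riesz_kernel \<alpha> \<epsilon> (z - y) + R y z) \<partial>lborel) x =
        (\<integral>y. h y * (fdiv \<alpha> (riesz_kernel \<alpha> \<epsilon>) (x - y) + fdiv \<alpha> (R y) x) \<partial>lborel))"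
    using corrected_field[OF \<alpha> C1, where 'a="real ^ 'n"] unfolding n_def by auto
  obtain \<kappa> where \<kappa>: "\<kappa> > 0" "\<And>\<epsilon> x. 0 < \<epsilon> \<Longrightarrow> fdiv \<alpha> (riesz_kernel \<alpha> \<epsilon>) (x::real ^ 'n) = \<kappa> * (\<epsilon> powr (- n / 2) * exp (-((norm x)\<^sup>2 / \<epsilon>)))"
    using fdiv_riesz_kernel[OF \<alpha>, where 'a="real ^ 'n"] unfolding n_def by auto
  define G where "G = gauss_total TYPE(real ^ 'n)"
  have G: "G > 0" unfolding G_def by (rule gauss_total_pos)
  define fc where "fc = frac_const CARD('n) \<alpha>"
  have fc: "fc > 0" unfolding fc_def using \<alpha> by (rule frac_const_pos)
  show ?thesis
  \<comment> \<open>C0 bounds the fields; the denominator collects the normalisation of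
    \<open>frac_div\<close>, the factor of the Gaussian divergence, and the Gaussian mass that
    appears in the limit.\<close>
  proof (rule exI[of _ "C0 / (fc * \<kappa> * G)"], intro conjI allI impI)
    show "0 \<le> C0 / (fc * \<kappa> * G)"
      using C0(1) fc \<kappa>(1) G by simp
    fix p and f :: "real ^ 'n \<Rightarrow> real" and x0 :: "real ^ 'n" and h :: "real ^ 'n \<Rightarrow> real" and \<delta> S :: real
    assume p: "1 \<le> p" and f: "f \<in> Lp p" and V: "frac_variation \<alpha> f < \<infinity>" and hc: "continuous_on UNIV h"
      and \<delta>: "0 < \<delta>" and hs: "\<forall>y. h y \<noteq> 0 \<longrightarrow> \<delta> \<le> norm y \<and> norm y \<le> S" and hb: "\<forall>y. \<bar>h y\<bar> \<le> norm y powr (-\<alpha>)"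
      and corr: "\<forall>\<epsilon>>0. \<exists>R. correction \<alpha> \<epsilon> C1 \<delta> S R \<and>
       (\<forall>x. (\<integral>y. h y * (fdiv \<alpha> (riesz_kernel \<alpha> \<epsilon>) (x - y) + fdiv \<alpha> (R y) x) \<partial>lborel) =
            (\<integral>y. h y * fdiv \<alpha> (riesz_kernel \<alpha> \<epsilon>) (x - y) \<partial>lborel))"
    define v where "v = real_of_ereal (frac_variation \<alpha> f)"
    have hm [measurable]: "h \<in> borel_measurable borel"
      using hc by (rule borel_measurable_continuous_onI)
    note [measurable] = Lp_borel[OF \<alpha> p f]
    define H where "H k x = gauss_average h (1 / real (Suc k)) (x - x0)" for k and x :: "real ^ 'n"
    have pairing: "\<bar>\<kappa> * (LINT x|lebesgue. f x * H k x)\<bar> \<le> C0 * v / fc" for k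
    proof -
      define r where "r = 1 / real (Suc k)"
      have r: "0 < r" by (simp add: r_def)
      define \<epsilon> where "\<epsilon> = r\<^sup>2"
      have \<epsilon>: "0 < \<epsilon>" using r by (simp add: \<epsilon>_def)
      obtain R where R: "correction \<alpha> \<epsilon> C1 \<delta> S R" "\<And>x. (\<integral>y. h y * (fdiv \<alpha> (riesz_kernel \<alpha> \<epsilon>) (x - y) + fdiv \<alpha> (R y) x) \<partial>lborel) =
            (\<integral>y. h y * fdiv \<alpha> (riesz_kernel \<alpha> \<epsilon>) (x - y) \<partial>lborel)"
        using corr \<epsilon> by blast
      define \<phi> where "\<phi> z = (\<integral>y. h y *\<^sub>R (riesz_kernel \<alpha> \<epsilon> (z - y) + R y z) \<partial>lborel)" for z
      have \<phi>: "\<exists>A. decay (n - \<alpha>) A \<phi>" "\<And>z. norm (\<phi> z) \<le> C0"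
         "\<And>x. fdiv \<alpha> \<phi> x = (\<integral>y. h y * (fdiv \<alpha> (riesz_kernel \<alpha> \<epsilon>) (x - y) + fdiv \<alpha> (R y) x) \<partial>lborel)"
        using C0(2)[OF \<epsilon> \<delta> R(1) hm hb hs] unfolding \<phi>_def[abs_def] by auto
      have \<phi>_div: "fdiv \<alpha> \<phi> x = \<kappa> * gauss_average h r x" for x
      proof -
        have "fdiv \<alpha> \<phi> x = (\<integral>y. \<kappa> * (h y * (\<epsilon> powr (- n / 2) * exp (-((norm (x - y))\<^sup>2 / \<epsilon>)))) \<partial>lborel)"
          unfolding \<phi>(3) R(2) unfolding \<kappa>(2)[OF \<epsilon>] by (simp only: mult_ac)
        also have "\<dots> = \<kappa> * gauss_average h r x"
          unfolding integral_mult_right_zero \<epsilon>_def using gauss_average_eq[OF hm r, of x] by (simp add: n_def)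
        finally show ?thesis .
      qed
      obtain A where A: "decay (n - \<alpha>) A \<phi>"
        using \<phi>(1) by blast
      have s: "0 \<le> n - \<alpha>"
        using DIM_minus_alpha_pos[OF \<alpha>, where 'a="real ^ 'n"] by (simp add: n_def)
      have "decay (real CARD('n) - \<alpha>) ((1 + norm x0) powr (n - \<alpha> + 1) * A) (\<lambda>z. \<phi> (z + - x0))"
        using decay_shift[OF A s, of "- x0" "norm x0"] by (simp add: n_def)
      from integral_times_fdiv_bound[OF \<alpha> p f V this \<phi>(2) C0(1)]
      have "\<bar>LINT x|lebesgue. f x * fdiv \<alpha> (\<lambda>z. \<phi> (z + - x0)) x\<bar> \<le> C0 * v / fc"
        by (simp only: v_def fc_def)
      moreover have "fdiv \<alpha> (\<lambda>z. \<phi> (z + - x0)) x = \<kappa> * H k x" for x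
        unfolding fdiv_shift[OF \<alpha>] \<phi>_div H_def r_def by simp
      then have "(LINT x|lebesgue. f x * fdiv \<alpha> (\<lambda>z. \<phi> (z + - x0)) x) = (LINT x|lebesgue. \<kappa> * (f x * H k x))"
        by (intro Bochner_Integration.integral_cong) auto
      ultimately show ?thesis
        by (simp only: integral_mult_right_zero)
    qed
    define M where "M = \<delta> powr (-\<alpha>) * (1 + S) powr n"
    have hM: "\<bar>h y\<bar> \<le> M * (1 + norm y) powr (- n)" for y
    proof (cases "h y = 0")
      case True
      then show ?thesis by (simp add: M_def)
    next
      case False
      then have y: "\<delta> \<le> norm y" "norm y \<le> S" using hs by auto
      have "\<bar>h y\<bar> \<le> norm y powr (-\<alpha>)" using hb by auto
      also have "\<dots> \<le> \<delta> powr (-\<alpha>) * 1"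
        using y \<delta> \<alpha> by (simp add: powr_mono2')
      also have "1 \<le> (1 + S) powr n * (1 + norm y) powr (- n)"
        using powr_one_plus_shift[of "norm y" 0 S n] y \<delta> by (simp add: n_def)
      finally show ?thesis
        by (simp add: M_def mult.assoc mult_left_mono)
    qed
    have hM': "\<bar>h y\<bar> \<le> M" for y
    proof -
      have "(1 + norm y) powr (- n) \<le> 1"
        using powr_mono2'[of "- n" 1 "1 + norm y"] by (simp add: n_def)
      then have "M * (1 + norm y) powr (- n) \<le> M * 1"
        by (intro mult_left_mono) (auto simp: M_def)
      then show ?thesis
        using hM[of y] by simp
    qed
    define W where "W = M * (\<integral>u. (1 + norm (u::real ^ 'n)) powr n * exp (-((norm u)\<^sup>2)) \<partial>lborel)"
    have W: "0 \<le> W"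
      unfolding W_def by (intro mult_nonneg_nonneg integral_nonneg_AE) (auto simp: M_def)
    have Hb: "\<bar>H k x\<bar> \<le> W * (1 + norm x0) powr n * (1 + norm x) powr (- n)" for k x
    proof -
      have "\<bar>H k x\<bar> \<le> W * (1 + norm (x - x0)) powr (- n)"
        unfolding H_def W_def by (intro gauss_average_bound hM) (auto simp: n_def)
      also have "\<dots> \<le> W * ((1 + norm x0) powr n * (1 + norm x) powr (- n))"
        using norm_triangle_ineq[of "x - x0" x0] W
        by (intro mult_left_mono powr_one_plus_shift) (auto simp: n_def)
      finally show ?thesis by (simp add: mult.assoc)
    qed
    have Hm [measurable]: "H k \<in> borel_measurable lebesgue" for k
    proof -
      have "H k \<in> borel_measurable borel"
        unfolding H_def gauss_average_def by measurable
      then show ?thesis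
        by (intro measurable_completion) simp
    qed
    have "(\<lambda>k. LINT x|lebesgue. f x * H k x) \<longlonglongrightarrow> (LINT x|lebesgue. f x * (G * h (x - x0)))"
    proof (rule integral_dominated_convergence)
      show "integrable lebesgue (\<lambda>x. (W * (1 + norm x0) powr n) * (\<bar>f x\<bar> * (1 + norm x) powr (- n)))"
        unfolding n_def by (intro integrable_mult_right Lp_integrable_weight[OF f p])
      show "AE x in lebesgue. norm (f x * H k x) \<le> (W * (1 + norm x0) powr n) * (\<bar>f x\<bar> * (1 + norm x) powr (- n))" for k
      proof (intro AE_I2)
        fix x
        have "\<bar>f x\<bar> * \<bar>H k x\<bar> \<le> \<bar>f x\<bar> * (W * (1 + norm x0) powr n * (1 + norm x) powr (- n))"
          by (intro mult_left_mono Hb) auto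
        then show "norm (f x * H k x) \<le> (W * (1 + norm x0) powr n) * (\<bar>f x\<bar> * (1 + norm x) powr (- n))"
          by (simp add: abs_mult mult_ac)
      qed
      show "AE x in lebesgue. (\<lambda>k. f x * H k x) \<longlonglongrightarrow> f x * (G * h (x - x0))"
        unfolding H_def G_def using hc hM' by (intro AE_I2 tendsto_mult tendsto_const gauss_average_tendsto)
      have "(\<lambda>x. h (x - x0)) \<in> borel_measurable lebesgue"
        by (intro measurable_completion) measurable
      then show "(\<lambda>x. f x * (G * h (x - x0))) \<in> borel_measurable lebesgue"
        by measurable
    qed measurable
    then have "(\<lambda>k. \<bar>\<kappa> * (LINT x|lebesgue. f x * H k x)\<bar>) \<longlonglongrightarrow> \<bar>\<kappa> * (LINT x|lebesgue. f x * (G * h (x - x0)))\<bar>"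
      by (intro tendsto_intros)
    then have "\<bar>\<kappa> * (LINT x|lebesgue. f x * (G * h (x - x0)))\<bar> \<le> C0 * v / fc"
      by (rule LIMSEQ_le_const2) (use pairing in auto)
    moreover have "(LINT x|lebesgue. f x * (G * h (x - x0))) = G * (LINT x|lebesgue. f x * h (x - x0))"
      by (simp add: mult.left_commute)
    ultimately have "\<kappa> * (G * \<bar>LINT x|lebesgue. f x * h (x - x0)\<bar>) \<le> C0 * v / fc"
      using \<kappa>(1) G by (simp add: abs_mult)
    then show "\<bar>LINT x|lebesgue. f x * h (x - x0)\<bar> \<le> C0 / (fc * \<kappa> * G) * real_of_ereal (frac_variation \<alpha> f)"
      using \<kappa>(1) G fc by (simp add: v_def field_simps)
  qed
qed

text \<open>For even h the symmetrising correction has a divergence odd in y, which integrates to 0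
  against h. For dimension at least 2 the divergence of the rotation correction is 0 pointwise, so h
  needs no symmetry.\<close>

lemma pairing_bound:
  "\<exists>C\<ge>0. \<forall>p. \<forall>f::real ^ 'n \<Rightarrow> real. \<forall>x0 h \<delta> S. 1 \<le> p \<longrightarrow> f \<in> Lp p \<longrightarrow> frac_variation \<alpha> f < \<infinity> \<longrightarrow>
    continuous_on UNIV h \<longrightarrow> 0 < \<delta> \<longrightarrow> (\<forall>y. h y \<noteq> 0 \<longrightarrow> \<delta> \<le> norm y \<and> norm y \<le> S) \<longrightarrow> (\<forall>y. \<bar>h y\<bar> \<le> norm y powr (-\<alpha>)) \<longrightarrow>
    (\<forall>y. h (- y) = h y) \<or> 2 \<le> CARD('n) \<longrightarrow>
    \<bar>LINT x|lebesgue. f x * h (x - x0)\<bar> \<le> C * real_of_ereal (frac_variation \<alpha> f)"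
proof -
  obtain \<kappa> where \<kappa>: "\<kappa> > 0" "\<And>\<epsilon> x. 0 < \<epsilon> \<Longrightarrow> fdiv \<alpha> (riesz_kernel \<alpha> \<epsilon>) (x::real ^ 'n) = \<kappa> * (\<epsilon> powr (- real CARD('n) / 2) * exp (-((norm x)\<^sup>2 / \<epsilon>)))"
    using fdiv_riesz_kernel[OF \<alpha>, where 'a="real ^ 'n"] by auto
  obtain Ce where Ce: "Ce \<ge> 0" "\<And>\<epsilon> \<delta> S. 0 < \<epsilon> \<Longrightarrow> correction \<alpha> \<epsilon> Ce \<delta> S
     (\<lambda>y z::real ^ 'n. (1/2) *\<^sub>R riesz_kernel \<alpha> \<epsilon> (z + y) + (-(1/2)) *\<^sub>R riesz_kernel \<alpha> \<epsilon> (z + - y))"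
    using even_correction[OF \<alpha>, where 'a="real ^ 'n"] by blast
  \<comment> \<open>In dimension one the condition is vacuous, so the constant can be fixed before
    the cases are separated.\<close>
  have "\<exists>Cr\<ge>0. 2 \<le> CARD('n) \<longrightarrow> (\<forall>\<epsilon>>0. \<forall>\<delta>>0. \<forall>S. correction \<alpha> \<epsilon> Cr \<delta> S (rotation_field \<alpha> \<epsilon> :: real ^ 'n \<Rightarrow> real ^ 'n \<Rightarrow> real ^ 'n))"
    using rotation_correction[OF \<alpha>, where 'a="real ^ 'n"] by (cases "2 \<le> CARD('n)") auto
  then obtain Cr where Cr: "Cr \<ge> 0" "\<And>\<epsilon> \<delta> S. 2 \<le> CARD('n) \<Longrightarrow> 0 < \<epsilon> \<Longrightarrow> 0 < \<delta> \<Longrightarrow>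
     correction \<alpha> \<epsilon> Cr \<delta> S (rotation_field \<alpha> \<epsilon> :: real ^ 'n \<Rightarrow> real ^ 'n \<Rightarrow> real ^ 'n)"
    by blast
  obtain Ke where Ke0: "0 \<le> Ke" and Ke: "\<forall>p. \<forall>f::real ^ 'n \<Rightarrow> real. \<forall>x0 h \<delta> S. 1 \<le> p \<longrightarrow> f \<in> Lp p \<longrightarrow> frac_variation \<alpha> f < \<infinity> \<longrightarrow>
    continuous_on UNIV h \<longrightarrow> 0 < \<delta> \<longrightarrow> (\<forall>y. h y \<noteq> 0 \<longrightarrow> \<delta> \<le> norm y \<and> norm y \<le> S) \<longrightarrow> (\<forall>y. \<bar>h y\<bar> \<le> norm y powr (-\<alpha>)) \<longrightarrow>
    (\<forall>\<epsilon>>0. \<exists>R. correction \<alpha> \<epsilon> Ce \<delta> S R \<and>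
       (\<forall>x. (\<integral>y. h y * (fdiv \<alpha> (riesz_kernel \<alpha> \<epsilon>) (x - y) + fdiv \<alpha> (R y) x) \<partial>lborel) =
            (\<integral>y. h y * fdiv \<alpha> (riesz_kernel \<alpha> \<epsilon>) (x - y) \<partial>lborel))) \<longrightarrow>
    \<bar>LINT x|lebesgue. f x * h (x - x0)\<bar> \<le> Ke * real_of_ereal (frac_variation \<alpha> f)"
    using variation_controls_pairing[OF Ce(1), where 'n='n] by (elim exE conjE) (rule that)
  obtain Kr where Kr0: "0 \<le> Kr" and Kr: "\<forall>p. \<forall>f::real ^ 'n \<Rightarrow> real. \<forall>x0 h \<delta> S. 1 \<le> p \<longrightarrow> f \<in> Lp p \<longrightarrow> frac_variation \<alpha> f < \<infinity> \<longrightarrow>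
    continuous_on UNIV h \<longrightarrow> 0 < \<delta> \<longrightarrow> (\<forall>y. h y \<noteq> 0 \<longrightarrow> \<delta> \<le> norm y \<and> norm y \<le> S) \<longrightarrow> (\<forall>y. \<bar>h y\<bar> \<le> norm y powr (-\<alpha>)) \<longrightarrow>
    (\<forall>\<epsilon>>0. \<exists>R. correction \<alpha> \<epsilon> Cr \<delta> S R \<and>
       (\<forall>x. (\<integral>y. h y * (fdiv \<alpha> (riesz_kernel \<alpha> \<epsilon>) (x - y) + fdiv \<alpha> (R y) x) \<partial>lborel) =
            (\<integral>y. h y * fdiv \<alpha> (riesz_kernel \<alpha> \<epsilon>) (x - y) \<partial>lborel))) \<longrightarrow>
    \<bar>LINT x|lebesgue. f x * h (x - x0)\<bar> \<le> Kr * real_of_ereal (frac_variation \<alpha> f)"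
    using variation_controls_pairing[OF Cr(1), where 'n='n] by (elim exE conjE) (rule that)
  show ?thesis
  proof (rule exI[of _ "Ke + Kr"], intro conjI allI impI)
    show "0 \<le> Ke + Kr" using Ke0 Kr0 by simp
    fix p and f :: "real ^ 'n \<Rightarrow> real" and x0 :: "real ^ 'n" and h :: "real ^ 'n \<Rightarrow> real" and \<delta> S :: real
    assume p: "1 \<le> p" and f: "f \<in> Lp p" and V: "frac_variation \<alpha> f < \<infinity>" and hc: "continuous_on UNIV h"
      and \<delta>: "0 < \<delta>" and hs: "\<forall>y. h y \<noteq> 0 \<longrightarrow> \<delta> \<le> norm y \<and> norm y \<le> S" and hb: "\<forall>y. \<bar>h y\<bar> \<le> norm y powr (-\<alpha>)"
      and cases: "(\<forall>y. h (- y) = h y) \<or> 2 \<le> CARD('n)"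
    have V0: "0 \<le> real_of_ereal (frac_variation \<alpha> f)"
      using frac_variation_nonneg[OF \<alpha> p f] by (rule real_of_ereal_pos)
    have hm [measurable]: "h \<in> borel_measurable borel"
      using hc by (rule borel_measurable_continuous_onI)
    show "\<bar>LINT x|lebesgue. f x * h (x - x0)\<bar> \<le> (Ke + Kr) * real_of_ereal (frac_variation \<alpha> f)"
      using cases
    proof
      assume ev: "\<forall>y. h (- y) = h y"
      have "\<bar>LINT x|lebesgue. f x * h (x - x0)\<bar> \<le> Ke * real_of_ereal (frac_variation \<alpha> f)"
      proof (rule Ke[THEN spec, THEN spec, THEN spec, THEN spec, THEN spec, THEN spec, THEN mp, OF p, THEN mp, OF f, THEN mp, OF V,
          THEN mp, OF hc, THEN mp, OF \<delta>, THEN mp, OF hs, THEN mp, OF hb, THEN mp], intro allI impI)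
        fix \<epsilon> :: real assume \<epsilon>: "0 < \<epsilon>"
        let ?K = "riesz_kernel \<alpha> \<epsilon> :: real ^ 'n \<Rightarrow> real ^ 'n"
        define R where "R y z = (1/2) *\<^sub>R ?K (z + y) + (-(1/2)) *\<^sub>R ?K (z + - y)" for y z
        obtain A where A: "decay (real CARD('n) - \<alpha>) A ?K"
          using riesz_kernel_decay[OF \<alpha> \<epsilon>, where 'a="real ^ 'n"] by auto
        have s: "0 \<le> real CARD('n) - \<alpha>"
          using DIM_minus_alpha_pos[OF \<alpha>, where 'a="real ^ 'n"] by simp
        define D where "D x = fdiv \<alpha> ?K x" for x
        have Dm [measurable]: "D \<in> borel_measurable borel"
          unfolding D_def by (intro fdiv_borel[OF \<alpha>] riesz_kernel_borel[OF \<alpha> \<epsilon>])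
        have sh: "decay (real CARD('n) - \<alpha>) ((1 + norm y) powr (real CARD('n) - \<alpha> + 1) * A) (\<lambda>z. ?K (z + y))" for y
          by (rule decay_shift[OF A s]) simp
        have RD: "fdiv \<alpha> (R y) x = 1/2 * D (x + y) + (-(1/2)) * D (x + - y)" for y x
        proof -
          have "fdiv \<alpha> (R y) x = fdiv \<alpha> (\<lambda>z. (1/2) *\<^sub>R ?K (z + y)) x + fdiv \<alpha> (\<lambda>z. (-(1/2)) *\<^sub>R ?K (z + - y)) x"
            unfolding R_def using decay_scaleR[OF sh[of y], of "1/2"] decay_scaleR[OF sh[of "- y"], of "-(1/2)"]
            by (intro fdiv_add[OF \<alpha>]) auto
          also have "\<dots> = 1/2 * D (x + y) + (-(1/2)) * D (x + - y)"
            unfolding fdiv_scaleR[OF \<alpha>] fdiv_shift[OF \<alpha>] D_def ..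
          finally show ?thesis .
        qed
        have Db: "\<bar>D x\<bar> \<le> \<kappa> * \<epsilon> powr (- real CARD('n) / 2)" for x
          unfolding D_def \<kappa>(2)[OF \<epsilon>] using \<kappa>(1) \<epsilon> by (simp add: abs_mult mult_left_le)
        have hi: "integrable lborel h"
        proof (rule Bochner_Integration.integrable_bound)
          show "integrable lborel (\<lambda>y::real ^ 'n. \<delta> powr (-\<alpha>) * indicator (cball 0 S) y)"
            using emeasure_lborel_cball_finite[of "0::real ^ 'n" S] by (intro integrable_mult_right integrable_real_indicator) auto
          have "\<bar>h y\<bar> \<le> \<delta> powr (-\<alpha>) * indicator (cball 0 S) y" for y
          proof (cases "h y = 0")
            case False
            then have y: "\<delta> \<le> norm y" "norm y \<le> S" using hs by auto
            have "\<bar>h y\<bar> \<le> norm y powr (-\<alpha>)" using hb by auto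
            also have "\<dots> \<le> \<delta> powr (-\<alpha>)"
              using y \<delta> \<alpha> by (intro powr_mono2') auto
            finally show ?thesis using y by simp
          qed simp
          then show "AE y in lborel. norm (h y) \<le> norm (\<delta> powr (-\<alpha>) * indicator (cball 0 S) y)"
            by simp
        qed measurable
        have hDi: "integrable lborel (\<lambda>y. h y * D (g y))" if [measurable]: "g \<in> borel_measurable borel" for g
        proof (rule Bochner_Integration.integrable_bound)
          show "integrable lborel (\<lambda>y. \<bar>h y\<bar> * (\<kappa> * \<epsilon> powr (- real CARD('n) / 2)))"
            by (intro integrable_mult_left integrable_abs hi)
          show "AE y in lborel. norm (h y * D (g y)) \<le> norm (\<bar>h y\<bar> * (\<kappa> * \<epsilon> powr (- real CARD('n) / 2)))"
            using Db \<kappa>(1) by (intro AE_I2) (simp add: abs_mult mult_left_mono)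
        qed measurable
        show "\<exists>R. correction \<alpha> \<epsilon> Ce \<delta> S R \<and>
          (\<forall>x. (\<integral>y. h y * (fdiv \<alpha> ?K (x - y) + fdiv \<alpha> (R y) x) \<partial>lborel) = (\<integral>y. h y * fdiv \<alpha> ?K (x - y) \<partial>lborel))"
        proof (intro exI[of _ R] conjI allI)
          show "correction \<alpha> \<epsilon> Ce \<delta> S R"
            unfolding R_def by (rule Ce(2)[OF \<epsilon>])
          fix x
          have flip: "(\<integral>y. h y * D (x + y) \<partial>lborel) = (\<integral>y. h y * D (x - y) \<partial>lborel)"
            using integral_lborel_shift(2)[of "\<lambda>y. h y * D (x + y)" 0] ev by simp
          have "(\<integral>y. h y * (fdiv \<alpha> ?K (x - y) + fdiv \<alpha> (R y) x) \<partial>lborel) = (\<integral>y. 1/2 * (h y * D (x - y)) + 1/2 * (h y * D (x + y)) \<partial>lborel)"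
            unfolding RD D_def[symmetric] by (intro Bochner_Integration.integral_cong) (auto simp: algebra_simps)
          also have "\<dots> = 1/2 * (\<integral>y. h y * D (x - y) \<partial>lborel) + 1/2 * (\<integral>y. h y * D (x + y) \<partial>lborel)"
            using hDi[of "\<lambda>y. x - y"] hDi[of "\<lambda>y. x + y"] by simp
          finally show "(\<integral>y. h y * (fdiv \<alpha> ?K (x - y) + fdiv \<alpha> (R y) x) \<partial>lborel) = (\<integral>y. h y * fdiv \<alpha> ?K (x - y) \<partial>lborel)"
            unfolding flip D_def[symmetric] by simp
        qed
      qed
      also have "\<dots> \<le> (Ke + Kr) * real_of_ereal (frac_variation \<alpha> f)"
        using Kr0 V0 by (intro mult_right_mono) auto
      finally show ?thesis .
    next
      assume n2: "2 \<le> CARD('n)"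
      have "\<bar>LINT x|lebesgue. f x * h (x - x0)\<bar> \<le> Kr * real_of_ereal (frac_variation \<alpha> f)"
      proof (rule Kr[THEN spec, THEN spec, THEN spec, THEN spec, THEN spec, THEN spec, THEN mp, OF p, THEN mp, OF f, THEN mp, OF V,
          THEN mp, OF hc, THEN mp, OF \<delta>, THEN mp, OF hs, THEN mp, OF hb, THEN mp], intro allI impI)
        fix \<epsilon> :: real assume \<epsilon>: "0 < \<epsilon>"
        have "h y * (fdiv \<alpha> (riesz_kernel \<alpha> \<epsilon>) (x - y) + fdiv \<alpha> (rotation_field \<alpha> \<epsilon> y) x) = h y * fdiv \<alpha> (riesz_kernel \<alpha> \<epsilon>) (x - y)" for x y
        proof (cases "h y = 0")
          case False
          then have "y \<noteq> 0" using hs \<delta> by auto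
          then show ?thesis by (simp add: rotation_field_fdiv[OF \<alpha>])
        qed simp
        then show "\<exists>R. correction \<alpha> \<epsilon> Cr \<delta> S R \<and>
          (\<forall>x. (\<integral>y. h y * (fdiv \<alpha> (riesz_kernel \<alpha> \<epsilon>) (x - y) + fdiv \<alpha> (R y) x) \<partial>lborel) =
               (\<integral>y. h y * fdiv \<alpha> (riesz_kernel \<alpha> \<epsilon>) (x - y) \<partial>lborel))"
          by (intro exI[of _ "rotation_field \<alpha> \<epsilon>"] conjI allI Cr(2)[OF n2 \<epsilon> \<delta>] Bochner_Integration.integral_cong refl)
      qed
      also have "\<dots> \<le> (Ke + Kr) * real_of_ereal (frac_variation \<alpha> f)"
        using Ke0 V0 by (intro mult_right_mono) auto
      finally show ?thesis .
    qed
  qed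
qed

end

subsection \<open>Riesz potentials\<close>

text \<open>With k = j + 1, the first factor removes |y| \<le> 1/k and the second |y| \<ge> 2 k.
  Inside the power, the maximum with 1/k avoids the singularity, so the function is continuous
  everywhere; on the support it changes nothing.\<close>

definition truncated_power :: "real \<Rightarrow> nat \<Rightarrow> 'a::real_normed_vector \<Rightarrow> real" where
  "truncated_power \<alpha> j y = (let k = real (Suc j) in
     max 0 (min 1 (k * norm y - 1)) * max 0 (min 1 (2 - norm y / k)) * max (norm y) (1 / k) powr (-\<alpha>))"

lemma truncated_power_continuous: "continuous_on UNIV (truncated_power \<alpha> j :: 'a::real_normed_vector \<Rightarrow> real)"
  unfolding truncated_power_def[abs_def] Let_def
  by (intro continuous_intros) (auto simp: less_max_iff_disj max_def)

lemma truncated_power_even: "truncated_power \<alpha> j (- y) = truncated_power \<alpha> j y"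
  by (simp add: truncated_power_def)

lemma truncated_power_nonneg: "0 \<le> truncated_power \<alpha> j y"
  by (auto simp: truncated_power_def Let_def intro!: mult_nonneg_nonneg)

lemma truncated_power_support:
  assumes "truncated_power \<alpha> j y \<noteq> 0"
  shows "1 / real (Suc j) \<le> norm y" "norm y \<le> 2 * real (Suc j)"
proof -
  define k where "k = real (Suc j)"
  have k: "k > 0" by (simp add: k_def)
  have "max 0 (min 1 (k * norm y - 1)) \<noteq> 0" "max 0 (min 1 (2 - norm y / k)) \<noteq> 0"
    using assms by (auto simp: truncated_power_def Let_def k_def)
  then have "k * norm y - 1 > 0" "2 - norm y / k > 0"
    by (auto simp: max_def min_def split: if_splits)
  then show "1 / real (Suc j) \<le> norm y" "norm y \<le> 2 * real (Suc j)"
    using k unfolding k_def[symmetric] by (auto simp: field_simps)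
qed

lemma truncated_power_le: "truncated_power \<alpha> j y \<le> norm y powr (-\<alpha>)"
proof (cases "truncated_power \<alpha> j y = 0")
  case True
  then show ?thesis by simp
next
  case False
  define k where "k = real (Suc j)"
  define u v where "u = max 0 (min 1 (k * norm y - 1))" and "v = max 0 (min 1 (2 - norm y / k))"
  have uv: "0 \<le> u" "u \<le> 1" "0 \<le> v" "v \<le> 1"
    by (auto simp: u_def v_def)
  have "max (norm y) (1 / k) = norm y"
    using truncated_power_support(1)[OF False] by (simp add: k_def max_def)
  then have "truncated_power \<alpha> j y = (u * v) * norm y powr (-\<alpha>)"
    by (simp add: truncated_power_def Let_def k_def u_def v_def)
  also have "\<dots> \<le> 1 * norm y powr (-\<alpha>)"
    using uv by (intro mult_right_mono mult_le_one) auto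
  finally show ?thesis by simp
qed

lemma truncated_power_tendsto:
  assumes "y \<noteq> 0"
  shows "(\<lambda>j. truncated_power \<alpha> j y) \<longlonglongrightarrow> norm y powr (-\<alpha>)"
proof (rule tendsto_eventually)
  obtain N where N: "max (norm y) (2 / norm y) \<le> real N"
    using real_arch_simple by blast
  have "truncated_power \<alpha> j y = norm y powr (-\<alpha>)" if "N \<le> j" for j
  proof -
    define k where "k = real (Suc j)"
    have k: "norm y \<le> k" "2 / norm y \<le> k" "k > 0"
      using N that by (auto simp: k_def)
    have ny: "norm y > 0" using assms by simp
    have 1: "k * norm y \<ge> 2"
      using k(2) ny by (simp add: field_simps)
    have 2: "norm y / k \<le> 1"
      using k by simp
    have 3: "1 / k \<le> norm y"
      using 1 k(3) ny by (simp add: field_simps)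
    have "max 0 (min 1 (k * norm y - 1)) = 1" "max 0 (min 1 (2 - norm y / k)) = 1" "max (norm y) (1 / k) = norm y"
      using 1 2 3 by (auto simp: max_def min_def)
    then show ?thesis
      by (simp add: truncated_power_def Let_def k_def)
  qed
  then show "\<forall>\<^sub>F j in sequentially. truncated_power \<alpha> j y = norm y powr (-\<alpha>)"
    by (auto simp: eventually_sequentially)
qed

text \<open>A measurable function is almost everywhere a limit of continuous ones, and clamping
  these to [-1, 1] does not affect the limit, a sign. Continuity matters because
  \<open>pairing_bound\<close> admits only continuous weights.\<close>

lemma continuous_sign_approximation:
  fixes f :: "'a::euclidean_space \<Rightarrow> real"
  assumes f: "f \<in> borel_measurable lebesgue"
  shows "\<exists>g. (\<forall>j. continuous_on UNIV (g j)) \<and> (\<forall>j x. \<bar>g j x\<bar> \<le> 1) \<and>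
    (AE x in lebesgue. (\<lambda>j::nat. g j x) \<longlonglongrightarrow> sgn (f x))"
proof -
  have "(\<lambda>x. sgn (f x)) \<in> borel_measurable lebesgue"
    using f by measurable
  then have "(\<lambda>x. sgn (f x)) measurable_on UNIV"
    by (rule lebesgue_measurable_imp_measurable_on) simp
  then obtain N g where N: "negligible N" and g: "\<And>j. continuous_on UNIV (g j)"
    and lim: "\<And>x. x \<notin> N \<Longrightarrow> (\<lambda>j. g j x) \<longlonglongrightarrow> sgn (f x)"
    unfolding measurable_on_def by auto
  show ?thesis
  proof (rule exI[of _ "\<lambda>j x. max (-1) (min 1 (g j x))"], intro conjI allI)
    show "continuous_on UNIV (\<lambda>x. max (-1) (min 1 (g j x)))" for j
      by (intro continuous_intros g)
    show "\<bar>max (-1) (min 1 (g j x))\<bar> \<le> 1" for j x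
      by auto
    show "AE x in lebesgue. (\<lambda>j. max (-1) (min 1 (g j x))) \<longlonglongrightarrow> sgn (f x)"
    proof (rule AE_I')
      show "N \<in> null_sets lebesgue"
        using N by (simp add: negligible_iff_null_sets)
      have "(\<lambda>j. max (-1) (min 1 (g j x))) \<longlonglongrightarrow> sgn (f x)" if "x \<notin> N" for x
      proof -
        have "(\<lambda>j. max (-1) (min 1 (g j x))) \<longlonglongrightarrow> max (-1) (min 1 (sgn (f x)))"
          by (intro tendsto_intros lim that)
        moreover have "max (-1) (min 1 (sgn (f x))) = sgn (f x)"
          by (simp add: sgn_if)
        ultimately show ?thesis by simp
      qed
      then show "{x \<in> space lebesgue. \<not> (\<lambda>j. max (-1) (min 1 (g j x))) \<longlonglongrightarrow> sgn (f x)} \<subseteq> N"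
        by blast
    qed
  qed
qed

lemma AE_lebesgue_neq: "AE w in (lebesgue::'a::euclidean_space measure). w \<noteq> c"
  by (intro AE_completion AE_lborel_neq)

lemma Lp_diff:
  fixes f g :: "real ^ 'n \<Rightarrow> real"
  assumes f: "f \<in> Lp p" and g: "g \<in> Lp p" and p: "1 \<le> p"
  shows "(\<lambda>x. f x - g x) \<in> Lp p"
proof -
  have [measurable]: "f \<in> borel_measurable lebesgue" "g \<in> borel_measurable lebesgue"
    using f g by (auto simp: Lp_def)
  have "integrable lebesgue (\<lambda>x. \<bar>f x - g x\<bar> powr p)"
  proof (rule Bochner_Integration.integrable_bound)
    show "integrable lebesgue (\<lambda>x. 2 powr p * (\<bar>f x\<bar> powr p + \<bar>g x\<bar> powr p))"
      using f g by (auto simp: Lp_def)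
    show "AE x in lebesgue. norm (\<bar>f x - g x\<bar> powr p) \<le> norm (2 powr p * (\<bar>f x\<bar> powr p + \<bar>g x\<bar> powr p))"
    proof (intro AE_I2)
      fix x
      define m where "m = max \<bar>f x\<bar> \<bar>g x\<bar>"
      have "\<bar>f x - g x\<bar> powr p \<le> (2 * m) powr p"
        using p by (intro powr_mono2) (auto simp: m_def)
      also have "\<dots> = 2 powr p * m powr p"
        by (rule powr_mult)
      also have "\<dots> \<le> 2 powr p * (\<bar>f x\<bar> powr p + \<bar>g x\<bar> powr p)"
        by (intro mult_left_mono) (auto simp: m_def max_def)
      finally show "norm (\<bar>f x - g x\<bar> powr p) \<le> norm (2 powr p * (\<bar>f x\<bar> powr p + \<bar>g x\<bar> powr p))"
        by simp
    qed
  qed measurable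
  then show ?thesis
    by (simp add: Lp_def)
qed

lemma lower_semicontinuous_borel:
  fixes F :: "'a::euclidean_space \<Rightarrow> real"
  assumes "lower_semicontinuous F"
  shows "F \<in> borel_measurable borel"
proof (rule borel_measurableI_greater)
  fix a
  have "open {x. a < F x}"
    unfolding open_subopen[of "{x. a < F x}"]
  proof
    fix x assume "x \<in> {x. a < F x}"
    then have "\<forall>\<^sub>F y in nhds x. a < F y"
      using assms by (auto simp: lower_semicontinuous_def)
    then show "\<exists>T. open T \<and> x \<in> T \<and> T \<subseteq> {x. a < F x}"
      by (auto simp: eventually_nhds)
  qed
  then show "{x \<in> space borel. a < F x} \<in> sets borel"
    by simp
qed

text \<open>Fatou's lemma along sequences tending to x: the integrands are nonnegative almost
  everywhere and converge for every y except x.\<close>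

lemma lower_semicontinuous_riesz_integral:
  fixes f :: "'a::euclidean_space \<Rightarrow> real"
  assumes f [measurable]: "f \<in> borel_measurable lebesgue" and nonneg: "AE x in lebesgue. 0 \<le> f x"
    and int: "\<And>x. integrable lebesgue (\<lambda>y. f y / norm (x - y) powr \<alpha>)"
  shows "lower_semicontinuous (\<lambda>x. LINT y|lebesgue. f y / norm (x - y) powr \<alpha>)"
  unfolding lower_semicontinuous_def
proof (intro allI impI)
  let ?I = "\<lambda>x. LINT y|lebesgue. f y / norm (x - y) powr \<alpha>"
  have nn: "AE y in lebesgue. 0 \<le> f y / norm (x - y) powr \<alpha>" for x
    using nonneg by eventually_elim simp
  have I: "ennreal (?I x) = (\<integral>\<^sup>+y. ennreal (f y / norm (x - y) powr \<alpha>) \<partial>lebesgue)" for x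
    using nn_integral_eq_integral[OF int nn] by simp
  have I0: "0 \<le> ?I x" for x
    by (rule integral_nonneg_AE[OF nn])
  fix x a assume a: "a < ?I x"
  show "\<forall>\<^sub>F y in nhds x. a < ?I y"
    unfolding eventually_nhds_iff_sequentially
  proof (intro allI impI)
    fix X assume X: "X \<longlonglongrightarrow> x"
    show "\<forall>\<^sub>F k in sequentially. a < ?I (X k)"
    \<comment> \<open>A negative level is handled apart, because the comparison below takes place in
      \<open>ennreal\<close>.\<close>
    proof (cases "a < 0")
      case True
      then have "a < ?I (X k)" for k
        using I0[of "X k"] by linarith
      then show ?thesis
        by simp
    next
      case False
      have "ennreal (?I x) \<le> (\<integral>\<^sup>+y. liminf (\<lambda>k. ennreal (f y / norm (X k - y) powr \<alpha>)) \<partial>lebesgue)"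
        unfolding I
      proof (rule nn_integral_mono_AE)
        show "AE y in lebesgue. ennreal (f y / norm (x - y) powr \<alpha>) \<le> liminf (\<lambda>k. ennreal (f y / norm (X k - y) powr \<alpha>))"
          using AE_lebesgue_neq[of x]
        proof eventually_elim
          case (elim y)
          have "(\<lambda>k. ennreal (f y / norm (X k - y) powr \<alpha>)) \<longlonglongrightarrow> ennreal (f y / norm (x - y) powr \<alpha>)"
            using elim X by (intro tendsto_ennrealI tendsto_intros) auto
          then have "liminf (\<lambda>k. ennreal (f y / norm (X k - y) powr \<alpha>)) = ennreal (f y / norm (x - y) powr \<alpha>)"
            by (intro lim_imp_Liminf) auto
          then show ?case by simp
        qed
      qed
      also have "\<dots> \<le> liminf (\<lambda>k. \<integral>\<^sup>+y. ennreal (f y / norm (X k - y) powr \<alpha>) \<partial>lebesgue)"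
      proof (rule nn_integral_liminf)
        show "(\<lambda>y. ennreal (f y / norm (X k - y) powr \<alpha>)) \<in> borel_measurable lebesgue" for k
          using borel_measurable_integrable[OF int[of "X k"]] by measurable
      qed
      also have "\<dots> = liminf (\<lambda>k. ennreal (?I (X k)))"
        by (simp only: I)
      finally have le: "ennreal (?I x) \<le> liminf (\<lambda>k. ennreal (?I (X k)))" .
      have "ennreal a < ennreal (?I x)"
        using a False by (simp add: ennreal_less_iff)
      from this le have "ennreal a < liminf (\<lambda>k. ennreal (?I (X k)))"
        by (rule less_le_trans)
      then have "\<forall>\<^sub>F k in sequentially. ennreal a < ennreal (?I (X k))"
        by (rule less_LiminfD)
      then show ?thesis
        using False by (simp add: ennreal_less_iff)
    qed
  qed
qed

context
  fixes \<alpha> :: real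
  assumes \<alpha>: "0 < \<alpha>" "\<alpha> < 1"
begin

text \<open>The set of test fields is symmetric, so the function subtracted may be tested with the
  negative of \<phi>.\<close>

lemma frac_variation_diff:
  fixes f g :: "real ^ 'n \<Rightarrow> real"
  assumes p: "1 \<le> p" and f: "f \<in> Lp p" and g: "g \<in> Lp p"
  shows "frac_variation \<alpha> (\<lambda>x. f x - g x) \<le> frac_variation \<alpha> f + frac_variation \<alpha> g"
  unfolding frac_variation_def[of \<alpha> "\<lambda>x. f x - g x"]
proof (rule SUP_least)
  fix \<phi> :: "real ^ 'n \<Rightarrow> real ^ 'n"
  assume "\<phi> \<in> {\<phi> \<in> Cc_infinity. Linf_norm \<phi> \<le> 1}"
  then have \<phi>: "\<phi> \<in> Cc_infinity" "Linf_norm \<phi> \<le> 1" by auto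
  have [measurable]: "\<phi> \<in> borel_measurable borel"
    using Cc_infinityD(1)[OF \<phi>(1), of 0] by (simp add: borel_measurable_continuous_onI)
  have s: "0 \<le> real CARD('n) - \<alpha>"
    using DIM_minus_alpha_pos[OF \<alpha>, where 'a="real ^ 'n"] by simp
  obtain A where A: "decay (real CARD('n) - \<alpha>) A \<phi>"
    using Cc_infinity_decay[OF \<phi>(1) s] by blast
  have int: "integrable lebesgue (\<lambda>x. u x * frac_div \<alpha> \<phi> x)" if "u \<in> Lp p" for u
    using integrable_mult_right[OF integrable_times_fdiv[OF \<alpha> p that A], of "frac_const CARD('n) \<alpha>"]
    by (simp add: frac_div_eq_fdiv mult.left_commute)
  have "(\<lambda>z. (-1) *\<^sub>R \<phi> z) \<in> Cc_infinity"
  proof -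
    obtain R where R: "R > 0" "\<And>x. \<phi> x \<noteq> 0 \<Longrightarrow> norm x \<le> R"
      using Cc_infinity_support[OF \<phi>(1)] by metis
    show ?thesis
      using R by (intro Cc_infinityI[where R = R] C_k_scaleR C_k_const Cc_infinityD(1)[OF \<phi>(1)]) auto
  qed
  then have neg: "(\<lambda>z. - \<phi> z) \<in> Cc_infinity" "Linf_norm (\<lambda>z. - \<phi> z) \<le> 1"
    using \<phi>(2) by (auto simp: Linf_norm_def)
  have negdiv: "frac_div \<alpha> (\<lambda>z. - \<phi> z) x = - frac_div \<alpha> \<phi> x" for x
    using fdiv_scaleR[OF \<alpha>, of "-1" \<phi> x] by (simp add: frac_div_eq_fdiv)
  have "(LINT x|lebesgue. (f x - g x) * frac_div \<alpha> \<phi> x) = (LINT x|lebesgue. f x * frac_div \<alpha> \<phi> x) + (LINT x|lebesgue. g x * frac_div \<alpha> (\<lambda>z. - \<phi> z) x)"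
    using int[OF f] int[OF g] by (simp add: left_diff_distrib negdiv)
  then have "ereal (LINT x|lebesgue. (f x - g x) * frac_div \<alpha> \<phi> x) = ereal (LINT x|lebesgue. f x * frac_div \<alpha> \<phi> x) + ereal (LINT x|lebesgue. g x * frac_div \<alpha> (\<lambda>z. - \<phi> z) x)"
    by simp
  also have "\<dots> \<le> frac_variation \<alpha> f + frac_variation \<alpha> g"
    unfolding frac_variation_def using \<phi> neg by (intro add_mono SUP_upper) auto
  finally show "ereal (LINT x|lebesgue. (f x - g x) * frac_div \<alpha> \<phi> x) \<le> frac_variation \<alpha> f + frac_variation \<alpha> g" .
qed

lemma BV_diff:
  fixes f g :: "real ^ 'n \<Rightarrow> real"
  assumes p: "1 \<le> p" and f: "f \<in> BV \<alpha> p" and g: "g \<in> BV \<alpha> p"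
  shows "(\<lambda>x. f x - g x) \<in> BV \<alpha> p"
    and "real_of_ereal (frac_variation \<alpha> (\<lambda>x. f x - g x)) \<le> real_of_ereal (frac_variation \<alpha> f) + real_of_ereal (frac_variation \<alpha> g)"
proof -
  have fl: "f \<in> Lp p" "g \<in> Lp p" and v: "frac_variation \<alpha> f < \<infinity>" "frac_variation \<alpha> g < \<infinity>"
    using f g by (auto simp: BV_def)
  note add = frac_variation_diff[OF p fl]
  have fin: "frac_variation \<alpha> (\<lambda>x. f x - g x) < \<infinity>"
    by (rule le_less_trans[OF add]) (use v in \<open>auto simp: less_top\<close>)
  then show "(\<lambda>x. f x - g x) \<in> BV \<alpha> p"
    using Lp_diff[OF fl p] by (simp add: BV_def)
  have "0 \<le> frac_variation \<alpha> f" "0 \<le> frac_variation \<alpha> g" "0 \<le> frac_variation \<alpha> (\<lambda>x. f x - g x)"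
    using frac_variation_nonneg[OF \<alpha> p] fl Lp_diff[OF fl p] by auto
  then show "real_of_ereal (frac_variation \<alpha> (\<lambda>x. f x - g x)) \<le> real_of_ereal (frac_variation \<alpha> f) + real_of_ereal (frac_variation \<alpha> g)"
    using add v fin
    by (cases "frac_variation \<alpha> f"; cases "frac_variation \<alpha> g"; cases "frac_variation \<alpha> (\<lambda>x. f x - g x)") auto
qed

text \<open>The second clause bounds every potential that happens to converge. It is stated in this
  way so as to apply to differences of nonnegative functions, which in dimension one have no
  sign.\<close>

lemma riesz_integral_bounds:
  "\<exists>C>0. \<forall>p. \<forall>f::real ^ 'n \<Rightarrow> real. 1 \<le> p \<longrightarrow> f \<in> BV \<alpha> p \<longrightarrow>
     ((AE x in lebesgue. 0 \<le> f x) \<or> 2 \<le> CARD('n) \<longrightarrow> (\<forall>x. integrable lebesgue (\<lambda>y. f y / norm (x - y) powr \<alpha>))) \<and>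
     (\<forall>x. integrable lebesgue (\<lambda>y. f y / norm (x - y) powr \<alpha>) \<longrightarrow>
        \<bar>LINT y|lebesgue. f y / norm (x - y) powr \<alpha>\<bar> \<le> C * real_of_ereal (frac_variation \<alpha> f))"
proof -
  obtain C where C0: "0 \<le> C" and C: "\<forall>p. \<forall>f::real ^ 'n \<Rightarrow> real. \<forall>x0 h \<delta> S. 1 \<le> p \<longrightarrow> f \<in> Lp p \<longrightarrow> frac_variation \<alpha> f < \<infinity> \<longrightarrow>
    continuous_on UNIV h \<longrightarrow> 0 < \<delta> \<longrightarrow> (\<forall>y. h y \<noteq> 0 \<longrightarrow> \<delta> \<le> norm y \<and> norm y \<le> S) \<longrightarrow> (\<forall>y. \<bar>h y\<bar> \<le> norm y powr (-\<alpha>)) \<longrightarrow>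
    (\<forall>y. h (- y) = h y) \<or> 2 \<le> CARD('n) \<longrightarrow>
    \<bar>LINT x|lebesgue. f x * h (x - x0)\<bar> \<le> C * real_of_ereal (frac_variation \<alpha> f)"
    using pairing_bound[OF \<alpha>, where 'n='n] by (elim exE conjE) (rule that)
  show ?thesis
  \<comment> \<open>A strictly positive constant is returned because the theorem divides by
    it.\<close>
  proof (rule exI[of _ "C + 1"], intro conjI allI impI)
    show "0 < C + 1" using C0 by simp
    fix p and f :: "real ^ 'n \<Rightarrow> real" and x0 :: "real ^ 'n"
    assume p: "1 \<le> p" and fBV: "f \<in> BV \<alpha> p"
    have f: "f \<in> Lp p" and V: "frac_variation \<alpha> f < \<infinity>"
      using fBV by (auto simp: BV_def)
    note [measurable] = Lp_borel[OF \<alpha> p f]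
    define h :: "nat \<Rightarrow> real ^ 'n \<Rightarrow> real" where "h = truncated_power \<alpha>"
    have h: "continuous_on UNIV (h j)" "h j y \<noteq> 0 \<longrightarrow> 1 / real (Suc j) \<le> norm y \<and> norm y \<le> 2 * real (Suc j)"
        "0 \<le> h j y" "h j y \<le> norm y powr (-\<alpha>)" "h j (- y) = h j y" for j y
      using truncated_power_continuous truncated_power_support[of \<alpha> j y] truncated_power_nonneg truncated_power_le truncated_power_even
      unfolding h_def by auto
    have hb: "\<bar>h j y\<bar> \<le> norm y powr (-\<alpha>)" for j y
      using h(3,4)[of j y] by simp
    have hm [measurable]: "(\<lambda>x. h j (x - x0)) \<in> borel_measurable lebesgue" for j
    proof -
      have [measurable]: "h j \<in> borel_measurable borel"
        using h(1) by (rule borel_measurable_continuous_onI)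
      show ?thesis by (intro measurable_completion) measurable
    qed
    have hlim: "(\<lambda>j. h j (y - x0)) \<longlonglongrightarrow> norm (x0 - y) powr (-\<alpha>)" if "y \<noteq> x0" for y
      using truncated_power_tendsto[of "y - x0" \<alpha>] that by (simp add: h_def norm_minus_commute)
    have kern: "f y / norm (x0 - y) powr \<alpha> = f y * norm (x0 - y) powr (-\<alpha>)" for y
      by (simp add: powr_minus divide_inverse)
    note Cf = C[THEN spec, THEN spec, THEN spec, THEN spec, THEN spec, THEN spec, THEN mp, OF p, THEN mp, OF f, THEN mp, OF V,
          THEN mp, THEN mp, THEN mp, THEN mp, THEN mp]
    {
      assume int: "integrable lebesgue (\<lambda>y. f y / norm (x0 - y) powr \<alpha>)"
      \<comment> \<open>The truncated powers are even, so \<open>pairing_bound\<close> covers them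
        in every dimension; convergence of the potential provides the majorant.\<close>
      have "(\<lambda>j. LINT y|lebesgue. f y * h j (y - x0)) \<longlonglongrightarrow> (LINT y|lebesgue. f y / norm (x0 - y) powr \<alpha>)"
      proof (rule integral_dominated_convergence)
        show "integrable lebesgue (\<lambda>y. \<bar>f y / norm (x0 - y) powr \<alpha>\<bar>)"
          using int by (rule integrable_abs)
        show "AE y in lebesgue. (\<lambda>j. f y * h j (y - x0)) \<longlonglongrightarrow> f y / norm (x0 - y) powr \<alpha>"
          using AE_lebesgue_neq[of x0] unfolding kern by eventually_elim (intro tendsto_intros hlim)
        have "norm (f y * h j (y - x0)) \<le> \<bar>f y / norm (x0 - y) powr \<alpha>\<bar>" for y j
          unfolding kern using hb[of j "y - x0"] by (simp add: abs_mult norm_minus_commute mult_left_mono)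
        then show "AE y in lebesgue. norm (f y * h j (y - x0)) \<le> \<bar>f y / norm (x0 - y) powr \<alpha>\<bar>" for j
          by simp
        show "(\<lambda>y. f y / norm (x0 - y) powr \<alpha>) \<in> borel_measurable lebesgue"
          using int by (rule borel_measurable_integrable)
      qed measurable
      then have "(\<lambda>j. \<bar>LINT y|lebesgue. f y * h j (y - x0)\<bar>) \<longlonglongrightarrow> \<bar>LINT y|lebesgue. f y / norm (x0 - y) powr \<alpha>\<bar>"
        by (rule tendsto_rabs)
      moreover have "\<bar>LINT y|lebesgue. f y * h j (y - x0)\<bar> \<le> C * real_of_ereal (frac_variation \<alpha> f)" for j
        by (rule Cf[of "h j" "1 / real (Suc j)"]) (use h hb in auto)
      ultimately have "\<bar>LINT y|lebesgue. f y / norm (x0 - y) powr \<alpha>\<bar> \<le> C * real_of_ereal (frac_variation \<alpha> f)"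
        by (intro LIMSEQ_le_const2) auto
      also have "\<dots> \<le> (C + 1) * real_of_ereal (frac_variation \<alpha> f)"
        using frac_variation_nonneg[OF \<alpha> p f] by (intro mult_right_mono real_of_ereal_pos) auto
      finally show "\<bar>LINT y|lebesgue. f y / norm (x0 - y) powr \<alpha>\<bar> \<le> (C + 1) * real_of_ereal (frac_variation \<alpha> f)" .
    }
    assume cases: "(AE x in lebesgue. 0 \<le> f x) \<or> 2 \<le> CARD('n)"
    have int: "integrable lebesgue (\<lambda>y. \<bar>f y\<bar> * h j (y - x0))" for j
    proof -
      \<comment> \<open>The shifted truncation is at most (j + 1)^\<alpha> and lives in the ball of
        radius |x0| + 2 (j + 1), hence below a multiple of the weight (1 + |y|)^(-n).\<close>
      define M where "M = real (Suc j) powr \<alpha> * (1 + (norm x0 + 2 * real (Suc j))) powr real CARD('n)"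
      have hM: "h j (y - x0) \<le> M * (1 + norm y) powr (- real CARD('n))" for y
      proof (cases "h j (y - x0) = 0")
        case True
        then show ?thesis by (simp add: M_def)
      next
        case False
        then have y: "1 / real (Suc j) \<le> norm (y - x0)" "norm (y - x0) \<le> 2 * real (Suc j)" using h(2) by auto
        have "h j (y - x0) \<le> norm (y - x0) powr (-\<alpha>)" by (rule h(4))
        also have "\<dots> \<le> (1 / real (Suc j)) powr (-\<alpha>)"
          using y \<alpha> by (intro powr_mono2') auto
        also have "\<dots> = real (Suc j) powr \<alpha> * 1"
          by (simp add: powr_divide powr_minus field_simps)
        also have "\<dots> \<le> real (Suc j) powr \<alpha> * ((1 + (norm x0 + 2 * real (Suc j))) powr real CARD('n) * (1 + norm y) powr (- real CARD('n)))"
        proof (intro mult_left_mono)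
          have "norm y \<le> 0 + (norm x0 + 2 * real (Suc j))"
            using y norm_triangle_ineq[of "y - x0" x0] by simp
          then show "1 \<le> (1 + (norm x0 + 2 * real (Suc j))) powr real CARD('n) * (1 + norm y) powr (- real CARD('n))"
            using powr_one_plus_shift[of "norm y" 0 "norm x0 + 2 * real (Suc j)" "real CARD('n)"] by simp
        qed auto
        finally show ?thesis by (simp add: M_def mult.assoc)
      qed
      show ?thesis
      proof (rule Bochner_Integration.integrable_bound)
        show "integrable lebesgue (\<lambda>y. M * (\<bar>f y\<bar> * (1 + norm y) powr (- real CARD('n))))"
          by (intro integrable_mult_right Lp_integrable_weight[OF f p])
        have "norm (\<bar>f y\<bar> * h j (y - x0)) \<le> norm (M * (\<bar>f y\<bar> * (1 + norm y) powr (- real CARD('n))))" for y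
        proof -
          have "\<bar>f y\<bar> * h j (y - x0) \<le> \<bar>f y\<bar> * (M * (1 + norm y) powr (- real CARD('n)))"
            by (intro mult_left_mono hM) auto
          then show ?thesis
            using h(3)[of j "y - x0"] by (simp add: M_def abs_mult mult_ac)
        qed
        then show "AE y in lebesgue. norm (\<bar>f y\<bar> * h j (y - x0)) \<le> norm (M * (\<bar>f y\<bar> * (1 + norm y) powr (- real CARD('n))))"
          by simp
      qed measurable
    qed
    have bound: "(LINT y|lebesgue. \<bar>f y\<bar> * h j (y - x0)) \<le> C * real_of_ereal (frac_variation \<alpha> f)" for j
      using cases
    proof
      assume nn: "AE x in lebesgue. 0 \<le> f x"
      have "(LINT y|lebesgue. \<bar>f y\<bar> * h j (y - x0)) = (LINT y|lebesgue. f y * h j (y - x0))"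
        using nn by (intro integral_cong_AE) (auto, measurable)
      also have "\<dots> \<le> \<bar>LINT y|lebesgue. f y * h j (y - x0)\<bar>"
        by simp
      also have "\<dots> \<le> C * real_of_ereal (frac_variation \<alpha> f)"
        by (rule Cf[of "h j" "1 / real (Suc j)"]) (use h hb in auto)
      finally show ?thesis .
    next
      assume n2: "2 \<le> CARD('n)"
      obtain g where g0: "\<forall>i. continuous_on UNIV (g i)" "\<forall>i x. \<bar>g i x\<bar> \<le> 1"
          and g3: "AE x in lebesgue. (\<lambda>i::nat. g i x) \<longlonglongrightarrow> sgn (f x)"
        using continuous_sign_approximation[OF Lp_borel[OF \<alpha> p f]] by (elim exE conjE) (rule that)
      note g = g0[rule_format]
      have gm [measurable]: "g i \<in> borel_measurable lebesgue" for i
        using borel_measurable_continuous_onI[OF g(1)[of i]] by (intro measurable_completion) simp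
      have "(\<lambda>i. LINT y|lebesgue. f y * (g i y * h j (y - x0))) \<longlonglongrightarrow> (LINT y|lebesgue. \<bar>f y\<bar> * h j (y - x0))"
      proof (rule integral_dominated_convergence[OF _ _ int[of j]])
        have "norm (f y * (g i y * h j (y - x0))) \<le> \<bar>f y\<bar> * h j (y - x0)" for i y
          using g(2)[of i y] h(3)[of j "y - x0"]
          by (simp add: abs_mult mult_left_mono mult_left_le_one_le)
        then show "AE y in lebesgue. norm (f y * (g i y * h j (y - x0))) \<le> \<bar>f y\<bar> * h j (y - x0)" for i
          by simp
        show "AE y in lebesgue. (\<lambda>i. f y * (g i y * h j (y - x0))) \<longlonglongrightarrow> \<bar>f y\<bar> * h j (y - x0)"
          using g3
        proof eventually_elim
          case (elim y)
          then have "(\<lambda>i. f y * (g i y * h j (y - x0))) \<longlonglongrightarrow> f y * (sgn (f y) * h j (y - x0))"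
            by (intro tendsto_intros)
          also have "f y * (sgn (f y) * h j (y - x0)) = \<bar>f y\<bar> * h j (y - x0)"
            by (simp add: abs_sgn mult.assoc[symmetric])
          finally show ?case .
        qed
      qed measurable
      moreover have "(LINT y|lebesgue. f y * (g i y * h j (y - x0))) \<le> C * real_of_ereal (frac_variation \<alpha> f)" for i
      proof -
        have "\<bar>LINT y|lebesgue. f y * (g i (x0 + (y - x0)) * h j (y - x0))\<bar> \<le> C * real_of_ereal (frac_variation \<alpha> f)"
        \<comment> \<open>Multiplying by the approximate sign, recentred at x0, destroys the
          evenness of the weight; here the alternative \<open>2 \<le> CARD('n)\<close> is
          used.\<close>
        proof (rule Cf[of "\<lambda>y. g i (x0 + y) * h j y" "1 / real (Suc j)" "2 * real (Suc j)"])
          have "continuous_on UNIV (g i \<circ> (\<lambda>y. x0 + y))"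
            by (intro continuous_on_compose continuous_intros continuous_on_subset[OF g(1)]) auto
          then have "continuous_on UNIV (\<lambda>y. g i (x0 + y))"
            by (simp add: o_def)
          then show "continuous_on UNIV (\<lambda>y. g i (x0 + y) * h j y)"
            by (intro continuous_on_mult h(1))
          show "\<forall>y. \<bar>g i (x0 + y) * h j y\<bar> \<le> norm y powr - \<alpha>"
          proof
            fix y
            have "\<bar>g i (x0 + y) * h j y\<bar> \<le> 1 * \<bar>h j y\<bar>"
              unfolding abs_mult using g(2) by (intro mult_right_mono) auto
            then show "\<bar>g i (x0 + y) * h j y\<bar> \<le> norm y powr - \<alpha>"
              using hb[of j y] by simp
          qed
        qed (use h(2) n2 in auto)
        then show ?thesis by simp
      qed
      ultimately show ?thesis
        by (intro LIMSEQ_le_const2) auto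
    qed
    have meas: "(\<lambda>y. \<bar>f y\<bar> * norm (x0 - y) powr (-\<alpha>)) \<in> borel_measurable lebesgue"
    proof -
      have "(\<lambda>y. norm (x0 - y) powr (-\<alpha>)) \<in> borel_measurable lebesgue"
        by (intro measurable_completion) measurable
      then show ?thesis by measurable
    qed
    \<comment> \<open>Fatou's lemma removes the truncation: the truncated integrals of |f| are
      bounded independently of j, so the full one is finite.\<close>
    have "(\<integral>\<^sup>+y. ennreal (\<bar>f y\<bar> * norm (x0 - y) powr (-\<alpha>)) \<partial>lebesgue) \<le> (\<integral>\<^sup>+y. liminf (\<lambda>j. ennreal (\<bar>f y\<bar> * h j (y - x0))) \<partial>lebesgue)"
    proof (rule nn_integral_mono_AE)
      show "AE y in lebesgue. ennreal (\<bar>f y\<bar> * norm (x0 - y) powr (-\<alpha>)) \<le> liminf (\<lambda>j. ennreal (\<bar>f y\<bar> * h j (y - x0)))"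
        using AE_lebesgue_neq[of x0]
      proof eventually_elim
        case (elim y)
        have "(\<lambda>j. ennreal (\<bar>f y\<bar> * h j (y - x0))) \<longlonglongrightarrow> ennreal (\<bar>f y\<bar> * norm (x0 - y) powr (-\<alpha>))"
          by (intro tendsto_ennrealI tendsto_intros hlim elim)
        then have "liminf (\<lambda>j. ennreal (\<bar>f y\<bar> * h j (y - x0))) = ennreal (\<bar>f y\<bar> * norm (x0 - y) powr (-\<alpha>))"
          by (intro lim_imp_Liminf) auto
        then show ?case by simp
      qed
    qed
    also have "\<dots> \<le> liminf (\<lambda>j. \<integral>\<^sup>+y. ennreal (\<bar>f y\<bar> * h j (y - x0)) \<partial>lebesgue)"
      by (rule nn_integral_liminf) measurable
    also have "\<dots> \<le> ennreal (C * real_of_ereal (frac_variation \<alpha> f))"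
    proof -
      have "(\<integral>\<^sup>+y. ennreal (\<bar>f y\<bar> * h j (y - x0)) \<partial>lebesgue) \<le> ennreal (C * real_of_ereal (frac_variation \<alpha> f))" for j
        using nn_integral_eq_integral[OF int[of j]] h(3) bound[of j] by (simp add: ennreal_leI)
      then have "limsup (\<lambda>j. \<integral>\<^sup>+y. ennreal (\<bar>f y\<bar> * h j (y - x0)) \<partial>lebesgue) \<le> ennreal (C * real_of_ereal (frac_variation \<alpha> f))"
        by (intro Limsup_bounded always_eventually allI)
      then show ?thesis
        using Liminf_le_Limsup[of sequentially] order_trans trivial_limit_sequentially by blast
    qed
    also have "\<dots> < \<infinity>"
      by simp
    finally have "integrable lebesgue (\<lambda>y. \<bar>f y\<bar> * norm (x0 - y) powr (-\<alpha>))"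
      using meas by (intro integrableI_bounded) auto
    then show "integrable lebesgue (\<lambda>y. f y / norm (x0 - y) powr \<alpha>)"
    proof (rule Bochner_Integration.integrable_bound)
      have "(\<lambda>y. norm (x0 - y) powr (-\<alpha>)) \<in> borel_measurable lebesgue"
        by (intro measurable_completion) measurable
      then show "(\<lambda>y. f y / norm (x0 - y) powr \<alpha>) \<in> borel_measurable lebesgue"
        unfolding kern by measurable
    qed (simp add: kern abs_mult)
  qed
qed

section \<open>Continuity with respect to the variation seminorm\<close>

text \<open>The variation is bounded by the norm, so continuity for the variation seminorm suffices.
  The domain P may be a cone that is not closed under subtraction; only the differences have to lie
  in \<open>BV\<close>.\<close>

lemma continuous_map_BV:
  fixes P :: "(real ^ 'n \<Rightarrow> real) set"
  assumes p: "1 \<le> p" and P: "P \<subseteq> BV \<alpha> p" and F: "\<And>f. f \<in> P \<Longrightarrow> F f \<in> topspace Y"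
    and cont: "\<And>U f. openin Y U \<Longrightarrow> f \<in> P \<Longrightarrow> F f \<in> U \<Longrightarrow>
       \<exists>r>0. \<forall>g\<in>P. real_of_ereal (frac_variation \<alpha> (\<lambda>x. f x - g x)) < r \<longrightarrow> F g \<in> U"
  shows "continuous_map (subtopology (BV_topology \<alpha> p) P) Y F"
proof -
  define V where "V f = real_of_ereal (frac_variation \<alpha> f)" for f :: "real ^ 'n \<Rightarrow> real"
  have top: "topspace (subtopology (BV_topology \<alpha> p) P) = P"
    using P by (auto simp: BV_topology_def)
  show ?thesis
    unfolding continuous_map_def top
  proof (intro conjI allI impI)
    show "F \<in> P \<rightarrow> topspace Y" using F by auto
    fix U assume U: "openin Y U"
    \<comment> \<open>The subspace topology asks for an open subset of the whole of
      \<open>BV\<close>. It is the union of the seminorm balls, centred in P, whose points of P are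
      mapped into U.\<close>
    define T where "T = {g \<in> BV \<alpha> p. \<exists>f\<in>P. \<exists>r. V (\<lambda>x. f x - g x) < r \<and> (\<forall>g'\<in>P. V (\<lambda>x. f x - g' x) < r \<longrightarrow> F g' \<in> U)}"
    have "openin (BV_topology \<alpha> p) T"
      unfolding BV_topology_def openin_pseudometric_topology
    proof (intro conjI ballI)
      show "T \<subseteq> BV \<alpha> p" by (auto simp: T_def)
      fix g assume "g \<in> T"
      then obtain f r where g: "g \<in> BV \<alpha> p" and f: "f \<in> P" and r: "V (\<lambda>x. f x - g x) < r" "\<forall>g'\<in>P. V (\<lambda>x. f x - g' x) < r \<longrightarrow> F g' \<in> U"
        by (auto simp: T_def)
      have "g' \<in> T" if g': "g' \<in> BV \<alpha> p" and d: "BV_norm \<alpha> p (\<lambda>x. g x - g' x) < r - V (\<lambda>x. f x - g x)" for g'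
      proof -
        have fB: "f \<in> BV \<alpha> p" using f P by auto
        have "V (\<lambda>x. f x - g' x) \<le> V (\<lambda>x. f x - g x) + V (\<lambda>x. g' x - g x)"
          using BV_diff(2)[OF p BV_diff(1)[OF p fB g] BV_diff(1)[OF p g' g]] by (simp add: V_def)
        \<comment> \<open>Symmetry of the seminorm, derived from its subadditivity for differences
          by writing g' - g = (g - g) - (g - g').\<close>
        moreover have "V (\<lambda>x. g' x - g x) \<le> V (\<lambda>x. g x - g' x)"
        proof -
          have 0: "(\<lambda>x. g x - g x) \<in> BV \<alpha> p"
            by (rule BV_diff(1)[OF p g g])
          have "V (\<lambda>x. (g x - g x) - (g x - g' x)) \<le> V (\<lambda>x. g x - g x) + V (\<lambda>x. g x - g' x)"
            using BV_diff(2)[OF p 0 BV_diff(1)[OF p g g']] by (simp add: V_def)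
          moreover have "V (\<lambda>x. g x - g x) = 0"
          proof -
            have "(\<lambda>_. 0) \<in> (Cc_infinity :: (real ^ 'n \<Rightarrow> real ^ 'n) set)"
              by (rule Cc_infinityI[where R = 0]) (auto intro: C_k_const)
            moreover have "Linf_norm (\<lambda>_. 0 :: real ^ 'n) \<le> 1"
              unfolding Linf_norm_def by (rule esssup_I) auto
            ultimately have "{\<phi> \<in> Cc_infinity :: (real ^ 'n \<Rightarrow> real ^ 'n) set. Linf_norm \<phi> \<le> 1} \<noteq> {}"
              by blast
            then show ?thesis
              by (simp add: V_def frac_variation_def)
          qed
          ultimately show ?thesis by simp
        qed
        moreover have "V (\<lambda>x. g x - g' x) \<le> BV_norm \<alpha> p (\<lambda>x. g x - g' x)"
          by (simp add: BV_norm_def V_def Lp_norm_def)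
        ultimately have "V (\<lambda>x. f x - g' x) < r" using d by simp
        then show ?thesis
          using g' f r(2) by (auto simp: T_def)
      qed
      then show "\<exists>\<rho>>0. \<forall>g'\<in>BV \<alpha> p. BV_norm \<alpha> p (\<lambda>x. g x - g' x) < \<rho> \<longrightarrow> g' \<in> T"
        using r(1) by (intro exI[of _ "r - V (\<lambda>x. f x - g x)"]) auto
    qed
    moreover have "{f \<in> P. F f \<in> U} = T \<inter> P"
    proof (intro equalityI subsetI)
      fix f assume "f \<in> {f \<in> P. F f \<in> U}"
      then have f: "f \<in> P" "F f \<in> U" by auto
      obtain r where r: "r > 0" "\<forall>g\<in>P. V (\<lambda>x. f x - g x) < r \<longrightarrow> F g \<in> U"
        using cont[OF U f] unfolding V_def by blast
      have "V (\<lambda>x. f x - f x) = 0"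
      proof -
        have "(\<lambda>_. 0) \<in> (Cc_infinity :: (real ^ 'n \<Rightarrow> real ^ 'n) set)"
          by (rule Cc_infinityI[where R = 0]) (auto intro: C_k_const)
        moreover have "Linf_norm (\<lambda>_. 0 :: real ^ 'n) \<le> 1"
          unfolding Linf_norm_def by (rule esssup_I) auto
        ultimately have "{\<phi> \<in> Cc_infinity :: (real ^ 'n \<Rightarrow> real ^ 'n) set. Linf_norm \<phi> \<le> 1} \<noteq> {}"
          by blast
        then show ?thesis
          by (simp add: V_def frac_variation_def)
      qed
      then show "f \<in> T \<inter> P"
        using f P r by (auto simp: T_def intro!: bexI[of _ f] exI[of _ r])
    qed (auto simp: T_def)
    ultimately show "openin (subtopology (BV_topology \<alpha> p) P) {f \<in> P. F f \<in> U}"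
      by (auto simp: openin_subtopology)
  qed
qed

end

lemma mspace_LSC_b:
  "mspace (submetric (funspace UNIV euclidean_metric) LSC_b) = (LSC_b :: (real ^ 'n \<Rightarrow> real) set)"
  by (auto simp: LSC_b_def Metric_space.fspace_def[OF Met_TC.Metric_space_axioms] bounded_def)

lemma lower_semicontinuous_cmult:
  fixes F :: "'a::topological_space \<Rightarrow> real"
  assumes "lower_semicontinuous F" and c: "0 < c"
  shows "lower_semicontinuous (\<lambda>x. c * F x)"
  unfolding lower_semicontinuous_def
proof (intro allI impI)
  fix x a assume "a < c * F x"
  then have "a / c < F x"
    using c by (simp add: field_simps)
  then have "\<forall>\<^sub>F y in nhds x. a / c < F y"
    using assms(1) by (auto simp: lower_semicontinuous_def)
  then show "\<forall>\<^sub>F y in nhds x. a < c * F y"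
    by eventually_elim (use c in \<open>simp add: field_simps\<close>)
qed

text \<open>The potentials of the positive and of the negative part are lower semicontinuous, hence
  Borel, and the potential of f is their difference.\<close>

lemma riesz_integral_borel:
  fixes f :: "'a::euclidean_space \<Rightarrow> real"
  assumes f [measurable]: "f \<in> borel_measurable lebesgue"
    and int: "\<And>x. integrable lebesgue (\<lambda>y. f y / norm (x - y) powr \<alpha>)"
  shows "(\<lambda>x. LINT y|lebesgue. f y / norm (x - y) powr \<alpha>) \<in> borel_measurable borel"
proof -
  have part: "integrable lebesgue (\<lambda>y. max 0 (c * f y) / norm (x - y) powr \<alpha>)" for c x
  proof -
    have "max 0 (c * f y) / norm (x - y) powr \<alpha> = max 0 (c * (f y / norm (x - y) powr \<alpha>))" for y
      by (cases "norm (x - y) powr \<alpha> = 0") (auto simp: max_def field_simps)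
    moreover have "integrable lebesgue (\<lambda>y. max 0 (c * (f y / norm (x - y) powr \<alpha>)))"
      by (intro Bochner_Integration.integrable_max integrable_mult_right int Bochner_Integration.integrable_zero)
    ultimately show ?thesis
      by (simp only:)
  qed
  have lsc: "lower_semicontinuous (\<lambda>x. LINT y|lebesgue. max 0 (c * f y) / norm (x - y) powr \<alpha>)" for c
    by (rule lower_semicontinuous_riesz_integral[OF _ _ part]) auto
  have "(LINT y|lebesgue. f y / norm (x - y) powr \<alpha>) =
      (LINT y|lebesgue. max 0 (1 * f y) / norm (x - y) powr \<alpha>) - (LINT y|lebesgue. max 0 ((-1) * f y) / norm (x - y) powr \<alpha>)" for x
    unfolding Bochner_Integration.integral_diff[OF part part, symmetric]
    by (intro Bochner_Integration.integral_cong) (auto simp: max_def)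
  then show ?thesis
    using lower_semicontinuous_borel[OF lsc[of 1]] lower_semicontinuous_borel[OF lsc[of "-1"]]
    by (simp only: borel_measurable_diff)
qed

lemma Linf_norm_le:
  fixes u :: "real ^ 'n \<Rightarrow> real"
  assumes [measurable]: "u \<in> borel_measurable lebesgue" and "\<And>x. \<bar>u x\<bar> \<le> c"
  shows "Linf_norm u \<le> ereal c" "real_of_ereal (Linf_norm u) \<le> c"
proof -
  show le: "Linf_norm u \<le> ereal c"
    unfolding Linf_norm_def using assms(2) by (intro esssup_I) auto
  have "0 \<le> c"
    using assms(2)[of 0] by (rule order_trans[OF abs_ge_zero])
  with le show "real_of_ereal (Linf_norm u) \<le> c"
    by (cases "Linf_norm u") auto
qed

theorem corollary1p5:
  fixes \<alpha> p :: real
  assumes "0 < \<alpha>" and "\<alpha> < 1"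
    and "1 \<le> p" and "p < real CARD('n) / (1 - \<alpha>)"
  shows "((\<forall>f \<in> (BV_plus \<alpha> p :: (real ^ 'n \<Rightarrow> real) set).
             riesz_potential_defined (real CARD('n) - \<alpha>) f) \<and>
          continuous_map
            (subtopology (BV_topology \<alpha> p) (BV_plus \<alpha> p :: (real ^ 'n \<Rightarrow> real) set))
            LSC_b_topology
            (riesz_potential (real CARD('n) - \<alpha>))) \<and>
         (CARD('n) \<ge> 2 \<longrightarrow>
          (\<forall>f \<in> (BV \<alpha> p :: (real ^ 'n \<Rightarrow> real) set).
             riesz_potential_defined (real CARD('n) - \<alpha>) f) \<and>
          continuous_map
            (BV_topology \<alpha> p :: (real ^ 'n \<Rightarrow> real) topology)
            Linf_topology
            (riesz_potential (real CARD('n) - \<alpha>)))"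
proof -
  note \<alpha> = assms(1,2) and p = assms(3)
  define F where "F = (riesz_potential (real CARD('n) - \<alpha>) :: (real ^ 'n \<Rightarrow> real) \<Rightarrow> real ^ 'n \<Rightarrow> real)"
  define I where "I f x = (LINT y|lebesgue. f y / norm (x - y) powr \<alpha>)" for f :: "real ^ 'n \<Rightarrow> real" and x
  \<comment> \<open>The normalising constant of order s = n - \<alpha>, for which n - s =
    \<alpha>.\<close>
  define c where "c = 2 powr (- (real CARD('n) - \<alpha>)) * pi powr (- real CARD('n) / 2) * Gamma (\<alpha> / 2) / Gamma ((real CARD('n) - \<alpha>) / 2)"
  define V where "V f = real_of_ereal (frac_variation \<alpha> f)" for f :: "real ^ 'n \<Rightarrow> real"
  have "0 < real CARD('n) - \<alpha>"
    using DIM_minus_alpha_pos[OF \<alpha>, where 'a="real ^ 'n"] by simp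
  then have c: "0 < c"
    unfolding c_def using \<alpha> by (intro mult_pos_pos divide_pos_pos Gamma_real_pos) auto
  have F_eq: "F f x = c * I f x" for f x
    by (simp add: F_def riesz_potential_def c_def I_def)
  have defined: "riesz_potential_defined (real CARD('n) - \<alpha>) f \<longleftrightarrow> (\<forall>x. integrable lebesgue (\<lambda>y. f y / norm (x - y) powr \<alpha>))"
    for f :: "real ^ 'n \<Rightarrow> real"
    by (simp add: riesz_potential_defined_def)
  obtain C where C0: "0 < C" and C: "\<forall>p. \<forall>f::real ^ 'n \<Rightarrow> real. 1 \<le> p \<longrightarrow> f \<in> BV \<alpha> p \<longrightarrow>
     ((AE x in lebesgue. 0 \<le> f x) \<or> 2 \<le> CARD('n) \<longrightarrow> (\<forall>x. integrable lebesgue (\<lambda>y. f y / norm (x - y) powr \<alpha>))) \<and>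
     (\<forall>x. integrable lebesgue (\<lambda>y. f y / norm (x - y) powr \<alpha>) \<longrightarrow>
        \<bar>LINT y|lebesgue. f y / norm (x - y) powr \<alpha>\<bar> \<le> C * real_of_ereal (frac_variation \<alpha> f))"
    using riesz_integral_bounds[OF \<alpha>, where 'n='n] by (elim exE conjE) (rule that)
  have int: "integrable lebesgue (\<lambda>y. f y / norm (x - y) powr \<alpha>)"
    if "f \<in> BV \<alpha> p" "(AE x in lebesgue. 0 \<le> f x) \<or> 2 \<le> CARD('n)" for f :: "real ^ 'n \<Rightarrow> real" and x
    using C[THEN spec, THEN spec, THEN mp, OF p, THEN mp, OF that(1)] that(2) by simp
  have bound: "\<bar>F f x\<bar> \<le> c * C * V f"
    if "f \<in> BV \<alpha> p" "integrable lebesgue (\<lambda>y. f y / norm (x - y) powr \<alpha>)" for f :: "real ^ 'n \<Rightarrow> real" and x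
  proof -
    have "\<bar>I f x\<bar> \<le> C * V f"
      using C[THEN spec, THEN spec, THEN mp, OF p, THEN mp, OF that(1)] that(2) by (simp add: I_def V_def)
    then show ?thesis
      using c by (simp add: F_eq abs_mult mult.assoc)
  qed
  \<comment> \<open>The potential of f - g converges as a difference of convergent ones, so the
    bound applies to it even when f - g changes sign. By linearity this is the Lipschitz estimate
    that yields both continuity claims.\<close>
  have diff: "\<bar>F f x - F g x\<bar> \<le> c * C * V (\<lambda>x. f x - g x)"
    if "f \<in> BV \<alpha> p" "g \<in> BV \<alpha> p" "(AE x in lebesgue. 0 \<le> f x) \<or> 2 \<le> CARD('n)" "(AE x in lebesgue. 0 \<le> g x) \<or> 2 \<le> CARD('n)"
    for f g :: "real ^ 'n \<Rightarrow> real" and x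
  proof -
    note fg = int[OF that(1,3), of x] int[OF that(2,4), of x]
    have "I f x - I g x = I (\<lambda>x. f x - g x) x"
      using fg by (simp add: I_def diff_divide_distrib)
    then have "F f x - F g x = F (\<lambda>x. f x - g x) x"
      by (simp add: F_eq flip: right_diff_distrib)
    moreover have "integrable lebesgue (\<lambda>y. (f y - g y) / norm (x - y) powr \<alpha>)"
      using Bochner_Integration.integrable_diff[OF fg] by (simp add: diff_divide_distrib)
    ultimately show ?thesis
      using bound[OF BV_diff(1)[OF \<alpha> p that(1,2)]] by simp
  qed
  have BV_borel: "f \<in> borel_measurable lebesgue" if "f \<in> BV \<alpha> p" for f :: "real ^ 'n \<Rightarrow> real"
    using that by (simp add: BV_def Lp_def)
  have plus: "f \<in> BV \<alpha> p" "AE x in lebesgue. 0 \<le> f x" if "f \<in> BV_plus \<alpha> p" for f :: "real ^ 'n \<Rightarrow> real"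
    using that by (auto simp: BV_plus_def)
  have small: "\<exists>r>0. \<forall>v<r. c * C * v < e" if "0 < e" for e
    using c C0 that by (intro exI[of _ "e / (c * C)"]) (simp add: field_simps)
  have LSC: "F f \<in> LSC_b" if "f \<in> BV_plus \<alpha> p" for f
  proof -
    note f = plus[OF that]
    have "lower_semicontinuous (F f)"
      unfolding F_eq[abs_def] I_def using f int[OF f(1)]
      by (intro lower_semicontinuous_cmult c lower_semicontinuous_riesz_integral BV_borel) auto
    moreover have "bounded (range (F f))"
      using bound[OF f(1)] int[OF f(1)] f(2) by (auto intro!: boundedI[of _ "c * C * V f"])
    ultimately show ?thesis
      by (simp add: LSC_b_def)
  qed
  have Linf: "F f \<in> borel_measurable lebesgue" if "f \<in> BV \<alpha> p" "2 \<le> CARD('n)" for f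
  proof -
    have "I f \<in> borel_measurable borel"
      unfolding I_def[abs_def] using that by (intro riesz_integral_borel BV_borel int) auto
    then have "I f \<in> borel_measurable lebesgue"
      by (intro measurable_completion) simp
    then show ?thesis
      unfolding F_eq[abs_def] by measurable
  qed
  let ?m = "submetric (funspace UNIV euclidean_metric) LSC_b :: (real ^ 'n \<Rightarrow> real) metric"
  interpret LSC: Metric_space "mspace ?m" "mdist ?m"
    by (rule Metric_space_mspace_mdist)
  have "continuous_map (subtopology (BV_topology \<alpha> p) (BV_plus \<alpha> p)) LSC_b_topology F"
  proof (rule continuous_map_BV[OF \<alpha> p])
    show "BV_plus \<alpha> p \<subseteq> (BV \<alpha> p :: (real ^ 'n \<Rightarrow> real) set)"
      using plus by blast
    show "F f \<in> topspace LSC_b_topology" if "f \<in> BV_plus \<alpha> p" for f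
      using LSC[OF that] unfolding LSC_b_topology_def topspace_mtopology_of mspace_LSC_b .
    fix U f assume U: "openin LSC_b_topology U" and f: "f \<in> BV_plus \<alpha> p" and fU: "F f \<in> U"
    obtain e where e: "0 < e" "LSC.mball (F f) e \<subseteq> U"
      using U fU unfolding LSC_b_topology_def mtopology_of_def LSC.openin_mtopology by blast
    obtain r where r: "0 < r" "\<And>v. v < r \<Longrightarrow> c * C * v < e"
      using small[OF e(1)] by blast
    have "F g \<in> U" if g: "g \<in> BV_plus \<alpha> p" and gr: "real_of_ereal (frac_variation \<alpha> (\<lambda>x. f x - g x)) < r" for g
    proof -
      have mem: "F f \<in> mspace ?m" "F g \<in> mspace ?m"
        unfolding mspace_LSC_b using LSC f g by auto
      have "mdist (funspace UNIV euclidean_metric) (F f) (F g) \<le> c * C * V (\<lambda>x. f x - g x)"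
      proof (subst funspace_mdist_le)
        show "\<forall>x\<in>UNIV. mdist euclidean_metric (F f x) (F g x) \<le> c * C * V (\<lambda>x. f x - g x)"
          using diff plus f g by (simp add: dist_real_def)
      qed (use mem in auto)
      also have "\<dots> < e"
        using r(2) gr by (simp add: V_def)
      finally have "F g \<in> LSC.mball (F f) e"
        unfolding LSC.in_mball using mem by simp
      then show ?thesis
        using e(2) by blast
    qed
    then show "\<exists>r>0. \<forall>g\<in>BV_plus \<alpha> p. real_of_ereal (frac_variation \<alpha> (\<lambda>x. f x - g x)) < r \<longrightarrow> F g \<in> U"
      using r(1) by blast
  qed
  moreover have "continuous_map (BV_topology \<alpha> p) Linf_topology F" if n2: "2 \<le> CARD('n)"
  proof -
    have "continuous_map (subtopology (BV_topology \<alpha> p) (BV \<alpha> p)) Linf_topology F"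
    proof (rule continuous_map_BV[OF \<alpha> p order_refl])
      show "F f \<in> topspace Linf_topology" if f: "f \<in> BV \<alpha> p" for f
      proof -
        have "Linf_norm (F f) \<le> ereal (c * C * V f)"
          using bound[OF f] int[OF f] n2 by (intro Linf_norm_le Linf f) auto
        also have "\<dots> < \<infinity>" by simp
        finally show ?thesis
          using Linf[OF f n2] by (simp add: Linf_topology_def Linf_def)
      qed
      fix U f assume U: "openin Linf_topology U" and f: "f \<in> BV \<alpha> p" and fU: "F f \<in> U"
      obtain e where e: "0 < e" "\<And>u. u \<in> Linf \<Longrightarrow> real_of_ereal (Linf_norm (\<lambda>x. F f x - u x)) < e \<Longrightarrow> u \<in> U"
        using U fU unfolding Linf_topology_def openin_pseudometric_topology by blast
      obtain r where r: "0 < r" "\<And>v. v < r \<Longrightarrow> c * C * v < e"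
        using small[OF e(1)] by blast
      have "F g \<in> U" if g: "g \<in> BV \<alpha> p" and gr: "real_of_ereal (frac_variation \<alpha> (\<lambda>x. f x - g x)) < r" for g
      proof (rule e(2))
        have "Linf_norm (F g) \<le> ereal (c * C * V g)"
          using bound[OF g] int[OF g] n2 by (intro Linf_norm_le Linf g) auto
        also have "\<dots> < \<infinity>" by simp
        finally show "F g \<in> Linf"
          using Linf[OF g n2] by (simp add: Linf_def)
        have "real_of_ereal (Linf_norm (\<lambda>x. F f x - F g x)) \<le> c * C * V (\<lambda>x. f x - g x)"
          using Linf[OF f n2] Linf[OF g n2] diff[OF f g] n2 by (intro Linf_norm_le(2)) auto
        also have "\<dots> < e"
          using r(2) gr by (simp add: V_def)
        finally show "real_of_ereal (Linf_norm (\<lambda>x. F f x - F g x)) < e" .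
      qed
      then show "\<exists>r>0. \<forall>g\<in>BV \<alpha> p. real_of_ereal (frac_variation \<alpha> (\<lambda>x. f x - g x)) < r \<longrightarrow> F g \<in> U"
        using r(1) by blast
    qed
    then show ?thesis
      using subtopology_topspace[of "BV_topology \<alpha> p :: (real ^ 'n \<Rightarrow> real) topology"] by (simp add: BV_topology_def)
  qed
  ultimately show ?thesis
    unfolding defined F_def[symmetric] using int plus by blast
qed

end
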